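(* For each rational number $r \geq 1$, the set $\mathcal{S}^{\mathrm{MDG}}_{r}$ is $\mathrm{P}^{\mathrm{NP}}_{\|}$-complete under polynomial-time many-one reductions.
   Context: All graphs are undirected, nonempty, finite, without multiple edges or self-loops. A vertex cover of a graph $G$ is a set $C \subseteq V(G)$ with $\{v,w\}\cap C \neq \emptyset$ for every edge $\{v,w\}\in E(G)$; $\mathrm{mvc}(G)$ denotes the minimum size of a vertex cover of $G$. The maximum-degree greedy heuristic (MDG) on input $G$ starts with $C=\emptyset$ and, as long as an edge remains, nondeterministically chooses a vertex $v$ of maximum degree in the current graph, adds $v$ to $C$, and deletes $v$ and all edges incident to $v$; it outputs $C$. Let $\mathrm{min\text{-}mdg}(G)$ be the minimum size of an output of MDG on input $G$ over all possible sequences of nondeterministic choices. For a rational $r\geq 1$, $\mathcal{S}^{\mathrm{MDG}}_{r} = \{G \mid G \text{ is a graph and } \mathrm{min\text{-}mdg}(G) \leq r\cdot\mathrm{mvc}(G)\}$ (graphs encoded as binary strings in a standard way). $\mathrm{P}^{\mathrm{NP}}_{\|}$ is the class of problems decidable in polynomial time with parallel (truth-table) access to an NP oracle. Hardness/completeness is with respect to polynomial-time many-one reducibility: $A \leq^p_m B$ iff there is a polynomial-time computable $f$ with $x\in A \iff f(x)\in B$ for all $x$. *)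

theory Defs
  imports Complex_Main "HOL-Computational_Algebra.Polynomial"
begin

type_synonym 'a graph = "'a set \<times> 'a set set"

definition is_graph :: "'a graph \<Rightarrow> bool" where
  "is_graph G \<longleftrightarrow> finite (fst G) \<and> fst G \<noteq> {} \<and>
     snd G \<subseteq> {{u, v} | u v. u \<in> fst G \<and> v \<in> fst G \<and> u \<noteq> v}"

definition vertex_cover :: "'a graph \<Rightarrow> 'a set \<Rightarrow> bool" where
  "vertex_cover G C \<longleftrightarrow> C \<subseteq> fst G \<and> (\<forall>e\<in>snd G. e \<inter> C \<noteq> {})"

definition mvc :: "'a graph \<Rightarrow> nat" where
  "mvc G = (LEAST k. \<exists>C. vertex_cover G C \<and> card C = k)"

definition degree_in :: "'a graph \<Rightarrow> 'a \<Rightarrow> nat" where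
  "degree_in G v = card {e \<in> snd G. v \<in> e}"

definition delete_vertex :: "'a graph \<Rightarrow> 'a \<Rightarrow> 'a graph" where
  "delete_vertex G v = (fst G - {v}, {e \<in> snd G. v \<notin> e})"

inductive mdg_step :: "'a graph \<times> 'a set \<Rightarrow> 'a graph \<times> 'a set \<Rightarrow> bool" where
  "\<lbrakk>snd G \<noteq> {}; v \<in> fst G; \<forall>u\<in>fst G. degree_in G u \<le> degree_in G v\<rbrakk>
    \<Longrightarrow> mdg_step (G, C) (delete_vertex G v, insert v C)"

definition mdg_outputs :: "'a graph \<Rightarrow> 'a set set" where
  "mdg_outputs G = {C. \<exists>H. mdg_step\<^sup>*\<^sup>* (G, {}) (H, C) \<and> snd H = {}}"

definition min_mdg :: "'a graph \<Rightarrow> nat" where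
  "min_mdg G = (LEAST k. \<exists>C\<in>mdg_outputs G. card C = k)"

type_synonym word = "bool list"
type_synonym lang = "word set"

text \<open>Every bit is doubled and the word is closed by the block 01, so that the result is
  self-delimiting.\<close>

definition enc_word :: "word \<Rightarrow> word" where
  "enc_word w = concat (map (\<lambda>b. [b, b]) w) @ [False, True]"

definition enc_pair :: "word \<Rightarrow> word \<Rightarrow> word" where
  "enc_pair x y = enc_word x @ y"

definition enc_words :: "word list \<Rightarrow> word" where
  "enc_words ws = concat (map enc_word ws)"

text \<open>The row-wise adjacency matrix of a graph with vertex set \<open>{..<n}\<close>.\<close>

definition enc_graph :: "nat graph \<Rightarrow> word" where
  "enc_graph G = (let n = card (fst G) in
     concat (map (\<lambda>i. map (\<lambda>j. {i, j} \<in> snd G) [0..<n]) [0..<n]))"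

definition S_MDG :: "rat \<Rightarrow> lang" where
  "S_MDG r = {enc_graph G | G n. is_graph G \<and> fst G = {..<n} \<and>
     of_nat (min_mdg G) \<le> r * of_nat (mvc G)}"

text \<open>The states are \<open>0, \<dots>, tm_states M\<close>, where \<open>0\<close> is initial and \<open>tm_states M\<close> is
  the halting state. The symbols are \<open>0, \<dots>, tm_symbols M - 1\<close>, where \<open>0\<close> is the blank and
  \<open>1\<close>, \<open>2\<close> represent the bits 0 and 1. In each step and for each tape the machine writes a symbol
  and moves the head by an offset in \<open>{-1, 0, 1}\<close>. Tapes are infinite in both directions. The
  first tape holds the input, the last one the output.\<close>

record tm =
  tm_tapes :: nat
  tm_states :: nat
  tm_symbols :: nat
  tm_trans :: "nat \<Rightarrow> nat list \<Rightarrow> nat \<times> (nat \<times> int) list"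

definition valid_tm :: "tm \<Rightarrow> bool" where
  "valid_tm M \<longleftrightarrow> tm_tapes M \<ge> 1 \<and> tm_symbols M \<ge> 3 \<and>
     (\<forall>q < tm_states M. \<forall>ss. length ss = tm_tapes M \<and> set ss \<subseteq> {..<tm_symbols M} \<longrightarrow>
        (case tm_trans M q ss of (q', acts) \<Rightarrow>
           q' \<le> tm_states M \<and> length acts = tm_tapes M \<and>
           set acts \<subseteq> {..<tm_symbols M} \<times> {-1, 0, 1}))"

type_synonym config = "nat \<times> ((int \<Rightarrow> nat) \<times> int) list"

definition tm_step :: "tm \<Rightarrow> config \<Rightarrow> config" where
  "tm_step M = (\<lambda>(q, ts).
     if q < tm_states M then
       (case tm_trans M q (map (\<lambda>(t, h). t h) ts) of (q', acts) \<Rightarrow>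
          (q', map2 (\<lambda>(t, h) (s, m). (t(h := s), h + m)) ts acts))
     else (q, ts))"

definition word_tape :: "word \<Rightarrow> int \<Rightarrow> nat" where
  "word_tape w i =
     (if 0 \<le> i \<and> i < int (length w) then (if w ! nat i then 2 else 1) else 0)"

definition tm_init :: "tm \<Rightarrow> word \<Rightarrow> config" where
  "tm_init M x = (0, (word_tape x, 0) # replicate (tm_tapes M - 1) (word_tape [], 0))"

definition tm_halts_with :: "tm \<Rightarrow> word \<Rightarrow> nat \<Rightarrow> word \<Rightarrow> bool" where
  "tm_halts_with M x t y \<longleftrightarrow>
     (case (tm_step M ^^ t) (tm_init M x) of (q, ts) \<Rightarrow>
        q = tm_states M \<and> fst (last ts) = word_tape y)"

definition polytime :: "(word \<Rightarrow> word) \<Rightarrow> bool" where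
  "polytime f \<longleftrightarrow> (\<exists>M (p :: nat poly). valid_tm M \<and>
     (\<forall>x. \<exists>t \<le> poly p (length x). tm_halts_with M x t (f x)))"

definition class_P :: "lang set" where
  "class_P = {L. polytime (\<lambda>x. [x \<in> L])}"

definition class_NP :: "lang set" where
  "class_NP = {L. \<exists>R \<in> class_P. \<exists>p :: nat poly. \<forall>x.
     x \<in> L \<longleftrightarrow> (\<exists>w. length w \<le> poly p (length x) \<and> enc_pair x w \<in> R)}"

text \<open>Parallel access: all queries \<open>g x\<close> are computed from the input before any answer is known;
  the input together with the vector of answers is then evaluated in polynomial time.\<close>

definition class_P_NP_par :: "lang set" where
  "class_P_NP_par = {L. \<exists>A \<in> class_NP. \<exists>g. \<exists>V \<in> class_P.
     polytime (\<lambda>x. enc_words (g x)) \<and>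
     (\<forall>x. x \<in> L \<longleftrightarrow> enc_pair x (map (\<lambda>y. y \<in> A) (g x)) \<in> V)}"

definition many_one_reducible :: "lang \<Rightarrow> lang \<Rightarrow> bool" (infix "\<le>\<^sub>m\<^sup>p" 50) where
  "A \<le>\<^sub>m\<^sup>p B \<longleftrightarrow> (\<exists>f. polytime f \<and> (\<forall>x. x \<in> A \<longleftrightarrow> f x \<in> B))"

definition many_one_complete :: "lang set \<Rightarrow> lang \<Rightarrow> bool" where
  "many_one_complete \<C> L \<longleftrightarrow> L \<in> \<C> \<and> (\<forall>A \<in> \<C>. A \<le>\<^sub>m\<^sup>p L)"

end

theory Submission
  imports Defs
begin

text \<open>
  Membership: ask for all \<open>k\<close> whether some greedy run has at most \<open>k\<close> steps, and whether some vertex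
  cover \<open>C\<close> satisfies \<open>p |C| < q k\<close>, where \<open>r = p / q\<close>. The graph belongs to the set iff for some
  \<open>k\<close> the first answer is yes and the second is no.

  Hardness: guess witnesses for the queries of a machine for \<open>L\<close>, let \<open>s\<close> be the number of verified
  ones and \<open>acc\<close> the verdict when exactly these queries are answered yes. The maximum of
  \<open>2 s + acc\<close> is attained at the true answers, so \<open>x \<in> L\<close> iff every optimal guess has \<open>acc = 1\<close>.
  The computation on a guess becomes a constraint satisfaction problem, and this a graph \<open>G\<close> on which
  the greedy heuristic is optimal and whose minimum vertex covers correspond to optimal guesses.
  Attaching to the vertex \<open>\<beta>\<close> of the claim \<open>acc = 1\<close> a vertex \<open>z\<close> with \<open>D\<close> pendant paths of length two
  forces the heuristic to take \<open>z\<close>, so that it pays \<open>D + 1 + mvc G\<close>. The minimum is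
  \<open>D + mvc G + e\<close>, where \<open>e = 0\<close> if \<open>\<beta>\<close> lies in some minimum cover of \<open>G\<close>, i.e. \<open>x \<notin> L\<close>, and \<open>e = 1\<close>
  otherwise. The unknown \<open>mvc G\<close> is cancelled in \<open>p mvc - q mdg\<close> by copies of \<open>G\<close> with such a gadget
  at every vertex, whose minimum does not depend on \<open>mvc G\<close>; copies of a fixed graph of
  ratio above \<open>r\<close> adjust the remaining constant to a threshold at \<open>e = 1\<close>.

  Polynomial time is handled by a language of stack programs: compiled to Turing machines, they yield a
  class of functions on encoded types with good closure properties; a simulation of Turing
  machines in this class gives the converse.
\<close>

section \<open>Stack programs and their compilation to Turing machines\<close>

datatype prog =
    Push nat bool
  | Pop nat
  | Seq prog prog (infixr ";;" 60)
  | Cond nat prog prog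
  | While nat prog

type_synonym store = "nat \<Rightarrow> word"

fun hd_true :: "word \<Rightarrow> bool" where
  "hd_true [] = False"
| "hd_true (b # w) = b"

inductive exec :: "prog \<Rightarrow> store \<Rightarrow> nat \<Rightarrow> store \<Rightarrow> bool" where
  exec_Push: "exec (Push r b) s 2 (s(r := b # s r))"
| exec_Pop: "exec (Pop r) s 1 (s(r := tl (s r)))"
| exec_Seq: "exec p s n s1 \<Longrightarrow> exec q s1 m s2 \<Longrightarrow> exec (p ;; q) s (n + m) s2"
| exec_Cond_True: "hd_true (s r) \<Longrightarrow> exec p s n s' \<Longrightarrow> exec (Cond r p q) s (Suc n) s'"
| exec_Cond_False: "\<not> hd_true (s r) \<Longrightarrow> exec q s n s' \<Longrightarrow> exec (Cond r p q) s (Suc n) s'"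
| exec_While_Nil: "s r = [] \<Longrightarrow> exec (While r p) s 1 s"
| exec_While_Cons: "s r \<noteq> [] \<Longrightarrow> exec p s n s1 \<Longrightarrow> exec (While r p) s1 m s2 \<Longrightarrow>
    exec (While r p) s (Suc (n + m)) s2"

lemma exec_length: "exec p s n s' \<Longrightarrow> length (s' r) \<le> length (s r) + n"
  by (induction rule: exec.induct) auto

fun reads :: "prog \<Rightarrow> nat set" where
  "reads (Push r b) = {}"
| "reads (Pop r) = {r}"
| "reads (p ;; q) = reads p \<union> reads q"
| "reads (Cond r p q) = insert r (reads p \<union> reads q)"
| "reads (While r p) = insert r (reads p)"

fun pushes :: "prog \<Rightarrow> nat set" where
  "pushes (Push r b) = {r}"
| "pushes (Pop r) = {}"
| "pushes (p ;; q) = pushes p \<union> pushes q"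
| "pushes (Cond r p q) = pushes p \<union> pushes q"
| "pushes (While r p) = pushes p"

fun prog_size :: "prog \<Rightarrow> nat" where
  "prog_size (Push r b) = 2"
| "prog_size (Pop r) = 1"
| "prog_size (p ;; q) = prog_size p + prog_size q"
| "prog_size (Cond r p q) = Suc (prog_size p + prog_size q)"
| "prog_size (While r p) = Suc (prog_size p)"

lemma prog_size_pos: "0 < prog_size p"
  by (induction p) auto

subsection \<open>Tapes and actions\<close>

type_synonym tape = "(int \<Rightarrow> nat) \<times> int"
type_synonym action = "nat \<times> int"

definition scanned :: "tape list \<Rightarrow> nat list" where
  "scanned ts = map (\<lambda>(t, h). t h) ts"

definition act_tape :: "action \<Rightarrow> tape \<Rightarrow> tape" where
  "act_tape a T = ((fst T)(snd T := fst a), snd T + snd a)"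

definition apply_actions :: "tape list \<Rightarrow> action list \<Rightarrow> tape list" where
  "apply_actions ts as = map2 (\<lambda>T a. act_tape a T) ts as"

lemma length_scanned [simp]: "length (scanned ts) = length ts"
  by (simp add: scanned_def)

lemma nth_scanned: "i < length ts \<Longrightarrow> scanned ts ! i = fst (ts ! i) (snd (ts ! i))"
  by (simp add: scanned_def case_prod_unfold)

lemma length_apply_actions [simp]: "length (apply_actions ts as) = min (length ts) (length as)"
  by (simp add: apply_actions_def)

lemma nth_apply_actions:
  "i < length ts \<Longrightarrow> i < length as \<Longrightarrow> apply_actions ts as ! i = act_tape (as ! i) (ts ! i)"
  by (simp add: apply_actions_def)

lemma tm_step_apply_actions:
  "tm_step M (q, ts) = (if q < tm_states M
     then map_prod id (apply_actions ts) (tm_trans M q (scanned ts)) else (q, ts))"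
proof -
  have "(\<lambda>(t, h) (s, m). (t(h := s), h + m)) = (\<lambda>T a. act_tape a T)"
    by (simp add: fun_eq_iff act_tape_def)
  then show ?thesis
    by (simp add: tm_step_def scanned_def apply_actions_def map_prod_def split: prod.split)
qed

definition idle :: "nat list \<Rightarrow> action list" where
  "idle ss = map (\<lambda>s. (s, 0)) ss"

definition act_on :: "nat \<Rightarrow> action \<Rightarrow> nat list \<Rightarrow> action list" where
  "act_on r a ss = (idle ss)[r := a]"

lemma apply_actions_idle [simp]: "apply_actions ts (idle (scanned ts)) = ts"
  by (rule nth_equalityI) (auto simp: nth_apply_actions act_tape_def idle_def nth_scanned)

lemma apply_actions_act_on:
  assumes "r < length ts"
  shows "apply_actions ts (act_on r a (scanned ts)) = ts[r := act_tape a (ts ! r)]"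
proof (rule nth_equalityI)
  fix i assume "i < length (apply_actions ts (act_on r a (scanned ts)))"
  then have i: "i < length ts" by simp
  have "apply_actions ts (idle (scanned ts)) ! i = ts ! i" by simp
  then show "apply_actions ts (act_on r a (scanned ts)) ! i = ts[r := act_tape a (ts ! r)] ! i"
    using i assms by (simp add: nth_apply_actions act_on_def idle_def nth_list_update)
qed (simp add: act_on_def idle_def)

lemma act_on_valid:
  assumes "set ss \<subseteq> {..<k}" "fst a < k" "snd a \<in> {-1, 0, 1}"
  shows "length (act_on r a ss) = length ss \<and> set (act_on r a ss) \<subseteq> {..<k} \<times> {-1, 0, 1}"
proof
  show "length (act_on r a ss) = length ss" by (simp add: act_on_def idle_def)
  have "set (idle ss) \<subseteq> {..<k} \<times> {-1, 0, 1}" using assms(1) by (auto simp: idle_def)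
  moreover have "a \<in> {..<k} \<times> {-1, 0, 1}" using assms(2,3) by (simp add: mem_Times_iff)
  ultimately show "set (act_on r a ss) \<subseteq> {..<k} \<times> {-1, 0, 1}"
    unfolding act_on_def using set_update_subset_insert[of "idle ss" r a] by blast
qed

lemma idle_valid:
  "set ss \<subseteq> {..<k} \<Longrightarrow> length (idle ss) = length ss \<and> set (idle ss) \<subseteq> {..<k} \<times> {-1, 0, 1}"
  by (auto simp: idle_def)

subsection \<open>Transition functions of compiled programs\<close>

text \<open>Tape \<open>K\<close> is the output tape. It is written from left to right and never read, so that
  the output starts at cell 0; the other tapes hold stacks that grow to the left.\<close>

definition bit_sym :: "bool \<Rightarrow> nat" where
  "bit_sym b = (if b then 2 else 1)"

fun compile :: "nat \<Rightarrow> prog \<Rightarrow> nat \<Rightarrow> nat list \<Rightarrow> nat \<times> action list" where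
  "compile K (Push r b) q ss =
     (if q = 0 then (1, act_on r (if r = K then (bit_sym b, 0) else (ss ! r, -1)) ss)
      else (2, act_on r (if r = K then (ss ! r, 1) else (bit_sym b, 0)) ss))"
| "compile K (Pop r) q ss = (1, act_on r (0, 1) ss)"
| "compile K (p1 ;; p2) q ss =
     (if q < prog_size p1 then compile K p1 q ss
      else map_prod ((+) (prog_size p1)) id (compile K p2 (q - prog_size p1) ss))"
| "compile K (Cond r p1 p2) q ss =
     (if q = 0 then (if ss ! r = 2 then 1 else Suc (prog_size p1), idle ss)
      else if q \<le> prog_size p1 then
        map_prod (\<lambda>q'. if q' = prog_size p1 then Suc (prog_size p1 + prog_size p2) else Suc q') id
          (compile K p1 (q - 1) ss)
      else map_prod ((+) (Suc (prog_size p1))) id (compile K p2 (q - Suc (prog_size p1)) ss))"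
| "compile K (While r p) q ss =
     (if q = 0 then (if ss ! r \<noteq> 0 then 1 else Suc (prog_size p), idle ss)
      else map_prod (\<lambda>q'. if q' = prog_size p then 0 else Suc q') id (compile K p (q - 1) ss))"

definition valid_response :: "nat \<Rightarrow> nat \<Rightarrow> nat \<times> action list \<Rightarrow> bool" where
  "valid_response K S z \<longleftrightarrow> fst z \<le> S \<and> length (snd z) = Suc K \<and> set (snd z) \<subseteq> {..<3} \<times> {-1, 0, 1}"

lemma valid_response_map_prod:
  "valid_response K S z \<Longrightarrow> (\<And>q. q \<le> S \<Longrightarrow> e q \<le> S') \<Longrightarrow> valid_response K S' (map_prod e id z)"
  by (simp add: valid_response_def)

lemma valid_response_idle:
  "length ss = Suc K \<Longrightarrow> set ss \<subseteq> {..<3} \<Longrightarrow> q \<le> S \<Longrightarrow> valid_response K S (q, idle ss)"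
  using idle_valid[of ss 3] by (simp add: valid_response_def)

lemma valid_response_compile:
  assumes "reads p \<subseteq> {..<K}" "pushes p \<subseteq> {..K}" "q < prog_size p" "length ss = Suc K" "set ss \<subseteq> {..<3}"
  shows "valid_response K (prog_size p) (compile K p q ss)"
  using assms(1-3)
proof (induction p arbitrary: q)
  case (Push r b)
  then have "ss ! r < 3" "bit_sym b < 3"
    using assms(4,5) nth_mem[of r ss] by (auto simp: bit_sym_def subset_iff)
  then show ?case
    by (cases "r = K") (use assms(4) in \<open>simp_all add: valid_response_def act_on_valid[OF assms(5)]\<close>)
next
  case (Pop r)
  show ?case using assms(4) by (simp add: valid_response_def act_on_valid[OF assms(5)])
next
  case (Seq p1 p2)
  show ?case
  proof (cases "q < prog_size p1")
    case True
    then show ?thesis using Seq.IH(1)[of q] Seq.prems by (simp add: valid_response_def)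
  next
    case False
    then have "valid_response K (prog_size p2) (compile K p2 (q - prog_size p1) ss)"
      using Seq.IH(2) Seq.prems by simp
    then show ?thesis using False by (simp add: valid_response_map_prod)
  qed
next
  case (Cond r p1 p2)
  have "valid_response K (prog_size p1) (compile K p1 (q - 1) ss)" if "q \<noteq> 0" "q \<le> prog_size p1"
    using Cond that by simp
  moreover have "valid_response K (prog_size p2) (compile K p2 (q - Suc (prog_size p1)) ss)"
    if "q > prog_size p1" using Cond that by simp
  ultimately show ?case
    using valid_response_idle[OF assms(4,5)] by (cases "q = 0") (auto intro!: valid_response_map_prod)
next
  case (While r p)
  have "valid_response K (prog_size p) (compile K p (q - 1) ss)" if "q \<noteq> 0"
    using While that by simp
  then show ?case
    using valid_response_idle[OF assms(4,5)] by (cases "q = 0") (auto intro!: valid_response_map_prod)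
qed

subsection \<open>Correctness of the compilation\<close>

inductive reaches :: "(nat \<Rightarrow> nat list \<Rightarrow> nat \<times> action list) \<Rightarrow> nat \<Rightarrow> nat \<Rightarrow> config \<Rightarrow> config \<Rightarrow> bool"
  for d S where
  reaches_0: "reaches d S 0 c c"
| reaches_Suc: "q < S \<Longrightarrow> reaches d S n (map_prod id (apply_actions ts) (d q (scanned ts))) c \<Longrightarrow>
    reaches d S (Suc n) (q, ts) c"

lemma reaches_trans:
  "reaches d S n c1 c2 \<Longrightarrow> reaches d S m c2 c3 \<Longrightarrow> reaches d S (n + m) c1 c3"
  by (induction rule: reaches.induct) (auto intro: reaches.intros)

lemma reaches_step:
  "q < S \<Longrightarrow> map_prod id (apply_actions ts) (d q (scanned ts)) = c \<Longrightarrow> reaches d S 1 (q, ts) c"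
  using reaches_Suc[of q S d 0 ts c] reaches_0 by fastforce

lemma reaches_embed:
  assumes "reaches d S n c c'"
    and "\<And>q ss. q < S \<Longrightarrow> e q < S' \<and> d' (e q) ss = map_prod e id (d q ss)"
  shows "reaches d' S' n (map_prod e id c) (map_prod e id c')"
  using assms(1)
proof (induction rule: reaches.induct)
  case (reaches_Suc q n ts c)
  have e: "e q < S'" "d' (e q) (scanned ts) = map_prod e id (d q (scanned ts))"
    using assms(2)[OF reaches_Suc(1)] by blast+
  have "reaches d' S' n (map_prod id (apply_actions ts) (d' (e q) (scanned ts))) (map_prod e id c)"
    using reaches_Suc(3) unfolding e(2) by (cases "d q (scanned ts)"; cases c) simp
  then have "reaches d' S' (Suc n) (e q, ts) (map_prod e id c)" by (rule reaches.reaches_Suc[OF e(1)])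
  then show ?case unfolding map_prod_simp id_apply .
qed (rule reaches.reaches_0)

lemma reaches_tm_step:
  "reaches (tm_trans M) (tm_states M) n c c' \<Longrightarrow> (tm_step M ^^ n) c = c'"
  by (induction rule: reaches.induct) (simp_all add: funpow_swap1 tm_step_apply_actions)

definition holds_stack :: "tape \<Rightarrow> word \<Rightarrow> bool" where
  "holds_stack T w \<longleftrightarrow> (\<forall>j. fst T (snd T + j) = word_tape w j)"

definition holds_output :: "tape \<Rightarrow> word \<Rightarrow> bool" where
  "holds_output T w \<longleftrightarrow> fst T = word_tape (rev w) \<and> snd T = int (length w)"

definition represents :: "nat \<Rightarrow> tape list \<Rightarrow> store \<Rightarrow> bool" where
  "represents K ts s \<longleftrightarrow> length ts = Suc K \<and> (\<forall>i<K. holds_stack (ts ! i) (s i)) \<and>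
      holds_output (ts ! K) (s K)"

lemma word_tape_Nil: "word_tape [] j = 0"
  by (simp add: word_tape_def)

lemma word_tape_Cons: "word_tape (b # w) j = (if j = 0 then bit_sym b else word_tape w (j - 1))"
  by (cases "j > 0") (auto simp: word_tape_def bit_sym_def nth_Cons' nat_diff_distrib)

lemma word_tape_tl: "word_tape (tl w) j = (if j = -1 then 0 else word_tape w (j + 1))"
proof (cases w)
  case (Cons b v)
  have "word_tape v (-1) = 0" by (simp add: word_tape_def)
  then show ?thesis using Cons by (simp add: word_tape_Cons)
qed (simp add: word_tape_Nil)

lemma word_tape_snoc: "word_tape (w @ [b]) = (word_tape w)(int (length w) := bit_sym b)"
  by (rule ext) (auto simp: word_tape_def bit_sym_def nth_append nat_less_iff)

lemma holds_stack_push: "holds_stack (t, h) w \<Longrightarrow> holds_stack (t(h - 1 := bit_sym b), h - 1) (b # w)"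
  unfolding holds_stack_def word_tape_Cons
proof
  fix j assume "\<forall>j. fst (t, h) (snd (t, h) + j) = word_tape w j"
  from spec[OF this, of "j - 1"]
  show "fst (t(h - 1 := bit_sym b), h - 1) (snd (t(h - 1 := bit_sym b), h - 1) + j) =
      (if j = 0 then bit_sym b else word_tape w (j - 1))"
    by (simp add: algebra_simps)
qed

lemma holds_stack_pop: "holds_stack (t, h) w \<Longrightarrow> holds_stack (t(h := 0), h + 1) (tl w)"
  unfolding holds_stack_def word_tape_tl
proof
  fix j assume "\<forall>j. fst (t, h) (snd (t, h) + j) = word_tape w j"
  from spec[OF this, of "j + 1"]
  show "fst (t(h := 0), h + 1) (snd (t(h := 0), h + 1) + j) =
      (if j = -1 then 0 else word_tape w (j + 1))"
    by (auto simp: algebra_simps)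
qed

lemma holds_output_push: "holds_output (t, h) w \<Longrightarrow> holds_output (t(h := bit_sym b), h + 1) (b # w)"
  by (simp add: holds_output_def word_tape_snoc)

lemma scanned_represents:
  assumes "represents K ts s" "r < K"
  shows "scanned ts ! r = (case s r of [] \<Rightarrow> 0 | b # _ \<Rightarrow> bit_sym b)"
proof -
  have "fst (ts ! r) (snd (ts ! r) + 0) = word_tape (s r) 0"
    using assms unfolding represents_def holds_stack_def by blast
  then show ?thesis
    using assms by (simp add: represents_def nth_scanned word_tape_Nil word_tape_Cons split: list.split)
qed

lemma represents_update_stack:
  "represents K ts s \<Longrightarrow> r < K \<Longrightarrow> holds_stack T w \<Longrightarrow> represents K (ts[r := T]) (s(r := w))"
  by (simp add: represents_def nth_list_update)

definition simulates :: "nat \<Rightarrow> prog \<Rightarrow> store \<Rightarrow> nat \<Rightarrow> store \<Rightarrow> bool" where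
  "simulates K p s n s' \<longleftrightarrow> (\<forall>ts. represents K ts s \<longrightarrow>
     (\<exists>ts'. reaches (compile K p) (prog_size p) n (0, ts) (prog_size p, ts') \<and> represents K ts' s'))"

lemma simulatesE:
  assumes "simulates K p s n s'" "represents K ts s"
  obtains ts' where "reaches (compile K p) (prog_size p) n (0, ts) (prog_size p, ts')"
    "represents K ts' s'"
  using assms unfolding simulates_def by blast

lemma simulates_Push:
  assumes "r \<le> K"
  shows "simulates K (Push r b) s 2 (s(r := b # s r))"
  unfolding simulates_def
proof (intro allI impI)
  fix ts assume ts: "represents K ts s"
  obtain t h where T: "ts ! r = (t, h)" by fastforce
  have r: "r < length ts" using ts assms by (simp add: represents_def)
  define T1 T2 where "T1 = (if r = K then (t(h := bit_sym b), h) else (t, h - 1))"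
    and "T2 = (if r = K then (t(h := bit_sym b), h + 1) else (t(h - 1 := bit_sym b), h - 1))"
  have "reaches (compile K (Push r b)) 2 1 (0, ts) (1, ts[r := T1])"
    by (rule reaches_step) (use r T
        in \<open>auto simp: apply_actions_act_on act_tape_def nth_scanned T1_def\<close>)
  moreover have "reaches (compile K (Push r b)) 2 1 (1, ts[r := T1]) (2, ts[r := T2])"
    by (rule reaches_step) (use r
        in \<open>auto simp: apply_actions_act_on act_tape_def nth_scanned T1_def T2_def\<close>)
  ultimately have "reaches (compile K (Push r b)) 2 (1 + 1) (0, ts) (2, ts[r := T2])"
    by (rule reaches_trans)
  moreover have "represents K (ts[r := T2]) (s(r := b # s r))"
  proof (cases "r = K")
    case True
    then show ?thesis using ts T
      by (auto simp: T2_def represents_def intro!: holds_output_push)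
  next
    case False
    then have "r < K" using assms by simp
    moreover have "holds_stack (t, h) (s r)" using ts T \<open>r < K\<close> unfolding represents_def by metis
    ultimately show ?thesis using False
      by (auto simp: T2_def intro!: represents_update_stack[OF ts] holds_stack_push)
  qed
  ultimately show "\<exists>ts'. reaches (compile K (Push r b)) (prog_size (Push r b)) 2 (0, ts)
      (prog_size (Push r b), ts') \<and> represents K ts' (s(r := b # s r))"
    unfolding one_add_one prog_size.simps by blast
qed

lemma simulates_Pop:
  assumes "r < K"
  shows "simulates K (Pop r) s 1 (s(r := tl (s r)))"
  unfolding simulates_def
proof (intro allI impI)
  fix ts assume ts: "represents K ts s"
  obtain t h where T: "ts ! r = (t, h)" by fastforce
  have "reaches (compile K (Pop r)) 1 1 (0, ts) (1, ts[r := (t(h := 0), h + 1)])"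
    by (rule reaches_step) (use ts assms T
        in \<open>auto simp: represents_def apply_actions_act_on act_tape_def\<close>)
  moreover have "holds_stack (t, h) (s r)" using ts T assms unfolding represents_def by metis
  then have "represents K (ts[r := (t(h := 0), h + 1)]) (s(r := tl (s r)))"
    by (intro represents_update_stack[OF ts assms] holds_stack_pop)
  ultimately show "\<exists>ts'. reaches (compile K (Pop r)) (prog_size (Pop r)) 1 (0, ts)
      (prog_size (Pop r), ts') \<and>
      represents K ts' (s(r := tl (s r)))"
    by auto
qed

lemma simulates_Seq:
  assumes "simulates K p s n s1" "simulates K q s1 m s2"
  shows "simulates K (p ;; q) s (n + m) s2"
  unfolding simulates_def
proof (intro allI impI)
  let ?d = "compile K (p ;; q)" let ?S = "prog_size (p ;; q)"
  fix ts assume ts: "represents K ts s"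
  obtain t1 where t1: "reaches (compile K p) (prog_size p) n (0, ts) (prog_size p, t1)"
    "represents K t1 s1"
    using simulatesE[OF assms(1) ts] .
  obtain t2 where t2: "reaches (compile K q) (prog_size q) m (0, t1) (prog_size q, t2)"
    "represents K t2 s2"
    using simulatesE[OF assms(2) t1(2)] .
  have "reaches ?d ?S n (0, ts) (prog_size p, t1)"
    using reaches_embed[OF t1(1), of id ?S ?d] by (simp add: map_prod.id)
  moreover have "reaches ?d ?S m (prog_size p, t1) (?S, t2)"
    using reaches_embed[OF t2(1), of "(+) (prog_size p)" ?S ?d] by simp
  ultimately show "\<exists>ts'. reaches ?d ?S (n + m) (0, ts) (?S, ts') \<and> represents K ts' s2"
    using reaches_trans t2(2) by blast
qed

lemma simulates_Cond_True:
  assumes "r < K" "hd_true (s r)" "simulates K p s n s'"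
  shows "simulates K (Cond r p q) s (Suc n) s'"
  unfolding simulates_def
proof (intro allI impI)
  let ?d = "compile K (Cond r p q)" let ?S = "prog_size (Cond r p q)"
  let ?e = "\<lambda>i. if i = prog_size p then Suc (prog_size p + prog_size q) else Suc i"
  fix ts assume ts: "represents K ts s"
  obtain t1 where t1: "reaches (compile K p) (prog_size p) n (0, ts) (prog_size p, t1)"
    "represents K t1 s'"
    using simulatesE[OF assms(3) ts] .
  have "scanned ts ! r = 2"
    using scanned_represents[OF ts assms(1)] assms(2) by (auto simp: bit_sym_def split: list.splits)
  then have "reaches ?d ?S 1 (0, ts) (1, ts)" by (intro reaches_step) simp_all
  moreover have "reaches ?d ?S n (1, ts) (?S, t1)"
    using reaches_embed[OF t1(1), of ?e ?S ?d] prog_size_pos[of p] by simp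
  ultimately show "\<exists>ts'. reaches ?d ?S (Suc n) (0, ts) (?S, ts') \<and> represents K ts' s'"
    using reaches_trans t1(2) by (metis plus_1_eq_Suc)
qed

lemma simulates_Cond_False:
  assumes "r < K" "\<not> hd_true (s r)" "simulates K q s n s'"
  shows "simulates K (Cond r p q) s (Suc n) s'"
  unfolding simulates_def
proof (intro allI impI)
  let ?d = "compile K (Cond r p q)" let ?S = "prog_size (Cond r p q)"
  fix ts assume ts: "represents K ts s"
  obtain t1 where t1: "reaches (compile K q) (prog_size q) n (0, ts) (prog_size q, t1)"
    "represents K t1 s'"
    using simulatesE[OF assms(3) ts] .
  have "scanned ts ! r \<noteq> 2"
    using scanned_represents[OF ts assms(1)] assms(2) by (auto simp: bit_sym_def split: list.splits)
  then have "reaches ?d ?S 1 (0, ts) (Suc (prog_size p), ts)" by (intro reaches_step) simp_all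
  moreover have "reaches ?d ?S n (Suc (prog_size p), ts) (?S, t1)"
    using reaches_embed[OF t1(1), of "(+) (Suc (prog_size p))" ?S ?d] by simp
  ultimately show "\<exists>ts'. reaches ?d ?S (Suc n) (0, ts) (?S, ts') \<and> represents K ts' s'"
    using reaches_trans t1(2) by (metis plus_1_eq_Suc)
qed

lemma simulates_While_Nil:
  assumes "r < K" "s r = []"
  shows "simulates K (While r p) s 1 s"
  unfolding simulates_def
proof (intro allI impI)
  fix ts assume ts: "represents K ts s"
  have "scanned ts ! r = 0" using scanned_represents[OF ts assms(1)] assms(2) by simp
  then have "reaches (compile K (While r p)) (prog_size (While r p)) 1 (0, ts)
      (prog_size (While r p), ts)"
    by (intro reaches_step) simp_all
  then show "\<exists>ts'. reaches (compile K (While r p)) (prog_size (While r p)) 1 (0, ts)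
      (prog_size (While r p), ts') \<and> represents K ts' s"
    using ts by blast
qed

lemma simulates_While_Cons:
  assumes "r < K" "s r \<noteq> []" "simulates K p s n s1" "simulates K (While r p) s1 m s2"
  shows "simulates K (While r p) s (Suc (n + m)) s2"
  unfolding simulates_def
proof (intro allI impI)
  let ?d = "compile K (While r p)" let ?S = "prog_size (While r p)"
  let ?e = "\<lambda>i. if i = prog_size p then 0 else Suc i"
  fix ts assume ts: "represents K ts s"
  obtain t1 where t1: "reaches (compile K p) (prog_size p) n (0, ts) (prog_size p, t1)"
    "represents K t1 s1"
    using simulatesE[OF assms(3) ts] .
  obtain t2 where t2: "reaches ?d ?S m (0, t1) (?S, t2)" "represents K t2 s2"
    using simulatesE[OF assms(4) t1(2)] .
  have "scanned ts ! r \<noteq> 0"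
    using scanned_represents[OF ts assms(1)] assms(2) by (auto simp: bit_sym_def split: list.splits)
  then have "reaches ?d ?S 1 (0, ts) (1, ts)" by (intro reaches_step) simp_all
  moreover have "reaches ?d ?S n (1, ts) (0, t1)"
    using reaches_embed[OF t1(1), of ?e ?S ?d] prog_size_pos[of p] by simp
  ultimately have "reaches ?d ?S (1 + n + m) (0, ts) (?S, t2)" using reaches_trans t2(1) by blast
  then show "\<exists>ts'. reaches ?d ?S (Suc (n + m)) (0, ts) (?S, ts') \<and> represents K ts' s2"
    using t2(2) by auto
qed

lemma exec_simulates:
  "exec p s n s' \<Longrightarrow> reads p \<subseteq> {..<K} \<Longrightarrow> pushes p \<subseteq> {..K} \<Longrightarrow> simulates K p s n s'"
  by (induction rule: exec.induct)
    (auto intro: simulates_Push simulates_Pop simulates_Seq simulates_Cond_True simulates_Cond_False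
      simulates_While_Nil simulates_While_Cons simp del: One_nat_def)

definition input_store :: "word \<Rightarrow> store" where
  "input_store x = (\<lambda>i. if i = 0 then x else [])"

lemma represents_tm_init:
  "0 < K \<Longrightarrow> tm_tapes M = Suc K \<Longrightarrow> represents K (snd (tm_init M x)) (input_store x)"
  by (auto simp: represents_def input_store_def tm_init_def nth_Cons' holds_stack_def holds_output_def)

theorem compile_correct:
  assumes "0 < K" "reads p \<subseteq> {..<K}" "pushes p \<subseteq> {..K}"
  obtains M where "valid_tm M"
    "\<And>x n s. exec p (input_store x) n s \<Longrightarrow> tm_halts_with M x n (rev (s K))"
proof
  let ?M = "\<lparr>tm_tapes = Suc K, tm_states = prog_size p, tm_symbols = 3, tm_trans = compile K p\<rparr>"
  show "valid_tm ?M"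
    using valid_response_compile[OF assms(2,3)]
    by (simp add: valid_tm_def valid_response_def case_prod_unfold)
  fix x n s assume e: "exec p (input_store x) n s"
  obtain ts where ts: "reaches (compile K p) (prog_size p) n (0, snd (tm_init ?M x)) (prog_size p, ts)"
    "represents K ts s"
    by (rule simulatesE[OF exec_simulates[OF e assms(2,3)] represents_tm_init[OF assms(1)],
        of ?M]) simp_all
  have "(tm_step ?M ^^ n) (tm_init ?M x) = (prog_size p, ts)"
    by (rule reaches_tm_step) (use ts(1) in \<open>simp add: tm_init_def\<close>)
  moreover have "fst (last ts) = word_tape (rev (s K))"
    using ts(2) by (cases ts rule: rev_cases) (auto simp: represents_def holds_output_def)
  ultimately show "tm_halts_with ?M x n (rev (s K))" by (simp add: tm_halts_with_def)
qed

section \<open>Programs for elementary operations\<close>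

definition regs :: "prog \<Rightarrow> nat set" where
  "regs p = reads p \<union> pushes p"

lemma regs_simps [simp]:
  "regs (Push r b) = {r}" "regs (Pop r) = {r}" "regs (p ;; q) = regs p \<union> regs q"
  "regs (Cond r p q) = insert r (regs p \<union> regs q)" "regs (While r p) = insert r (regs p)"
  by (auto simp: regs_def)

definition runs :: "prog \<Rightarrow> store \<Rightarrow> nat \<Rightarrow> store \<Rightarrow> bool" where
  "runs p s N s' \<longleftrightarrow> (\<exists>n\<le>N. exec p s n s')"

lemma runs_mono: "runs p s N s' \<Longrightarrow> N \<le> N' \<Longrightarrow> runs p s N' s'"
  unfolding runs_def by (meson order_trans)

lemma runs_cong: "runs p s N s' \<Longrightarrow> N \<le> N' \<Longrightarrow> s' = s'' \<Longrightarrow> runs p s N' s''"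
  using runs_mono by blast

lemma runs_Push: "runs (Push r b) s 2 (s(r := b # s r))"
  unfolding runs_def using exec_Push by blast

lemma runs_Pop: "runs (Pop r) s 1 (s(r := tl (s r)))"
  unfolding runs_def using exec_Pop by blast

lemma runs_Seq: "runs p s a s1 \<Longrightarrow> runs q s1 b s2 \<Longrightarrow> runs (p ;; q) s (a + b) s2"
  unfolding runs_def by (meson add_mono exec_Seq)

lemma runs_Cond_True: "hd_true (s r) \<Longrightarrow> runs p s a s1 \<Longrightarrow> runs (Cond r p q) s (Suc a) s1"
  unfolding runs_def by (meson exec_Cond_True Suc_le_mono)

lemma runs_Cond_False: "\<not> hd_true (s r) \<Longrightarrow> runs q s a s1 \<Longrightarrow> runs (Cond r p q) s (Suc a) s1"
  unfolding runs_def by (meson exec_Cond_False Suc_le_mono)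

lemma runs_While_Nil: "s r = [] \<Longrightarrow> runs (While r p) s 1 s"
  unfolding runs_def using exec_While_Nil by blast

lemma runs_While_Cons:
  "s r \<noteq> [] \<Longrightarrow> runs p s a s1 \<Longrightarrow> runs (While r p) s1 b s2 \<Longrightarrow> runs (While r p) s (Suc (a + b)) s2"
  unfolding runs_def by (meson add_mono exec_While_Cons Suc_le_mono)

subsection \<open>Moving and copying stacks\<close>

definition for_each :: "nat \<Rightarrow> (bool \<Rightarrow> prog) \<Rightarrow> prog" where
  "for_each a B = While a (Cond a (B True) (B False) ;; Pop a)"

lemma fold_fun_upd_commute:
  assumes "\<And>c s w. g c (s(a := w)) = (g c s)(a := w)"
  shows "fold g cs (s(a := w)) = (fold g cs s)(a := w)"
  by (induction cs arbitrary: s) (simp_all add: assms)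

lemma runs_for_each:
  assumes body: "\<And>c s. runs (B c) s t (g c s)"
    and indep: "\<And>c s w. g c (s(a := w)) = (g c s)(a := w)"
  shows "runs (for_each a B) s ((t + 3) * length (s a) + 1) ((fold g (s a) s)(a := []))"
proof (induction "s a" arbitrary: s)
  case Nil
  show ?case unfolding for_each_def
    by (rule runs_cong[OF runs_While_Nil]) (use Nil in \<open>auto simp: fun_eq_iff\<close>)
next
  case (Cons c w)
  note sa = Cons(2)[symmetric]
  have ga: "g c s a = s a" using fun_cong[OF indep[of c s "s a"], of a] by simp
  have "runs (Cond a (B True) (B False)) s (Suc t) (g c s)"
    by (cases c) (use body sa in \<open>auto intro: runs_Cond_True runs_Cond_False\<close>)
  then have "runs (Cond a (B True) (B False) ;; Pop a) s (Suc t + 1) (g c (s(a := w)))"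
    by (rule runs_cong[OF runs_Seq[OF _ runs_Pop]]) (simp_all add: ga sa indep)
  moreover have "g c (s(a := w)) a = w" by (simp add: indep)
  then have "runs (for_each a B) (g c (s(a := w))) ((t + 3) * length w + 1)
      ((fold g w (g c (s(a := w))))(a := []))"
    using Cons(1)[of "g c (s(a := w))"] by simp
  ultimately have "runs (for_each a B) s (Suc ((Suc t + 1) + ((t + 3) * length w + 1)))
      ((fold g w (g c (s(a := w))))(a := []))"
    unfolding for_each_def by (intro runs_While_Cons) (auto simp: sa)
  then show ?case
    by (rule runs_cong) (simp_all add: sa indep fold_fun_upd_commute[of g a, OF indep])
qed

definition clear :: "nat \<Rightarrow> prog" where
  "clear a = While a (Pop a)"

definition pour :: "nat \<Rightarrow> nat \<Rightarrow> prog" where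
  "pour a b = for_each a (Push b)"

definition pour_both :: "nat \<Rightarrow> nat \<Rightarrow> nat \<Rightarrow> prog" where
  "pour_both a b c = for_each a (\<lambda>d. Push b d ;; Push c d)"

definition move_via :: "nat \<Rightarrow> nat \<Rightarrow> nat \<Rightarrow> prog" where
  "move_via t a b = pour a t ;; pour t b"

definition copy_via :: "nat \<Rightarrow> nat \<Rightarrow> nat \<Rightarrow> prog" where
  "copy_via t a b = pour a t ;; pour_both t a b"

lemma regs_move [simp]:
  "regs (clear a) = {a}" "regs (pour a b) = {a, b}" "regs (pour_both a b c) = {a, b, c}"
  "regs (move_via t a b) = {t, a, b}" "regs (copy_via t a b) = {t, a, b}"
  by (auto simp: clear_def pour_def pour_both_def move_via_def copy_via_def for_each_def)

lemma runs_clear: "runs (clear a) s (2 * length (s a) + 1) (s(a := []))"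
proof (induction "s a" arbitrary: s)
  case Nil
  show ?case unfolding clear_def by (rule runs_cong[OF runs_While_Nil]) (use Nil in auto)
next
  case (Cons c w)
  note sa = Cons(2)[symmetric]
  have "runs (clear a) (s(a := w)) (2 * length w + 1) (s(a := []))"
    by (rule runs_cong[OF Cons(1)]) simp_all
  moreover have "runs (Pop a) s 1 (s(a := w))" by (rule runs_cong[OF runs_Pop]) (simp_all add: sa)
  ultimately have "runs (clear a) s (Suc (1 + (2 * length w + 1))) (s(a := []))"
    unfolding clear_def by (intro runs_While_Cons) (auto simp: sa)
  then show ?case by (rule runs_mono) (simp add: sa)
qed

lemma runs_pour:
  assumes "a \<noteq> b"
  shows "runs (pour a b) s (5 * length (s a) + 1) (s(a := [], b := rev (s a) @ s b))"
proof -
  have fold: "fold (\<lambda>c s. s(b := c # s b)) w s = s(b := rev w @ s b)" for w and s :: store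
    by (induction w arbitrary: s) auto
  show ?thesis unfolding pour_def
    by (rule runs_cong[OF runs_for_each[OF runs_Push]]) (use assms in \<open>auto simp: fold fun_eq_iff\<close>)
qed

lemma runs_pour_both:
  assumes "a \<noteq> b" "a \<noteq> c" "b \<noteq> c"
  shows "runs (pour_both a b c) s (7 * length (s a) + 1)
    (s(a := [], b := rev (s a) @ s b, c := rev (s a) @ s c))"
proof -
  have fold: "fold (\<lambda>d s. s(b := d # s b, c := d # s c)) w s = s(b := rev w @ s b, c := rev w @ s c)"
    for w and s :: store
    using assms(3) by (induction w arbitrary: s) (auto simp: fun_eq_iff)
  have body: "runs (Push b d ;; Push c d) s 4 (s(b := d # s b, c := d # s c))" for d s
    by (rule runs_cong[OF runs_Seq[OF runs_Push runs_Push]]) (use assms(3) in auto)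
  show ?thesis unfolding pour_both_def
    by (rule runs_cong[OF runs_for_each[OF body]]) (use assms in \<open>auto simp: fold fun_eq_iff\<close>)
qed

lemma runs_move_via:
  assumes "distinct [t, a, b]" "s t = []"
  shows "runs (move_via t a b) s (10 * length (s a) + 2) (s(a := [], b := s a @ s b))"
  unfolding move_via_def
  by (rule runs_cong[OF runs_Seq[OF runs_pour runs_pour]]) (use assms in \<open>auto simp: fun_eq_iff\<close>)

lemma runs_copy_via:
  assumes "distinct [t, a, b]" "s t = []"
  shows "runs (copy_via t a b) s (12 * length (s a) + 2) (s(b := s a @ s b))"
  unfolding copy_via_def
  by (rule runs_cong[OF runs_Seq[OF runs_pour runs_pour_both]]) (use assms in \<open>auto simp: fun_eq_iff\<close>)

fun load :: "nat \<Rightarrow> word \<Rightarrow> prog" where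
  "load a [] = clear a"
| "load a (b # w) = load a w ;; Push a b"

lemma regs_load [simp]: "regs (load a w) = {a}"
  by (induction w) auto

lemma runs_load: "runs (load a w) s (2 * length (s a) + 1 + 2 * length w) (s(a := w))"
proof (induction w)
  case Nil
  show ?case unfolding load.simps by (rule runs_cong[OF runs_clear]) auto
next
  case (Cons b w)
  show ?case unfolding load.simps by (rule runs_cong[OF runs_Seq[OF Cons runs_Push]]) auto
qed

subsection \<open>Self-delimiting words\<close>

lemma enc_word_Nil: "enc_word [] = [False, True]"
  by (simp add: enc_word_def)

lemma enc_word_Cons: "enc_word (b # w) = b # b # enc_word w"
  by (simp add: enc_word_def)

lemma length_enc_word [simp]: "length (enc_word w) = 2 * length w + 2"
  by (induction w) (simp_all add: enc_word_Nil enc_word_Cons)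

lemma enc_word_append_eq_iff: "enc_word u @ y = enc_word v @ z \<longleftrightarrow> u = v \<and> y = z"
proof (induction u arbitrary: v)
  case Nil
  show ?case by (cases v) (auto simp: enc_word_Nil enc_word_Cons)
next
  case (Cons b u)
  then show ?case by (cases v) (auto simp: enc_word_Nil enc_word_Cons)
qed

definition encode :: "nat \<Rightarrow> nat \<Rightarrow> prog" where
  "encode a b = Push b True ;; Push b False ;; for_each a (\<lambda>c. Push b c ;; Push b c)"

definition decode_body :: "nat \<Rightarrow> nat \<Rightarrow> nat \<Rightarrow> prog" where
  "decode_body t a b = Cond a (Pop a ;; Pop a ;; Push b True)
     (Pop a ;; Cond a (Pop a ;; Pop t) (Pop a ;; Push b False))"

definition decode :: "nat \<Rightarrow> nat \<Rightarrow> nat \<Rightarrow> prog" where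
  "decode t a b = Push t True ;; While t (decode_body t a b)"

lemma regs_encode [simp]: "regs (encode a b) = {a, b}"
  by (auto simp: encode_def for_each_def)

lemma regs_decode [simp]: "regs (decode t a b) = {t, a, b}"
  by (auto simp: decode_def decode_body_def)

lemma runs_encode:
  assumes "a \<noteq> b"
  shows "runs (encode a b) s (7 * length (s a) + 5) (s(a := [], b := enc_word (rev (s a)) @ s b))"
proof -
  have fold: "fold (\<lambda>c s. s(b := c # c # s b)) w s = s(b := concat (map (\<lambda>c. [c, c]) (rev w)) @ s b)"
    for w and s :: store
    by (induction w arbitrary: s) auto
  have body: "runs (Push b c ;; Push b c) s 4 (s(b := c # c # s b))" for c s
    by (rule runs_cong[OF runs_Seq[OF runs_Push runs_Push]]) auto
  have "runs (for_each a (\<lambda>c. Push b c ;; Push b c)) s (7 * length (s a) + 1)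
      (s(a := [], b := concat (map (\<lambda>c. [c, c]) (rev (s a))) @ s b))" for s
    by (rule runs_cong[OF runs_for_each[OF body]]) (use assms in \<open>auto simp: fold fun_eq_iff\<close>)
  then show ?thesis unfolding encode_def
    by (rule runs_cong[OF runs_Seq[OF runs_Push runs_Seq[OF runs_Push]]])
      (use assms in \<open>auto simp: fun_eq_iff enc_word_def\<close>)
qed

lemma runs_decode_body_Nil:
  assumes "distinct [t, a, b]" "s a = enc_word [] @ v" "s t = [True]"
  shows "runs (decode_body t a b) s 5 (s(a := v, t := []))"
proof -
  have inner: "runs (Cond a (Pop a ;; Pop t) (Pop a ;; Push b False))
      (s(a := True # v)) 3 (s(a := v, t := []))"
    by (rule runs_cong[OF runs_Cond_True[OF _ runs_Seq[OF runs_Pop runs_Pop]]])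
      (use assms in \<open>auto simp: fun_eq_iff\<close>)
  have pop: "runs (Pop a) s 1 (s(a := True # v))"
    by (rule runs_cong[OF runs_Pop]) (simp_all add: assms enc_word_Nil)
  show ?thesis unfolding decode_body_def
    by (rule runs_cong[OF runs_Cond_False[OF _ runs_Seq[OF pop inner]]])
      (simp_all add: assms enc_word_Nil)
qed

lemma runs_decode_body_Cons:
  assumes "distinct [t, a, b]" "s a = enc_word (c # u) @ v"
  shows "runs (decode_body t a b) s 6 (s(a := enc_word u @ v, b := c # s b))"
proof (cases c)
  case True
  show ?thesis unfolding decode_body_def
    by (rule runs_cong[OF runs_Cond_True[OF _ runs_Seq[OF runs_Pop runs_Seq[OF runs_Pop runs_Push]]]])
      (use True assms in \<open>auto simp: fun_eq_iff enc_word_Cons\<close>)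
next
  case False
  have inner: "runs (Cond a (Pop a ;; Pop t) (Pop a ;; Push b False)) (s(a := False # enc_word u @ v)) 4
      (s(a := enc_word u @ v, b := c # s b))"
    by (rule runs_cong[OF runs_Cond_False[OF _ runs_Seq[OF runs_Pop runs_Push]]])
      (use assms False in \<open>auto simp: fun_eq_iff\<close>)
  have pop: "runs (Pop a) s 1 (s(a := False # enc_word u @ v))"
    by (rule runs_cong[OF runs_Pop]) (use assms False in \<open>simp_all add: enc_word_Cons\<close>)
  show ?thesis unfolding decode_body_def
    by (rule runs_cong[OF runs_Cond_False[OF _ runs_Seq[OF pop inner]]])
      (use assms False in \<open>simp_all add: enc_word_Cons\<close>)
qed

lemma runs_While_decode_body:
  assumes "distinct [t, a, b]" "s a = enc_word u @ v" "s t = [True]"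
  shows "runs (While t (decode_body t a b)) s (7 * length u + 7) (s(a := v, b := rev u @ s b, t := []))"
  using assms(2,3)
proof (induction u arbitrary: s)
  case Nil
  have stop: "runs (While t (decode_body t a b)) (s(a := v, t := [])) 1 (s(a := v, t := []))"
    by (rule runs_While_Nil) simp
  show ?case
    by (rule runs_cong[OF runs_While_Cons[OF _ runs_decode_body_Nil[OF assms(1) Nil] stop]])
      (use Nil assms(1) in \<open>auto simp: fun_eq_iff\<close>)
next
  case (Cons c u)
  let ?s = "s(a := enc_word u @ v, b := c # s b)"
  have rest: "runs (While t (decode_body t a b)) ?s (7 * length u + 7)
      (?s(a := v, b := rev u @ ?s b, t := []))"
    by (rule Cons.IH) (use Cons.prems assms(1) in auto)
  show ?case
    by (rule runs_cong[OF runs_While_Cons[OF _ runs_decode_body_Cons[of t a b s c u v,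
        OF assms(1) Cons.prems(1)] rest]])
      (use assms(1) Cons.prems(2) in \<open>auto simp: fun_eq_iff\<close>)
qed

lemma runs_decode:
  assumes "distinct [t, a, b]" "s a = enc_word u @ v" "s t = []"
  shows "runs (decode t a b) s (7 * length u + 9) (s(a := v, b := rev u @ s b))"
proof -
  have "runs (Push t True) s 2 (s(t := [True]))"
    by (rule runs_cong[OF runs_Push]) (simp_all add: assms(3))
  moreover have "runs (While t (decode_body t a b)) (s(t := [True])) (7 * length u + 7)
      (s(t := [True], a := v, b := rev u @ s b, t := []))"
    by (rule runs_cong[OF runs_While_decode_body[OF assms(1), of _ u v]]) (use assms in auto)
  ultimately show ?thesis unfolding decode_def
    by (rule runs_cong[OF runs_Seq]) (use assms in \<open>auto simp: fun_eq_iff\<close>)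
qed

section \<open>Polynomial-time functions between encoded types\<close>

subsection \<open>Encoded types\<close>

class enc =
  fixes enc :: "'a \<Rightarrow> word"
  assumes enc_inject: "enc x = enc y \<Longrightarrow> x = y"

abbreviation len :: "'a::enc \<Rightarrow> nat" where
  "len x \<equiv> length (enc x)"

instantiation bool :: enc
begin
definition enc_bool :: "bool \<Rightarrow> word" where "enc_bool b = [b]"
instance by standard (simp add: enc_bool_def)
end

instantiation nat :: enc
begin
definition enc_nat :: "nat \<Rightarrow> word" where "enc_nat n = replicate n True"
instance by standard (simp add: enc_nat_def replicate_eq_replicate)
end

instantiation prod :: (enc, enc) enc
begin
definition enc_prod :: "'a \<times> 'b \<Rightarrow> word" where "enc_prod p = enc_pair (enc (fst p)) (enc (snd p))"
instance by standard (auto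
    simp: enc_prod_def enc_pair_def enc_word_append_eq_iff prod_eq_iff enc_inject)
end

instantiation sum :: (enc, enc) enc
begin
definition enc_sum :: "'a + 'b \<Rightarrow> word" where
  "enc_sum z = (case z of Inl a \<Rightarrow> False # enc a | Inr b \<Rightarrow> True # enc b)"
instance by standard (auto simp: enc_sum_def enc_inject split: sum.splits)
end

instantiation list :: (enc) enc
begin
definition enc_list :: "'a list \<Rightarrow> word" where "enc_list xs = enc_words (map enc xs)"
instance
proof
  fix xs ys :: "'a list"
  show "enc xs = enc ys \<Longrightarrow> xs = ys"
  proof (induction xs arbitrary: ys)
    case Nil
    then show ?case by (cases ys) (auto simp: enc_list_def enc_words_def enc_word_def)
  next
    case (Cons x xs)
    then obtain y zs where "ys = y # zs"
      by (cases ys) (auto simp: enc_list_def enc_words_def enc_word_def)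
    then show ?case
      using Cons by (auto simp: enc_list_def enc_words_def enc_word_append_eq_iff enc_inject)
  qed
qed
end

text \<open>Words that are encoded by themselves, in contrast to the generic encoding of lists.\<close>

datatype raw = Raw (unraw: word)

instantiation raw :: enc
begin
definition enc_raw :: "raw \<Rightarrow> word" where "enc_raw = unraw"
instance by standard (simp add: enc_raw_def raw.expand)
end

lemma enc_simps [simp]:
  "enc b = [b]" "enc n = replicate n True" "enc (x, y) = enc_word (enc x) @ enc y"
  "enc (Inl x :: 'a::enc + 'b::enc) = False # enc x" "enc (Inr y :: 'a + 'b) = True # enc y"
  "enc ([] :: 'a list) = []" "enc (z # zs) = enc_word (enc z) @ enc zs"
  "enc (Raw w) = w"
  by (simp_all add: enc_bool_def enc_nat_def enc_prod_def enc_pair_def enc_sum_def enc_list_def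
      enc_words_def enc_raw_def)

subsection \<open>Polynomial bounds\<close>

definition poly_bounded :: "('a::enc \<Rightarrow> nat) \<Rightarrow> bool" where
  "poly_bounded T \<longleftrightarrow> (\<exists>p :: nat poly. \<forall>x. T x \<le> poly p (len x))"

named_theorems poly_bounded_intros

lemma poly_nat_mono: "m \<le> n \<Longrightarrow> poly (p :: nat poly) m \<le> poly p n"
  by (induction p) (auto intro!: add_mono mult_mono)

lemma poly_boundedI: "(\<And>x. T x \<le> poly p (len x)) \<Longrightarrow> poly_bounded T"
  unfolding poly_bounded_def by blast

lemma poly_boundedE:
  assumes "poly_bounded T" obtains p where "\<And>x. T x \<le> poly p (len x)"
  using assms unfolding poly_bounded_def by blast

lemma poly_bounded_mono: "poly_bounded T \<Longrightarrow> (\<And>x. S x \<le> T x) \<Longrightarrow> poly_bounded S"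
  unfolding poly_bounded_def by (meson order_trans)

lemma poly_bounded_const [poly_bounded_intros]: "poly_bounded (\<lambda>x. c)"
  by (rule poly_boundedI[of _ "[:c:]"]) simp

lemma poly_bounded_len [poly_bounded_intros]: "poly_bounded len"
  by (rule poly_boundedI[of _ "[:0, 1:]"]) simp

lemma poly_bounded_add [poly_bounded_intros]:
  assumes "poly_bounded S" "poly_bounded T" shows "poly_bounded (\<lambda>x. S x + T x)"
proof -
  obtain p where p: "S x \<le> poly p (len x)" for x using assms(1) by (rule poly_boundedE) blast
  obtain q where q: "T x \<le> poly q (len x)" for x using assms(2) by (rule poly_boundedE) blast
  show ?thesis by (rule poly_boundedI[of _ "p + q"]) (simp add: add_mono p q)
qed

lemma poly_bounded_mult [poly_bounded_intros]:
  assumes "poly_bounded S" "poly_bounded T" shows "poly_bounded (\<lambda>x. S x * T x)"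
proof -
  obtain p where p: "S x \<le> poly p (len x)" for x using assms(1) by (rule poly_boundedE) blast
  obtain q where q: "T x \<le> poly q (len x)" for x using assms(2) by (rule poly_boundedE) blast
  show ?thesis by (rule poly_boundedI[of _ "p * q"]) (simp add: mult_mono p q)
qed

lemma poly_bounded_Suc [poly_bounded_intros]: "poly_bounded T \<Longrightarrow> poly_bounded (\<lambda>x. Suc (T x))"
  using poly_bounded_add[OF poly_bounded_const[of 1]] by simp

lemma poly_bounded_poly [poly_bounded_intros]:
  assumes "poly_bounded T" shows "poly_bounded (\<lambda>x. poly p (T x))"
proof -
  obtain q where q: "T x \<le> poly q (len x)" for x using assms by (rule poly_boundedE) blast
  show ?thesis by (rule poly_boundedI[of _ "pcompose p q"]) (simp add: poly_pcompose poly_nat_mono q)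
qed

subsection \<open>Implementations by stack programs\<close>

definition work_clear :: "nat \<Rightarrow> store \<Rightarrow> bool" where
  "work_clear K s \<longleftrightarrow> (\<forall>i. 0 < i \<longrightarrow> i < K \<longrightarrow> s i = [])"

lemma work_clear_upd [simp]: "i = 0 \<or> K \<le> i \<Longrightarrow> work_clear K (s(i := w)) \<longleftrightarrow> work_clear K s"
  unfolding work_clear_def fun_upd_apply by (metis leD less_irrefl)

lemma work_clear_mono: "work_clear K s \<Longrightarrow> L \<le> K \<Longrightarrow> work_clear L s"
  by (simp add: work_clear_def)

definition implements :: "nat \<Rightarrow> prog \<Rightarrow> nat poly \<Rightarrow> 'a set \<Rightarrow> ('a::enc \<Rightarrow> 'b::enc) \<Rightarrow> bool" where
  "implements K P p D f \<longleftrightarrow> 0 < K \<and> regs P \<subseteq> {..<K} \<and>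
     (\<forall>x\<in>D. \<forall>s. s 0 = enc x \<longrightarrow> work_clear K s \<longrightarrow> runs P s (poly p (len x)) (s(0 := enc (f x))))"

lemma implements_mono: "implements K P p D f \<Longrightarrow> K \<le> L \<Longrightarrow> implements L P p D f"
  by (fastforce simp: implements_def work_clear_mono subset_eq)

lemma implements_runs:
  "implements K P p D f \<Longrightarrow> x \<in> D \<Longrightarrow> s 0 = enc x \<Longrightarrow> work_clear K s \<Longrightarrow>
   runs P s (poly p (len x)) (s(0 := enc (f x)))"
  by (simp add: implements_def)

lemma implements_regs: "implements K P p D f \<Longrightarrow> regs P \<subseteq> {..<K}"
  by (simp add: implements_def)

definition ptime_on :: "'a set \<Rightarrow> ('a::enc \<Rightarrow> 'b::enc) \<Rightarrow> bool" where
  "ptime_on D f \<longleftrightarrow> (\<exists>K P p. implements K P p D f)"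

abbreviation ptime :: "('a::enc \<Rightarrow> 'b::enc) \<Rightarrow> bool" where
  "ptime \<equiv> ptime_on UNIV"

lemma ptime_onI:
  assumes "0 < K" "regs P \<subseteq> {..<K}" "poly_bounded T"
    "\<And>x s. x \<in> D \<Longrightarrow> s 0 = enc x \<Longrightarrow> work_clear K s \<Longrightarrow> runs P s (T x) (s(0 := enc (f x)))"
  shows "ptime_on D f"
proof -
  obtain p where p: "T x \<le> poly p (len x)" for x using assms(3) by (rule poly_boundedE) blast
  have "implements K P p D f"
    using assms(1,2) runs_mono[OF assms(4) p] by (simp add: implements_def)
  then show ?thesis unfolding ptime_on_def by blast
qed

lemma ptime_onE:
  assumes "ptime_on D f"
  obtains K P p where "\<And>L. K \<le> L \<Longrightarrow> implements L P p D f" "\<And>x. x \<in> D \<Longrightarrow> len (f x) \<le> poly p (len x)"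
proof -
  obtain K P p where impl: "implements K P p D f" using assms unfolding ptime_on_def by blast
  let ?p = "[:0, 1:] + p"
  have impl': "implements K P ?p D f"
    using impl runs_mono[OF _ le_add2] by (auto simp: implements_def)
  have size: "len (f x) \<le> poly ?p (len x)" if "x \<in> D" for x
  proof -
    let ?s = "input_store (enc x)"
    have "runs P ?s (poly p (len x)) (?s(0 := enc (f x)))"
      by (rule implements_runs[OF impl that]) (simp_all add: input_store_def work_clear_def)
    then obtain n where "n \<le> poly p (len x)" "exec P ?s n (?s(0 := enc (f x)))"
      unfolding runs_def by blast
    then show ?thesis using exec_length[of P ?s n _ 0] by (fastforce simp: input_store_def)
  qed
  show thesis by (rule that[OF implements_mono[OF impl'] size])
qed

lemma ptime_on_subset: "ptime_on D f \<Longrightarrow> E \<subseteq> D \<Longrightarrow> ptime_on E f"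
  unfolding ptime_on_def implements_def by (meson subsetD)

lemma ptime_on_enc_cong:
  "ptime_on D f \<Longrightarrow> (\<And>x. x \<in> D \<Longrightarrow> enc (g x) = enc (f x)) \<Longrightarrow> ptime_on D g"
  by (simp add: ptime_on_def implements_def)

lemma ptime_on_cong: "ptime_on D f \<Longrightarrow> (\<And>x. x \<in> D \<Longrightarrow> f x = g x) \<Longrightarrow> ptime_on D g"
  by (rule ptime_on_enc_cong[of D f]) simp_all

lemma ptime_on_id: "ptime_on D (\<lambda>x. x)"
  by (rule ptime_onI[of 2 "Pop 1" "\<lambda>_. 1"])
    (auto intro!: poly_bounded_intros runs_cong[OF runs_Pop] simp: fun_eq_iff work_clear_def)

lemma ptime_on_recode: "(\<And>x. x \<in> D \<Longrightarrow> enc (f x) = enc x) \<Longrightarrow> ptime_on D f"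
  by (rule ptime_on_enc_cong[OF ptime_on_id])

lemma ptime_on_const: "ptime_on D (\<lambda>x. c)"
  by (rule ptime_onI[of 1 "load 0 (enc c)" "\<lambda>x. 2 * len x + 1 + 2 * len c"])
    (auto intro!: poly_bounded_intros runs_cong[OF runs_load])

lemma ptime_on_comp:
  assumes "ptime_on D g" "ptime_on E f" "\<And>x. x \<in> D \<Longrightarrow> g x \<in> E"
  shows "ptime_on D (\<lambda>x. f (g x))"
proof -
  obtain K\<^sub>g P p where g: "\<And>L. K\<^sub>g \<le> L \<Longrightarrow> implements L P p D g" "\<And>x. x \<in> D \<Longrightarrow> len (g x) \<le> poly p (len x)"
    using assms(1) by (rule ptime_onE) blast
  obtain K\<^sub>f Q q where f: "\<And>L. K\<^sub>f \<le> L \<Longrightarrow> implements L Q q E f"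
    using assms(2) by (rule ptime_onE) blast
  define K where "K = Suc (max K\<^sub>g K\<^sub>f)"
  have P: "implements K P p D g" and Q: "implements K Q q E f" using g f by (simp_all add: K_def)
  show ?thesis
  proof (rule ptime_onI[of K "P ;; Q" "\<lambda>x. poly p (len x) + poly q (poly p (len x))"])
    fix x s assume x: "x \<in> D" and s: "s 0 = enc x" "work_clear K s"
    have "runs P s (poly p (len x)) (s(0 := enc (g x)))"
      by (rule implements_runs[OF P x s])
    moreover have "runs Q (s(0 := enc (g x))) (poly q (len (g x)))
        (s(0 := enc (g x), 0 := enc (f (g x))))"
      by (rule implements_runs[OF Q assms(3)[OF x]]) (simp_all add: s)
    ultimately show "runs (P ;; Q) s (poly p (len x) + poly q (poly p (len x))) (s(0 := enc (f (g x))))"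
      by (rule runs_cong[OF runs_Seq]) (simp_all add: poly_nat_mono g(2)[OF x])
  qed (use implements_regs[OF P] implements_regs[OF Q]
      in \<open>auto simp: K_def subset_iff intro!: poly_bounded_intros\<close>)
qed

subsection \<open>Pairs and conditionals\<close>

lemma ptime_on_Pair:
  assumes "ptime_on D f" "ptime_on D g"
  shows "ptime_on D (\<lambda>x. (f x, g x))"
proof -
  obtain K\<^sub>f P p where f: "\<And>L. K\<^sub>f \<le> L \<Longrightarrow> implements L P p D f" "\<And>x. x \<in> D \<Longrightarrow> len (f x) \<le> poly p (len x)"
    using assms(1) by (rule ptime_onE) blast
  obtain K\<^sub>g Q q where g: "\<And>L. K\<^sub>g \<le> L \<Longrightarrow> implements L Q q D g" "\<And>x. x \<in> D \<Longrightarrow> len (g x) \<le> poly q (len x)"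
    using assms(2) by (rule ptime_onE) blast
  define K where "K = Suc (max K\<^sub>f K\<^sub>g)"
  have P: "implements K P p D f" and Q: "implements K Q q D g" and K: "0 < K"
    using f g by (simp_all add: K_def)
  let ?R = "copy_via (K + 1) 0 K ;; Q ;; move_via (K + 1) 0 (K + 2) ;; move_via (K + 1) K 0 ;; P ;;
    pour 0 K ;; move_via (K + 1) (K + 2) 0 ;; encode K 0"
  let ?T = "\<lambda>x. (12 * len x + 2) + (poly q (len x) + ((10 * poly q (len x) + 2) + ((10 * len x + 2) +
    (poly p (len x) + ((5 * poly p (len x) + 1) +
        ((10 * poly q (len x) + 2) + (7 * poly p (len x) + 5)))))))"
  show ?thesis
  proof (rule ptime_onI[of "K + 3" ?R ?T])
    show "regs ?R \<subseteq> {..<K + 3}"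
      using implements_regs[OF P] implements_regs[OF Q]
      by (auto simp: subset_iff intro: trans_less_add1)
    fix x s assume x: "x \<in> D" and s0: "s 0 = enc x" and wc: "work_clear (K + 3) s"
    let ?F = "enc (f x)" and ?G = "enc (g x)"
    have le: "length ?F \<le> poly p (len x)" "length ?G \<le> poly q (len x)" using f(2) g(2) x by auto
    have s: "s K = []" "s (K + 1) = []" "s (K + 2) = []" "K \<noteq> 0" "0 \<noteq> K" "work_clear K s"
      using wc K by (auto simp: work_clear_def)
    have "runs (copy_via (K + 1) 0 K) s (12 * len x + 2) (s(K := enc x))"
      by (rule runs_cong[OF runs_copy_via]) (use s s0 in auto)
    moreover have "runs Q (s(K := enc x)) (poly q (len x)) (s(K := enc x, 0 := ?G))"
      by (rule implements_runs[OF Q x]) (use s s0 in auto)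
    moreover have "runs (move_via (K + 1) 0 (K + 2)) (s(K := enc x, 0 := ?G)) (10 * poly q (len x) + 2)
        (s(K := enc x, 0 := [], K + 2 := ?G))"
      by (rule runs_cong[OF runs_move_via]) (use s le in \<open>auto simp: fun_eq_iff\<close>)
    moreover have "runs (move_via (K + 1) K 0) (s(K := enc x, 0 := [], K + 2 := ?G)) (10 * len x + 2)
        (s(K + 2 := ?G))"
      by (rule runs_cong[OF runs_move_via]) (use s s0 in \<open>auto simp: fun_eq_iff\<close>)
    moreover have "runs P (s(K + 2 := ?G)) (poly p (len x)) (s(K + 2 := ?G, 0 := ?F))"
      by (rule implements_runs[OF P x]) (use s s0 in auto)
    moreover have "runs (pour 0 K) (s(K + 2 := ?G, 0 := ?F)) (5 * poly p (len x) + 1)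
        (s(K + 2 := ?G, 0 := [], K := rev ?F))"
      by (rule runs_cong[OF runs_pour]) (use s le in \<open>auto simp: fun_eq_iff\<close>)
    moreover have "runs (move_via (K + 1) (K + 2) 0) (s(K + 2 := ?G, 0 := [], K := rev ?F))
        (10 * poly q (len x) + 2) (s(0 := ?G, K := rev ?F))"
      by (rule runs_cong[OF runs_move_via]) (use s le in \<open>auto simp: fun_eq_iff\<close>)
    moreover have "runs (encode K 0) (s(0 := ?G, K := rev ?F)) (7 * poly p (len x) + 5)
        (s(0 := enc (f x, g x)))"
      by (rule runs_cong[OF runs_encode]) (use s le in \<open>auto simp: fun_eq_iff\<close>)
    ultimately show "runs ?R s (?T x) (s(0 := enc (f x, g x)))" by (intro runs_Seq)
  qed (auto intro!: poly_bounded_intros)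
qed

lemma ptime_on_fst: "ptime_on D fst"
proof (rule ptime_onI[of 3 "decode 2 0 1 ;; clear 0 ;; pour 1 0"
      "\<lambda>x. (7 * len x + 9) + ((2 * len x + 1) + (5 * len x + 1))"])
  fix x :: "'a \<times> 'b" and s :: store assume s: "s 0 = enc x" "work_clear 3 s"
  obtain a b where x: "x = (a, b)" by fastforce
  have "runs (decode 2 0 1) s (7 * len x + 9) (s(0 := enc b, 1 := rev (enc a)))"
    by (rule runs_cong[OF runs_decode]) (use s in \<open>auto simp: x work_clear_def\<close>)
  moreover have "runs (clear 0) (s(0 := enc b, 1 := rev (enc a))) (2 * len x + 1)
      (s(0 := [], 1 := rev (enc a)))"
    by (rule runs_cong[OF runs_clear]) (auto simp: x)
  moreover have "runs (pour 1 0) (s(0 := [], 1 := rev (enc a))) (5 * len x + 1) (s(0 := enc (fst x)))"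
    by (rule runs_cong[OF runs_pour]) (use s in \<open>auto simp: x fun_eq_iff work_clear_def\<close>)
  ultimately show "runs (decode 2 0 1 ;; clear 0 ;; pour 1 0) s
      ((7 * len x + 9) + ((2 * len x + 1) + (5 * len x + 1))) (s(0 := enc (fst x)))"
    by (intro runs_Seq)
qed (auto intro!: poly_bounded_intros)

lemma ptime_on_snd: "ptime_on D snd"
proof (rule ptime_onI[of 3 "decode 2 0 1 ;; clear 1" "\<lambda>x. (7 * len x + 9) + (2 * len x + 1)"])
  fix x :: "'a \<times> 'b" and s :: store assume s: "s 0 = enc x" "work_clear 3 s"
  obtain a b where x: "x = (a, b)" by fastforce
  have "runs (decode 2 0 1) s (7 * len x + 9) (s(0 := enc b, 1 := rev (enc a)))"
    by (rule runs_cong[OF runs_decode]) (use s in \<open>auto simp: x work_clear_def\<close>)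
  moreover have "runs (clear 1) (s(0 := enc b, 1 := rev (enc a))) (2 * len x + 1) (s(0 := enc (snd x)))"
    by (rule runs_cong[OF runs_clear]) (use s in \<open>auto simp: x fun_eq_iff work_clear_def\<close>)
  ultimately show "runs (decode 2 0 1 ;; clear 1) s ((7 * len x + 9) + (2 * len x + 1))
      (s(0 := enc (snd x)))"
    by (intro runs_Seq)
qed (auto intro!: poly_bounded_intros)

lemma runs_restore_and:
  assumes "implements K R r D f" "x \<in> D" "s 0 = enc x" "work_clear (K + 2) s" "0 < K"
  shows "runs (Pop 0 ;; move_via (K + 1) K 0 ;; R) (s(K := enc x, 0 := [b]))
    (1 + ((10 * len x + 2) + poly r (len x))) (s(0 := enc (f x)))"
proof -
  have s: "s K = []" "s (K + 1) = []" "K \<noteq> 0" "work_clear K s"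
    using assms(4,5) by (auto simp: work_clear_def)
  have "runs (Pop 0) (s(K := enc x, 0 := [b])) 1 (s(K := enc x, 0 := []))"
    by (rule runs_cong[OF runs_Pop]) (use s in \<open>auto simp: fun_eq_iff\<close>)
  moreover have "runs (move_via (K + 1) K 0) (s(K := enc x, 0 := [])) (10 * len x + 2) s"
    by (rule runs_cong[OF runs_move_via]) (use s assms(3) in \<open>auto simp: fun_eq_iff\<close>)
  moreover have "runs R s (poly r (len x)) (s(0 := enc (f x)))"
    by (rule implements_runs[OF assms(1-3) s(4)])
  ultimately show ?thesis by (intro runs_Seq)
qed

lemma ptime_on_If:
  assumes "ptime_on D b" "ptime_on {x \<in> D. b x} f" "ptime_on {x \<in> D. \<not> b x} g"
  shows "ptime_on D (\<lambda>x. if b x then f x else g x)"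
proof -
  obtain K\<^sub>b B h where b: "\<And>L. K\<^sub>b \<le> L \<Longrightarrow> implements L B h D b"
    using assms(1) by (rule ptime_onE) blast
  obtain K\<^sub>f P p where f: "\<And>L. K\<^sub>f \<le> L \<Longrightarrow> implements L P p {x \<in> D. b x} f"
    using assms(2) by (rule ptime_onE) blast
  obtain K\<^sub>g Q q where g: "\<And>L. K\<^sub>g \<le> L \<Longrightarrow> implements L Q q {x \<in> D. \<not> b x} g"
    using assms(3) by (rule ptime_onE) blast
  define K where "K = Suc (max K\<^sub>b (max K\<^sub>f K\<^sub>g))"
  have B: "implements K B h D b" and P: "implements K P p {x \<in> D. b x} f"
    and Q: "implements K Q q {x \<in> D. \<not> b x} g" and K: "0 < K" using b f g by (simp_all add: K_def)
  let ?branch = "\<lambda>P. Pop 0 ;; move_via (K + 1) K 0 ;; P"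
  let ?R = "copy_via (K + 1) 0 K ;; B ;; Cond 0 (?branch P) (?branch Q)"
  let ?t = "\<lambda>x. 1 + ((10 * len x + 2) + (poly p (len x) + poly q (len x)))"
  let ?T = "\<lambda>x. (12 * len x + 2) + (poly h (len x) + Suc (?t x))"
  show ?thesis
  proof (rule ptime_onI[of "K + 2" ?R ?T])
    show "regs ?R \<subseteq> {..<K + 2}"
      using implements_regs[OF P] implements_regs[OF Q] implements_regs[OF B]
      by (auto simp: subset_iff intro: less_SucI)
    fix x s assume x: "x \<in> D" and s0: "s 0 = enc x" and wc: "work_clear (K + 2) s"
    have s: "s K = []" "s (K + 1) = []" "K \<noteq> 0" "0 \<noteq> K" "work_clear K s"
      using wc K by (auto simp: work_clear_def)
    let ?h = "if b x then f x else g x" and ?s = "s(K := enc x, 0 := [b x])"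
    have "runs (copy_via (K + 1) 0 K) s (12 * len x + 2) (s(K := enc x))"
      by (rule runs_cong[OF runs_copy_via]) (use s s0 in auto)
    moreover have "runs B (s(K := enc x)) (poly h (len x)) ?s"
      using implements_runs[OF B x, of "s(K := enc x)"] s s0 by simp
    moreover have "runs (Cond 0 (?branch P) (?branch Q)) ?s (Suc (?t x)) (s(0 := enc ?h))"
    proof (cases "b x")
      case True
      then have "runs (?branch P) ?s (?t x) (s(0 := enc ?h))"
        using runs_mono[OF runs_restore_and[OF P _ s0 wc K, where b = "b x"], where N' = "?t x"] x
        by simp
      then show ?thesis using True by (intro runs_Cond_True) auto
    next
      case False
      then have "runs (?branch Q) ?s (?t x) (s(0 := enc ?h))"
        using runs_mono[OF runs_restore_and[OF Q _ s0 wc K, where b = "b x"], where N' = "?t x"] x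
        by simp
      then show ?thesis using False by (intro runs_Cond_False) auto
    qed
    ultimately show "runs ?R s (?T x) (s(0 := enc ?h))" by (intro runs_Seq)
  qed (auto intro!: poly_bounded_intros)
qed

subsection \<open>Raw words\<close>

lemma ptime_raw_hd_true: "ptime (\<lambda>w. hd_true (unraw w))"
proof (rule ptime_onI[of 1 "Cond 0 (load 0 [True]) (load 0 [False])" "\<lambda>x. Suc (2 * len x + 3)"])
  fix x :: raw and s :: store assume s: "s 0 = enc x"
  have load: "runs (load 0 [b]) s (2 * len x + 3) (s(0 := [b]))" for b
    by (rule runs_cong[OF runs_load]) (simp_all add: s)
  show "runs (Cond 0 (load 0 [True]) (load 0 [False])) s (Suc (2 * len x + 3))
      (s(0 := enc (hd_true (unraw x))))"
  proof (cases "hd_true (unraw x)")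
    case True
    then show ?thesis by (intro runs_cong[OF runs_Cond_True[OF _ load]]) (simp_all add: s enc_raw_def)
  next
    case False
    then show ?thesis by (intro runs_cong[OF runs_Cond_False[OF _ load]]) (simp_all add: s enc_raw_def)
  qed
qed (auto intro!: poly_bounded_intros)

lemma ptime_raw_null: "ptime (\<lambda>w. unraw w = [])"
proof (rule ptime_onI[of 2 "Push 1 True ;; While 0 (clear 0 ;; Pop 1) ;; Push 0 False ;;
      Cond 1 (Pop 1 ;; load 0 [True]) (Pop 1)" "\<lambda>x. 2 + ((2 * len x + 4) + (2 + 7))"])
  fix x :: raw and s :: store assume s: "s 0 = enc x" "work_clear 2 s"
  let ?b = "s 0 = []" let ?w = "if ?b then [True] else []"
  have s1: "s (Suc 0) = []" using s(2) by (simp add: work_clear_def)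
  have "runs (Push 1 True) s 2 (s(1 := [True]))" by (rule runs_cong[OF runs_Push]) (simp_all add: s1)
  moreover have "runs (While 0 (clear 0 ;; Pop 1)) (s(1 := [True])) (2 * len x + 4)
      (s(1 := ?w, 0 := []))"
  proof (cases ?b)
    case True
    then show ?thesis by (intro runs_cong[OF runs_While_Nil]) (auto simp: fun_eq_iff)
  next
    case False
    have "runs (clear 0 ;; Pop 1) (s(1 := [True])) (2 * len x + 2) (s(0 := []))"
      by (rule runs_cong[OF runs_Seq[OF runs_clear runs_Pop]]) (use s s1 in \<open>auto simp: fun_eq_iff\<close>)
    moreover have "runs (While 0 (clear 0 ;; Pop 1)) (s(0 := [])) 1 (s(0 := []))"
      by (rule runs_While_Nil) simp
    ultimately have "runs (While 0 (clear 0 ;; Pop 1)) (s(1 := [True])) (Suc ((2 * len x + 2) + 1))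
        (s(0 := []))"
      by (intro runs_While_Cons) (use False in auto)
    then show ?thesis by (rule runs_cong) (use False s1 in \<open>auto simp: fun_eq_iff\<close>)
  qed
  moreover have "runs (Push 0 False) (s(1 := ?w, 0 := [])) 2 (s(1 := ?w, 0 := [False]))"
    by (rule runs_cong[OF runs_Push]) (auto simp: fun_eq_iff)
  moreover have "runs (Cond 1 (Pop 1 ;; load 0 [True]) (Pop 1))
      (s(1 := ?w, 0 := [False])) 7 (s(0 := [?b]))"
  proof (cases ?b)
    case True
    then show ?thesis
      by (intro runs_cong[OF runs_Cond_True[OF _ runs_Seq[OF runs_Pop runs_load]]])
        (auto simp: fun_eq_iff s1)
  next
    case False
    then show ?thesis
      by (intro runs_cong[OF runs_Cond_False[OF _ runs_Pop]]) (auto simp: fun_eq_iff s1)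
  qed
  ultimately show "runs (Push 1 True ;; While 0 (clear 0 ;; Pop 1) ;; Push 0 False ;;
      Cond 1 (Pop 1 ;; load 0 [True]) (Pop 1))
          s (2 + ((2 * len x + 4) + (2 + 7))) (s(0 := enc (unraw x = [])))"
    using s(1) by (intro runs_Seq) (simp_all add: enc_raw_def)
qed (auto intro!: poly_bounded_intros)

lemma ptime_raw_tl: "ptime (\<lambda>w. Raw (tl (unraw w)))"
  by (rule ptime_onI[of 1 "Pop 0" "\<lambda>_. 1"])
    (auto intro!: poly_bounded_intros runs_cong[OF runs_Pop] simp: enc_raw_def)

lemma ptime_raw_Cons: "ptime (\<lambda>w. Raw (b # unraw w))"
  by (rule ptime_onI[of 1 "Push 0 b" "\<lambda>_. 2"])
    (auto intro!: poly_bounded_intros runs_cong[OF runs_Push] simp: enc_raw_def)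

subsection \<open>Iteration\<close>

lemma runs_While_funpow:
  fixes f :: "'a::enc \<Rightarrow> 'a"
  assumes F: "implements K F p UNIV f"
    and "s 0 = enc a" "work_clear K s" "\<And>i. i \<le> length (s K) \<Longrightarrow> len ((f ^^ i) a) \<le> m"
  shows "runs (While K (Pop K ;; F)) s (length (s K) * (2 + poly p m) + 1)
    (s(0 := enc ((f ^^ length (s K)) a), K := []))"
  using assms(2-)
proof (induction "s K" arbitrary: s a)
  case Nil
  then show ?case
    using F by (intro runs_cong[OF runs_While_Nil])
      (auto simp: fun_eq_iff implements_def simp flip: Nil.hyps)
next
  case (Cons c w)
  note sK = Cons.hyps(2)[symmetric]
  have K: "K \<noteq> 0" using F by (simp add: implements_def)
  let ?s = "s(K := w, 0 := enc (f a))"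
  have "runs (Pop K) s 1 (s(K := w))" by (rule runs_cong[OF runs_Pop]) (simp_all add: sK)
  moreover have "runs F (s(K := w)) (poly p (len a)) ?s"
    by (rule implements_runs[OF F]) (use Cons.prems K in auto)
  then have "runs F (s(K := w)) (poly p m) ?s"
    by (rule runs_mono) (use Cons.prems(3)[of 0] in \<open>simp add: poly_nat_mono\<close>)
  ultimately have body: "runs (Pop K ;; F) s (1 + poly p m) ?s" by (rule runs_Seq)
  have "len ((f ^^ i) (f a)) \<le> m" if "i \<le> length w" for i
    using Cons.prems(3)[of "Suc i"] that by (simp add: funpow_swap1 sK)
  then have "runs (While K (Pop K ;; F)) ?s (length (?s K) * (2 + poly p m) + 1)
      (?s(0 := enc ((f ^^ length (?s K)) (f a)), K := []))"
    by (intro Cons.hyps(1)) (use Cons.prems K in auto)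
  from runs_While_Cons[OF _ body this] show ?case
    by (rule runs_cong) (use K in \<open>auto simp: sK fun_eq_iff funpow_swap1\<close>)
qed

lemma ptime_funpow_len:
  fixes f :: "'a::enc \<Rightarrow> 'a" and g :: "'x::enc \<Rightarrow> 'c::enc \<times> 'a"
  assumes "ptime f" "ptime g" "poly_bounded B"
    and bound: "\<And>x i. i \<le> len (fst (g x)) \<Longrightarrow> len ((f ^^ i) (snd (g x))) \<le> B x"
  shows "ptime (\<lambda>x. (f ^^ len (fst (g x))) (snd (g x)))"
proof -
  obtain K\<^sub>g G q where g: "\<And>L. K\<^sub>g \<le> L \<Longrightarrow> implements L G q UNIV g" "\<And>x. len (g x) \<le> poly q (len x)"
    using assms(2) by (rule ptime_onE) blast
  obtain K\<^sub>f F p where f: "\<And>L. K\<^sub>f \<le> L \<Longrightarrow> implements L F p UNIV f"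
    using assms(1) by (rule ptime_onE) blast
  define K where "K = max 3 (max K\<^sub>f K\<^sub>g)"
  have F: "implements K F p UNIV f" and G: "implements K G q UNIV g" and K: "3 \<le> K"
    using f g by (simp_all add: K_def)
  let ?W = "While K (Pop K ;; F)" let ?R = "G ;; decode 2 0 1 ;; pour 1 K ;; ?W"
  let ?T = "\<lambda>x. poly q (len x) + ((7 * poly q (len x) + 9) + ((5 * poly q (len x) + 1) +
    (poly q (len x) * (2 + poly p (B x)) + 1)))"
  show ?thesis
  proof (rule ptime_onI[of "K + 1" ?R ?T])
    show "regs ?R \<subseteq> {..<K + 1}"
      using implements_regs[OF F] implements_regs[OF G] K by (auto simp: subset_iff intro: less_SucI)
    fix x :: 'x and s :: store assume s0: "s 0 = enc x" and wc: "work_clear (K + 1) s"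
    obtain c a where gx: "g x = (c, a)" by fastforce
    have le: "2 * len c + 2 + len a \<le> poly q (len x)" using g(2)[of x] by (simp add: gx)
    have s: "s 1 = []" "s 2 = []" "s K = []" "work_clear K s" using wc K by (auto simp: work_clear_def)
    let ?s = "s(0 := enc a, K := enc c)"
    have "runs G s (poly q (len x)) (s(0 := enc (g x)))"
      by (rule implements_runs[OF G]) (simp_all add: s0 s)
    moreover have "runs (decode 2 0 1) (s(0 := enc (g x))) (7 * poly q (len x) + 9)
        (s(0 := enc a, 1 := rev (enc c)))"
      by (rule runs_cong[OF runs_decode[where u = "enc c" and v = "enc a"]])
        (use s le in \<open>auto simp: gx fun_eq_iff\<close>)
    moreover have "runs (pour 1 K) (s(0 := enc a, 1 := rev (enc c))) (5 * poly q (len x) + 1) ?s"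
      by (rule runs_cong[OF runs_pour]) (use s le K in \<open>auto simp: fun_eq_iff\<close>)
    moreover have "runs ?W ?s (poly q (len x) * (2 + poly p (B x)) + 1) (s(0 := enc ((f ^^ len c) a)))"
    proof (rule runs_cong[OF runs_While_funpow[OF F]])
      show "length (?s K) * (2 + poly p (B x)) + 1 \<le> poly q (len x) * (2 + poly p (B x)) + 1"
        using le by (intro add_right_mono mult_right_mono) auto
    qed (use K s bound[of _ x] in \<open>auto simp: gx fun_eq_iff\<close>)
    ultimately show "runs ?R s (?T x) (s(0 := enc ((f ^^ len (fst (g x))) (snd (g x)))))"
      unfolding gx fst_conv snd_conv by (intro runs_Seq)
  qed (use assms(3) in \<open>auto intro!: poly_bounded_intros\<close>)
qed

theorem ptime_imp_polytime:
  assumes "ptime f" shows "polytime (\<lambda>w. enc (f (Raw w)))"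
proof -
  obtain L P p where f: "\<And>K. L \<le> K \<Longrightarrow> implements K P p UNIV f" "\<And>x. len (f x) \<le> poly p (len x)"
    using assms by (rule ptime_onE) blast
  define K where "K = Suc L"
  have P: "implements K P p UNIV f" using f(1) by (simp add: K_def)
  let ?Q = "P ;; pour 0 K" let ?p = "[:6:] * p + [:1:]"
  have "regs ?Q \<subseteq> {..K}" using implements_regs[OF P] by (auto simp: subset_iff less_imp_le)
  moreover have "reads ?Q \<subseteq> {..<K}"
    using implements_regs[OF P] by (auto simp: K_def regs_def pour_def for_each_def)
  ultimately obtain M where M: "valid_tm M"
    "\<And>x n s. exec ?Q (input_store x) n s \<Longrightarrow> tm_halts_with M x n (rev (s K))"
    using compile_correct[of K ?Q] by (auto simp: K_def regs_def)
  have "\<exists>t\<le>poly ?p (length w). tm_halts_with M w t (enc (f (Raw w)))" for w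
  proof -
    let ?s = "input_store w" let ?y = "enc (f (Raw w))"
    have "runs P ?s (poly p (length w)) (?s(0 := ?y))"
      using implements_runs[OF P, of "Raw w" ?s] by (simp add: input_store_def work_clear_def)
    moreover have "runs (pour 0 K) (?s(0 := ?y)) (5 * poly p (length w) + 1) (?s(0 := [], K := rev ?y))"
      by (rule runs_cong[OF runs_pour])
        (use f(2)[of "Raw w"] in \<open>auto simp: K_def input_store_def fun_eq_iff\<close>)
    ultimately have "runs ?Q ?s (poly p (length w) + (5 * poly p (length w) + 1))
        (?s(0 := [], K := rev ?y))"
      by (rule runs_Seq)
    then show ?thesis unfolding runs_def using M(2)[of w] by fastforce
  qed
  then show ?thesis unfolding polytime_def using M(1) by blast
qed

section \<open>A library of polynomial-time functions\<close>

named_theorems ptime_intros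

lemma ptime_comp: "ptime f \<Longrightarrow> ptime g \<Longrightarrow> ptime (\<lambda>x. f (g x))"
  by (rule ptime_on_comp[of UNIV g UNIV f]) simp_all

lemma ptime_const [ptime_intros]: "ptime (\<lambda>x. c)"
  by (rule ptime_on_const)

lemma ptime_id [ptime_intros]: "ptime (\<lambda>x. x)"
  by (rule ptime_on_id)

lemma ptime_Pair [ptime_intros]: "ptime f \<Longrightarrow> ptime g \<Longrightarrow> ptime (\<lambda>x. (f x, g x))"
  by (rule ptime_on_Pair)

lemma ptime_fst [ptime_intros]: "ptime f \<Longrightarrow> ptime (\<lambda>x. fst (f x))"
  by (rule ptime_comp[OF ptime_on_fst])

lemma ptime_snd [ptime_intros]: "ptime f \<Longrightarrow> ptime (\<lambda>x. snd (f x))"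
  by (rule ptime_comp[OF ptime_on_snd])

lemma ptime_If [ptime_intros]: "ptime b \<Longrightarrow> ptime f \<Longrightarrow> ptime g \<Longrightarrow> ptime (\<lambda>x. if b x then f x else g x)"
  by (rule ptime_on_If) (auto intro: ptime_on_subset)

lemma ptime_not [ptime_intros]: "ptime f \<Longrightarrow> ptime (\<lambda>x. \<not> f x)"
  by (rule ptime_on_cong[OF ptime_If[OF _ ptime_const[of False] ptime_const[of True], of f]]) auto

lemma ptime_conj [ptime_intros]: "ptime f \<Longrightarrow> ptime g \<Longrightarrow> ptime (\<lambda>x. f x \<and> g x)"
  by (rule ptime_on_cong[OF ptime_If[OF _ _ ptime_const[of False], of f g]]) auto

lemma ptime_disj [ptime_intros]: "ptime f \<Longrightarrow> ptime g \<Longrightarrow> ptime (\<lambda>x. f x \<or> g x)"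
  by (rule ptime_on_cong[OF ptime_If[OF _ ptime_const[of True], of f g]]) auto

lemma ptime_imp [ptime_intros]: "ptime f \<Longrightarrow> ptime g \<Longrightarrow> ptime (\<lambda>x. f x \<longrightarrow> g x)"
  by (rule ptime_on_cong[OF ptime_If[OF _ _ ptime_const[of True], of f g]]) auto

subsection \<open>Iteration and equality\<close>

lemma poly_bounded_len_ptime [poly_bounded_intros]: "ptime f \<Longrightarrow> poly_bounded (\<lambda>x. len (f x))"
  by (erule ptime_onE) (auto intro: poly_boundedI)

lemma poly_bounded_ptime_nat: "ptime f \<Longrightarrow> poly_bounded f"
  using poly_bounded_len_ptime[of f] by simp

lemma ptime_funpow_len_comp:
  fixes f :: "'a::enc \<Rightarrow> 'a"
  assumes "ptime c" "ptime h" "ptime f" "poly_bounded B"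
    "\<And>x i. i \<le> len (c x) \<Longrightarrow> len ((f ^^ i) (h x)) \<le> B x"
  shows "ptime (\<lambda>x. (f ^^ len (c x)) (h x))"
  using ptime_funpow_len[where f = f and g = "\<lambda>x. (c x, h x)" and B = B] assms by (simp add: ptime_Pair)

lemma ptime_funpow:
  fixes f :: "'a::enc \<Rightarrow> 'a"
  assumes "ptime c" "ptime h" "ptime f" "poly_bounded B" "\<And>x i. i \<le> c x \<Longrightarrow> len ((f ^^ i) (h x)) \<le> B x"
  shows "ptime (\<lambda>x. (f ^^ c x) (h x))"
  using ptime_funpow_len_comp[of c h f B] assms by simp

definition compare_step :: "raw \<times> raw \<times> bool \<Rightarrow> raw \<times> raw \<times> bool" where
  "compare_step z = (Raw (tl (unraw (fst z))), Raw (tl (unraw (fst (snd z)))),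
     snd (snd z) \<and> unraw (fst (snd z)) \<noteq> [] \<and>
     (if hd_true (unraw (fst z)) then hd_true (unraw (fst (snd z)))
         else \<not> hd_true (unraw (fst (snd z)))))"

lemma ptime_compare_step: "ptime compare_step"
  unfolding compare_step_def
  by (intro ptime_intros ptime_comp[OF ptime_raw_tl] ptime_comp[OF ptime_raw_null]
      ptime_comp[OF ptime_raw_hd_true])

lemma funpow_compare_step:
  "(compare_step ^^ length u) (Raw u, Raw v, ok) =
      (Raw [], Raw (drop (length u) v), ok \<and> take (length u) v = u)"
proof (induction u arbitrary: v ok)
  case (Cons c u)
  have "compare_step (Raw (c # u), Raw v, ok) = (Raw u, Raw (tl v), ok \<and> v \<noteq> [] \<and> hd_true v = c)"
    by (auto simp: compare_step_def)
  then show ?case using Cons by (cases v) (auto simp: funpow_swap1)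
qed simp

lemma funpow_compare_step_words:
  "\<exists>ok'. (compare_step ^^ i) (Raw u, Raw v, ok) = (Raw (drop i u), Raw (drop i v), ok')"
  by (induction i) (auto simp: compare_step_def drop_Suc tl_drop)

lemma ptime_raw_eq: "ptime (\<lambda>z. fst z = (snd z :: raw))"
proof -
  let ?it = "\<lambda>z. (compare_step ^^ len (fst z)) (fst z, snd z, True)"
  have "ptime ?it"
  proof (rule ptime_funpow_len_comp[OF _ _ ptime_compare_step])
    show "poly_bounded (\<lambda>z :: raw \<times> raw. 4 * len z + 10)"
      by (intro poly_bounded_intros)
    fix z :: "raw \<times> raw" and i
    obtain u v where z: "z = (Raw u, Raw v)" by (cases z) (metis raw.exhaust)
    obtain ok where "(compare_step ^^ i) (Raw u, Raw v, True) = (Raw (drop i u), Raw (drop i v), ok)"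
      using funpow_compare_step_words by blast
    then show "len ((compare_step ^^ i) (fst z, snd z, True)) \<le> 4 * len z + 10" by (simp add: z)
  qed (intro ptime_intros)+
  then have "ptime (\<lambda>z. snd (snd (?it z)) \<and> unraw (fst (snd (?it z))) = [])"
    by (intro ptime_intros ptime_comp[OF ptime_raw_null])
  then show ?thesis
  proof (rule ptime_on_cong)
    fix z :: "raw \<times> raw"
    obtain u v where z: "z = (Raw u, Raw v)" by (cases z) (metis raw.exhaust)
    have "take (length u) v = u \<and> drop (length u) v = [] \<longleftrightarrow> u = v"
      by (metis append.right_neutral append_take_drop_id drop_all le_refl take_all)
    then show "(snd (snd (?it z)) \<and> unraw (fst (snd (?it z))) = []) = (fst z = snd z)"
      by (simp add: z funpow_compare_step)
  qed
qed

lemma ptime_Raw_enc: "ptime f \<Longrightarrow> ptime (\<lambda>x. Raw (enc (f x)))"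
  by (erule ptime_on_enc_cong) simp

lemma ptime_eq [ptime_intros]: "ptime f \<Longrightarrow> ptime g \<Longrightarrow> ptime (\<lambda>x. f x = g x)"
  by (rule ptime_on_cong[OF
      ptime_comp[OF ptime_raw_eq ptime_Pair[OF ptime_Raw_enc ptime_Raw_enc]], of f g])
    (auto dest: enc_inject)

subsection \<open>Sums, lists and natural numbers\<close>

lemma ptime_on_branch:
  assumes "ptime (\<lambda>z. f (fst z) (snd z))" "ptime_on E p" "ptime h" "\<And>x. x \<in> D \<Longrightarrow> h x \<in> E"
  shows "ptime_on D (\<lambda>x. f x (p (h x)))"
proof -
  have "ptime_on D (\<lambda>x. p (h x))"
    using assms(4) by (intro ptime_on_comp[OF ptime_on_subset[OF assms(3)] assms(2)]) auto
  from ptime_on_comp[OF ptime_on_Pair[OF ptime_on_id this] assms(1)] show ?thesis by simp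
qed

lemma ptime_Inl [ptime_intros]:
  assumes "ptime f" shows "ptime (\<lambda>x. Inl (f x) :: 'a::enc + 'b::enc)"
  by (rule ptime_on_enc_cong[OF ptime_comp[OF ptime_raw_Cons[of False] ptime_Raw_enc[OF assms]]]) simp

lemma ptime_Inr [ptime_intros]:
  assumes "ptime f" shows "ptime (\<lambda>x. Inr (f x) :: 'a::enc + 'b::enc)"
  by (rule ptime_on_enc_cong[OF ptime_comp[OF ptime_raw_Cons[of True] ptime_Raw_enc[OF assms]]]) simp

lemma ptime_case_sum [ptime_intros]:
  fixes h :: "'x::enc \<Rightarrow> 'a::enc + 'b::enc"
  assumes "ptime h" "ptime (\<lambda>z. f (fst z) (snd z))" "ptime (\<lambda>z. g (fst z) (snd z))"
  shows "ptime (\<lambda>x. case h x of Inl a \<Rightarrow> f x a | Inr b \<Rightarrow> g x b)"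
proof -
  have tl: "ptime (\<lambda>z :: 'a + 'b. Raw (tl (enc z)))"
    using ptime_comp[OF ptime_raw_tl ptime_Raw_enc[OF ptime_id]] by simp
  have hd: "hd_true (enc z) \<longleftrightarrow> \<not> isl z" for z :: "'a + 'b" by (cases z) simp_all
  have left: "enc (projl z) = tl (enc z)" if "isl z" for z :: "'a + 'b" using that by (cases z) simp_all
  have right: "enc (projr z) = tl (enc z)" if "\<not> isl z" for z :: "'a + 'b" using that
    by (cases z) simp_all
  have "ptime (\<lambda>x. \<not> hd_true (enc (h x)))"
    using ptime_not[OF ptime_comp[OF ptime_raw_hd_true ptime_Raw_enc[OF assms(1)]]] by simp
  then have "ptime (\<lambda>x. isl (h x))" by (rule ptime_on_cong) (simp add: hd)
  moreover have "ptime_on {z :: 'a + 'b. isl z} projl"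
    by (rule ptime_on_enc_cong[OF ptime_on_subset[OF tl]]) (simp_all add: left)
  from ptime_on_branch[OF assms(2) this assms(1), of "{x \<in> UNIV. isl (h x)}"]
  have "ptime_on {x \<in> UNIV. isl (h x)} (\<lambda>x. f x (projl (h x)))" by simp
  moreover have "ptime_on {z :: 'a + 'b. \<not> isl z} projr"
    by (rule ptime_on_enc_cong[OF ptime_on_subset[OF tl]]) (simp_all add: right)
  from ptime_on_branch[OF assms(3) this assms(1), of "{x \<in> UNIV. \<not> isl (h x)}"]
  have "ptime_on {x \<in> UNIV. \<not> isl (h x)} (\<lambda>x. g x (projr (h x)))" by simp
  ultimately have "ptime (\<lambda>x. if isl (h x) then f x (projl (h x)) else g x (projr (h x)))"
    by (rule ptime_on_If)
  then show ?thesis by (rule ptime_on_cong) (simp split: sum.split)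
qed

lemma ptime_Cons [ptime_intros]: "ptime f \<Longrightarrow> ptime g \<Longrightarrow> ptime (\<lambda>x. f x # g x)"
  by (rule ptime_on_enc_cong[OF ptime_Pair, of f g]) auto

lemma ptime_case_list [ptime_intros]:
  fixes l :: "'x::enc \<Rightarrow> 'a::enc list"
  assumes "ptime l" "ptime f" "ptime (\<lambda>z. g (fst z) (fst (snd z)) (snd (snd z)))"
  shows "ptime (\<lambda>x. case l x of [] \<Rightarrow> f x | a # t \<Rightarrow> g x a t)"
proof -
  have "ptime_on {l :: 'a list. l \<noteq> []} (\<lambda>l. (hd l, tl l))"
    by (rule ptime_on_recode) (auto simp: neq_Nil_conv)
  from ptime_on_branch[where f = "\<lambda>x p. g x (fst p) (snd p)", OF assms(3) this assms(1),
      of "{x. l x \<noteq> []}"]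
  have "ptime_on {x \<in> UNIV. l x \<noteq> []} (\<lambda>x. g x (hd (l x)) (tl (l x)))" by simp
  then have "ptime (\<lambda>x. if l x = [] then f x else g x (hd (l x)) (tl (l x)))"
    using assms by (intro ptime_on_If ptime_eq ptime_const) (auto intro: ptime_on_subset)
  then show ?thesis by (rule ptime_on_cong) (simp split: list.split)
qed

lemma ptime_tl [ptime_intros]: "ptime f \<Longrightarrow> ptime (\<lambda>x. tl (f x))"
  unfolding tl_def by (intro ptime_intros)

lemma ptime_Suc [ptime_intros]: "ptime f \<Longrightarrow> ptime (\<lambda>x. Suc (f x))"
  by (rule ptime_on_enc_cong[OF ptime_comp[OF ptime_raw_Cons[of True] ptime_Raw_enc], of f]) simp_all

lemma ptime_pred: "ptime f \<Longrightarrow> ptime (\<lambda>x. f x - 1 :: nat)"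
  by (rule ptime_on_enc_cong[OF ptime_comp[OF ptime_raw_tl ptime_Raw_enc], of f]) simp_all

lemma ptime_add [ptime_intros]:
  assumes "ptime f" "ptime g" shows "ptime (\<lambda>x. f x + g x :: nat)"
proof -
  have iter: "(Suc ^^ i) n = n + i" for i n by (induction i) auto
  have "ptime (\<lambda>x. (Suc ^^ g x) (f x))"
    by (rule ptime_funpow[where B = "\<lambda>x. f x + g x"])
      (use assms in \<open>auto intro!: ptime_intros poly_bounded_add
          intro: poly_bounded_ptime_nat simp: iter\<close>)
  then show ?thesis by (simp only: iter)
qed

lemma ptime_diff [ptime_intros]:
  assumes "ptime f" "ptime g" shows "ptime (\<lambda>x. f x - g x :: nat)"
proof -
  have iter: "((\<lambda>n. n - 1) ^^ i) n = n - i" for i n :: nat by (induction i) auto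
  have "ptime (\<lambda>x. ((\<lambda>n. n - 1) ^^ g x) (f x))"
    by (rule ptime_funpow[where B = f])
      (use assms in \<open>auto intro!: ptime_intros ptime_pred poly_bounded_ptime_nat
          simp: iter simp del: One_nat_def\<close>)
  then show ?thesis by (simp add: iter del: One_nat_def)
qed

lemma ptime_le [ptime_intros]: "ptime f \<Longrightarrow> ptime g \<Longrightarrow> ptime (\<lambda>x. f x \<le> (g x :: nat))"
  using ptime_eq[OF ptime_diff ptime_const[of 0], of f g] by simp

lemma ptime_less [ptime_intros]: "ptime f \<Longrightarrow> ptime g \<Longrightarrow> ptime (\<lambda>x. f x < (g x :: nat))"
  using ptime_le[OF ptime_Suc, of f g] by (simp add: Suc_le_eq)

subsection \<open>Folding over lists\<close>

lemma len_mem: "a \<in> set l \<Longrightarrow> 2 * len a + 2 \<le> len l"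
  by (induction l) auto

lemma len_append: "len (l @ m) = len l + len m"
  by (induction l) auto

lemma len_le: "(\<And>a. a \<in> set l \<Longrightarrow> len a \<le> b) \<Longrightarrow> len l \<le> length l * (2 * b + 2)"
proof (induction l)
  case (Cons a l)
  then have "len a \<le> b" "len l \<le> length l * (2 * b + 2)" by auto
  then show ?case by simp
qed simp

lemma len_le_bound:
  assumes "\<And>a. a \<in> set l \<Longrightarrow> len a \<le> b" "length l \<le> n"
  shows "len l \<le> n * (2 * b + 2)"
  by (rule order_trans[OF len_le mult_le_mono1]) (use assms in auto)

lemma length_le_len: "length l \<le> len l"
  by (induction l) auto

lemma len_take: "len (take k l) \<le> len l"
  by (metis append_take_drop_id le_add1 len_append)

lemma len_drop: "len (drop k l) \<le> len l"
  by (metis append_take_drop_id le_add2 len_append)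

lemma len_rev: "len (rev l) = len l"
  by (induction l) (auto simp: len_append)

lemma len_concat: "len (concat ls) \<le> len ls"
  by (induction ls) (auto simp: len_append)

lemma poly_bounded_length: "ptime f \<Longrightarrow> poly_bounded (\<lambda>x. length (f x))"
  by (rule poly_bounded_mono[OF poly_bounded_len_ptime]) (auto intro: length_le_len)

definition fold_step :: "('x \<Rightarrow> 'a \<Rightarrow> 'b \<Rightarrow> 'b) \<Rightarrow> 'x \<times> 'a list \<times> 'b \<Rightarrow> 'x \<times> 'a list \<times> 'b" where
  "fold_step g z = (case fst (snd z) of [] \<Rightarrow> z | a # t \<Rightarrow> (fst z, t, g (fst z) a (snd (snd z))))"

lemma funpow_fold_step: "(fold_step g ^^ n) (x, l, acc) = (x, drop n l, fold (g x) (take n l) acc)"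
proof (induction n arbitrary: l acc)
  case (Suc n)
  have "(fold_step g ^^ Suc n) (x, l, acc) = (fold_step g ^^ n) (fold_step g (x, l, acc))"
    by (simp add: funpow_swap1)
  also have "\<dots> = (x, drop (Suc n) l, fold (g x) (take (Suc n) l) acc)"
    by (cases l) (simp_all add: fold_step_def Suc)
  finally show ?case .
qed simp

lemma ptime_fold:
  assumes "ptime l" "ptime h" "ptime (\<lambda>z. g (fst z) (fst (snd z)) (snd (snd z)))" "poly_bounded B"
    and bound: "\<And>x k. k \<le> length (l x) \<Longrightarrow> len (fold (g x) (take k (l x)) (h x)) \<le> B x"
  shows "ptime (\<lambda>x. fold (g x) (l x) (h x))"
proof -
  let ?it = "\<lambda>x. (fold_step g ^^ len (l x)) (x, l x, h x)"
  have "ptime ?it"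
  proof (rule ptime_funpow_len_comp[OF assms(1)])
    show "ptime (\<lambda>x. (x, l x, h x))" using assms by (intro ptime_intros)
    show "ptime (fold_step g)" unfolding fold_step_def
      by (intro ptime_intros ptime_comp[OF assms(3),
          of "\<lambda>z. (fst (fst z), fst (snd z), snd (snd (fst z)))", simplified])
    show "poly_bounded (\<lambda>x. 2 * len x + 2 + (2 * len (l x) + 2 + B x))"
      by (intro poly_bounded_intros assms ptime_intros)
    fix x i
    have "take i (l x) = take (min i (length (l x))) (l x)" by (simp add: min_def)
    then have "len (fold (g x) (take i (l x)) (h x)) \<le> B x"
      using bound[of "min i (length (l x))" x] by simp
    then show "len ((fold_step g ^^ i) (x, l x, h x)) \<le> 2 * len x + 2 + (2 * len (l x) + 2 + B x)"
      using len_drop[of i "l x"] by (simp add: funpow_fold_step)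
  qed
  then have "ptime (\<lambda>x. snd (snd (?it x)))" by (intro ptime_intros)
  then show ?thesis by (simp add: funpow_fold_step length_le_len)
qed

lemma ptime_rev [ptime_intros]:
  assumes "ptime l" shows "ptime (\<lambda>x. rev (l x))"
proof -
  have "ptime (\<lambda>x. fold Cons (l x) [])"
    by (rule ptime_fold[where B = "\<lambda>x. len (l x)"])
      (use assms in \<open>auto intro!: ptime_intros poly_bounded_intros
          simp: len_rev len_take simp flip: rev_conv_fold\<close>)
  then show ?thesis by (simp add: rev_conv_fold)
qed

lemma ptime_append [ptime_intros]:
  assumes "ptime l" "ptime m" shows "ptime (\<lambda>x. l x @ m x)"
proof -
  have fold_Cons: "fold Cons l m = rev l @ m" for l m :: "'c list" by (induction l arbitrary: m) auto
  have "ptime (\<lambda>x. fold Cons (rev (l x)) (m x))"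
    by (rule ptime_fold[where B = "\<lambda>x. len (l x) + len (m x)"])
      (use assms in \<open>auto intro!: ptime_intros poly_bounded_intros simp: fold_Cons len_rev len_append\<close>,
       metis len_rev len_take)
  then show ?thesis by (simp add: fold_Cons)
qed

lemma ptime_map [ptime_intros]:
  assumes "ptime l" "ptime (\<lambda>z. g (fst z) (snd z))" shows "ptime (\<lambda>x. map (g x) (l x))"
proof -
  have fold_map: "fold (\<lambda>a acc. g x a # acc) l m = map (g x) (rev l) @ m" for x l m
    by (induction l arbitrary: m) auto
  obtain p where p: "\<And>z. len (g (fst z) (snd z)) \<le> poly p (len z)"
    using assms(2) by (rule ptime_onE) auto
  let ?b = "\<lambda>x. poly p (2 * len x + 2 + len (l x))"
  have "ptime (\<lambda>x. fold (\<lambda>a acc. g x a # acc) (rev (l x)) [])"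
  proof (rule ptime_fold[where B = "\<lambda>x. length (l x) * (2 * ?b x + 2)"])
    show "ptime (\<lambda>z. g (fst z) (fst (snd z)) # snd (snd z))"
      by (intro ptime_intros ptime_comp[OF assms(2), of "\<lambda>z. (fst z, fst (snd z))", simplified])
    show "poly_bounded (\<lambda>x. length (l x) * (2 * ?b x + 2))"
      by (intro poly_bounded_intros poly_bounded_length assms ptime_intros)
    fix x k
    have "len (g x a) \<le> ?b x" if "a \<in> set (l x)" for a
    proof -
      have "len (g x a) \<le> poly p (len (x, a))" using p[of "(x, a)"] by simp
      also have "\<dots> \<le> ?b x" by (rule poly_nat_mono) (use len_mem[OF that] in simp)
      finally show ?thesis .
    qed
    then have "len (map (g x) (rev (take k (rev (l x))))) \<le> length (l x) * (2 * ?b x + 2)"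
      by (intro len_le_bound) (auto dest: in_set_takeD)
    then show "len (fold (\<lambda>a acc. g x a # acc) (take k (rev (l x))) []) \<le> length (l x) * (2 * ?b x + 2)"
      by (simp add: fold_map)
  qed (use assms in \<open>auto intro!: ptime_intros\<close>)
  then show ?thesis by (simp add: fold_map)
qed

lemma ptime_concat [ptime_intros]:
  assumes "ptime l" shows "ptime (\<lambda>x. concat (l x))"
proof -
  have fold_append: "fold (@) l m = concat (rev l) @ m" for l and m :: "'c list"
    by (induction l arbitrary: m) auto
  have "ptime (\<lambda>x. fold (@) (rev (l x)) [])"
  proof (rule ptime_fold[where B = "\<lambda>x. len (l x)"])
    fix x k
    have "len (concat (rev (take k (rev (l x))))) \<le> len (rev (take k (rev (l x))))" by (rule len_concat)
    also have "\<dots> \<le> len (l x)" by (metis len_rev len_take)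
    finally show "len (fold (@) (take k (rev (l x))) []) \<le> len (l x)" by (simp add: fold_append)
  qed (use assms in \<open>auto intro!: ptime_intros poly_bounded_intros\<close>)
  then show ?thesis by (simp add: fold_append)
qed

lemma ptime_filter [ptime_intros]:
  assumes "ptime l" "ptime (\<lambda>z. P (fst z) (snd z))" shows "ptime (\<lambda>x. filter (P x) (l x))"
proof -
  have "filter P l = concat (map (\<lambda>a. if P a then [a] else []) l)" for P and l :: "'b list"
    by (induction l) auto
  then show ?thesis by (simp only:) (intro ptime_intros assms)
qed

lemma ptime_length [ptime_intros]:
  assumes "ptime l" shows "ptime (\<lambda>x. length (l x))"
proof -
  have fold_Suc: "fold (\<lambda>_. Suc) l n = length l + n" for l :: "'c list" and n
    by (induction l arbitrary: n) auto
  have "ptime (\<lambda>x. fold (\<lambda>_. Suc) (l x) 0)"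
    by (rule ptime_fold[where B = "\<lambda>x. length (l x)"])
      (use assms in \<open>auto intro!: ptime_intros poly_bounded_length simp: fold_Suc\<close>)
  then show ?thesis by (simp add: fold_Suc)
qed

lemma ptime_sum_list [ptime_intros]:
  assumes "ptime l" shows "ptime (\<lambda>x. sum_list (l x) :: nat)"
proof -
  have fold_add: "fold (+) l n = sum_list l + n" for l and n :: nat by (induction l arbitrary: n) auto
  have sum_list_le: "sum_list l \<le> len l" for l :: "nat list" by (induction l) auto
  have "ptime (\<lambda>x. fold (+) (l x) 0)"
    by (rule ptime_fold[where B = "\<lambda>x. len (l x)"])
      (use assms in \<open>auto intro!: ptime_intros poly_bounded_intros simp: fold_add
        intro: order_trans[OF sum_list_le len_take]\<close>)
  then show ?thesis by (simp add: fold_add)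
qed

lemma ptime_remdups [ptime_intros]:
  assumes "ptime l" shows "ptime (\<lambda>x. remdups (l x))"
proof -
  let ?g = "\<lambda>a acc. if a \<in> set acc then acc else a # acc"
  have fold_remdups: "fold ?g l [] = remdups (rev l)" for l :: "'b list"
    by (induction l rule: rev_induct) auto
  have len_remdups: "len (remdups l) \<le> len l" for l :: "'b list" by (induction l) auto
  have filter_mem: "a \<in> set l \<longleftrightarrow> filter (\<lambda>b. b = a) l \<noteq> []" for a :: 'b and l
    by (auto simp: filter_empty_conv)
  have "ptime (\<lambda>x. fold ?g (rev (l x)) [])"
  proof (rule ptime_fold[where B = "\<lambda>x. len (l x)"])
    show "ptime (\<lambda>z :: 'a \<times> 'b \<times> 'b list. ?g (fst (snd z)) (snd (snd z)))"
      unfolding filter_mem by (intro ptime_intros)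
    fix x k
    have "len (fold ?g (take k (rev (l x))) []) \<le> len (take k (rev (l x)))"
      unfolding fold_remdups by (rule order_trans[OF len_remdups]) (simp add: len_rev)
    also have "\<dots> \<le> len (l x)" using len_take[of k "rev (l x)"] by (simp add: len_rev)
    finally show "len (fold ?g (take k (rev (l x))) []) \<le> len (l x)" .
  qed (use assms in \<open>auto intro!: ptime_intros poly_bounded_intros\<close>)
  then show ?thesis by (simp add: fold_remdups)
qed

subsection \<open>Derived operations\<close>

lemma ptime_Ball [ptime_intros]:
  assumes "ptime l" "ptime (\<lambda>z. P (fst z) (snd z))" shows "ptime (\<lambda>x. \<forall>a\<in>set (l x). P x a)"
proof -
  have "(\<forall>a\<in>set l. P a) \<longleftrightarrow> filter (\<lambda>a. \<not> P a) l = []" for P and l :: "'b list"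
    by (simp add: filter_empty_conv)
  then show ?thesis by (simp only:) (intro ptime_intros assms)
qed

lemma ptime_Bex [ptime_intros]:
  assumes "ptime l" "ptime (\<lambda>z. P (fst z) (snd z))" shows "ptime (\<lambda>x. \<exists>a\<in>set (l x). P x a)"
proof -
  have "(\<exists>a\<in>set l. P a) \<longleftrightarrow> filter P l \<noteq> []" for P and l :: "'b list"
    by (auto simp: filter_empty_conv)
  then show ?thesis by (simp only:) (intro ptime_intros assms)
qed

lemma ptime_mem [ptime_intros]:
  assumes "ptime f" "ptime l" shows "ptime (\<lambda>x. f x \<in> set (l x))"
proof -
  have "ptime (\<lambda>x. \<exists>b\<in>set (l x). b = f x)"
    by (intro ptime_intros assms(2) assms(1)[THEN ptime_comp])
  then show ?thesis by simp
qed

lemma ptime_upt [ptime_intros]: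
  assumes "ptime f" "ptime g" shows "ptime (\<lambda>x. [f x..<g x])"
proof -
  let ?F = "\<lambda>z. (Suc (fst z), snd z @ [fst z])"
  have iter: "(?F ^^ i) (0, []) = (i, [0..<i])" for i by (induction i) auto
  have "ptime (\<lambda>x. (?F ^^ n x) (0, []))" if n: "ptime n" for n :: "'a \<Rightarrow> nat"
  proof (rule ptime_funpow[where B = "\<lambda>x. 2 * n x + 2 + n x * (2 * n x + 2)"])
    fix x i assume i: "i \<le> n x"
    have "len [0..<i] \<le> n x * (2 * n x + 2)" by (rule len_le_bound) (use i in auto)
    then show "len ((?F ^^ i) (0, [])) \<le> 2 * n x + 2 + n x * (2 * n x + 2)" using i by (simp add: iter)
  qed (use n in \<open>auto intro!: ptime_intros poly_bounded_intros poly_bounded_ptime_nat[OF n]\<close>)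
  from ptime_snd[OF this[OF ptime_diff[OF assms(2,1)]]]
  have "ptime (\<lambda>x. [0..<g x - f x])" by (simp add: iter)
  then have "ptime (\<lambda>x. map (\<lambda>i. i + f x) [0..<g x - f x])"
    by (intro ptime_intros assms(1)[THEN ptime_comp])
  then show ?thesis
  proof (rule ptime_on_cong)
    show "map (\<lambda>i. i + f x) [0..<g x - f x] = [f x..<g x]" for x
      by (cases "f x \<le> g x") (simp_all add: map_add_upt)
  qed
qed

lemma ptime_mult [ptime_intros]:
  assumes "ptime f" "ptime g" shows "ptime (\<lambda>x. f x * g x :: nat)"
proof -
  have "ptime (\<lambda>x. sum_list (map (\<lambda>_. g x) [0..<f x]))"
    by (intro ptime_intros assms(1) assms(2)[THEN ptime_comp])
  then show ?thesis by (simp add: sum_list_triv)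
qed

lemma ptime_poly [ptime_intros]: "ptime f \<Longrightarrow> ptime (\<lambda>x. poly p (f x) :: nat)"
  by (induction p) (auto intro!: ptime_intros)

lemma ptime_drop [ptime_intros]:
  assumes "ptime f" "ptime g" shows "ptime (\<lambda>x. drop (f x) (g x))"
proof -
  have iter: "(tl ^^ i) l = drop i l" for i and l :: "'b list"
    by (induction i) (auto simp: drop_Suc tl_drop)
  have "ptime (\<lambda>x. (tl ^^ f x) (g x))"
    by (rule ptime_funpow[where B = "\<lambda>x. len (g x)"])
      (use assms in \<open>auto intro!: ptime_intros poly_bounded_intros simp: iter len_drop\<close>)
  then show ?thesis by (simp add: iter)
qed

lemma ptime_take [ptime_intros]:
  assumes "ptime f" "ptime g" shows "ptime (\<lambda>x. take (f x) (g x))"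
proof -
  have "take i l = rev (drop (length l - i) (rev l))" for i and l :: "'b list"
    by (cases "i \<le> length l") (simp_all add: rev_drop)
  then show ?thesis by (simp only:) (intro ptime_intros assms)
qed

lemma ptime_nth_default [ptime_intros]:
  assumes "ptime d" "ptime l" "ptime i" shows "ptime (\<lambda>x. nth_default (d x) (l x) (i x))"
proof -
  have "ptime (\<lambda>x. case drop (i x) (l x) of [] \<Rightarrow> d x | a # t \<Rightarrow> a)"
    by (intro ptime_intros assms)
  then show ?thesis by (rule ptime_on_cong) (auto simp: nth_default_def Cons_nth_drop_Suc[symmetric])
qed

lemma ptime_zip [ptime_intros]:
  assumes "ptime l" "ptime m" shows "ptime (\<lambda>x. zip (l x) (m x))"
proof -
  have "ptime (\<lambda>x. map (\<lambda>i. (nth_default undefined (l x) i, nth_default undefined (m x) i))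
      [0..<(if length (l x) \<le> length (m x) then length (l x) else length (m x))])"
    by (intro ptime_intros assms assms[THEN ptime_comp])
  then show ?thesis
    by (rule ptime_on_cong) (auto intro!: nth_equalityI simp: nth_default_def)
qed

lemma ptime_list_update [ptime_intros]:
  assumes "ptime l" "ptime i" "ptime f" shows "ptime (\<lambda>x. (l x)[i x := f x])"
proof -
  have "ptime (\<lambda>x. take (i x) (l x) @ (case drop (i x) (l x) of [] \<Rightarrow> [] | a # t \<Rightarrow> f x # t))"
    by (intro ptime_intros assms assms(3)[THEN ptime_comp])
  then show ?thesis
  proof (rule ptime_on_cong)
    show "take (i x) (l x) @ (case drop (i x) (l x) of [] \<Rightarrow> [] | a # t \<Rightarrow> f x # t) = (l x)[i x := f x]"
      for x
      by (cases "i x < length (l x)")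
        (auto simp: Cons_nth_drop_Suc[symmetric] upd_conv_take_nth_drop list_update_beyond)
  qed
qed

lemma ptime_replicate [ptime_intros]:
  assumes "ptime f" "ptime g" shows "ptime (\<lambda>x. replicate (f x) (g x))"
proof -
  have "ptime (\<lambda>x. map (\<lambda>_. g x) [0..<f x])" by (intro ptime_intros assms(1) assms(2)[THEN ptime_comp])
  then show ?thesis by (simp add: map_replicate_const)
qed

lemma ptime_n_lists [ptime_intros]:
  assumes "ptime l" shows "ptime (\<lambda>x. List.n_lists k (l x))"
  by (induction k) (auto intro!: ptime_intros assms[THEN ptime_comp])

lemma ptime_finite_table:
  assumes "finite A" "ptime f" "ptime g" shows "ptime (\<lambda>x. if f x \<in> A then h (f x) else g x)"
  using assms(1)
proof (induction A rule: finite_induct)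
  case empty
  then show ?case using assms(3) by simp
next
  case (insert a A)
  have "ptime (\<lambda>x. if f x = a then h a else if f x \<in> A then h (f x) else g x)"
    by (intro ptime_intros assms insert)
  then show ?case by (rule ptime_on_cong) auto
qed

subsection \<open>Words\<close>

definition unpack_step :: "raw \<times> bool list \<Rightarrow> raw \<times> bool list" where
  "unpack_step z = (if unraw (fst z) = [] then z
     else (Raw (tl (unraw (fst z))), hd_true (unraw (fst z)) # snd z))"

lemma funpow_unpack_step: "(unpack_step ^^ i) (Raw w, l) = (Raw (drop i w), rev (take i w) @ l)"
proof (induction i arbitrary: w l)
  case (Suc i)
  have "(unpack_step ^^ Suc i) (Raw w, l) = (unpack_step ^^ i) (unpack_step (Raw w, l))"
    by (simp add: funpow_swap1)
  also have "\<dots> = (Raw (drop (Suc i) w), rev (take (Suc i) w) @ l)"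
    by (cases w) (auto simp: unpack_step_def Suc)
  finally show ?case .
qed simp

lemma ptime_unraw [ptime_intros]:
  assumes "ptime f" shows "ptime (\<lambda>x. unraw (f x))"
proof -
  let ?it = "\<lambda>x. (unpack_step ^^ len (f x)) (f x, [])"
  have "ptime ?it"
  proof (rule ptime_funpow_len_comp[where B = "\<lambda>x. 2 * len (f x) + 2 + len (f x) * (2 * 1 + 2)"])
    show "ptime unpack_step" unfolding unpack_step_def
      by (intro ptime_intros ptime_comp[OF ptime_raw_tl] ptime_comp[OF ptime_raw_null]
          ptime_comp[OF ptime_raw_hd_true])
    fix x i
    obtain w where w: "f x = Raw w" by (cases "f x")
    have "len (rev (take i w)) \<le> length w * (2 * 1 + 2)" by (rule len_le_bound) auto
    then show "len ((unpack_step ^^ i) (f x, [])) \<le> 2 * len (f x) + 2 + len (f x) * (2 * 1 + 2)"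
      by (simp add: w funpow_unpack_step)
  qed (auto intro!: ptime_intros poly_bounded_intros assms)
  then have "ptime (\<lambda>x. rev (snd (?it x)))" by (intro ptime_intros)
  then show ?thesis
  proof (rule ptime_on_cong)
    show "rev (snd (?it x)) = unraw (f x)" for x by (cases "f x") (simp add: funpow_unpack_step)
  qed
qed

lemma ptime_Raw [ptime_intros]:
  assumes "ptime f" shows "ptime (\<lambda>x. Raw (f x))"
proof -
  let ?g = "\<lambda>b acc. if b then Raw (True # unraw acc) else Raw (False # unraw acc)"
  have fold_Raw: "fold ?g l (Raw w) = Raw (rev l @ w)" for l w by (induction l arbitrary: w) auto
  have "ptime (\<lambda>x. fold ?g (rev (f x)) (Raw []))"
  proof (rule ptime_fold[where B = "\<lambda>x. length (f x)"])
    show "ptime (\<lambda>z :: 'a \<times> bool \<times> raw. ?g (fst (snd z)) (snd (snd z)))"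
      by (intro ptime_intros ptime_raw_Cons[THEN ptime_comp])
  qed (use assms in \<open>auto intro!: ptime_intros poly_bounded_length simp: fold_Raw\<close>)
  then show ?thesis by (simp add: fold_Raw)
qed

lemma ptime_enc_pair [ptime_intros]:
  assumes "ptime f" "ptime g" shows "ptime (\<lambda>x. enc_pair (f x) (g x))"
proof -
  have "ptime (\<lambda>x. (Raw (f x), Raw (g x)))" by (intro ptime_intros assms)
  from ptime_unraw[OF ptime_Raw_enc[OF this]] show ?thesis by (simp add: enc_pair_def)
qed

lemma ptime_enc_word [ptime_intros]: "ptime f \<Longrightarrow> ptime (\<lambda>x. enc_word (f x))"
  using ptime_enc_pair[OF _ ptime_const[of "[]"]] by (simp add: enc_pair_def)

lemma ptime_enc_words [ptime_intros]: "ptime f \<Longrightarrow> ptime (\<lambda>x. enc_words (f x))"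
  unfolding enc_words_def by (intro ptime_intros)

lemma ptime_word_imp_polytime:
  assumes "ptime f" shows "polytime f"
proof -
  have "ptime (\<lambda>x. Raw (f (unraw x)))" by (intro ptime_intros assms[THEN ptime_comp])
  from ptime_imp_polytime[OF this] show ?thesis by simp
qed

section \<open>Simulation of Turing machines by polynomial-time functions\<close>

definition config_bounded :: "tm \<Rightarrow> nat \<Rightarrow> nat \<Rightarrow> config \<Rightarrow> bool" where
  "config_bounded M N n c \<longleftrightarrow> fst c \<le> tm_states M \<and> length (snd c) = tm_tapes M \<and>
     (\<forall>i<tm_tapes M. \<bar>snd (snd c ! i)\<bar> \<le> int n \<and>
        (\<forall>j. fst (snd c ! i) j < tm_symbols M \<and> (\<bar>j\<bar> > int N \<longrightarrow> fst (snd c ! i) j = 0)))"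

lemma config_boundedD:
  assumes "config_bounded M N n (q, ts)"
  shows "q \<le> tm_states M" "length ts = tm_tapes M"
    "i < tm_tapes M \<Longrightarrow> \<bar>snd (ts ! i)\<bar> \<le> int n"
    "i < tm_tapes M \<Longrightarrow> fst (ts ! i) j < tm_symbols M"
    "i < tm_tapes M \<Longrightarrow> \<bar>j\<bar> > int N \<Longrightarrow> fst (ts ! i) j = 0"
  using assms by (auto simp: config_bounded_def)

lemma set_scanned_config_bounded:
  "config_bounded M N n (q, ts) \<Longrightarrow> set (scanned ts) \<subseteq> {..<tm_symbols M}"
  by (auto simp: set_conv_nth nth_scanned config_boundedD)

lemma tm_init_nth:
  "i < tm_tapes M \<Longrightarrow> snd (tm_init M w) ! i = (word_tape (if i = 0 then w else []), 0)"
  by (auto simp: tm_init_def nth_Cons')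

lemma config_bounded_init: "valid_tm M \<Longrightarrow> length w \<le> N \<Longrightarrow> config_bounded M N 0 (tm_init M w)"
  by (auto simp: config_bounded_def tm_init_nth)
    (auto simp: tm_init_def valid_tm_def word_tape_def)

text \<open>Moves are shifted by one to become natural numbers, and a halted machine rewrites what it scans,
  so that every step is given by a table lookup.\<close>

definition trans_dom :: "tm \<Rightarrow> (nat \<times> nat list) set" where
  "trans_dom M = {..<tm_states M} \<times> {ss. set ss \<subseteq> {..<tm_symbols M} \<and> length ss = tm_tapes M}"

definition shifted_trans :: "tm \<Rightarrow> nat \<times> nat list \<Rightarrow> nat \<times> (nat \<times> nat) list" where
  "shifted_trans M z = (if z \<in> trans_dom M
     then map_prod id (map (\<lambda>(s, m). (s, nat (m + 1)))) (tm_trans M (fst z) (snd z))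
     else (fst z, map (\<lambda>s. (s, 1)) (snd z)))"

lemma ptime_shifted_trans [ptime_intros]: "ptime f \<Longrightarrow> ptime (\<lambda>x. shifted_trans M (f x))"
  unfolding shifted_trans_def
  by (intro ptime_finite_table ptime_intros) (auto simp: trans_dom_def finite_lists_length_eq)

lemma shifted_trans_step:
  assumes M: "valid_tm M" and c: "config_bounded M N n (q, ts)" and s: "tm_step M (q, ts) = (q', ts')"
  obtains as where "shifted_trans M (q, scanned ts) = (q', as)" "q' \<le> tm_states M"
    "length as = tm_tapes M" "length ts' = tm_tapes M"
    "\<And>i. i < tm_tapes M \<Longrightarrow> fst (as ! i) < tm_symbols M \<and> snd (as ! i) \<le> 2 \<and>
       ts' ! i = act_tape (fst (as ! i), int (snd (as ! i)) - 1) (ts ! i)"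
proof (cases "q < tm_states M")
  case False
  then have "q' = q" "ts' = ts" "shifted_trans M (q, scanned ts) = (q, map (\<lambda>s. (s, 1)) (scanned ts))"
    using s by (auto simp: tm_step_apply_actions shifted_trans_def trans_dom_def)
  then show thesis
    using that[of "map (\<lambda>s. (s, 1)) (scanned ts)"] config_boundedD[OF c]
    by (simp add: nth_scanned act_tape_def)
next
  case True
  obtain p as where t: "tm_trans M q (scanned ts) = (p, as)" by fastforce
  have dom: "(q, scanned ts) \<in> trans_dom M"
    using True config_boundedD(2)[OF c] set_scanned_config_bounded[OF c] by (simp add: trans_dom_def)
  then have as: "p \<le> tm_states M" "length as = tm_tapes M" "set as \<subseteq> {..<tm_symbols M} \<times> {-1, 0, 1}"
    using M t unfolding valid_tm_def trans_dom_def by fastforce+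
  let ?as = "map (\<lambda>(s, m). (s, nat (m + 1))) as"
  have "p = q'" and ts': "ts' = apply_actions ts as"
    using s t True by (auto simp: tm_step_apply_actions)
  show thesis
  proof (rule that[of ?as])
    fix i assume i: "i < tm_tapes M"
    then have "as ! i \<in> {..<tm_symbols M} \<times> {-1, 0, 1}" using as(2,3) nth_mem[of i as] by auto
    then show "fst (?as ! i) < tm_symbols M \<and> snd (?as ! i) \<le> 2 \<and>
        ts' ! i = act_tape (fst (?as ! i), int (snd (?as ! i)) - 1) (ts ! i)"
      using i as(2) config_boundedD(2)[OF c]
      by (auto simp: ts' nth_apply_actions act_tape_def case_prod_unfold mem_Times_iff)
  qed (use t dom as \<open>p = q'\<close> ts' config_boundedD(2)[OF c] in \<open>simp_all add: shifted_trans_def\<close>)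
qed

lemma config_bounded_step:
  assumes M: "valid_tm M" and c: "config_bounded M N n c" and "n \<le> N"
  shows "config_bounded M N (Suc n) (tm_step M c)"
proof -
  obtain q ts where qts: "c = (q, ts)" by fastforce
  obtain q' ts' where step: "tm_step M (q, ts) = (q', ts')" by fastforce
  note b = config_boundedD[OF c[unfolded qts]]
  from shifted_trans_step[OF M c[unfolded qts] step] obtain as where
    as: "q' \<le> tm_states M" "length ts' = tm_tapes M"
    "\<And>i. i < tm_tapes M \<Longrightarrow> fst (as ! i) < tm_symbols M \<and> snd (as ! i) \<le> 2 \<and>
       ts' ! i = act_tape (fst (as ! i), int (snd (as ! i)) - 1) (ts ! i)" by metis
  have "\<bar>snd (ts' ! i)\<bar> \<le> int (Suc n) \<and>
      (\<forall>j. fst (ts' ! i) j < tm_symbols M \<and>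
          (\<bar>j\<bar> > int N \<longrightarrow> fst (ts' ! i) j = 0))" if i: "i < tm_tapes M" for i
    using as(3)[OF i] b(3-5)[OF i] \<open>n \<le> N\<close> by (auto simp: act_tape_def)
  then show ?thesis using as(1,2) by (simp add: config_bounded_def qts step)
qed

lemma config_bounded_funpow:
  assumes "valid_tm M" "length w \<le> N" "n \<le> N"
  shows "config_bounded M N n ((tm_step M ^^ n) (tm_init M w))"
  using assms(3) by (induction n) (auto intro: config_bounded_init config_bounded_step assms)

lemma tm_halts_with_mono:
  assumes "tm_halts_with M x t y" "t \<le> t'" shows "tm_halts_with M x t' y"
proof -
  obtain q ts where c: "(tm_step M ^^ t) (tm_init M x) = (q, ts)" by fastforce
  then have "q = tm_states M" using assms(1) by (simp add: tm_halts_with_def)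
  then have "(tm_step M ^^ i) (q, ts) = (q, ts)" for i by (induction i) (auto simp: tm_step_def)
  then have "(tm_step M ^^ (t' - t + t)) (tm_init M x) = (q, ts)" by (simp add: funpow_add c)
  then show ?thesis using assms c by (simp add: tm_halts_with_def)
qed

subsection \<open>Tape windows\<close>

type_synonym window = "nat list \<times> nat"

definition window :: "nat \<Rightarrow> tape \<Rightarrow> window" where
  "window N T = (map (\<lambda>j. fst T (int j - int N)) [0..<2 * N + 1], nat (snd T + int N))"

definition config_windows :: "nat \<Rightarrow> config \<Rightarrow> nat \<times> window list" where
  "config_windows N c = (fst c, map (window N) (snd c))"

definition window_scan :: "window list \<Rightarrow> nat list" where
  "window_scan cs = map (\<lambda>z. nth_default 0 (fst z) (snd z)) cs"

definition window_act :: "window list \<Rightarrow> (nat \<times> nat) list \<Rightarrow> window list" where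
  "window_act cs as = map (\<lambda>z. ((fst (fst z))[snd (fst z) := fst (snd z)],
     snd (fst z) + snd (snd z) - 1)) (zip cs as)"

definition window_step :: "tm \<Rightarrow> nat \<times> window list \<Rightarrow> nat \<times> window list" where
  "window_step M z = (fst (shifted_trans M (fst z, window_scan (snd z))),
     window_act (snd z) (snd (shifted_trans M (fst z, window_scan (snd z)))))"

lemma ptime_window_step: "ptime (window_step M)"
  unfolding window_step_def window_scan_def window_act_def by (intro ptime_intros)

lemma nth_window:
  assumes "\<bar>snd T\<bar> \<le> int N"
  shows "nth_default 0 (fst (window N T)) (snd (window N T)) = fst T (snd T)"
proof -
  have "nat (snd T + int N) < 2 * N + 1" "int (nat (snd T + int N)) = snd T + int N" using assms by auto
  then show ?thesis by (simp add: window_def nth_default_def del: upt_Suc)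
qed

lemma window_scan_windows:
  assumes "config_bounded M N n (q, ts)" "n \<le> N"
  shows "window_scan (map (window N) ts) = scanned ts"
proof (rule nth_equalityI)
  fix i assume "i < length (window_scan (map (window N) ts))"
  then have i: "i < length ts" by (simp add: window_scan_def)
  then have "\<bar>snd (ts ! i)\<bar> \<le> int N"
    using config_boundedD(2)[OF assms(1)] config_boundedD(3)[OF assms(1), of i] assms(2) by auto
  then show "window_scan (map (window N) ts) ! i = scanned ts ! i"
    using i nth_window[of "ts ! i" N] by (simp add: window_scan_def nth_scanned)
qed (simp add: window_scan_def)

lemma window_act_tape:
  assumes "\<bar>snd T\<bar> < int N" "m \<le> 2"
  shows "window N (act_tape (a, int m - 1) T) =
    ((fst (window N T))[snd (window N T) := a], snd (window N T) + m - 1)"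
proof -
  have "map (\<lambda>j. ((fst T)(snd T := a)) (int j - int N)) [0..<2 * N + 1] =
      (map (\<lambda>j. fst T (int j - int N)) [0..<2 * N + 1])[nat (snd T + int N) := a]"
    by (rule nth_equalityI) (use assms(1) in \<open>auto simp: nth_list_update simp del: upt_Suc\<close>)
  moreover have "nat (snd T + (int m - 1) + int N) = nat (snd T + int N) + m - 1"
    using assms by auto
  ultimately show ?thesis by (simp add: window_def act_tape_def del: upt_Suc)
qed

lemma window_step_windows:
  assumes M: "valid_tm M" and c: "config_bounded M N n (q, ts)" and n: "n < N"
  shows "window_step M (config_windows N (q, ts)) = config_windows N (tm_step M (q, ts))"
proof -
  obtain q' ts' where step: "tm_step M (q, ts) = (q', ts')" by fastforce
  obtain as where as: "shifted_trans M (q, scanned ts) = (q', as)" "length as = tm_tapes M"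
    "length ts' = tm_tapes M" "\<And>i. i < tm_tapes M \<Longrightarrow> fst (as ! i) < tm_symbols M \<and> snd (as ! i) \<le> 2 \<and>
       ts' ! i = act_tape (fst (as ! i), int (snd (as ! i)) - 1) (ts ! i)"
    using shifted_trans_step[OF M c step] by metis
  have "window_act (map (window N) ts) as = map (window N) ts'"
  proof (rule nth_equalityI)
    fix i assume "i < length (window_act (map (window N) ts) as)"
    then have i: "i < tm_tapes M" using as(2) by (simp add: window_act_def)
    have "\<bar>snd (ts ! i)\<bar> < int N" using config_boundedD(3)[OF c i] n by linarith
    then show "window_act (map (window N) ts) as ! i = map (window N) ts' ! i"
      using i as(2,3) as(4)[OF i] config_boundedD(2)[OF c] by (simp add: window_act_def window_act_tape)
  qed (use as(2,3) config_boundedD(2)[OF c] in \<open>simp add: window_act_def\<close>)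
  then show ?thesis
    using window_scan_windows[OF c] n as(1) by (simp add: window_step_def config_windows_def step)
qed

definition window_init :: "tm \<Rightarrow> nat \<Rightarrow> word \<Rightarrow> nat \<times> window list" where
  "window_init M N w = (0, (map (\<lambda>j. if N \<le> j \<and> j - N < length w
       then (if nth_default False w (j - N) then 2 else 1) else 0) [0..<2 * N + 1], N) #
     replicate (tm_tapes M - 1) (replicate (2 * N + 1) 0, N))"

lemma window_init_windows: "window_init M N w = config_windows N (tm_init M w)"
proof -
  have "(if N \<le> j \<and> j - N < length w then (if nth_default False w (j - N) then 2 else 1) else 0) =
     word_tape w (int j - int N)" for j
    by (auto simp: word_tape_def nat_diff_distrib nth_default_def)
  moreover have "map (\<lambda>j. word_tape [] (int j - int N)) [0..<2 * N + 1] = replicate (2 * N + 1) 0"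
    by (simp add: word_tape_Nil map_replicate_const del: upt_Suc replicate.simps)
  ultimately show ?thesis
    unfolding window_init_def tm_init_def
    by (simp add: window_def config_windows_def del: upt_Suc replicate.simps)
qed

lemma window_steps_windows:
  assumes "valid_tm M" "length w \<le> N" "n \<le> N"
  shows "(window_step M ^^ n) (window_init M N w) =
    config_windows N ((tm_step M ^^ n) (tm_init M w))"
  using assms(3)
proof (induction n)
  case 0
  show ?case by (simp only: funpow_0 window_init_windows)
next
  case (Suc n)
  obtain q ts where c: "(tm_step M ^^ n) (tm_init M w) = (q, ts)" by fastforce
  then have "config_bounded M N n (q, ts)" using config_bounded_funpow[OF assms(1,2), of n] Suc by simp
  from window_step_windows[OF assms(1) this] Suc c show ?case by simp
qed

definition window_output :: "nat \<times> window list \<Rightarrow> word" where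
  "window_output z = map (\<lambda>s. s = 2)
     (filter (\<lambda>s. s \<noteq> 0) (fst (nth_default ([], 0) (snd z) (length (snd z) - 1))))"

lemma config_bounded_last:
  assumes "config_bounded M N n (q, ts)" "valid_tm M"
  shows "ts \<noteq> []" "last ts = ts ! (tm_tapes M - 1)" "\<bar>j\<bar> > int N \<Longrightarrow> fst (last ts) j = 0"
proof -
  have k: "length ts = tm_tapes M" "0 < tm_tapes M"
    using assms by (auto simp: config_boundedD valid_tm_def)
  then show ne: "ts \<noteq> []" by auto
  show last: "last ts = ts ! (tm_tapes M - 1)" using last_conv_nth[OF ne] k by simp
  show "fst (last ts) j = 0" if "\<bar>j\<bar> > int N"
    using config_boundedD(5)[OF assms(1), of "tm_tapes M - 1" j] that k(2) by (simp add: last)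
qed

lemma output_length_le:
  assumes "config_bounded M N n (q, ts)" "valid_tm M" "fst (last ts) = word_tape y"
  shows "length y \<le> N + 1"
  using config_bounded_last(3)[OF assms(1,2), of "int N + 1"]
  by (auto simp: assms(3) word_tape_def split: if_splits)

lemma filter_word_tape:
  assumes "length y \<le> N + 1"
  shows "map (\<lambda>s. s = 2) (filter (\<lambda>s. s \<noteq> 0)
      (map (\<lambda>j. word_tape y (int j - int N)) [0..<2 * N + 1])) = y"
proof -
  let ?f = "\<lambda>j. word_tape y (int j - int N)"
  have "2 * N + 1 = N + length y + (N + 1 - length y)" using assms by simp
  then have "[0..<2 * N + 1] = [0..<N] @ [N..<N + length y] @ [N + length y..<2 * N + 1]"
    by (metis add_0 append.assoc le_add1 upt_add_eq_append)
  then have "filter (\<lambda>s. s \<noteq> 0) (map ?f [0..<2 * N + 1]) =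
      filter (\<lambda>s. s \<noteq> 0) (map ?f [N..<N + length y])"
    by (simp only: map_append filter_append) (auto simp: filter_empty_conv word_tape_def)
  also have "map ?f [N..<N + length y] = map bit_sym y"
    by (rule nth_equalityI) (auto simp: word_tape_def bit_sym_def)
  also have "filter (\<lambda>s. s \<noteq> 0) (map bit_sym y) = map bit_sym y"
    by (auto simp: filter_id_conv bit_sym_def)
  also have "map (\<lambda>s. s = 2) (map bit_sym y) = y" by (induction y) (auto simp: bit_sym_def)
  finally show ?thesis .
qed

lemma window_output_windows:
  assumes "config_bounded M N n (q, ts)" "valid_tm M" "fst (last ts) = word_tape y"
  shows "window_output (config_windows N (q, ts)) = y"
proof -
  note last = config_bounded_last[OF assms(1,2)]
  have "0 < length ts" using last(1) by simp
  then have "fst (nth_default ([], 0) (map (window N) ts) (length ts - 1)) =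
      map (\<lambda>j. word_tape y (int j - int N)) [0..<2 * N + 1]"
    using assms(3) last_conv_nth[OF last(1)] by (simp add: nth_default_def window_def del: upt_Suc)
  then show ?thesis
    using filter_word_tape[OF output_length_le[OF assms]]
    by (simp add: window_output_def config_windows_def del: upt_Suc)
qed

definition windows_bound :: "tm \<Rightarrow> nat \<Rightarrow> nat" where
  "windows_bound M N = 2 * tm_states M + 2 +
     tm_tapes M * (2 * (2 * ((2 * N + 1) * (2 * tm_symbols M + 2)) + 2 + 2 * N) + 2)"

lemma len_windows_le:
  assumes "config_bounded M N n (q, ts)" "n \<le> N"
  shows "len (config_windows N (q, ts)) \<le> windows_bound M N"
proof -
  note b = config_boundedD[OF assms(1)]
  have "len (window N T) \<le> 2 * ((2 * N + 1) * (2 * tm_symbols M + 2)) + 2 + 2 * N"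
    if T: "T \<in> set ts" for T
  proof -
    obtain i where i: "i < tm_tapes M" "T = ts ! i"
      using T b(2) by (auto simp: in_set_conv_nth)
    have "len (map (\<lambda>j. fst T (int j - int N)) [0..<2 * N + 1]) \<le> (2 * N + 1) * (2 * tm_symbols M + 2)"
      by (rule len_le_bound) (use b(4)[OF i(1)] i(2) in \<open>auto simp: less_imp_le\<close>)
    moreover have "nat (snd T + int N) \<le> 2 * N" using b(3)[OF i(1)] i(2) assms(2) by auto
    ultimately show ?thesis by (simp add: window_def del: upt_Suc)
  qed
  then have "len (map (window N) ts) \<le>
      tm_tapes M * (2 * (2 * ((2 * N + 1) * (2 * tm_symbols M + 2)) + 2 + 2 * N) + 2)"
    by (intro len_le_bound) (auto simp: b(2))
  then show ?thesis using b(1) by (simp add: windows_bound_def config_windows_def)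
qed

theorem polytime_imp_ptime:
  assumes "polytime f" "ptime g" shows "ptime (\<lambda>x. f (g x))"
proof -
  obtain M p where M: "valid_tm M" and halts: "\<And>x. \<exists>t\<le>poly p (length x). tm_halts_with M x t (f x)"
    using assms(1) unfolding polytime_def by blast
  define N where "N w = poly p (length w) + length w" for w :: word
  have ptime_N: "ptime N" unfolding N_def by (intro ptime_intros)
  have bounded: "config_bounded M (N w) n ((tm_step M ^^ n) (tm_init M w))" if "n \<le> N w" for n w
    by (rule config_bounded_funpow) (use M that in \<open>auto simp: N_def\<close>)
  have steps: "(window_step M ^^ n) (window_init M (N w) w) =
      config_windows (N w) ((tm_step M ^^ n) (tm_init M w))" if "n \<le> N w" for n w
    by (rule window_steps_windows) (use M that in \<open>auto simp: N_def\<close>)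
  have "ptime (\<lambda>w. (window_step M ^^ N w) (window_init M (N w) w))"
  proof (rule ptime_funpow[OF ptime_N _ ptime_window_step])
    show "ptime (\<lambda>w. window_init M (N w) w)" unfolding window_init_def
      by (intro ptime_intros ptime_N[THEN ptime_comp])
    show "poly_bounded (\<lambda>w. windows_bound M (N w))" unfolding windows_bound_def
      by (intro poly_bounded_intros poly_bounded_ptime_nat[OF ptime_N])
    fix w i assume "i \<le> N w"
    then show "len ((window_step M ^^ i) (window_init M (N w) w)) \<le> windows_bound M (N w)"
      using steps[of i w] bounded[of i w] len_windows_le[of M "N w" i]
      by (cases "(tm_step M ^^ i) (tm_init M w)") simp
  qed
  then have "ptime (\<lambda>w. window_output ((window_step M ^^ N w) (window_init M (N w) w)))"
    unfolding window_output_def by (intro ptime_intros)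
  moreover have "window_output ((window_step M ^^ N w) (window_init M (N w) w)) = f w" for w
  proof -
    obtain q ts where c: "(tm_step M ^^ N w) (tm_init M w) = (q, ts)" by fastforce
    obtain t where "t \<le> poly p (length w)" "tm_halts_with M w t (f w)" using halts by blast
    then have "tm_halts_with M w (N w) (f w)" using tm_halts_with_mono by (simp add: N_def)
    then have "fst (last ts) = word_tape (f w)" by (simp add: tm_halts_with_def c)
    then show ?thesis
      using window_output_windows[of M "N w" "N w" q ts "f w"] bounded[of "N w" w]
        steps[of "N w" w] c M by simp
  qed
  ultimately have "ptime f" by simp
  then show ?thesis using assms(2) by (rule ptime_comp)
qed

subsection \<open>Splitting sequences of self-delimiting words\<close>

text \<open>The state consists of a pending bit, the word read so far and the finished words.\<close>

definition split_step :: "bool \<Rightarrow> bool list \<times> word \<times> word list \<Rightarrow> bool list \<times> word \<times> word list" where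
  "split_step b z = (case fst z of [] \<Rightarrow> ([b], snd z)
     | a # _ \<Rightarrow> if a = b then ([], fst (snd z) @ [b], snd (snd z)) else
        ([], [], snd (snd z) @ [fst (snd z)]))"

definition split_words :: "word \<Rightarrow> word list" where
  "split_words w = snd (snd (fold split_step w ([], [], [])))"

lemma fold_split_step_enc_word:
  "fold split_step (enc_word u @ r) ([], acc, out) = fold split_step r ([], [], out @ [acc @ u])"
  by (induction u arbitrary: acc) (simp_all add: enc_word_Nil enc_word_Cons split_step_def)

lemma fold_split_step_enc_words:
  "fold split_step (enc_words ws @ r) ([], [], out) = fold split_step r ([], [], out @ ws)"
  by (induction ws arbitrary: out)
    (simp_all add: enc_words_def fold_split_step_enc_word del: fold_append)

lemma fold_split_step_extends: "\<exists>more. snd (snd (fold split_step r z)) = snd (snd z) @ more"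
proof (induction r arbitrary: z)
  case (Cons b r)
  obtain more where "snd (snd (fold split_step r (split_step b z))) = snd (snd (split_step b z)) @ more"
    using Cons by blast
  moreover have "\<exists>m. snd (snd (split_step b z)) = snd (snd z) @ m"
    by (auto simp: split_step_def split: list.split)
  ultimately show ?case by auto
qed simp

lemma split_words_append: "\<exists>more. split_words (enc_words ws @ r) = ws @ more"
  unfolding split_words_def fold_split_step_enc_words
  using fold_split_step_extends[of r "([], [], [] @ ws)"] by simp

lemma split_words_enc_words [simp]: "split_words (enc_words ws) = ws"
  using fold_split_step_enc_words[of ws "[]" "[]"] by (simp add: split_words_def)

lemma fold_split_step_size:
  "case fold split_step w ([], [], []) of (pending, acc, out) \<Rightarrow> length pending \<le> 1 \<and>
     length acc \<le> length w \<and> length out \<le> length w \<and> (\<forall>u\<in>set out. length u \<le> length w)"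
  by (induction w rule: rev_induct) (auto simp: split_step_def le_SucI split: list.splits)

lemma len_word: "len (w :: word) = 4 * length w"
  by (induction w) (auto simp: enc_word_def)

lemma ptime_split_words [ptime_intros]:
  assumes "ptime f" shows "ptime (\<lambda>x. split_words (f x))"
proof -
  let ?b = "\<lambda>n. 10 + (2 * (4 * n) + 2) + n * (2 * (4 * n) + 2)"
  have "ptime (\<lambda>x. fold split_step (f x) ([], [], []))"
  proof (rule ptime_fold[where B = "\<lambda>x. ?b (length (f x))"])
    show "ptime (\<lambda>z :: 'a \<times> bool \<times> bool list \<times> word \<times> word list. split_step (fst (snd z))
        (snd (snd z)))"
      unfolding split_step_def by (intro ptime_intros)
    show "poly_bounded (\<lambda>x. ?b (length (f x)))"
      by (intro poly_bounded_add poly_bounded_mult poly_bounded_const poly_bounded_length[OF assms])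
    fix x k
    let ?w = "take k (f x)" let ?n = "length (f x)"
    obtain pending acc out where z: "fold split_step ?w ([], [], []) = (pending, acc, out)"
      by (metis prod.exhaust)
    have s: "length pending \<le> 1" "length acc \<le> ?n" "length out \<le> ?n" "\<forall>u\<in>set out. length u \<le> ?n"
      using fold_split_step_size[of ?w] by (auto simp: z)
    have "len out \<le> ?n * (2 * (4 * ?n) + 2)" by (rule len_le_bound) (use s in \<open>auto simp: len_word\<close>)
    then show "len (fold split_step ?w ([], [], [])) \<le> ?b ?n" using s by (simp add: z len_word)
  qed (use assms in \<open>auto intro!: ptime_intros\<close>)
  then show ?thesis unfolding split_words_def by (intro ptime_intros)
qed

definition pair_fst :: "word \<Rightarrow> word" where
  "pair_fst z = nth_default [] (split_words z) 0"

definition pair_snd :: "word \<Rightarrow> word" where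
  "pair_snd z = drop (2 * length (pair_fst z) + 2) z"

lemma pair_fst_enc_pair [simp]: "pair_fst (enc_pair x w) = x"
proof -
  obtain more where "split_words (enc_words [x] @ w) = [x] @ more" using split_words_append by blast
  then show ?thesis by (simp add: enc_words_def pair_fst_def enc_pair_def)
qed

lemma pair_snd_enc_pair [simp]: "pair_snd (enc_pair x w) = w"
  unfolding pair_snd_def pair_fst_enc_pair by (simp add: enc_pair_def)

lemma ptime_pair_fst [ptime_intros]: "ptime f \<Longrightarrow> ptime (\<lambda>x. pair_fst (f x))"
  unfolding pair_fst_def by (intro ptime_intros)

lemma ptime_pair_snd [ptime_intros]: "ptime f \<Longrightarrow> ptime (\<lambda>x. pair_snd (f x))"
  unfolding pair_snd_def by (intro ptime_intros)

lemma length_enc_words_le: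
  assumes "\<And>w. w \<in> set ws \<Longrightarrow> length w \<le> b" "length ws \<le> n"
  shows "length (enc_words ws) \<le> n * (2 * b + 2)"
proof -
  have "length (enc_words ws) \<le> length ws * (2 * b + 2)"
    using assms(1)
  proof (induction ws)
    case (Cons w ws)
    then have "length w \<le> b" "length (enc_words ws) \<le> length ws * (2 * b + 2)" by auto
    then show ?case by (simp add: enc_words_def)
  qed (simp add: enc_words_def)
  also have "\<dots> \<le> n * (2 * b + 2)" using assms(2) by (rule mult_le_mono1)
  finally show ?thesis .
qed

lemma length_le_length_enc_words:
  "length ws \<le> length (enc_words ws)" "w \<in> set ws \<Longrightarrow> length w \<le> length (enc_words ws)"
  by (induction ws) (auto simp: enc_words_def)

subsection \<open>Membership in complexity classes\<close>

lemma ptime_class_P: "L \<in> class_P \<Longrightarrow> ptime g \<Longrightarrow> ptime (\<lambda>x. g x \<in> L)"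
  using ptime_eq[OF polytime_imp_ptime[of "\<lambda>x. [x \<in> L]" g] ptime_const[of "[True]"]]
  by (simp add: class_P_def)

lemma class_P_ptime: "ptime (\<lambda>x. x \<in> L) \<Longrightarrow> L \<in> class_P"
  unfolding class_P_def mem_Collect_eq by (intro ptime_word_imp_polytime ptime_intros)

lemma class_P_pairs:
  fixes R :: "word \<Rightarrow> word \<Rightarrow> bool"
  shows "ptime (\<lambda>z. R (fst z) (snd z)) \<Longrightarrow> {z. R (pair_fst z) (pair_snd z)} \<in> class_P"
  using ptime_comp[of "\<lambda>z. R (fst z) (snd z)" "\<lambda>z. (pair_fst z, pair_snd z)"]
  by (intro class_P_ptime) (simp add: ptime_intros)

lemma class_NP_ptime:
  fixes R :: "word \<Rightarrow> word \<Rightarrow> bool"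
  assumes "ptime (\<lambda>z. R (fst z) (snd z))"
  shows "{y. \<exists>w. length w \<le> poly p (length y) \<and> R y w} \<in> class_NP"
  unfolding class_NP_def using class_P_pairs[OF assms]
  by (intro CollectI bexI[of _ "{z. R (pair_fst z) (pair_snd z)}"] exI[of _ p]) simp_all

lemma class_P_NP_par_ptime:
  assumes "A \<in> class_NP" "ptime g" "ptime (\<lambda>z. V (fst z) (snd z))"
    and "\<And>x. x \<in> L \<longleftrightarrow> V x (map (\<lambda>y. y \<in> A) (g x))"
  shows "L \<in> class_P_NP_par"
proof -
  have "polytime (\<lambda>x. enc_words (g x))" by (intro ptime_word_imp_polytime ptime_intros assms(2))
  then show ?thesis
    unfolding class_P_NP_par_def using assms(1,4) class_P_pairs[OF assms(3)]
    by (intro CollectI bexI[of _ A] exI[of _ g] bexI[of _ "{z. V (pair_fst z) (pair_snd z)}"]) simp_all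
qed

section \<open>Greedy runs and vertex covers\<close>

abbreviation verts :: "'a graph \<Rightarrow> 'a set" where "verts G \<equiv> fst G"
abbreviation edges :: "'a graph \<Rightarrow> 'a set set" where "edges G \<equiv> snd G"

definition simple_graph :: "'a graph \<Rightarrow> bool" where
  "simple_graph G \<longleftrightarrow> finite (verts G) \<and>
     edges G \<subseteq> {{u, v} | u v. u \<in> verts G \<and> v \<in> verts G \<and> u \<noteq> v}"

lemma is_graph_iff: "is_graph G \<longleftrightarrow> simple_graph G \<and> verts G \<noteq> {}"
  by (auto simp: is_graph_def simple_graph_def)

lemma simple_graph_finite: "simple_graph G \<Longrightarrow> finite (verts G)"
  by (simp add: simple_graph_def)

lemma simple_graph_edgeE:
  assumes "simple_graph G" "e \<in> edges G"
  obtains u v where "e = {u, v}" "u \<in> verts G" "v \<in> verts G" "u \<noteq> v"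
  using assms unfolding simple_graph_def by blast

lemma simple_graph_edge_subset: "simple_graph G \<Longrightarrow> e \<in> edges G \<Longrightarrow> e \<subseteq> verts G"
  by (auto elim!: simple_graph_edgeE)

lemma simple_graph_edge_left: "simple_graph G \<Longrightarrow> {u, v} \<in> edges G \<Longrightarrow> u \<in> verts G"
  using simple_graph_edge_subset by fast

lemma simple_graph_finite_edges: "simple_graph G \<Longrightarrow> finite (edges G)"
  using finite_subset[of "edges G" "Pow (verts G)"] simple_graph_edge_subset simple_graph_finite
  by blast

definition neighbours :: "'a graph \<Rightarrow> 'a \<Rightarrow> 'a set" where
  "neighbours G v = {u. {v, u} \<in> edges G}"

lemma neighbours_sym: "u \<in> neighbours G v \<longleftrightarrow> v \<in> neighbours G u"
  by (simp add: neighbours_def insert_commute)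

lemma neighbours_subset: "simple_graph G \<Longrightarrow> neighbours G v \<subseteq> verts G"
  using simple_graph_edge_subset by (fastforce simp: neighbours_def)

lemma finite_neighbours: "simple_graph G \<Longrightarrow> finite (neighbours G v)"
  using neighbours_subset finite_subset simple_graph_finite by metis

lemma degree_in_eq_card_neighbours:
  assumes "simple_graph G" shows "degree_in G v = card (neighbours G v)"
proof -
  have "{e \<in> edges G. v \<in> e} \<subseteq> (\<lambda>u. {v, u}) ` neighbours G v"
  proof
    fix e assume e: "e \<in> {e \<in> edges G. v \<in> e}"
    then obtain a b where "e = {a, b}" using simple_graph_edgeE[OF assms] by (metis mem_Collect_eq)
    with e have "e = {v, a} \<or> e = {v, b}" by auto
    then show "e \<in> (\<lambda>u. {v, u}) ` neighbours G v" using e by (auto simp: neighbours_def)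
  qed
  then have "{e \<in> edges G. v \<in> e} = (\<lambda>u. {v, u}) ` neighbours G v"
    by (auto simp: neighbours_def)
  moreover have "inj_on (\<lambda>u. {v, u}) (neighbours G v)"
    by (rule inj_onI) (metis doubleton_eq_iff)
  ultimately show ?thesis by (simp add: degree_in_def card_image)
qed

lemma vertex_cover_iff_neighbours:
  assumes "simple_graph G"
  shows "vertex_cover G C \<longleftrightarrow> C \<subseteq> verts G \<and> (\<forall>u\<in>verts G. \<forall>v\<in>neighbours G u. u \<in> C \<or> v \<in> C)"
proof -
  have "(\<forall>e\<in>edges G. e \<inter> C \<noteq> {}) \<longleftrightarrow> (\<forall>u\<in>verts G. \<forall>v\<in>neighbours G u. u \<in> C \<or> v \<in> C)"
  proof
    assume "\<forall>e\<in>edges G. e \<inter> C \<noteq> {}"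
    then show "\<forall>u\<in>verts G. \<forall>v\<in>neighbours G u. u \<in> C \<or> v \<in> C" by (fastforce simp: neighbours_def)
  next
    assume cover: "\<forall>u\<in>verts G. \<forall>v\<in>neighbours G u. u \<in> C \<or> v \<in> C"
    show "\<forall>e\<in>edges G. e \<inter> C \<noteq> {}"
    proof
      fix e assume e: "e \<in> edges G"
      obtain u v where "e = {u, v}" "u \<in> verts G" using simple_graph_edgeE[OF assms e] by metis
      then show "e \<inter> C \<noteq> {}" using e cover by (auto simp: neighbours_def)
    qed
  qed
  then show ?thesis by (simp add: vertex_cover_def)
qed

lemma vertex_cover_verts: "simple_graph G \<Longrightarrow> vertex_cover G (verts G)"
  by (auto simp: vertex_cover_def elim!: simple_graph_edgeE)

lemma finite_vertex_cover: "simple_graph G \<Longrightarrow> vertex_cover G C \<Longrightarrow> finite C"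
  using rev_finite_subset[OF simple_graph_finite, of G C] by (simp add: vertex_cover_def)

lemma mvc_le: "vertex_cover G C \<Longrightarrow> mvc G \<le> card C"
  unfolding mvc_def by (rule Least_le) blast

lemma mvc_obtain:
  assumes "simple_graph G" obtains C where "vertex_cover G C" "card C = mvc G"
proof -
  have "\<exists>k C. vertex_cover G C \<and> card C = k" using vertex_cover_verts[OF assms] by blast
  from LeastI_ex[OF this] have "\<exists>C. vertex_cover G C \<and> card C = mvc G" unfolding mvc_def .
  then show ?thesis using that by blast
qed

subsection \<open>Greedy runs\<close>

definition delete_vertices :: "'a graph \<Rightarrow> 'a set \<Rightarrow> 'a graph" where
  "delete_vertices G U = (verts G - U, {e \<in> edges G. e \<inter> U = {}})"

definition degree_outside :: "'a graph \<Rightarrow> 'a set \<Rightarrow> 'a \<Rightarrow> nat" where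
  "degree_outside G U v = card (neighbours G v - U)"

definition max_degree_outside :: "'a graph \<Rightarrow> 'a set \<Rightarrow> 'a \<Rightarrow> bool" where
  "max_degree_outside G U v \<longleftrightarrow> v \<in> verts G - U \<and>
     (\<forall>u\<in>verts G - U. degree_outside G U u \<le> degree_outside G U v)"

fun greedy_run :: "'a graph \<Rightarrow> 'a set \<Rightarrow> 'a list \<Rightarrow> bool" where
  "greedy_run G U [] \<longleftrightarrow> (\<forall>v\<in>verts G - U. degree_outside G U v = 0)"
| "greedy_run G U (v # vs) \<longleftrightarrow>
     max_degree_outside G U v \<and> 0 < degree_outside G U v \<and> greedy_run G (insert v U) vs"

lemma max_degree_outsideD:
  "max_degree_outside G U v \<Longrightarrow> u \<in> verts G \<Longrightarrow> u \<notin> U \<Longrightarrow> degree_outside G U u \<le> degree_outside G U v"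
  by (simp add: max_degree_outside_def)

lemma max_degree_outside_trans:
  assumes "max_degree_outside G U u" "v \<in> verts G - U" "degree_outside G U u \<le> degree_outside G U v"
  shows "max_degree_outside G U v"
  using assms unfolding max_degree_outside_def by (meson order_trans)

lemma max_degree_outside_exists:
  assumes "simple_graph G" "u \<in> verts G - U" obtains v where "max_degree_outside G U v"
proof -
  let ?D = "degree_outside G U ` (verts G - U)"
  have fin: "finite ?D" using simple_graph_finite[OF assms(1)] by simp
  moreover have "?D \<noteq> {}" using assms(2) by blast
  ultimately obtain v where "v \<in> verts G - U" "degree_outside G U v = Max ?D"
    using Max_in[of ?D] by (metis imageE)
  then have "max_degree_outside G U v" using Max_ge[OF fin] by (simp add: max_degree_outside_def)
  then show thesis by (rule that)
qed

lemma degree_outside_pos: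
  "simple_graph G \<Longrightarrow> u \<in> neighbours G v - U \<Longrightarrow> 0 < degree_outside G U v"
  using finite_neighbours[of G v] by (auto simp: degree_outside_def card_gt_0_iff)

lemma degree_outside_posE:
  assumes "0 < degree_outside G U v" obtains u where "u \<in> neighbours G v - U"
  using assms unfolding degree_outside_def by (metis card.empty ex_in_conv less_numeral_extra(3))

lemma degree_outside_le: "simple_graph G \<Longrightarrow> degree_outside G U v \<le> card (neighbours G v)"
  unfolding degree_outside_def by (rule card_mono[OF finite_neighbours]) auto

lemma delete_vertices_empty [simp]: "delete_vertices G {} = G"
  by (simp add: delete_vertices_def)

lemma delete_vertex_delete_vertices:
  "delete_vertex (delete_vertices G U) v = delete_vertices G (insert v U)"
  by (auto simp: delete_vertex_def delete_vertices_def)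

lemma simple_graph_delete_vertices: "simple_graph G \<Longrightarrow> simple_graph (delete_vertices G U)"
  unfolding simple_graph_def delete_vertices_def by (auto dest!: subsetD)

lemma neighbours_delete_vertices:
  "v \<notin> U \<Longrightarrow> neighbours (delete_vertices G U) v = neighbours G v - U"
  by (auto simp: neighbours_def delete_vertices_def)

lemma degree_in_delete_vertices:
  "simple_graph G \<Longrightarrow> v \<notin> U \<Longrightarrow> degree_in (delete_vertices G U) v = degree_outside G U v"
  by (simp add: degree_in_eq_card_neighbours simple_graph_delete_vertices neighbours_delete_vertices
      degree_outside_def)

lemma delete_vertices_no_edges:
  assumes "simple_graph G"
  shows "edges (delete_vertices G U) = {} \<longleftrightarrow> (\<forall>v\<in>verts G - U. degree_outside G U v = 0)"
proof
  assume "edges (delete_vertices G U) = {}"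
  then have "neighbours (delete_vertices G U) v = {}" for v by (simp add: neighbours_def)
  then show "\<forall>v\<in>verts G - U. degree_outside G U v = 0"
    by (metis DiffE card.empty degree_outside_def neighbours_delete_vertices)
next
  assume zero: "\<forall>v\<in>verts G - U. degree_outside G U v = 0"
  show "edges (delete_vertices G U) = {}"
  proof (rule ccontr)
    assume "edges (delete_vertices G U) \<noteq> {}"
    then obtain e where e: "e \<in> edges G" "e \<inter> U = {}" by (auto simp: delete_vertices_def)
    obtain u v where uv: "e = {u, v}" "u \<in> verts G" using simple_graph_edgeE[OF assms e(1)] by metis
    then have "v \<in> neighbours G u - U" using e by (auto simp: neighbours_def)
    then have "0 < degree_outside G U u" by (rule degree_outside_pos[OF assms])
    then show False using zero uv e(2) by auto
  qed
qed

lemma mdg_step_delete_vertices: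
  assumes "simple_graph G"
  shows "mdg_step (delete_vertices G U, C) S \<longleftrightarrow> (\<exists>v. max_degree_outside G U v \<and>
    0 < degree_outside G U v \<and> S = (delete_vertices G (insert v U), insert v C))"
proof -
  have max: "v \<in> verts (delete_vertices G U) \<and>
      (\<forall>u\<in>verts (delete_vertices G U). degree_in (delete_vertices G U) u \<le>
          degree_in (delete_vertices G U) v) \<longleftrightarrow>
      max_degree_outside G U v" for v
    using degree_in_delete_vertices[OF assms, of _ U]
    by (auto simp: max_degree_outside_def delete_vertices_def)
  have pos: "edges (delete_vertices G U) \<noteq> {} \<longleftrightarrow> 0 < degree_outside G U v"
    if "max_degree_outside G U v" for v
  proof -
    have "(\<forall>u\<in>verts G - U. degree_outside G U u = 0) \<longleftrightarrow> degree_outside G U v = 0"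
      using that unfolding max_degree_outside_def by auto
    then show ?thesis unfolding delete_vertices_no_edges[OF assms] by simp
  qed
  show ?thesis
  proof
    assume "mdg_step (delete_vertices G U, C) S"
    then obtain v where v: "max_degree_outside G U v" "edges (delete_vertices G U) \<noteq> {}"
      "S = (delete_vertex (delete_vertices G U) v, insert v C)"
      using max by cases auto
    then show "\<exists>v. max_degree_outside G U v \<and> 0 < degree_outside G U v \<and>
        S = (delete_vertices G (insert v U), insert v C)"
      using pos[OF v(1)] by (auto simp: delete_vertex_delete_vertices)
  next
    assume "\<exists>v. max_degree_outside G U v \<and> 0 < degree_outside G U v \<and>
        S = (delete_vertices G (insert v U), insert v C)"
    then obtain v where v: "max_degree_outside G U v" "0 < degree_outside G U v"
      "S = (delete_vertices G (insert v U), insert v C)" by blast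
    show "mdg_step (delete_vertices G U, C) S"
      unfolding v(3) delete_vertex_delete_vertices[symmetric]
      by (rule mdg_step.intros) (use max[of v] pos[OF v(1)] v in auto)
  qed
qed

lemma greedy_run_imp_mdg_steps:
  assumes "simple_graph G"
  shows "greedy_run G U vs \<Longrightarrow>
    \<exists>H. mdg_step\<^sup>*\<^sup>* (delete_vertices G U, C) (H, C \<union> set vs) \<and> edges H = {}"
proof (induction vs arbitrary: U C)
  case Nil
  then have "edges (delete_vertices G U) = {}" by (simp add: delete_vertices_no_edges[OF assms])
  then show ?case by (intro exI[of _ "delete_vertices G U"]) simp
next
  case (Cons v vs)
  then have "greedy_run G (insert v U) vs" by simp
  from Cons.IH[OF this, of "insert v C"] obtain H where
    H: "mdg_step\<^sup>*\<^sup>* (delete_vertices G (insert v U), insert v C) (H, insert v C \<union> set vs)"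
      "edges H = {}"
    by (elim exE conjE)
  have "mdg_step (delete_vertices G U, C) (delete_vertices G (insert v U), insert v C)"
    unfolding mdg_step_delete_vertices[OF assms] using Cons.prems by (intro exI[of _ v]) simp
  from converse_rtranclp_into_rtranclp[OF this H(1)] H(2) show ?case
    by (intro exI[of _ H] conjI) simp_all
qed

lemma mdg_steps_imp_greedy_run:
  assumes "simple_graph G"
  shows "mdg_step\<^sup>*\<^sup>* S (H, C') \<Longrightarrow> edges H = {} \<Longrightarrow> S = (delete_vertices G U, C) \<Longrightarrow>
    \<exists>vs. greedy_run G U vs \<and> C' = C \<union> set vs"
proof (induction arbitrary: U C rule: converse_rtranclp_induct)
  case base
  then have "edges (delete_vertices G U) = {}" "C' = C" by simp_all
  then show ?case unfolding delete_vertices_no_edges[OF assms] by (intro exI[of _ "[]"]) simp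
next
  case (step S T)
  from step.hyps(1) obtain v where v: "max_degree_outside G U v" "0 < degree_outside G U v"
    "T = (delete_vertices G (insert v U), insert v C)"
    unfolding step.prems(2) mdg_step_delete_vertices[OF assms] by (elim exE conjE)
  from step.IH[OF step.prems(1) v(3)] obtain vs where
    "greedy_run G (insert v U) vs" "C' = insert v C \<union> set vs" by (elim exE conjE)
  then show ?case using v(1,2) by (intro exI[of _ "v # vs"]) simp
qed

lemma mdg_outputs_eq_greedy_runs:
  assumes "simple_graph G" shows "mdg_outputs G = {set vs | vs. greedy_run G {} vs}"
proof (intro set_eqI iffI)
  fix C assume "C \<in> mdg_outputs G"
  then obtain H where "mdg_step\<^sup>*\<^sup>* (G, {}) (H, C)" "edges H = {}" unfolding mdg_outputs_def by blast
  from mdg_steps_imp_greedy_run[OF assms this, of "{}" "{}"]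
  show "C \<in> {set vs | vs. greedy_run G {} vs}" by auto
next
  fix C assume "C \<in> {set vs | vs. greedy_run G {} vs}"
  then obtain vs where "greedy_run G {} vs" "C = set vs" by blast
  with greedy_run_imp_mdg_steps[OF assms this(1), of "{}"]
  show "C \<in> mdg_outputs G" by (simp add: mdg_outputs_def)
qed

lemma greedy_run_distinct: "greedy_run G U vs \<Longrightarrow> distinct vs \<and> set vs \<subseteq> verts G - U"
  by (induction vs arbitrary: U) (fastforce simp: max_degree_outside_def)+

lemma greedy_run_vertex_cover:
  assumes "simple_graph G"
  shows "greedy_run G U vs \<Longrightarrow> U \<subseteq> verts G \<Longrightarrow> vertex_cover G (U \<union> set vs)"
proof (induction vs arbitrary: U)
  case Nil
  have "v \<notin> neighbours G u" if "u \<in> verts G - U" "v \<notin> U" for u v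
    using Nil(1) that degree_outside_pos[OF assms, of v u U] by auto
  then show ?case using Nil(2) by (auto simp: vertex_cover_iff_neighbours[OF assms])
next
  case (Cons v vs)
  then show ?case using Cons.IH[of "insert v U"] by (simp add: max_degree_outside_def)
qed

lemma min_mdg_eq_Least:
  assumes "simple_graph G"
  shows "min_mdg G = (LEAST k. \<exists>vs. greedy_run G {} vs \<and> length vs = k)"
proof -
  have "card (set vs) = length vs" if "greedy_run G {} vs" for vs
    using greedy_run_distinct[OF that] distinct_card by blast
  then have "(\<exists>C\<in>mdg_outputs G. card C = k) \<longleftrightarrow> (\<exists>vs. greedy_run G {} vs \<and> length vs = k)" for k
    unfolding mdg_outputs_eq_greedy_runs[OF assms] by auto
  then show ?thesis unfolding min_mdg_def by simp
qed

lemma min_mdg_le: "simple_graph G \<Longrightarrow> greedy_run G {} vs \<Longrightarrow> min_mdg G \<le> length vs"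
  unfolding min_mdg_eq_Least by (rule Least_le) blast

lemma greedy_run_within_cover:
  assumes "simple_graph G" "vertex_cover G C" "I U" "U \<subseteq> C"
    and step: "\<And>U. I U \<Longrightarrow> U \<subseteq> C \<Longrightarrow> \<exists>u\<in>verts G - U. 0 < degree_outside G U u \<Longrightarrow>
      \<exists>v\<in>C - U. max_degree_outside G U v \<and> I (insert v U)"
  shows "\<exists>vs. greedy_run G U vs \<and> set vs \<subseteq> C - U"
  using assms(3,4)
proof (induction "card (C - U)" arbitrary: U rule: less_induct)
  case less
  show ?case
  proof (cases "\<exists>u\<in>verts G - U. 0 < degree_outside G U u")
    case False
    then show ?thesis by (intro exI[of _ "[]"]) simp
  next
    case True
    then obtain v where v: "v \<in> C - U" "max_degree_outside G U v" "I (insert v U)"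
      using step less.prems by blast
    have "0 < degree_outside G U v"
      using True v(2) by (metis DiffE gr_zeroI less_zeroE max_degree_outsideD neq0_conv not_less)
    moreover have "card (C - insert v U) < card (C - U)"
      using v(1) finite_vertex_cover[OF assms(1,2)] by (intro psubset_card_mono) auto
    then obtain vs where "greedy_run G (insert v U) vs" "set vs \<subseteq> C - insert v U"
      using less(1)[of "insert v U"] less.prems v by blast
    ultimately show ?thesis using v by (intro exI[of _ "v # vs"]) auto
  qed
qed

lemma min_mdg_obtain:
  assumes "simple_graph G" obtains vs where "greedy_run G {} vs" "length vs = min_mdg G"
proof -
  have "\<exists>vs. greedy_run G {} vs \<and> set vs \<subseteq> verts G - {}"
  proof (rule greedy_run_within_cover[OF assms vertex_cover_verts[OF assms], where I = "\<lambda>_. True"])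
    fix U assume "\<exists>u\<in>verts G - U. 0 < degree_outside G U u"
    then obtain v where "max_degree_outside G U v" using max_degree_outside_exists[OF assms] by blast
    then show "\<exists>v\<in>verts G - U. max_degree_outside G U v \<and> True" by (auto simp: max_degree_outside_def)
  qed auto
  then have "\<exists>k vs. greedy_run G {} vs \<and> length vs = k" by blast
  from LeastI_ex[OF this] have "\<exists>vs. greedy_run G {} vs \<and> length vs = min_mdg G"
    unfolding min_mdg_eq_Least[OF assms] .
  then show ?thesis using that by blast
qed

lemma mvc_le_min_mdg:
  assumes "simple_graph G" shows "mvc G \<le> min_mdg G"
proof -
  obtain vs where vs: "greedy_run G {} vs" "length vs = min_mdg G" using min_mdg_obtain[OF assms] .
  have "mvc G \<le> card (set vs)" using mvc_le greedy_run_vertex_cover[OF assms vs(1)] by fastforce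
  then show ?thesis using vs(2) card_length[of vs] by simp
qed

lemma greedy_run_takes_dominant:
  assumes "simple_graph G" "Z \<subseteq> verts G" "w \<in> verts G - Z"
    and dominant: "\<And>U v. U \<subset> Z \<Longrightarrow> v \<in> verts G - Z \<Longrightarrow>
      \<exists>z\<in>Z - U. degree_outside G U v < degree_outside G U z"
  shows "greedy_run G U vs \<Longrightarrow> U \<subseteq> Z \<Longrightarrow> Z \<subseteq> U \<union> set vs"
proof (induction vs arbitrary: U)
  case Nil
  show ?case
  proof (rule ccontr)
    assume "\<not> ?thesis"
    then have "U \<subset> Z" using Nil by auto
    from dominant[OF this assms(3)] obtain z where "z \<in> Z - U" "0 < degree_outside G U z"
      by (metis gr_zeroI not_less_zero)
    then show False using Nil(1) assms(2) by auto
  qed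
next
  case (Cons v vs)
  show ?case
  proof (cases "U = Z")
    case False
    then have U: "U \<subset> Z" using Cons by blast
    have v: "max_degree_outside G U v" using Cons.prems(1) by simp
    have "v \<in> Z"
    proof (rule ccontr)
      assume "v \<notin> Z"
      then obtain z where "z \<in> Z - U" "degree_outside G U v < degree_outside G U z"
        using dominant[OF U] v by (auto simp: max_degree_outside_def)
      then show False using max_degree_outsideD[OF v, of z] assms(2) by auto
    qed
    then show ?thesis using Cons.IH[of "insert v U"] Cons.prems by auto
  qed auto
qed

lemma greedy_run_prepend:
  assumes "Z \<subseteq> verts G"
    and max: "\<And>U z. U \<subseteq> Z \<Longrightarrow> z \<in> Z - U \<Longrightarrow> max_degree_outside G U z \<and> 0 < degree_outside G U z"
    and rest: "greedy_run G Z us"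
  shows "distinct zs \<Longrightarrow> U \<subseteq> Z \<Longrightarrow> set zs = Z - U \<Longrightarrow> greedy_run G U (zs @ us)"
proof (induction zs arbitrary: U)
  case Nil
  then have "U = Z" by auto
  then show ?case using rest by simp
next
  case (Cons z zs)
  then have "greedy_run G (insert z U) (zs @ us)" by (intro Cons.IH) auto
  then show ?case using max[of U z] Cons.prems by auto
qed

lemma length_greedy_run_le_card_edges:
  assumes "simple_graph G"
  shows "greedy_run G U vs \<Longrightarrow> length vs \<le> card {e \<in> edges G. e \<inter> U = {}}"
proof (induction vs arbitrary: U)
  case (Cons v vs)
  let ?remaining = "\<lambda>U. {e \<in> edges G. e \<inter> U = {}}"
  have "0 < degree_outside G U v" "v \<notin> U" using Cons.prems by (simp_all add: max_degree_outside_def)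
  then obtain u where u: "{v, u} \<in> edges G" "u \<notin> U"
    by (metis DiffD1 DiffD2 degree_outside_posE mem_Collect_eq neighbours_def)
  have "{v, u} \<in> ?remaining U" using u \<open>v \<notin> U\<close> by simp
  moreover have fin: "finite (?remaining U)" using simple_graph_finite_edges[OF assms] by simp
  moreover have "?remaining (insert v U) \<subseteq> ?remaining U - {{v, u}}" by auto
  ultimately have "card (?remaining (insert v U)) < card (?remaining U)"
    by (meson card_Diff1_less card_mono finite_Diff le_less_trans)
  moreover have "length vs \<le> card (?remaining (insert v U))" by (rule Cons.IH) (use Cons.prems in simp)
  ultimately show ?case by simp
qed simp

lemma min_mdg_le_card_edges:
  assumes "simple_graph G" shows "min_mdg G \<le> card (edges G)"
proof -
  obtain vs where "greedy_run G {} vs" "length vs = min_mdg G" using min_mdg_obtain[OF assms] .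
  then show ?thesis using length_greedy_run_le_card_edges[OF assms, of "{}" vs] by simp
qed

lemma greedy_run_delete_vertices:
  "greedy_run (delete_vertices G W) U vs \<longleftrightarrow> greedy_run G (W \<union> U) vs"
proof (induction vs arbitrary: U)
  have verts: "verts (delete_vertices G W) - U = verts G - (W \<union> U)" for U
    by (auto simp: delete_vertices_def)
  have deg: "degree_outside (delete_vertices G W) U v = degree_outside G (W \<union> U) v"
    if "v \<in> verts G - (W \<union> U)" for U v
  proof -
    have "neighbours (delete_vertices G W) v - U = neighbours G v - (W \<union> U)"
      using that by (auto simp: neighbours_delete_vertices)
    then show ?thesis by (simp add: degree_outside_def)
  qed
  {
    case Nil
    show ?case using deg by (simp add: verts)
  next
    case (Cons v vs)
    have "max_degree_outside (delete_vertices G W) U v \<longleftrightarrow> max_degree_outside G (W \<union> U) v"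
      unfolding max_degree_outside_def verts using deg by auto
    moreover have "degree_outside (delete_vertices G W) U v = degree_outside G (W \<union> U) v"
      if "max_degree_outside G (W \<union> U) v" using that deg by (simp add: max_degree_outside_def)
    ultimately show ?case using Cons.IH[of "insert v U"] by auto
  }
qed

subsection \<open>Isomorphisms\<close>

definition graph_iso :: "('a \<Rightarrow> 'b) \<Rightarrow> 'a graph \<Rightarrow> 'b graph \<Rightarrow> bool" where
  "graph_iso f G H \<longleftrightarrow> bij_betw f (verts G) (verts H) \<and>
     (\<forall>v\<in>verts G. neighbours H (f v) = f ` neighbours G v)"

lemma graph_isoD:
  assumes "graph_iso f G H"
  shows "inj_on f (verts G)" "verts H = f ` verts G"
    "v \<in> verts G \<Longrightarrow> neighbours H (f v) = f ` neighbours G v"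
  using assms by (auto simp: graph_iso_def bij_betw_def)

lemma graph_iso_inverse:
  assumes "graph_iso f G H" "simple_graph G" obtains g where "graph_iso g H G"
proof -
  let ?g = "the_inv_into (verts G) f"
  have inv: "?g (f v) = v" if "v \<in> verts G" for v
    using the_inv_into_f_f[OF graph_isoD(1)[OF assms(1)] that] .
  have "neighbours G (?g w) = ?g ` neighbours H w" if "w \<in> verts H" for w
  proof -
    obtain v where v: "v \<in> verts G" "w = f v" using \<open>w \<in> verts H\<close> graph_isoD(2)[OF assms(1)] by auto
    have "?g ` f ` neighbours G v = (\<lambda>u. u) ` neighbours G v"
      unfolding image_image by (rule image_cong) (use inv neighbours_subset[OF assms(2), of v] in auto)
    then show ?thesis using v inv graph_isoD(3)[OF assms(1)] by simp
  qed
  moreover have "bij_betw ?g (verts H) (verts G)"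
    using bij_betw_the_inv_into[of f "verts G" "verts H"] assms(1) by (simp add: graph_iso_def)
  ultimately have "graph_iso ?g H G" by (simp add: graph_iso_def)
  then show thesis by (rule that)
qed

lemma degree_outside_iso:
  assumes "graph_iso f G H" "simple_graph G" "U \<subseteq> verts G" "v \<in> verts G"
  shows "degree_outside H (f ` U) (f v) = degree_outside G U v"
proof -
  note sub = neighbours_subset[OF assms(2), of v]
  have "neighbours H (f v) - f ` U = f ` (neighbours G v - U)"
    unfolding graph_isoD(3)[OF assms(1,4)]
    by (rule inj_on_image_set_diff[symmetric, OF graph_isoD(1)[OF assms(1)]]) (use sub assms(3) in auto)
  moreover have "inj_on f (neighbours G v - U)"
    by (rule inj_on_subset[OF graph_isoD(1)[OF assms(1)]]) (use sub in auto)
  ultimately show ?thesis by (simp add: degree_outside_def card_image)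
qed

lemma greedy_run_iso:
  assumes "graph_iso f G H" "simple_graph G"
  shows "greedy_run G U vs \<Longrightarrow> U \<subseteq> verts G \<Longrightarrow> greedy_run H (f ` U) (map f vs)"
proof (induction vs arbitrary: U)
  have rest: "verts H - f ` U = f ` (verts G - U)" if "U \<subseteq> verts G" for U
    unfolding graph_isoD(2)[OF assms(1)]
    by (rule inj_on_image_set_diff[symmetric, OF graph_isoD(1)[OF assms(1)]]) (use that in auto)
  {
    case Nil
    then show ?case using degree_outside_iso[OF assms] by (simp add: rest)
  next
    case (Cons v vs)
    then have v: "v \<in> verts G - U" by (simp add: max_degree_outside_def)
    have "max_degree_outside H (f ` U) (f v)"
      using Cons.prems v degree_outside_iso[OF assms Cons.prems(2)]
      by (auto simp: max_degree_outside_def rest)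
    moreover have "greedy_run H (f ` insert v U) (map f vs)"
      by (rule Cons.IH) (use Cons.prems v in auto)
    ultimately show ?case using Cons.prems v degree_outside_iso[OF assms Cons.prems(2), of v] by simp
  }
qed

lemma min_mdg_iso:
  assumes "graph_iso f G H" "simple_graph G" "simple_graph H" shows "min_mdg G = min_mdg H"
proof -
  have le: "min_mdg H \<le> min_mdg G" if iso: "graph_iso f G H" and simple: "simple_graph G"
    "simple_graph H"
    for f :: "'c \<Rightarrow> 'd" and G H
  proof -
    obtain vs where "greedy_run G {} vs" "length vs = min_mdg G" using min_mdg_obtain[OF simple(1)] .
    then show ?thesis
      using min_mdg_le[OF simple(2), of "map f vs"] greedy_run_iso[OF iso simple(1), of "{}" vs] by simp
  qed
  obtain g where "graph_iso g H G" using graph_iso_inverse[OF assms(1,2)] .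
  then show ?thesis using le[OF assms] le[of g H G] assms(2,3) by simp
qed

lemma vertex_cover_iso:
  assumes "graph_iso f G H" "simple_graph G" "simple_graph H" "vertex_cover G C"
  shows "vertex_cover H (f ` C)"
proof -
  have cover: "u \<in> C \<or> v \<in> C" if "u \<in> verts G" "v \<in> neighbours G u" for u v
    using assms(4) that by (auto simp: vertex_cover_iff_neighbours[OF assms(2)])
  have "f ` C \<subseteq> verts H" using assms(4) graph_isoD(2)[OF assms(1)] by (auto simp: vertex_cover_def)
  moreover have "x \<in> f ` C \<or> y \<in> f ` C" if x: "x \<in> verts H" and y: "y \<in> neighbours H x" for x y
  proof -
    obtain u where u: "u \<in> verts G" "x = f u" using x graph_isoD(2)[OF assms(1)] by auto
    then obtain v where v: "v \<in> neighbours G u" "y = f v" using y graph_isoD(3)[OF assms(1)] by auto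
    show ?thesis using cover[OF u(1) v(1)] u(2) v(2) by blast
  qed
  ultimately show ?thesis by (simp add: vertex_cover_iff_neighbours[OF assms(3)])
qed

lemma mvc_iso:
  assumes "graph_iso f G H" "simple_graph G" "simple_graph H" shows "mvc G = mvc H"
proof -
  have le: "mvc H \<le> mvc G" if iso: "graph_iso f G H" and simple: "simple_graph G" "simple_graph H"
    for f :: "'c \<Rightarrow> 'd" and G H
  proof -
    obtain C where C: "vertex_cover G C" "card C = mvc G" using mvc_obtain[OF simple(1)] .
    have "mvc H \<le> card (f ` C)" by (rule mvc_le[OF vertex_cover_iso[OF iso simple C(1)]])
    then show ?thesis using C(2) card_image_le[OF finite_vertex_cover[OF simple(1) C(1)], of f] by simp
  qed
  obtain g where "graph_iso g H G" using graph_iso_inverse[OF assms(1,2)] .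
  then show ?thesis using le[OF assms] le[of g H G] assms(2,3) by simp
qed

subsection \<open>Disjoint unions\<close>

definition graph_union :: "'a graph \<Rightarrow> 'a graph \<Rightarrow> 'a graph" where
  "graph_union G H = (verts G \<union> verts H, edges G \<union> edges H)"

lemma verts_graph_union [simp]: "verts (graph_union G H) = verts G \<union> verts H"
  by (simp add: graph_union_def)

lemma graph_union_commute: "graph_union G H = graph_union H G"
  by (simp add: graph_union_def Un_commute)

lemma simple_graph_union: "simple_graph G \<Longrightarrow> simple_graph H \<Longrightarrow> simple_graph (graph_union G H)"
  unfolding simple_graph_def graph_union_def fst_conv snd_conv by blast

lemma greedy_run_cong:
  "U \<inter> verts G = U' \<inter> verts G \<Longrightarrow> simple_graph G \<Longrightarrow> greedy_run G U vs \<longleftrightarrow> greedy_run G U' vs"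
proof (induction vs arbitrary: U U')
  have deg: "degree_outside G U = degree_outside G U'" if "U \<inter> verts G = U' \<inter> verts G"
    "simple_graph G" for U U'
  proof
    fix v
    have "neighbours G v - U = neighbours G v - U'"
      using that(1) neighbours_subset[OF that(2), of v] by blast
    then show "degree_outside G U v = degree_outside G U' v" by (simp add: degree_outside_def)
  qed
  have rest: "verts G - U = verts G - U'" if "U \<inter> verts G = U' \<inter> verts G" for U U' using that by blast
  {
    case Nil
    then show ?case using deg[OF Nil] rest[OF Nil(1)] by simp
  next
    case (Cons v vs)
    have "greedy_run G (insert v U) vs = greedy_run G (insert v U') vs"
      by (rule Cons.IH) (use Cons.prems in auto)
    then show ?case using deg[OF Cons.prems] rest[OF Cons.prems(1)]
      by (simp add: max_degree_outside_def)
  }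
qed

context
  fixes G H :: "'a graph"
  assumes simple: "simple_graph G" "simple_graph H" and disjoint: "verts G \<inter> verts H = {}"
begin

lemma neighbours_graph_union:
  shows "v \<in> verts G \<Longrightarrow> neighbours (graph_union G H) v = neighbours G v"
    and "v \<in> verts H \<Longrightarrow> neighbours (graph_union G H) v = neighbours H v"
  using disjoint by (auto simp: neighbours_def graph_union_def
      dest: simple_graph_edge_left[OF simple(1)] simple_graph_edge_left[OF simple(2)])

lemma degree_outside_union:
  shows "v \<in> verts G \<Longrightarrow> degree_outside (graph_union G H) U v = degree_outside G U v"
    and "v \<in> verts H \<Longrightarrow> degree_outside (graph_union G H) U v = degree_outside H U v"
  by (simp_all add: degree_outside_def neighbours_graph_union)

lemma max_degree_outside_union:
  assumes "v \<in> verts G"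
  shows "max_degree_outside (graph_union G H) U v \<longleftrightarrow> max_degree_outside G U v \<and>
    (\<forall>u\<in>verts H - U. degree_outside H U u \<le> degree_outside G U v)"
  using assms unfolding max_degree_outside_def verts_graph_union Un_Diff ball_Un
  by (auto simp: degree_outside_union)

lemma greedy_run_restrict:
  "greedy_run (graph_union G H) U us \<Longrightarrow> greedy_run G U (filter (\<lambda>v. v \<in> verts G) us)"
proof (induction us arbitrary: U)
  case Nil
  then show ?case by (simp add: Un_Diff ball_Un degree_outside_union(1))
next
  case (Cons v us)
  then have IH: "greedy_run G (insert v U) (filter (\<lambda>v. v \<in> verts G) us)" by simp
  show ?case
  proof (cases "v \<in> verts G")
    case True
    then show ?thesis using IH Cons.prems
      by (simp add: max_degree_outside_union degree_outside_union(1))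
  next
    case False
    then show ?thesis using IH greedy_run_cong[OF _ simple(1), of "insert v U" U] by simp
  qed
qed

lemma greedy_run_union_Cons:
  assumes "greedy_run G U (v # vs)" "\<forall>u\<in>verts H - U. degree_outside H U u \<le> degree_outside G U v"
    and "greedy_run (graph_union G H) (insert v U) us"
  shows "greedy_run (graph_union G H) U (v # us)"
proof -
  have "v \<in> verts G" using assms(1) by (simp add: max_degree_outside_def)
  then show ?thesis using assms by (simp add: max_degree_outside_union degree_outside_union(1))
qed

lemma mvc_union: "mvc (graph_union G H) = mvc G + mvc H"
proof (rule antisym)
  obtain C where C: "vertex_cover G C" "card C = mvc G" using mvc_obtain[OF simple(1)] .
  obtain D where D: "vertex_cover H D" "card D = mvc H" using mvc_obtain[OF simple(2)] .
  have "vertex_cover (graph_union G H) (C \<union> D)" using C D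
    by (auto simp: vertex_cover_def graph_union_def)
  then have "mvc (graph_union G H) \<le> card (C \<union> D)" by (rule mvc_le)
  then show "mvc (graph_union G H) \<le> mvc G + mvc H" using C D card_Un_le[of C D] by simp
  have restrict: "vertex_cover K (E \<inter> verts K)"
    if "vertex_cover (graph_union G H) E" "simple_graph K" "edges K \<subseteq> edges (graph_union G H)" for E K
  proof -
    have "e \<inter> E \<noteq> {}" "e \<subseteq> verts K" if "e \<in> edges K" for e
      using that \<open>edges K \<subseteq> edges (graph_union G H)\<close> \<open>vertex_cover (graph_union G H) E\<close>
        simple_graph_edge_subset[OF \<open>simple_graph K\<close>] by (auto simp: vertex_cover_def)
    then show ?thesis unfolding vertex_cover_def by blast
  qed
  obtain E where E: "vertex_cover (graph_union G H) E" "card E = mvc (graph_union G H)"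
    using mvc_obtain[OF simple_graph_union[OF simple]] .
  have "mvc G + mvc H \<le> card (E \<inter> verts G) + card (E \<inter> verts H)"
    using mvc_le[OF restrict[OF E(1) simple(1)]] mvc_le[OF restrict[OF E(1) simple(2)]]
    by (simp add: graph_union_def)
  also have "\<dots> = card (E \<inter> verts G \<union> E \<inter> verts H)"
    by (rule card_Un_disjoint[symmetric]) (use simple disjoint in \<open>auto simp: simple_graph_finite\<close>)
  also have "\<dots> \<le> card E"
    using finite_vertex_cover[OF simple_graph_union[OF simple] E(1)] by (intro card_mono) auto
  finally show "mvc G + mvc H \<le> mvc (graph_union G H)" using E by simp
qed

end

definition leading_degree :: "'a graph \<Rightarrow> 'a set \<Rightarrow> 'a list \<Rightarrow> nat" where
  "leading_degree G U vs = (case vs of [] \<Rightarrow> 0 | v # _ \<Rightarrow> degree_outside G U v)"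

lemma degree_outside_le_leading_degree:
  "greedy_run G U vs \<Longrightarrow> u \<in> verts G - U \<Longrightarrow> degree_outside G U u \<le> leading_degree G U vs"
  by (cases vs) (auto simp: leading_degree_def max_degree_outside_def)

lemma greedy_run_union_leading:
  assumes graphs: "simple_graph G" "simple_graph H" "verts G \<inter> verts H = {}"
    and runs: "greedy_run G U (v # vs)" "greedy_run H U ws"
    and leads: "leading_degree H U ws \<le> degree_outside G U v"
  shows "greedy_run H (insert v U) ws"
    "greedy_run (graph_union G H) (insert v U) us \<Longrightarrow> greedy_run (graph_union G H) U (v # us)"
proof -
  have "v \<in> verts G" using runs(1) by (simp add: max_degree_outside_def)
  then show "greedy_run H (insert v U) ws"
    using runs(2) graphs(3) greedy_run_cong[OF _ graphs(2), of "insert v U" U ws] by auto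
  have "\<forall>u\<in>verts H - U. degree_outside H U u \<le> degree_outside G U v"
    using degree_outside_le_leading_degree[OF runs(2)] leads by (auto intro: order_trans)
  then show "greedy_run (graph_union G H) U (v # us)" if "greedy_run (graph_union G H) (insert v U) us"
    by (rule greedy_run_union_Cons[OF graphs runs(1) _ that])
qed

lemma greedy_run_interleave:
  "simple_graph G \<Longrightarrow> simple_graph H \<Longrightarrow> verts G \<inter> verts H = {} \<Longrightarrow>
   greedy_run G U vs \<Longrightarrow> greedy_run H U ws \<Longrightarrow>
   \<exists>us. greedy_run (graph_union G H) U us \<and> length us = length vs + length ws"
proof (induction "length vs + length ws" arbitrary: G H U vs ws)
  case 0
  then have "greedy_run (graph_union G H) U []" by (simp add: Un_Diff ball_Un degree_outside_union)
  then show ?case using 0 by (intro exI[of _ "[]"]) simp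
next
  case (Suc n)
  have take_larger: "\<exists>us. greedy_run (graph_union G H) U us \<and> length us = length vs + length ws"
    if leads: "leading_degree H U ws \<le> leading_degree G U vs" and total: "Suc n = length vs + length ws"
      and graphs: "simple_graph G" "simple_graph H" "verts G \<inter> verts H = {}"
      and runs: "greedy_run G U vs" "greedy_run H U ws" for G H and vs ws :: "'a list"
  proof (cases vs)
    case Nil
    then show ?thesis using that by (cases ws) (auto simp: leading_degree_def)
  next
    case (Cons v vs')
    then have run: "greedy_run G U (v # vs')" and leads': "leading_degree H U ws \<le> degree_outside G U v"
      using runs(1) leads by (simp_all add: leading_degree_def)
    note step = greedy_run_union_leading[OF graphs run runs(2) leads']
    obtain us where "greedy_run (graph_union G H) (insert v U) us" "length us = length vs' + length ws"
      using Suc.hyps(1)[OF _ graphs _ step(1), of vs'] run total Cons by auto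
    then show ?thesis using step(2) Cons by (intro exI[of _ "v # us"]) simp
  qed
  show ?case
  proof (cases "leading_degree H U ws \<le> leading_degree G U vs")
    case True
    then show ?thesis using take_larger[of H ws G vs] Suc by simp
  next
    case False
    then have "\<exists>us. greedy_run (graph_union H G) U us \<and> length us = length ws + length vs"
      using take_larger[of G vs H ws] Suc by (simp add: Int_commute add.commute)
    then show ?thesis by (simp only: graph_union_commute[of G H] add.commute)
  qed
qed

lemma min_mdg_union:
  assumes graphs: "simple_graph G" "simple_graph H" "verts G \<inter> verts H = {}"
  shows "min_mdg (graph_union G H) = min_mdg G + min_mdg H"
proof (rule antisym)
  note union = simple_graph_union[OF graphs(1,2)]
  obtain vs where vs: "greedy_run G {} vs" "length vs = min_mdg G" using min_mdg_obtain[OF graphs(1)] .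
  obtain ws where ws: "greedy_run H {} ws" "length ws = min_mdg H" using min_mdg_obtain[OF graphs(2)] .
  show "min_mdg (graph_union G H) \<le> min_mdg G + min_mdg H"
    using greedy_run_interleave[OF graphs vs(1) ws(1)] min_mdg_le[OF union] vs(2) ws(2) by metis
  obtain us where us: "greedy_run (graph_union G H) {} us" "length us = min_mdg (graph_union G H)"
    using min_mdg_obtain[OF union] .
  have "filter (\<lambda>v. v \<in> verts H) us = filter (\<lambda>v. v \<notin> verts G) us"
    by (rule filter_cong) (use greedy_run_distinct[OF us(1)] graphs(3) in auto)
  moreover have "greedy_run H {} (filter (\<lambda>v. v \<in> verts H) us)"
    using greedy_run_restrict[OF graphs(2,1)] us(1) graphs(3)
    by (simp add: graph_union_commute Int_commute)
  ultimately have "min_mdg H \<le> length (filter (\<lambda>v. v \<notin> verts G) us)"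
    using min_mdg_le[OF graphs(2)] by metis
  moreover have "min_mdg G \<le> length (filter (\<lambda>v. v \<in> verts G) us)"
    by (rule min_mdg_le[OF graphs(1) greedy_run_restrict[OF graphs us(1)]])
  ultimately show "min_mdg G + min_mdg H \<le> min_mdg (graph_union G H)"
    using sum_length_filter_compl[of "\<lambda>v. v \<in> verts G" us] us(2) by simp
qed

subsection \<open>Graphs given by an adjacency relation\<close>

definition graph_of :: "'a set \<Rightarrow> ('a \<Rightarrow> 'a \<Rightarrow> bool) \<Rightarrow> 'a graph" where
  "graph_of V adj = (V, {{u, v} | u v. u \<in> V \<and> v \<in> V \<and> u \<noteq> v \<and> adj u v})"

lemma verts_graph_of [simp]: "verts (graph_of V adj) = V"
  by (simp add: graph_of_def)

lemma simple_graph_of: "finite V \<Longrightarrow> simple_graph (graph_of V adj)"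
  by (auto simp: simple_graph_def graph_of_def)

lemma edge_graph_of_iff:
  "symp adj \<Longrightarrow> {u, v} \<in> edges (graph_of V adj) \<longleftrightarrow> u \<in> V \<and> v \<in> V \<and> u \<noteq> v \<and> adj u v"
  by (auto simp: graph_of_def doubleton_eq_iff dest: sympD)

lemma neighbours_graph_of:
  "symp adj \<Longrightarrow> v \<in> V \<Longrightarrow> neighbours (graph_of V adj) v = {u \<in> V. u \<noteq> v \<and> adj v u}"
  by (auto simp: neighbours_def edge_graph_of_iff)

lemma vertex_cover_graph_of_iff:
  "vertex_cover (graph_of V adj) C \<longleftrightarrow> C \<subseteq> V \<and> (\<forall>u\<in>V. \<forall>v\<in>V. u \<noteq> v \<longrightarrow> adj u v \<longrightarrow> u \<in> C \<or> v \<in> C)"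
proof -
  have "(\<forall>e\<in>edges (graph_of V adj). e \<inter> C \<noteq> {}) \<longleftrightarrow>
      (\<forall>u\<in>V. \<forall>v\<in>V. u \<noteq> v \<longrightarrow> adj u v \<longrightarrow> {u, v} \<inter> C \<noteq> {})"
    unfolding graph_of_def snd_conv by blast
  then show ?thesis unfolding vertex_cover_def verts_graph_of by simp
qed

lemma graph_of_edges: "simple_graph G \<Longrightarrow> graph_of (verts G) (\<lambda>u v. {u, v} \<in> edges G) = G"
proof -
  assume "simple_graph G"
  then have "edges G = {{u, v} | u v. u \<in> verts G \<and> v \<in> verts G \<and> u \<noteq> v \<and> {u, v} \<in> edges G}"
    unfolding simple_graph_def by blast
  then show ?thesis by (simp add: graph_of_def prod_eq_iff)
qed

lemma graph_of_cong:
  assumes "\<And>u v. u \<in> V \<Longrightarrow> v \<in> V \<Longrightarrow> u \<noteq> v \<Longrightarrow> adj u v = adj' u v"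
  shows "graph_of V adj = graph_of V adj'"
proof -
  have "{{u, v} | u v. u \<in> V \<and> v \<in> V \<and> u \<noteq> v \<and> adj u v} =
      {{u, v} | u v. u \<in> V \<and> v \<in> V \<and> u \<noteq> v \<and> adj' u v}"
    using assms by metis
  then show ?thesis by (simp add: graph_of_def)
qed

lemma delete_vertices_graph_of: "delete_vertices (graph_of V adj) U = graph_of (V - U) adj"
proof -
  have "{e \<in> edges (graph_of V adj). e \<inter> U = {}} = edges (graph_of (V - U) adj)"
    unfolding graph_of_def snd_conv by blast
  then show ?thesis by (simp add: delete_vertices_def prod_eq_iff)
qed

lemma graph_of_Un:
  assumes "\<And>u v. u \<in> V \<Longrightarrow> v \<in> W \<Longrightarrow> \<not> adj u v \<and> \<not> adj v u"
  shows "graph_of (V \<union> W) adj = graph_union (graph_of V adj) (graph_of W adj)"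
proof -
  have "edges (graph_of (V \<union> W) adj) = edges (graph_of V adj) \<union> edges (graph_of W adj)"
    unfolding graph_of_def snd_conv using assms by blast
  then show ?thesis by (simp add: graph_union_def prod_eq_iff)
qed

lemma graph_iso_graph_of:
  assumes bij: "bij_betw f V W" and symp: "symp adj" "symp adj'"
    and adj: "\<And>u v. u \<in> V \<Longrightarrow> v \<in> V \<Longrightarrow> u \<noteq> v \<Longrightarrow> adj' (f u) (f v) \<longleftrightarrow> adj u v"
  shows "graph_iso f (graph_of V adj) (graph_of W adj')"
  unfolding graph_iso_def verts_graph_of
proof (intro conjI ballI bij)
  fix v assume v: "v \<in> V"
  have inj: "inj_on f V" and W: "W = f ` V" using bij by (auto simp: bij_betw_def)
  have "neighbours (graph_of W adj') (f v) = {w \<in> W. w \<noteq> f v \<and> adj' (f v) w}"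
    using v W by (intro neighbours_graph_of symp) simp
  also have "\<dots> = f ` {u \<in> V. u \<noteq> v \<and> adj v u}"
  proof -
    have "f u \<noteq> f v \<and> adj' (f v) (f u) \<longleftrightarrow> u \<noteq> v \<and> adj v u" if "u \<in> V" for u
      using adj[OF v that] inj_on_eq_iff[OF inj that v] by blast
    then show ?thesis unfolding W by (auto intro!: imageI)
  qed
  finally show "neighbours (graph_of W adj') (f v) = f ` neighbours (graph_of V adj) v"
    using v by (simp add: neighbours_graph_of symp)
qed

lemma mdg_mvc_graph_of_bij:
  assumes "bij_betw f V W" "finite V" "symp adj" "symp adj'"
    and "\<And>u v. u \<in> V \<Longrightarrow> v \<in> V \<Longrightarrow> u \<noteq> v \<Longrightarrow> adj' (f u) (f v) \<longleftrightarrow> adj u v"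
  shows "min_mdg (graph_of W adj') = min_mdg (graph_of V adj)"
    "mvc (graph_of W adj') = mvc (graph_of V adj)"
proof -
  have iso: "graph_iso f (graph_of V adj) (graph_of W adj')"
    by (rule graph_iso_graph_of[OF assms(1,3,4,5)])
  have "simple_graph (graph_of V adj)" "simple_graph (graph_of W adj')"
    using assms(2) bij_betw_finite[OF assms(1)] by (simp_all add: simple_graph_of)
  then show "min_mdg (graph_of W adj') = min_mdg (graph_of V adj)"
    "mvc (graph_of W adj') = mvc (graph_of V adj)"
    using min_mdg_iso[OF iso] mvc_iso[OF iso] by simp_all
qed

lemma mdg_mvc_disjoint_sum:
  fixes V :: "nat \<Rightarrow> 'a set"
  assumes finite: "\<And>i. i < n \<Longrightarrow> finite (V i)" and symp: "symp adj"
  defines "adj_sum \<equiv> \<lambda>x y :: nat \<times> 'a. fst x = fst y \<and> adj (snd x) (snd y)"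
  shows "min_mdg (graph_of (Sigma {..<n} V) adj_sum) = (\<Sum>i<n. min_mdg (graph_of (V i) adj)) \<and>
    mvc (graph_of (Sigma {..<n} V) adj_sum) = (\<Sum>i<n. mvc (graph_of (V i) adj))"
  using finite
proof (induction n)
  case 0
  have simple: "simple_graph (graph_of {} adj_sum)" by (simp add: simple_graph_of)
  have "greedy_run (graph_of {} adj_sum) {} []" by simp
  from min_mdg_le[OF simple this] have "min_mdg (graph_of {} adj_sum) = 0" by simp
  then show ?case using mvc_le_min_mdg[OF simple] by simp
next
  case (Suc n)
  let ?last = "graph_of (Pair n ` V n) adj_sum" and ?rest = "graph_of (Sigma {..<n} V) adj_sum"
  have symp_sum: "symp adj_sum" using symp by (auto simp: symp_def adj_sum_def)
  have "bij_betw (Pair n) (V n) (Pair n ` V n)" by (simp add: bij_betw_def inj_on_def)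
  note last = mdg_mvc_graph_of_bij[OF this Suc.prems[OF lessI] symp symp_sum,
      unfolded adj_sum_def, simplified,
      folded adj_sum_def]
  have "Sigma {..<Suc n} V = Pair n ` V n \<union> Sigma {..<n} V" by (auto simp: less_Suc_eq)
  then have "graph_of (Sigma {..<Suc n} V) adj_sum = graph_union ?last ?rest"
    by (simp only:, intro graph_of_Un) (auto simp: adj_sum_def)
  moreover have "simple_graph ?last" "simple_graph ?rest"
    using Suc.prems by (auto intro!: simple_graph_of)
  moreover have "verts ?last \<inter> verts ?rest = {}" by auto
  ultimately show ?case using Suc last by (simp add: min_mdg_union mvc_union)
qed

subsection \<open>Encodings of graphs\<close>

lemma length_concat_map_upt: "length (concat (map (\<lambda>i. map (f i) [0..<n]) [0..<k])) = k * n"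
  by (induction k) auto

lemma nth_concat_map_upt:
  assumes "i < k" "j < n" shows "concat (map (\<lambda>i. map (f i) [0..<n]) [0..<k]) ! (i * n + j) = f i j"
  using assms(1)
proof (induction k)
  case (Suc k)
  show ?case
  proof (cases "i = k")
    case True
    then show ?thesis using length_concat_map_upt[of f n k] assms(2) by (simp add: nth_append)
  next
    case False
    then have "i < k" using Suc.prems by simp
    have "i * n + j < Suc i * n" using assms(2) by simp
    also have "\<dots> \<le> k * n" using \<open>i < k\<close> by (intro mult_le_mono1) simp
    finally show ?thesis using Suc.IH[OF \<open>i < k\<close>] length_concat_map_upt[of f n k]
      by (simp add: nth_append)
  qed
qed simp

lemma length_enc_graph: "verts G = {..<n} \<Longrightarrow> length (enc_graph G) = n * n"
  by (simp add: enc_graph_def length_concat_map_upt)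

lemma enc_graph_nth:
  "verts G = {..<n} \<Longrightarrow> i < n \<Longrightarrow> j < n \<Longrightarrow> enc_graph G ! (i * n + j) \<longleftrightarrow> {i, j} \<in> edges G"
  by (simp add: enc_graph_def nth_concat_map_upt)

lemma enc_graph_inj:
  assumes "simple_graph G" "verts G = {..<n}" "simple_graph H" "verts H = {..<k}"
    "enc_graph G = enc_graph H"
  shows "G = H"
proof -
  have "n * n = k * k" using length_enc_graph assms(2,4,5) by metis
  then have "n = k" by (metis nat_neq_iff mult_strict_mono' zero_le)
  have edges: "{i, j} \<in> edges G \<longleftrightarrow> {i, j} \<in> edges H" if "i \<in> verts G" "j \<in> verts G" for i j
    using enc_graph_nth[OF assms(2), of i j] enc_graph_nth[OF assms(4), of i j]
      that assms(2,5) \<open>n = k\<close> by simp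
  have "G = graph_of (verts G) (\<lambda>i j. {i, j} \<in> edges G)" using graph_of_edges[OF assms(1)] by simp
  also have "\<dots> = graph_of (verts G) (\<lambda>i j. {i, j} \<in> edges H)" by (rule graph_of_cong) (rule edges)
  also have "\<dots> = H" using graph_of_edges[OF assms(3)] assms(2,4) \<open>n = k\<close> by simp
  finally show ?thesis .
qed

lemma enc_graph_in_S_MDG_iff:
  assumes "is_graph G" "verts G = {..<n}"
  shows "enc_graph G \<in> S_MDG r \<longleftrightarrow> of_nat (min_mdg G) \<le> r * of_nat (mvc G)"
proof
  assume "enc_graph G \<in> S_MDG r"
  then obtain H k where H: "enc_graph G = enc_graph H" "is_graph H" "verts H = {..<k}"
    "of_nat (min_mdg H) \<le> r * of_nat (mvc H)" unfolding S_MDG_def by blast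
  then have "G = H" using enc_graph_inj[OF _ assms(2) _ H(3,1)] assms(1) by (simp add: is_graph_iff)
  then show "of_nat (min_mdg G) \<le> r * of_nat (mvc G)" using H(4) by simp
qed (use assms in \<open>unfold S_MDG_def, blast\<close>)

lemma of_nat_le_ratio_mult_iff:
  assumes "0 < q" shows "of_nat a \<le> of_nat p / of_nat q * (of_nat b :: 'a :: linordered_field) \<longleftrightarrow>
      q * a \<le> p * b"
proof -
  have "of_nat a \<le> of_nat p / of_nat q * (of_nat b :: 'a) \<longleftrightarrow> of_nat (q * a) \<le> (of_nat (p * b) :: 'a)"
    using assms by (simp add: field_simps)
  then show ?thesis by (simp only: of_nat_le_iff)
qed

lemma map_eq_map_nth: "map f xs = map (\<lambda>i. f (xs ! i)) [0..<length xs]"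
  by (rule nth_equalityI) auto

lemma enumerated_graph:
  assumes "distinct vs" "vs \<noteq> []" "symp adj"
  obtains G :: "nat graph" where "is_graph G" "verts G = {..<length vs}"
    "enc_graph G = concat (map (\<lambda>u. map (\<lambda>v. u \<noteq> v \<and> adj u v) vs) vs)"
    "min_mdg G = min_mdg (graph_of (set vs) adj)" "mvc G = mvc (graph_of (set vs) adj)"
proof
  let ?adj = "\<lambda>i j. adj (vs ! i) (vs ! j)" and ?n = "length vs"
  let ?G = "graph_of {..<?n} ?adj"
  have symp: "symp ?adj" using assms(3) by (simp add: symp_def)
  show "is_graph ?G" using assms(2) by (simp add: is_graph_iff simple_graph_of lessThan_empty_iff)
  show "verts ?G = {..<?n}" by simp
  have bij: "bij_betw ((!) vs) {..<?n} (set vs)" by (rule bij_betw_nth[OF assms(1)]) simp_all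
  from mdg_mvc_graph_of_bij[OF this _ symp assms(3)]
  show "min_mdg ?G = min_mdg (graph_of (set vs) adj)" "mvc ?G = mvc (graph_of (set vs) adj)" by simp_all
  have "enc_graph ?G = concat (map (\<lambda>i. map (\<lambda>j. {i, j} \<in> edges ?G) [0..<?n]) [0..<?n])"
    by (simp add: enc_graph_def Let_def)
  also have "\<dots> = concat (map (\<lambda>i. map (\<lambda>j. vs ! i \<noteq> vs ! j \<and> ?adj i j) [0..<?n]) [0..<?n])"
    by (intro arg_cong[of _ _ concat] map_cong refl)
      (simp add: edge_graph_of_iff[OF symp] nth_eq_iff_index_eq[OF assms(1)])
  also have "\<dots> = concat (map (\<lambda>u. map (\<lambda>v. u \<noteq> v \<and> adj u v) vs) vs)"
    unfolding map_eq_map_nth[of "\<lambda>u. map (\<lambda>v. u \<noteq> v \<and> adj u v) vs"]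
    by (subst map_eq_map_nth[of _ vs]) (rule refl)
  finally show "enc_graph ?G = concat (map (\<lambda>u. map (\<lambda>v. u \<noteq> v \<and> adj u v) vs) vs)" .
qed

section \<open>A graph on which greedy choices are bad\<close>

text \<open>The small cover \<open>{0} \<times> {..<N}\<close> is beaten in degree by the vertices \<open>(j, b)\<close> with \<open>j\<close>
  neighbours each, which are taken in the order \<open>j = k, \<dots>, 2\<close>.\<close>

definition trap_blocks :: "nat \<Rightarrow> nat \<Rightarrow> (nat \<times> nat) set" where
  "trap_blocks k N = (SIGMA j:{2..k}. {..<N div j})"

definition trap_adj :: "nat \<times> nat \<Rightarrow> nat \<times> nat \<Rightarrow> bool" where
  "trap_adj x y \<longleftrightarrow> (fst x = 0 \<and> fst y \<noteq> 0 \<and> snd y = snd x div fst y) \<or>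
     (fst y = 0 \<and> fst x \<noteq> 0 \<and> snd x = snd y div fst x)"

definition trap_graph :: "nat \<Rightarrow> nat \<Rightarrow> (nat \<times> nat) graph" where
  "trap_graph k N = graph_of ({0} \<times> {..<N} \<union> trap_blocks k N) trap_adj"

lemma symp_trap_adj: "symp trap_adj"
  by (auto simp: symp_def trap_adj_def)

lemma verts_trap_graph: "verts (trap_graph k N) = {0} \<times> {..<N} \<union> trap_blocks k N"
  by (simp add: trap_graph_def)

lemma simple_trap_graph: "simple_graph (trap_graph k N)"
  unfolding trap_graph_def by (rule simple_graph_of) (simp add: trap_blocks_def)

lemma neighbours_trap_base:
  assumes "l < N" shows "neighbours (trap_graph k N)
      (0, l) \<subseteq> trap_blocks k N \<inter> (\<lambda>j. (j, l div j)) ` {2..k}"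
  using assms unfolding trap_graph_def
  by (subst neighbours_graph_of[OF symp_trap_adj]) (auto simp: trap_blocks_def trap_adj_def)

lemma neighbours_trap_block:
  assumes "(j, b) \<in> trap_blocks k N" "j dvd N"
  shows "neighbours (trap_graph k N) (j, b) = Pair 0 ` {b * j..<(b + 1) * j}"
proof -
  have j: "2 \<le> j" "b < N div j" using assms(1) by (auto simp: trap_blocks_def)
  have block: "l div j = b \<longleftrightarrow> b * j \<le> l \<and> l < (b + 1) * j" for l
    using j(1) by (auto simp: div_nat_eqI mult.commute dividend_less_times_div)
  have "(b + 1) * j \<le> N" using j(2) assms(2)
    by (metis Suc_eq_plus1 Suc_leI dvd_div_mult_self mult_le_mono1)
  then have "l < N \<and> b = l div j \<longleftrightarrow> b * j \<le> l \<and> l < (b + 1) * j" for l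
    using block[of l] by (metis less_le_trans)
  then have "{l. l < N \<and> b = l div j} = {b * j..<(b + 1) * j}"
    unfolding set_eq_iff mem_Collect_eq atLeastLessThan_iff by blast
  moreover have "neighbours (trap_graph k N) (j, b) = Pair 0 ` {l. l < N \<and> b = l div j}"
    using assms(1) unfolding trap_graph_def
    by (subst neighbours_graph_of[OF symp_trap_adj]) (auto simp: trap_blocks_def trap_adj_def)
  ultimately show ?thesis by simp
qed

lemma trap_blocks_dominant:
  assumes dvd: "\<And>j. j \<in> {2..k} \<Longrightarrow> j dvd N" and U: "U \<subset> trap_blocks k N"
    and v: "v \<in> verts (trap_graph k N) - trap_blocks k N"
  shows "\<exists>z\<in>trap_blocks k N - U. degree_outside (trap_graph k N) U v < degree_outside
      (trap_graph k N) U z"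
proof -
  let ?G = "trap_graph k N" and ?J = "fst ` (trap_blocks k N - U)"
  obtain l where l: "v = (0, l)" "l < N" using v by (auto simp: verts_trap_graph)
  have J: "finite ?J" "?J \<noteq> {}" using U by (auto simp: trap_blocks_def)
  define j where "j = Max ?J"
  obtain b where block: "(j, b) \<in> trap_blocks k N - U"
    using Max_in[OF J, folded j_def] by (auto elim!: imageE)
  have "neighbours ?G v - U \<subseteq> (\<lambda>i. (i, l div i)) ` {2..j}"
  proof
    fix y assume y: "y \<in> neighbours ?G v - U"
    then obtain i where i: "y = (i, l div i)" "i \<in> {2..k}" "y \<in> trap_blocks k N - U"
      using neighbours_trap_base[OF l(2), of k] l(1) by blast
    then have "i \<in> ?J" by force
    then have "i \<le> j" unfolding j_def by (rule Max_ge[OF J(1)])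
    then show "y \<in> (\<lambda>i. (i, l div i)) ` {2..j}" using i by simp
  qed
  then have "degree_outside ?G U v \<le> card ((\<lambda>i. (i, l div i)) ` {2..j})"
    unfolding degree_outside_def by (intro card_mono) simp_all
  also have "\<dots> \<le> card {2..j}" by (rule card_image_le) simp
  also have "\<dots> < j" using block by (auto simp: trap_blocks_def)
  also have "j = degree_outside ?G U (j, b)"
  proof -
    have "neighbours ?G (j, b) = Pair 0 ` {b * j..<(b + 1) * j}"
      using block dvd[of j] by (intro neighbours_trap_block) (auto simp: trap_blocks_def)
    moreover have "U \<inter> Pair 0 ` {b * j..<(b + 1) * j} = {}" using U by (auto simp: trap_blocks_def)
    ultimately have "degree_outside ?G U (j, b) = card (Pair (0 :: nat) ` {b * j..<(b + 1) * j})"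
      by (simp add: degree_outside_def Diff_triv Int_commute)
    also have "\<dots> = j" by (subst card_image) (auto simp: inj_on_def)
    finally show ?thesis by simp
  qed
  finally show ?thesis by (rule bexI[OF _ block])
qed

lemma min_mdg_trap_graph:
  assumes "\<And>j. j \<in> {2..k} \<Longrightarrow> j dvd N" "0 < N"
  shows "(\<Sum>j\<in>{2..k}. N div j) \<le> min_mdg (trap_graph k N)"
proof -
  let ?G = "trap_graph k N"
  obtain vs where vs: "greedy_run ?G {} vs" "length vs = min_mdg ?G"
    using min_mdg_obtain[OF simple_trap_graph] .
  have "trap_blocks k N \<subseteq> {} \<union> set vs"
  proof (rule greedy_run_takes_dominant[OF simple_trap_graph _ _ _ vs(1)])
    show "trap_blocks k N \<subseteq> verts ?G" by (simp add: verts_trap_graph)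
    show "(0, 0) \<in> verts ?G - trap_blocks k N" using assms(2)
      by (simp add: verts_trap_graph trap_blocks_def)
  qed (use trap_blocks_dominant assms(1) in auto)
  then have "card (trap_blocks k N) \<le> card (set vs)" by (intro card_mono) auto
  also have "\<dots> \<le> min_mdg ?G" using card_length vs(2) by metis
  finally show ?thesis by (simp add: trap_blocks_def)
qed

lemma mvc_trap_graph: "mvc (trap_graph k N) \<le> N"
proof -
  have "vertex_cover (trap_graph k N) ({0} \<times> {..<N})"
    by (auto simp: trap_graph_def vertex_cover_graph_of_iff trap_blocks_def trap_adj_def)
  then show ?thesis using mvc_le by fastforce
qed

lemma harmonic_sum_ge: "real m / 2 \<le> (\<Sum>j\<in>{2..2 ^ m}. 1 / real j)"
proof (induction m)
  case (Suc m)
  have "{2..2 ^ Suc m} = {2..2 ^ m} \<union> {2 ^ m + 1..2 ^ Suc m :: nat}"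
    using self_le_power[of "2 :: nat" m] by (cases "m = 0") auto
  then have "(\<Sum>j\<in>{2..2 ^ Suc m}. 1 / real j) =
      (\<Sum>j\<in>{2..2 ^ m}. 1 / real j) + (\<Sum>j\<in>{2 ^ m + 1..2 ^ Suc m}. 1 / real j)"
    by (simp only:) (rule sum.union_disjoint, auto)
  moreover have "(\<Sum>j\<in>{2 ^ m + 1..2 ^ Suc m :: nat}. 1 / 2 ^ Suc m) \<le>
      (\<Sum>j\<in>{2 ^ m + 1..2 ^ Suc m}. 1 / real j)"
    by (intro sum_mono divide_left_mono) (auto simp flip: of_nat_le_iff[where 'a = real])
  moreover have "(\<Sum>j\<in>{2 ^ m + 1..2 ^ Suc m :: nat}. 1 / 2 ^ Suc m :: real) = 1 / 2" by simp
  ultimately show ?case using Suc by simp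
qed simp

lemma trap_graph_ratio:
  assumes "k = 2 ^ (2 * p + 2)"
  shows "p * mvc (trap_graph k (fact k)) < min_mdg (trap_graph k (fact k))"
proof -
  define N :: nat where "N = fact k"
  have N: "0 < N" "\<And>j. j \<in> {2..k} \<Longrightarrow> j dvd N" by (auto simp: N_def dvd_fact)
  have "real (2 * p + 2) / 2 * real N \<le> (\<Sum>j\<in>{2..k}. 1 / real j) * real N"
    unfolding assms by (intro mult_right_mono harmonic_sum_ge) simp
  also have "\<dots> = (\<Sum>j\<in>{2..k}. real (N div j))"
    unfolding sum_distrib_right using N(2) by (intro sum.cong refl) (simp add: real_of_nat_div)
  also have "\<dots> \<le> real (min_mdg (trap_graph k N))"
    using min_mdg_trap_graph[OF N(2,1)] by (metis of_nat_le_iff of_nat_sum)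
  finally have "real ((p + 1) * N) \<le> real (min_mdg (trap_graph k N))" by (simp add: algebra_simps)
  then have "(p + 1) * N \<le> min_mdg (trap_graph k N)" by (simp only: of_nat_le_iff)
  have "p * mvc (trap_graph k N) \<le> p * N" by (rule mult_le_mono2[OF mvc_trap_graph])
  also have "\<dots> < (p + 1) * N" using N(1) by simp
  also note \<open>(p + 1) * N \<le> min_mdg (trap_graph k N)\<close>
  finally show ?thesis by (simp add: N_def)
qed

lemma bad_graph_exists:
  assumes "0 < q"
  obtains B :: "nat graph" and n where "is_graph B" "verts B = {..<n}" "p * mvc B < q * min_mdg B"
proof -
  define k :: nat where "k = 2 ^ (2 * p + 2)"
  let ?T = "trap_graph k (fact k)"
  have fin: "finite (verts ?T)" by (rule simple_graph_finite[OF simple_trap_graph])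
  obtain vs where vs: "distinct vs" "set vs = verts ?T" using finite_distinct_list[OF fin] by blast
  have "(0, 0) \<in> verts ?T" by (simp add: verts_trap_graph)
  then have "vs \<noteq> []" using vs(2) by (metis empty_iff list.set(1))
  then obtain B :: "nat graph" where B: "is_graph B" "verts B = {..<length vs}"
    "min_mdg B = min_mdg (graph_of (set vs) trap_adj)" "mvc B = mvc (graph_of (set vs) trap_adj)"
    using enumerated_graph[OF vs(1) _ symp_trap_adj] by metis
  have "graph_of (set vs) trap_adj = ?T" unfolding vs(2) by (simp add: trap_graph_def)
  then have "p * mvc B < 1 * min_mdg B" using B(3,4) trap_graph_ratio[OF k_def] by simp
  also have "\<dots> \<le> q * min_mdg B" using assms by (intro mult_le_mono1) simp
  finally show ?thesis using that[OF B(1,2)] by blast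
qed

section \<open>Forcing vertices next to given vertices into every greedy run\<close>

text \<open>Every \<open>v \<in> S\<close> gets a hub, to which \<open>D\<close> paths of length two are attached. The high degree of
  the hub forces the heuristic to take it, while in a minimum vertex cover it can be replaced by
  \<open>v\<close>.\<close>

datatype 'a hub_vertex = Base 'a | Hub 'a | Near 'a nat | Far 'a nat

fun hub_adj :: "('a \<Rightarrow> 'a \<Rightarrow> bool) \<Rightarrow> 'a hub_vertex \<Rightarrow> 'a hub_vertex \<Rightarrow> bool" where
  "hub_adj E (Base u) (Base v) \<longleftrightarrow> E u v"
| "hub_adj E (Base u) (Hub v) \<longleftrightarrow> u = v"
| "hub_adj E (Hub u) (Base v) \<longleftrightarrow> u = v"
| "hub_adj E (Hub u) (Near v i) \<longleftrightarrow> u = v"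
| "hub_adj E (Near u i) (Hub v) \<longleftrightarrow> u = v"
| "hub_adj E (Near u i) (Far v j) \<longleftrightarrow> u = v \<and> i = j"
| "hub_adj E (Far u i) (Near v j) \<longleftrightarrow> u = v \<and> i = j"
| "hub_adj E _ _ \<longleftrightarrow> False"

lemma symp_hub_adj: assumes "symp E" shows "symp (hub_adj E)"
proof (rule sympI)
  fix x y assume "hub_adj E x y"
  then show "hub_adj E y x" using sympD[OF assms] by (cases x; cases y) auto
qed

definition pendants :: "'a set \<Rightarrow> nat \<Rightarrow> 'a hub_vertex set" where
  "pendants S D = case_prod Near ` (S \<times> {..<D}) \<union> case_prod Far ` (S \<times> {..<D})"

definition hub_verts :: "'a set \<Rightarrow> 'a set \<Rightarrow> nat \<Rightarrow> 'a hub_vertex set" where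
  "hub_verts V S D = Base ` V \<union> Hub ` S \<union> pendants S D"

lemma mem_pendants [simp]:
  "Base v \<notin> pendants S D" "Hub v \<notin> pendants S D"
  "Near v i \<in> pendants S D \<longleftrightarrow> v \<in> S \<and> i < D" "Far v i \<in> pendants S D \<longleftrightarrow> v \<in> S \<and> i < D"
  by (auto simp: pendants_def)

lemma mem_hub_verts [simp]:
  "Base v \<in> hub_verts V S D \<longleftrightarrow> v \<in> V" "Hub v \<in> hub_verts V S D \<longleftrightarrow> v \<in> S"
  "Near v i \<in> hub_verts V S D \<longleftrightarrow> v \<in> S \<and> i < D" "Far v i \<in> hub_verts V S D \<longleftrightarrow> v \<in> S \<and> i < D"
  by (auto simp: hub_verts_def)

definition hub_graph :: "'a set \<Rightarrow> ('a \<Rightarrow> 'a \<Rightarrow> bool) \<Rightarrow> 'a set \<Rightarrow> nat \<Rightarrow> 'a hub_vertex graph" where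
  "hub_graph V E S D = graph_of (hub_verts V S D) (hub_adj E)"

locale hub_gadget =
  fixes V S :: "'a set" and E :: "'a \<Rightarrow> 'a \<Rightarrow> bool" and D :: nat
  assumes finite_V: "finite V" and S_subset: "S \<subseteq> V" and symp_E: "symp E"
begin

abbreviation "G \<equiv> graph_of V E"
abbreviation "H \<equiv> hub_graph V E S D"

lemma finite_S: "finite S"
  using finite_subset[OF S_subset finite_V] .

lemma finite_hub_verts: "finite (hub_verts V S D)"
  by (simp add: hub_verts_def pendants_def finite_V finite_S)

lemma simple_hub_graph: "simple_graph H"
  unfolding hub_graph_def by (rule simple_graph_of[OF finite_hub_verts])

lemma verts_hub_graph [simp]: "verts H = hub_verts V S D"
  by (simp add: hub_graph_def)

lemma neighbours_hub_graph:
  "x \<in> hub_verts V S D \<Longrightarrow> neighbours H x = {y \<in> hub_verts V S D. y \<noteq> x \<and> hub_adj E x y}"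
  unfolding hub_graph_def by (rule neighbours_graph_of[OF symp_hub_adj[OF symp_E]])

lemma hub_cover_edge:
  "vertex_cover H X \<Longrightarrow> x \<in> hub_verts V S D \<Longrightarrow> y \<in> hub_verts V S D \<Longrightarrow> x \<noteq> y \<Longrightarrow> hub_adj E x y \<Longrightarrow> x \<in> X \<or> y \<in> X"
  unfolding hub_graph_def vertex_cover_graph_of_iff by blast

lemma hub_cover_base: "vertex_cover H X \<Longrightarrow> vertex_cover G (Base -` X)"
  using hub_cover_edge[of X "Base _" "Base _"]
  by (auto simp: vertex_cover_graph_of_iff hub_graph_def)

lemma hub_cover_hub: "vertex_cover H X \<Longrightarrow> v \<in> S \<Longrightarrow> Base v \<in> X \<or> Hub v \<in> X"
  using hub_cover_edge[of X "Base v" "Hub v"] S_subset by auto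

lemma hub_cover_card:
  assumes "vertex_cover H X"
  shows "card S * D + card (Base -` X) + card {v \<in> S. Hub v \<in> X} \<le> card X"
proof -
  let ?hubs = "{v \<in> S. Hub v \<in> X}"
  define rep where "rep = (\<lambda>(v, i). if Near v i \<in> X then Near v i else Far v i)"
  have X: "finite X" by (rule finite_vertex_cover[OF simple_hub_graph assms])
  have "rep (v, i) \<in> X" if "v \<in> S" "i < D" for v i
    using hub_cover_edge[OF assms, of "Near v i" "Far v i"] that by (auto simp: rep_def)
  then have subset: "rep ` (S \<times> {..<D}) \<union> (Base ` Base -` X \<union> Hub ` ?hubs) \<subseteq> X" by auto
  have "inj_on rep (S \<times> {..<D})" by (auto simp: inj_on_def rep_def split: if_splits)
  then have "card S * D + (card (Base -` X) + card ?hubs) =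
      card (rep ` (S \<times> {..<D})) + (card (Base ` Base -` X) + card (Hub ` ?hubs))"
    by (simp add: card_image card_cartesian_product inj_on_def del: image_vimage_eq)
  also have "\<dots> = card (rep ` (S \<times> {..<D}) \<union> (Base ` Base -` X \<union> Hub ` ?hubs))"
    using finite_subset[OF subset X]
    by (subst card_Un_disjoint; auto simp: card_Un_disjoint rep_def split: if_splits)+
  also have "\<dots> \<le> card X" by (rule card_mono[OF X subset])
  finally show ?thesis by simp
qed

lemma mvc_hub_graph_le:
  assumes "vertex_cover G C" shows "mvc H \<le> card S * D + card C + card (S - C)"
proof -
  let ?X = "case_prod Near ` (S \<times> {..<D}) \<union> (Base ` C \<union> Hub ` (S - C))"
  have C: "C \<subseteq> V" "\<And>u v. u \<in> V \<Longrightarrow> v \<in> V \<Longrightarrow> u \<noteq> v \<Longrightarrow> E u v \<Longrightarrow> u \<in> C \<or> v \<in> C"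
    using assms by (auto simp: vertex_cover_graph_of_iff)
  have "vertex_cover H ?X" unfolding hub_graph_def vertex_cover_graph_of_iff
  proof (intro conjI ballI impI)
    show "?X \<subseteq> hub_verts V S D" using C(1) by auto
    fix x y assume edge: "x \<in> hub_verts V S D" "y \<in> hub_verts V S D" "x \<noteq> y" "hub_adj E x y"
    show "x \<in> ?X \<or> y \<in> ?X"
    proof (cases "\<exists>u v. x = Base u \<and> y = Base v")
      case True
      then obtain u v where "x = Base u" "y = Base v" by blast
      then show ?thesis using C(2)[of u v] edge by auto
    next
      case False
      then show ?thesis using edge by (cases x; cases y) auto
    qed
  qed
  then have "mvc H \<le> card ?X" by (rule mvc_le)
  also have "\<dots> \<le> card (case_prod Near ` (S \<times> {..<D})) + (card (Base ` C) + card (Hub ` (S - C)))"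
    by (intro order_trans[OF card_Un_le] add_mono order_refl card_Un_le)
  also have "\<dots> = card S * D + (card C + card (S - C))"
    by (simp add: card_image inj_on_def card_cartesian_product)
  finally show ?thesis by simp
qed

lemma degree_outside_hub:
  assumes "v \<in> S" "U \<subseteq> Hub ` S" shows "degree_outside H U (Hub v) = D + 1"
proof -
  have "neighbours H (Hub v) = insert (Base v) (Near v ` {..<D})"
    using assms(1) S_subset by (subst neighbours_hub_graph) (auto simp: hub_verts_def pendants_def)
  then have "neighbours H (Hub v) - U = insert (Base v) (Near v ` {..<D})" using assms(2) by auto
  then show ?thesis by (auto simp: degree_outside_def card_insert_if card_image inj_on_def)
qed

lemma degree_outside_non_hub:
  assumes deg: "\<And>v. v \<in> V \<Longrightarrow> card (neighbours G v) < D" and "2 \<le> D"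
    and x: "x \<in> hub_verts V S D - Hub ` S"
  shows "degree_outside H U x \<le> D"
proof -
  have "card (neighbours H x) \<le> D"
  proof (cases x)
    case (Base v)
    have fin: "finite (neighbours G v)" by (rule finite_neighbours[OF simple_graph_of[OF finite_V]])
    have "neighbours H x \<subseteq> insert (Hub v) (Base ` neighbours G v)"
    proof
      fix y assume "y \<in> neighbours H x"
      then show "y \<in> insert (Hub v) (Base ` neighbours G v)"
        using x Base by (cases y) (auto simp: neighbours_hub_graph neighbours_graph_of[OF symp_E])
    qed
    then have "card (neighbours H x) \<le> card (insert (Hub v) (Base ` neighbours G v))"
      by (intro card_mono) (simp_all add: fin)
    also have "\<dots> \<le> Suc (card (neighbours G v))"
      by (simp add: card_insert_if fin card_image inj_on_def image_iff)
    finally show ?thesis using deg[of v] x Base by simp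
  next
    case (Near v i)
    have "neighbours H x \<subseteq> {Hub v, Far v i}"
    proof
      fix y assume "y \<in> neighbours H x"
      then show "y \<in> {Hub v, Far v i}" using x Near by (cases y) (auto simp: neighbours_hub_graph)
    qed
    then have "card (neighbours H x) \<le> card {Hub v, Far v i}" by (intro card_mono) simp_all
    then show ?thesis using \<open>2 \<le> D\<close> by simp
  next
    case (Far v i)
    have "neighbours H x \<subseteq> {Near v i}"
    proof
      fix y assume "y \<in> neighbours H x"
      then show "y \<in> {Near v i}" using x Far by (cases y) (auto simp: neighbours_hub_graph)
    qed
    then have "card (neighbours H x) \<le> card {Near v i}" by (intro card_mono) simp_all
    then show ?thesis using \<open>2 \<le> D\<close> by simp
  qed (use x in auto)
  then show ?thesis using degree_outside_le[OF simple_hub_graph] le_trans by blast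
qed

lemma min_mdg_delete_hubs: "min_mdg (delete_vertices H (Hub ` S)) \<le> min_mdg G + card S * D"
proof -
  let ?copy = "graph_of (Base ` V) (hub_adj E)" and ?rest = "graph_of (pendants S D) (hub_adj E)"
  have "hub_verts V S D - Hub ` S = Base ` V \<union> pendants S D" by (auto simp: hub_verts_def)
  then have "delete_vertices H (Hub ` S) = graph_of (Base ` V \<union> pendants S D) (hub_adj E)"
    unfolding hub_graph_def delete_vertices_graph_of by simp
  also have "\<dots> = graph_union ?copy ?rest" by (rule graph_of_Un) (auto simp: pendants_def)
  finally have split: "delete_vertices H (Hub ` S) = graph_union ?copy ?rest" .
  have rest: "simple_graph ?rest" by (rule simple_graph_of) (simp add: pendants_def finite_S)
  have "min_mdg (delete_vertices H (Hub ` S)) = min_mdg ?copy + min_mdg ?rest"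
    unfolding split by (rule min_mdg_union[OF simple_graph_of rest]) (auto simp: finite_V)
  moreover have "min_mdg ?copy = min_mdg G"
    by (rule mdg_mvc_graph_of_bij(1)[of Base, OF _ finite_V symp_E symp_hub_adj[OF symp_E]])
      (auto simp: bij_betw_def inj_on_def)
  moreover have "min_mdg ?rest \<le> card S * D"
  proof -
    have "edges ?rest \<subseteq> (\<lambda>(v, i). {Near v i, Far v i}) ` (S \<times> {..<D})"
      unfolding graph_of_def pendants_def by (auto simp: image_iff insert_commute)
    then have "card (edges ?rest) \<le> card ((\<lambda>(v, i). {Near v i, Far v i}) ` (S \<times> {..<D}))"
      using finite_S by (intro card_mono) auto
    also have "\<dots> \<le> card (S \<times> {..<D})" using finite_S by (intro card_image_le) auto
    finally have "card (edges ?rest) \<le> card S * D" by (simp add: card_cartesian_product)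
    with min_mdg_le_card_edges[OF rest] show ?thesis by simp
  qed
  ultimately show ?thesis by simp
qed

context
  assumes small_degree: "\<And>v. v \<in> V \<Longrightarrow> card (neighbours G v) < D" and D_ge_2: "2 \<le> D"
    and S_nonempty: "S \<noteq> {}"
begin

lemma min_mdg_hub_graph_ge: "card S * (D + 1) + mvc G \<le> min_mdg H"
proof -
  obtain vs where vs: "greedy_run H {} vs" "length vs = min_mdg H"
    using min_mdg_obtain[OF simple_hub_graph] .
  obtain s where s: "s \<in> S" using S_nonempty by blast
  have "Hub ` S \<subseteq> {} \<union> set vs"
  proof (rule greedy_run_takes_dominant[OF simple_hub_graph _ _ _ vs(1)])
    show "Base s \<in> verts H - Hub ` S" using s S_subset by auto
    fix U v assume U: "U \<subset> Hub ` S" and v: "v \<in> verts H - Hub ` S"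
    then obtain z where z: "z \<in> S" "Hub z \<notin> U" by auto
    have "degree_outside H U v < degree_outside H U (Hub z)"
      using degree_outside_non_hub[OF small_degree D_ge_2, of v U]
        degree_outside_hub[OF z(1), of U] U v by simp
    then show "\<exists>z\<in>Hub ` S - U. degree_outside H U v < degree_outside H U z" using z by blast
  qed auto
  then have "{v \<in> S. Hub v \<in> set vs} = S" by auto
  moreover have cover: "vertex_cover H (set vs)"
    using greedy_run_vertex_cover[OF simple_hub_graph vs(1)] by simp
  ultimately have "card S * D + card (Base -` set vs) + card S \<le> card (set vs)"
    using hub_cover_card[OF cover] by simp
  then show ?thesis using mvc_le[OF hub_cover_base[OF cover]] card_length[of vs] vs(2) by simp
qed

lemma min_mdg_hub_graph_le: "min_mdg H \<le> card S * (D + 1) + min_mdg G"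
proof -
  let ?rest = "delete_vertices H (Hub ` S)"
  obtain us where us: "greedy_run ?rest {} us" "length us = min_mdg ?rest"
    using min_mdg_obtain[OF simple_graph_delete_vertices[OF simple_hub_graph]] .
  obtain zs where zs: "set zs = Hub ` S" "distinct zs"
    using finite_distinct_list[of "Hub ` S"] finite_S by auto
  have "greedy_run H {} (zs @ us)"
  proof (rule greedy_run_prepend[OF _ _ _ zs(2)])
    show "greedy_run H (Hub ` S) us" using us(1) by (simp add: greedy_run_delete_vertices)
    fix U z assume U: "U \<subseteq> Hub ` S" and z: "z \<in> Hub ` S - U"
    then have hub: "degree_outside H U z = D + 1" using degree_outside_hub[of _ U] by auto
    have "degree_outside H U u \<le> D + 1" if "u \<in> hub_verts V S D" for u
      using degree_outside_hub[of _ U] degree_outside_non_hub[OF small_degree D_ge_2, of u U] that U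
      by (cases "u \<in> Hub ` S") auto
    then show "max_degree_outside H U z \<and> 0 < degree_outside H U z"
      using hub z by (auto simp: max_degree_outside_def)
  qed (use zs in auto)
  then have "min_mdg H \<le> length zs + length us" using min_mdg_le[OF simple_hub_graph] by fastforce
  moreover have "length zs = card S" using distinct_card[OF zs(2)] zs(1)
    by (simp add: card_image inj_on_def)
  ultimately show ?thesis using us(2) min_mdg_delete_hubs by simp
qed

lemma min_mdg_hub_graph: "min_mdg G = mvc G \<Longrightarrow> min_mdg H = card S * (D + 1) + mvc G"
  using min_mdg_hub_graph_ge min_mdg_hub_graph_le by simp

end

lemma mvc_hub_graph_all:
  assumes "S = V" shows "mvc H = card V * (D + 1)"
proof (rule antisym)
  have "vertex_cover G V" by (simp add: vertex_cover_graph_of_iff)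
  from mvc_hub_graph_le[OF this] show "mvc H \<le> card V * (D + 1)" using assms by simp
  obtain X where X: "vertex_cover H X" "card X = mvc H" by (rule mvc_obtain[OF simple_hub_graph])
  have fin: "finite (Base -` X)"
    by (rule finite_vertex_cover[OF simple_graph_of[OF finite_V] hub_cover_base[OF X(1)]])
  have "card V \<le> card (Base -` X \<union> {v \<in> S. Hub v \<in> X})"
    using hub_cover_hub[OF X(1)] fin finite_S assms by (intro card_mono) auto
  also have "\<dots> \<le> card (Base -` X) + card {v \<in> S. Hub v \<in> X}" by (rule card_Un_le)
  finally show "card V * (D + 1) \<le> mvc H" using hub_cover_card[OF X(1)] X(2) assms by simp
qed

end

section \<open>Graphs of constraint satisfaction problems\<close>

text \<open>A choice \<open>c\<close> is a partial assignment \<open>snd c\<close> that satisfies the constraint \<open>fst c\<close>. The vertices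
  \<open>Copy v a c i\<close> stand for assigning \<open>a\<close> to \<open>v\<close>; all copies for \<open>v\<close> form a complete multipartite
  graph with one block per value, so a vertex cover contains all blocks of \<open>v\<close> but one. The copies with
  \<open>i = 0\<close> are joined to the choices they contradict.\<close>

type_synonym ('i, 'v, 'a) choice = "'i \<times> ('v \<times> 'a) list"

datatype ('i, 'v, 'a) csp_vertex = Copy 'v 'a "('i, 'v, 'a) choice" nat | Choice "('i, 'v, 'a) choice"

definition contradicts :: "('i, 'v, 'a) choice \<Rightarrow> 'v \<Rightarrow> 'a \<Rightarrow> bool" where
  "contradicts c v a \<longleftrightarrow> (\<exists>z\<in>set (snd c). fst z = v \<and> snd z \<noteq> a)"

definition agrees :: "('v \<Rightarrow> 'a) \<Rightarrow> ('i, 'v, 'a) choice \<Rightarrow> bool" where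
  "agrees \<sigma> c \<longleftrightarrow> (\<forall>z\<in>set (snd c). \<sigma> (fst z) = snd z)"

fun csp_adj :: "('i, 'v, 'a) csp_vertex \<Rightarrow> ('i, 'v, 'a) csp_vertex \<Rightarrow> bool" where
  "csp_adj (Copy v a c i) (Copy w b d j) \<longleftrightarrow> v = w \<and> a \<noteq> b"
| "csp_adj (Copy v a c i) (Choice d) \<longleftrightarrow> i = 0 \<and> c = d \<and> contradicts c v a"
| "csp_adj (Choice d) (Copy v a c i) \<longleftrightarrow> i = 0 \<and> c = d \<and> contradicts c v a"
| "csp_adj (Choice c) (Choice d) \<longleftrightarrow> fst c = fst d \<and> c \<noteq> d"

lemma csp_adj_commute: "csp_adj x y \<longleftrightarrow> csp_adj y x"
  by (cases x; cases y) auto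

lemma symp_csp_adj: "symp csp_adj"
  unfolding symp_def using csp_adj_commute by blast

fun choice_of :: "('i, 'v, 'a) csp_vertex \<Rightarrow> ('i, 'v, 'a) choice" where
  "choice_of (Copy v a c i) = c"
| "choice_of (Choice c) = c"

definition csp_verts :: "'v set \<Rightarrow> ('v \<Rightarrow> 'a set) \<Rightarrow> ('i, 'v, 'a) choice set \<Rightarrow> nat \<Rightarrow>
    ('i, 'v, 'a) csp_vertex set" where
  "csp_verts vars domain choices n =
     (\<Union>v\<in>vars. \<Union>a\<in>domain v. case_prod (Copy v a) ` (choices \<times> {..<n})) \<union> Choice ` choices"

locale csp =
  fixes vars :: "'v set" and domain :: "'v \<Rightarrow> 'a set"
    and choices :: "('i, 'v, 'a) choice set" and n :: nat
  assumes finite_vars: "finite vars" and vars_nonempty: "vars \<noteq> {}"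
    and finite_dom: "v \<in> vars \<Longrightarrow> finite (domain v)" and dom_nonempty: "v \<in> vars \<Longrightarrow> domain v \<noteq> {}"
    and finite_choices: "finite choices" and choices_nonempty: "choices \<noteq> {}"
    and same_scope: "c \<in> choices \<Longrightarrow> d \<in> choices \<Longrightarrow> fst c = fst d \<Longrightarrow> map fst (snd c) = map fst (snd d)"
    and scope_subset: "c \<in> choices \<Longrightarrow> fst ` set (snd c) \<subseteq> vars"
    and always_contradicted: "v \<in> vars \<Longrightarrow> \<exists>c\<in>choices. \<forall>a. contradicts c v a"
    and many_copies: "(\<Sum>v\<in>vars. card (domain v)) < n"
begin

abbreviation "vertices \<equiv> csp_verts vars domain choices n"
abbreviation "G \<equiv> graph_of vertices csp_adj"
abbreviation "K \<equiv> card choices * n"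

definition block :: "'v \<Rightarrow> 'a \<Rightarrow> ('i, 'v, 'a) csp_vertex set" where
  "block v a = case_prod (Copy v a) ` (choices \<times> {..<n})"

definition valid :: "('v \<Rightarrow> 'a) \<Rightarrow> bool" where
  "valid \<sigma> \<longleftrightarrow> (\<forall>v\<in>vars. \<sigma> v \<in> domain v)"

definition agreeing :: "('v \<Rightarrow> 'a) \<Rightarrow> ('i, 'v, 'a) choice set" where
  "agreeing \<sigma> = {c \<in> choices. agrees \<sigma> c}"

definition rejected :: "('v \<Rightarrow> 'a) \<Rightarrow> ('i, 'v, 'a) csp_vertex set" where
  "rejected \<sigma> = (\<Union>v\<in>vars. \<Union>a\<in>domain v - {\<sigma> v}. block v a)"

definition rejected_size :: nat where
  "rejected_size = (\<Sum>v\<in>vars. (card (domain v) - 1) * K)"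

definition assignment_cover :: "('v \<Rightarrow> 'a) \<Rightarrow> ('i, 'v, 'a) csp_vertex set" where
  "assignment_cover \<sigma> = rejected \<sigma> \<union> Choice ` (choices - agreeing \<sigma>)"

lemma mem_block [simp]:
  "Copy w b c i \<in> block v a \<longleftrightarrow> w = v \<and> b = a \<and> c \<in> choices \<and> i < n" "Choice c \<notin> block v a"
  by (auto simp: block_def)

lemma mem_vertices [simp]:
  "Copy v a c i \<in> vertices \<longleftrightarrow> v \<in> vars \<and> a \<in> domain v \<and> c \<in> choices \<and> i < n"
  "Choice c \<in> vertices \<longleftrightarrow> c \<in> choices"
  by (auto simp: csp_verts_def)

lemma mem_rejected [simp]:
  "Copy v a c i \<in> rejected \<sigma> \<longleftrightarrow> v \<in> vars \<and> a \<in> domain v \<and> a \<noteq> \<sigma> v \<and> c \<in> choices \<and> i < n"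
  "Choice c \<notin> rejected \<sigma>"
  by (auto simp: rejected_def)

lemma mem_assignment_cover [simp]:
  "Copy v a c i \<in> assignment_cover \<sigma> \<longleftrightarrow> Copy v a c i \<in> rejected \<sigma>"
  "Choice c \<in> assignment_cover \<sigma> \<longleftrightarrow> c \<in> choices \<and> \<not> agrees \<sigma> c"
  by (auto simp: assignment_cover_def agreeing_def)

lemma finite_block: "finite (block v a)"
  using finite_choices by (simp add: block_def)

lemma card_block: "card (block v a) = K"
proof -
  have "inj_on (case_prod (Copy v a)) (choices \<times> {..<n})" by (auto simp: inj_on_def)
  then show ?thesis by (simp add: block_def card_image card_cartesian_product)
qed

lemma finite_vertices: "finite vertices"
  using finite_vars finite_dom finite_choices by (auto simp: csp_verts_def)

lemma simple_G: "simple_graph G"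
  by (rule simple_graph_of[OF finite_vertices])

lemma neighbours_G: "x \<in> vertices \<Longrightarrow> neighbours G x = {y \<in> vertices. y \<noteq> x \<and> csp_adj x y}"
  by (rule neighbours_graph_of[OF symp_csp_adj])

lemma card_choices_pos: "0 < card choices"
  using finite_choices choices_nonempty by (simp add: card_gt_0_iff)

lemma n_ge_2: "2 \<le> n"
proof -
  obtain v where v: "v \<in> vars" using vars_nonempty by blast
  have "0 < card (domain v)" using finite_dom[OF v] dom_nonempty[OF v] by (simp add: card_gt_0_iff)
  also have "card (domain v) \<le> (\<Sum>v\<in>vars. card (domain v))" using finite_vars v
    by (intro member_le_sum) auto
  finally show ?thesis using many_copies by simp
qed

lemma K_ge_2: "2 \<le> K"
  using mult_le_mono[of 1 "card choices" 2 n] card_choices_pos n_ge_2 by simp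

lemma finite_agreeing: "finite (agreeing \<sigma>)"
  using finite_choices by (simp add: agreeing_def)

lemma finite_rejected: "finite (rejected \<sigma>)"
  using finite_vars finite_dom finite_block by (auto simp: rejected_def)

lemma card_rejected:
  assumes "valid \<sigma>" shows "card (rejected \<sigma>) = rejected_size"
proof -
  have "card (rejected \<sigma>) = (\<Sum>v\<in>vars. card (\<Union>a\<in>domain v - {\<sigma> v}. block v a))"
    unfolding rejected_def
    using finite_vars finite_dom finite_block by (intro card_UN_disjoint) (auto simp: block_def)
  also have "\<dots> = (\<Sum>v\<in>vars. \<Sum>a\<in>domain v - {\<sigma> v}. card (block v a))"
    using finite_dom finite_block by (intro sum.cong refl card_UN_disjoint) (auto simp: block_def)
  also have "\<dots> = rejected_size"
    unfolding rejected_size_def card_block using assms finite_dom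
    by (intro sum.cong refl) (simp add: valid_def)
  finally show ?thesis .
qed

lemma card_assignment_cover:
  assumes "valid \<sigma>" shows "card (assignment_cover \<sigma>) + card (agreeing \<sigma>) = rejected_size + card choices"
proof -
  have "rejected \<sigma> \<inter> Choice ` (choices - agreeing \<sigma>) = {}" by auto
  then have "card (assignment_cover \<sigma>) = card (rejected \<sigma>) + card (Choice ` (choices - agreeing \<sigma>))"
    unfolding assignment_cover_def using finite_rejected finite_choices by (intro card_Un_disjoint) auto
  also have "\<dots> = rejected_size + card (choices - agreeing \<sigma>)"
    by (simp add: card_rejected[OF assms] card_image inj_on_def)
  finally have "card (assignment_cover \<sigma>) = rejected_size + card (choices - agreeing \<sigma>)" .
  moreover have "agreeing \<sigma> \<subseteq> choices" by (auto simp: agreeing_def)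
  ultimately show ?thesis
    using card_Diff_subset[OF finite_agreeing, of \<sigma> choices]
      card_mono[OF finite_choices, of "agreeing \<sigma>"] by simp
qed

lemma agrees_contradicts: "agrees \<sigma> c \<Longrightarrow> contradicts c v a \<Longrightarrow> a \<noteq> \<sigma> v"
  unfolding agrees_def contradicts_def by auto

lemma not_agrees_contradicts:
  assumes "\<not> agrees \<sigma> c" "c \<in> choices" obtains v where "v \<in> vars" "contradicts c v (\<sigma> v)"
proof -
  obtain z where "z \<in> set (snd c)" "\<sigma> (fst z) \<noteq> snd z" using assms(1) by (auto simp: agrees_def)
  moreover from this have "contradicts c (fst z) (\<sigma> (fst z))" unfolding contradicts_def by metis
  ultimately show thesis using scope_subset[OF assms(2)] that[of "fst z"] by blast
qed

lemma agrees_unique: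
  assumes "agrees \<sigma> c" "agrees \<sigma> d" "c \<in> choices" "d \<in> choices" "fst c = fst d" shows "c = d"
proof -
  have "snd c = map (\<lambda>v. (v, \<sigma> v)) (map fst (snd c))" if "agrees \<sigma> c" for c :: "('i, 'v, 'a) choice"
    unfolding map_map by (rule map_idI[symmetric]) (use that in \<open>auto simp: agrees_def\<close>)
  then have "snd c = snd d" using same_scope[OF assms(3-5)] assms(1,2) by metis
  then show ?thesis using assms(5) by (simp add: prod_eq_iff)
qed

subsection \<open>Vertex covers\<close>

lemma vertex_cover_assignment_cover: "vertex_cover G (assignment_cover \<sigma>)"
  unfolding vertex_cover_graph_of_iff
proof (intro conjI ballI impI)
  show "assignment_cover \<sigma> \<subseteq> vertices"
  proof
    fix x assume "x \<in> assignment_cover \<sigma>"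
    then show "x \<in> vertices" by (cases x) auto
  qed
  have copy: "Copy v a c i \<in> assignment_cover \<sigma> \<or> y \<in> assignment_cover \<sigma>"
    if "Copy v a c i \<in> vertices" "y \<in> vertices" "csp_adj (Copy v a c i) y" for v a c i y
    using that agrees_contradicts[of \<sigma> c v a] by (cases y) auto
  fix x y assume edge: "x \<in> vertices" "y \<in> vertices" "x \<noteq> y" "csp_adj x y"
  show "x \<in> assignment_cover \<sigma> \<or> y \<in> assignment_cover \<sigma>"
  proof (cases x; cases y)
    fix c d assume "x = Choice c" "y = Choice d"
    then show ?thesis using edge agrees_unique[of \<sigma> c d] by auto
  qed (use edge copy csp_adj_commute in blast)+
qed

lemma vertex_cover_edge:
  "vertex_cover G X \<Longrightarrow> x \<in> vertices \<Longrightarrow> y \<in> vertices \<Longrightarrow> csp_adj x y \<Longrightarrow> x \<noteq> y \<Longrightarrow> x \<in> X \<or> y \<in> X"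
  by (auto simp: vertex_cover_graph_of_iff)

lemma vertex_cover_omits_one_block:
  assumes "vertex_cover G X" "v \<in> vars" shows "\<exists>a\<in>domain v. \<forall>b\<in>domain v - {a}. block v b \<subseteq> X"
proof (cases "\<exists>a\<in>domain v. \<not> block v a \<subseteq> X")
  case True
  then obtain a c i where a: "a \<in> domain v" "c \<in> choices" "i < n" "Copy v a c i \<notin> X"
    by (auto simp: block_def)
  have "block v b \<subseteq> X" if "b \<in> domain v - {a}" for b
  proof
    fix x assume "x \<in> block v b"
    then show "x \<in> X" using vertex_cover_edge[OF assms(1), of "Copy v a c i" x] a that assms(2)
      by (cases x) auto
  qed
  then show ?thesis using a(1) by blast
next
  case False
  then show ?thesis using dom_nonempty[OF assms(2)] by blast
qed

lemma vertex_cover_selects_assignment: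
  assumes "vertex_cover G X" obtains \<sigma> where "valid \<sigma>" "rejected \<sigma> \<subseteq> X"
proof -
  have "\<forall>v\<in>vars. \<exists>a. a \<in> domain v \<and> (\<forall>b\<in>domain v - {a}. block v b \<subseteq> X)"
    using vertex_cover_omits_one_block[OF assms] by blast
  from bchoice[OF this] obtain \<sigma> where "\<forall>v\<in>vars. \<sigma> v \<in> domain v \<and>
      (\<forall>b\<in>domain v - {\<sigma> v}. block v b \<subseteq> X)" ..
  then have "valid \<sigma>" "rejected \<sigma> \<subseteq> X" unfolding valid_def rejected_def by blast+
  then show thesis by (rule that)
qed

lemma vertex_cover_card_ge:
  assumes "vertex_cover G X"
  obtains \<sigma> where "valid \<sigma>" "rejected_size + card {c \<in> choices. \<not> agrees \<sigma> c \<or> Choice c \<in> X} \<le> card X"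
proof -
  obtain \<sigma> where \<sigma>: "valid \<sigma>" "rejected \<sigma> \<subseteq> X" using vertex_cover_selects_assignment[OF assms] .
  let ?bad = "{c \<in> choices. \<not> agrees \<sigma> c \<or> Choice c \<in> X}"
  have "c \<in> choice_of ` (X - rejected \<sigma>)" if c: "c \<in> ?bad" for c
  proof (cases "Choice c \<in> X")
    case True
    then show ?thesis by (intro image_eqI[of _ _ "Choice c"]) auto
  next
    case False
    then obtain v where v: "v \<in> vars" "contradicts c v (\<sigma> v)"
      using c not_agrees_contradicts[of \<sigma> c] by blast
    have "Copy v (\<sigma> v) c 0 \<in> X \<or> Choice c \<in> X"
      using v c \<sigma>(1) n_ge_2 by (intro vertex_cover_edge[OF assms]) (auto simp: valid_def)
    then show ?thesis using False by (intro image_eqI[of _ _ "Copy v (\<sigma> v) c 0"]) auto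
  qed
  moreover have X: "finite X" by (rule finite_vertex_cover[OF simple_G assms])
  ultimately have "card ?bad \<le> card (X - rejected \<sigma>)" by (intro surj_card_le[of _ _ choice_of]) auto
  also have "\<dots> = card X - rejected_size"
    using card_Diff_subset[OF finite_rejected \<sigma>(2)] card_rejected[OF \<sigma>(1)] by simp
  finally have "rejected_size + card ?bad \<le> card X"
    using card_mono[OF X \<sigma>(2)] card_rejected[OF \<sigma>(1)] by simp
  then show thesis by (rule that[OF \<sigma>(1)])
qed

subsection \<open>A greedy run that follows an assignment\<close>

definition cross :: "'v \<Rightarrow> 'a \<Rightarrow> ('i, 'v, 'a) choice \<Rightarrow> nat \<Rightarrow> ('i, 'v, 'a) csp_vertex set" where
  "cross v a c i = (if i = 0 \<and> contradicts c v a then {Choice c} else {})"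

definition remaining :: "('i, 'v, 'a) csp_vertex set \<Rightarrow> 'v \<Rightarrow> 'a \<Rightarrow> nat" where
  "remaining U v a = card (block v a - U)"

lemma remaining_untouched: "block v a \<inter> U = {} \<Longrightarrow> remaining U v a = K"
  by (simp add: remaining_def Diff_triv card_block)

lemma neighbours_Copy:
  assumes "Copy v a c i \<in> vertices"
  shows "neighbours G (Copy v a c i) = (\<Union>b\<in>domain v - {a}. block v b) \<union> cross v a c i"
proof (rule set_eqI)
  fix y
  show "y \<in> neighbours G (Copy v a c i) \<longleftrightarrow> y \<in> (\<Union>b\<in>domain v - {a}. block v b) \<union> cross v a c i"
    using assms by (cases y) (auto simp: neighbours_G cross_def)
qed

lemma degree_outside_Copy:
  assumes "Copy v a c i \<in> vertices"
  shows "degree_outside G U (Copy v a c i) + remaining U v a =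
    (\<Sum>b\<in>domain v. remaining U v b) + card (cross v a c i - U)"
proof -
  have v: "v \<in> vars" "a \<in> domain v" using assms by auto
  have "neighbours G (Copy v a c i) - U = (\<Union>b\<in>domain v - {a}. block v b - U) \<union> (cross v a c i - U)"
    unfolding neighbours_Copy[OF assms] by blast
  moreover have "(\<Union>b\<in>domain v - {a}. block v b - U) \<inter> (cross v a c i - U) = {}"
    by (auto simp: cross_def)
  ultimately have "degree_outside G U (Copy v a c i) =
      card (\<Union>b\<in>domain v - {a}. block v b - U) + card (cross v a c i - U)"
    using finite_dom[OF v(1)] finite_block by (simp add: degree_outside_def card_Un_disjoint cross_def)
  also have "card (\<Union>b\<in>domain v - {a}. block v b - U) = (\<Sum>b\<in>domain v - {a}. remaining U v b)"
    unfolding remaining_def using finite_dom[OF v(1)] finite_block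
    by (intro card_UN_disjoint) (auto simp: block_def)
  finally show ?thesis using sum.remove[OF finite_dom[OF v(1)] v(2), of "remaining U v"] by simp
qed

lemma card_cross: "card (cross v a c i - U) \<le> 1"
  using card_mono[of "{Choice c}" "cross v a c i - U"] by (auto simp: cross_def)

lemma degree_outside_Choice:
  assumes "c \<in> choices" shows "degree_outside G U (Choice c) < K"
proof -
  let ?copies = "(\<lambda>(v, a). Copy v a c 0) ` (SIGMA v:vars. domain v)"
  have fin: "finite (SIGMA v:vars. domain v)" using finite_vars finite_dom by auto
  have "neighbours G (Choice c) \<subseteq> Choice ` (choices - {c}) \<union> ?copies"
  proof
    fix y assume "y \<in> neighbours G (Choice c)"
    then show "y \<in> Choice ` (choices - {c}) \<union> ?copies"
      using assms by (cases y) (auto simp: neighbours_G image_iff)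
  qed
  then have "card (neighbours G (Choice c)) \<le> card (Choice ` (choices - {c}) \<union> ?copies)"
    using finite_choices fin by (intro card_mono) auto
  also have "\<dots> \<le> card (choices - {c}) + card (SIGMA v:vars. domain v)"
    using finite_choices fin by (intro order_trans[OF card_Un_le] add_mono card_image_le) auto
  also have "\<dots> = (card choices - 1) + (\<Sum>v\<in>vars. card (domain v))"
    using assms finite_vars finite_dom by (simp add: card_SigmaI)
  also have "\<dots> < (card choices - 1) + n" using many_copies by simp
  also have "\<dots> \<le> (card choices - 1) * n + n" using n_ge_2 by simp
  also have "\<dots> = K" using card_choices_pos by (metis Suc_pred' add.commute mult_Suc)
  finally show ?thesis using degree_outside_le[OF simple_G] le_less_trans by blast
qed

definition started :: "('i, 'v, 'a) csp_vertex set \<Rightarrow> 'v \<Rightarrow> 'a \<Rightarrow> bool" where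
  "started U v a \<longleftrightarrow> block v a \<inter> U \<noteq> {} \<and> \<not> block v a \<subseteq> U"

definition removing_blocks :: "('v \<Rightarrow> 'a) \<Rightarrow> ('i, 'v, 'a) csp_vertex set \<Rightarrow> bool" where
  "removing_blocks \<sigma> U \<longleftrightarrow> U \<subseteq> rejected \<sigma> \<and> (\<forall>v\<in>vars. \<forall>a b. started U v a \<longrightarrow> started U v b \<longrightarrow> a = b)"

lemma removing_blocks_untouched: "removing_blocks \<sigma> U \<Longrightarrow> block v (\<sigma> v) \<inter> U = {}"
  by (auto simp: removing_blocks_def rejected_def block_def)

lemma removing_blocks_insert:
  assumes U: "removing_blocks \<sigma> U" and x: "x \<in> block v a - U" and v: "v \<in> vars" "a \<in> domain v" "a \<noteq> \<sigma> v"
    and only: "\<And>b. started U v b \<Longrightarrow> b = a"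
  shows "removing_blocks \<sigma> (insert x U)"
  unfolding removing_blocks_def
proof (intro conjI ballI allI impI)
  have "x \<in> rejected \<sigma>" using x v by (auto simp: rejected_def)
  then show "insert x U \<subseteq> rejected \<sigma>" using U by (simp add: removing_blocks_def)
  have other: "started U w b" if "started (insert x U) w b" "w \<noteq> v \<or> b \<noteq> a" for w b
  proof -
    have "x \<notin> block w b" using x that(2) by (auto simp: block_def)
    then show ?thesis using that(1) unfolding started_def by blast
  qed
  fix w b d assume w: "w \<in> vars" and started: "started (insert x U) w b" "started (insert x U) w d"
  show "b = d"
  proof (cases "w = v")
    case True
    then have "b = a" "d = a" using other[OF started(1)] other[OF started(2)] only by blast+
    then show ?thesis by simp
  next
    case False
    then show ?thesis using other[OF started(1)] other[OF started(2)] U w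
      by (auto simp: removing_blocks_def)
  qed
qed

lemma max_degree_while_removing:
  assumes val: "valid \<sigma>" and U: "removing_blocks \<sigma> U" "\<not> rejected \<sigma> \<subseteq> U"
    and u: "max_degree_outside G U u"
  obtains v b c i where "u = Copy v b c i" "Copy v b c i \<in> vertices - U" "K \<le> degree_outside G U u"
proof -
  obtain x where x: "x \<in> rejected \<sigma>" "x \<notin> U" using U(2) by blast
  then obtain v a c i where x_eq: "x = Copy v a c i" by (cases x) auto
  then have vert: "Copy v a c i \<in> vertices" and a: "a \<noteq> \<sigma> v" "v \<in> vars" "a \<in> domain v"
    using x(1) by auto
  have "remaining U v (\<sigma> v) + remaining U v a = (\<Sum>b\<in>{\<sigma> v, a}. remaining U v b)" using a(1) by simp
  also have "\<dots> \<le> (\<Sum>b\<in>domain v. remaining U v b)"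
    using a finite_dom val by (intro sum_mono2) (auto simp: valid_def)
  also have "\<dots> \<le> degree_outside G U x + remaining U v a"
    using degree_outside_Copy[OF vert, of U] x_eq by simp
  finally have "K \<le> degree_outside G U x"
    using remaining_untouched[OF removing_blocks_untouched[OF U(1)]] by simp
  also have "\<dots> \<le> degree_outside G U u" using max_degree_outsideD[OF u, of x] x_eq vert x(2) by simp
  finally have large: "K \<le> degree_outside G U u" .
  have u_vert: "u \<in> vertices - U" using u by (simp add: max_degree_outside_def)
  show thesis
  proof (cases u)
    case (Copy v b c i)
    then show ?thesis using that u_vert large by simp
  next
    case (Choice c)
    then show ?thesis using degree_outside_Choice[of c U] u_vert large by simp
  qed
qed

lemma block_unfinished:
  assumes u: "Copy v b c i \<in> vertices - U" "2 \<le> degree_outside G U (Copy v b c i)"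
  shows "\<exists>a\<in>domain v - {\<sigma> v}. \<not> block v a \<subseteq> U"
proof (rule ccontr)
  assume finished: "\<not> ?thesis"
  then have zero: "remaining U v a = 0" if "a \<in> domain v - {\<sigma> v}" for a
    using that by (auto simp: remaining_def Diff_eq_empty_iff[THEN iffD2])
  have "Copy v b c i \<in> block v b - U" using u(1) by auto
  moreover have v: "v \<in> vars" and b_dom: "b \<in> domain v" using u(1) by simp_all
  ultimately have b: "b = \<sigma> v" using finished by blast
  have "(\<Sum>a\<in>domain v. remaining U v a) = remaining U v b"
    using sum.remove[OF finite_dom[OF v] b_dom, of "remaining U v"] zero b by simp
  then show False using degree_outside_Copy[of v b c i U] u card_cross[of v b c i U] by simp
qed

lemma degree_outside_started_block:
  assumes "Copy v b c i \<in> vertices - U" "started U v a" "\<not> started U v b"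
    and y: "Copy v a d j \<in> vertices - U"
  shows "degree_outside G U (Copy v b c i) \<le> degree_outside G U (Copy v a d j)"
proof -
  have "block v b \<inter> U = {}"
    using assms(1,3) unfolding started_def by (metis DiffE mem_block(1) mem_vertices(1) subsetD)
  then have "remaining U v b = K" by (rule remaining_untouched)
  moreover have "remaining U v a < K"
    unfolding remaining_def card_block[of v a, symmetric]
    by (rule psubset_card_mono[OF finite_block]) (use assms(2) in \<open>auto simp: started_def\<close>)
  ultimately show ?thesis
    using degree_outside_Copy[of v b c i U] degree_outside_Copy[of v a d j U] card_cross[of v b c i U]
      assms(1) y by simp
qed

lemma degree_outside_fresh_block:
  assumes u: "Copy v b c i \<in> vertices - U" and untouched: "block v a \<inter> U = {}" "block v b \<inter> U = {}"
    and a: "a \<in> domain v" and d: "d \<in> choices" "contradicts d v a" "Choice d \<notin> U"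
  shows "degree_outside G U (Copy v b c i) \<le> degree_outside G U (Copy v a d 0)"
proof -
  have "Copy v a d 0 \<in> vertices" using u a d n_ge_2 by auto
  moreover have "cross v a d 0 - U = {Choice d}" using d by (auto simp: cross_def)
  ultimately show ?thesis
    using degree_outside_Copy[of v b c i U] degree_outside_Copy[of v a d 0 U] card_cross[of v b c i U]
      remaining_untouched[OF untouched(1)] remaining_untouched[OF untouched(2)] u by simp
qed

lemma removing_blocks_take_Copy:
  assumes "removing_blocks \<sigma> U" "max_degree_outside G U u"
    "degree_outside G U u \<le> degree_outside G U (Copy v a d j)"
    and "Copy v a d j \<in> vertices - U" "a \<noteq> \<sigma> v" "\<And>b. started U v b \<Longrightarrow> b = a"
  shows "\<exists>x\<in>rejected \<sigma> - U. max_degree_outside G U x \<and> removing_blocks \<sigma> (insert x U)"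
proof (intro bexI[of _ "Copy v a d j"] conjI)
  show "max_degree_outside G U (Copy v a d j)"
    using max_degree_outside_trans[OF assms(2)] assms(3,4) by simp
  show "removing_blocks \<sigma> (insert (Copy v a d j) U)"
    by (rule removing_blocks_insert[OF assms(1), of _ v a]) (use assms(4-6) in auto)
  show "Copy v a d j \<in> rejected \<sigma> - U" using assms(4,5) by simp
qed

lemma removing_blocks_step:
  assumes val: "valid \<sigma>" and U: "removing_blocks \<sigma> U" "\<not> rejected \<sigma> \<subseteq> U"
  shows "\<exists>x\<in>rejected \<sigma> - U. max_degree_outside G U x \<and> removing_blocks \<sigma> (insert x U)"
proof -
  have "rejected \<sigma> \<subseteq> vertices" using vertex_cover_assignment_cover[of \<sigma>]
    by (auto simp: vertex_cover_def assignment_cover_def)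
  then obtain u where max: "max_degree_outside G U u"
    using U(2) max_degree_outside_exists[OF simple_G, of _ U] by auto
  obtain v b c i where u: "u = Copy v b c i" "Copy v b c i \<in> vertices - U" "K \<le> degree_outside G U u"
    using max_degree_while_removing[OF val U max] .
  have v: "v \<in> vars" "b \<in> domain v" using u(2) by auto
  note take = removing_blocks_take_Copy[OF U(1) max, of v]
  show ?thesis
  proof (cases "\<exists>a. started U v a")
    case True
    then obtain a where a: "started U v a" by blast
    have only: "b = a" if "started U v b" for b using a that v U(1) by (simp add: removing_blocks_def)
    have a_dom: "a \<in> domain v" "a \<noteq> \<sigma> v"
      using a U(1) unfolding started_def removing_blocks_def rejected_def by (auto simp: block_def)
    obtain d j where y: "Copy v a d j \<in> vertices - U"
      using a a_dom v unfolding started_def block_def by auto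
    show ?thesis
    proof (cases "b = a")
      case True
      then show ?thesis using take[of b c i] u a_dom only by simp
    next
      case False
      then show ?thesis using take[OF _ y a_dom(2) only] degree_outside_started_block[OF u(2) a _ y]
        only u(1) by blast
    qed
  next
    case False
    obtain a where a: "a \<in> domain v" "a \<noteq> \<sigma> v" "\<not> block v a \<subseteq> U"
      using block_unfinished[OF u(2), of \<sigma>] u(1,3) K_ge_2 by auto
    obtain d where d: "d \<in> choices" "contradicts d v a" using always_contradicted[OF v(1)] by blast
    have untouched: "block v a \<inter> U = {}" "block v b \<inter> U = {}"
      using False a(3) u(2) unfolding started_def by (metis DiffE mem_block(1) mem_vertices(1) subsetD)+
    moreover have "Choice d \<notin> U" using U(1) by (auto simp: removing_blocks_def)
    ultimately have "degree_outside G U u \<le> degree_outside G U (Copy v a d 0)"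
      unfolding u(1) by (intro degree_outside_fresh_block[OF u(2)] a(1) d)
    moreover have "Copy v a d 0 \<in> block v a" "Copy v a d 0 \<in> vertices" using a d v n_ge_2 by auto
    ultimately show ?thesis using take[of a d 0] a False untouched(1) by blast
  qed
qed

lemma surviving_copy:
  assumes "rejected \<sigma> \<subseteq> U" "Copy v a c i \<in> vertices - U" shows "a = \<sigma> v"
  using assms subsetD[OF assms(1), of "Copy v a c i"] by auto

lemma agreeing_choice_not_max:
  assumes val: "valid \<sigma>" and U: "rejected \<sigma> \<subseteq> U" "U \<subseteq> assignment_cover \<sigma>"
    and c: "c \<in> choices" "agrees \<sigma> c"
    and max: "max_degree_outside G U (Choice c)" "0 < degree_outside G U (Choice c)"
  shows False
proof -
  let ?N = "\<lambda>x. neighbours G x - U"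
  have choices_only: "\<exists>d. y = Choice d \<and> d \<in> choices \<and> fst d = fst c \<and> d \<noteq> c"
    if "y \<in> ?N (Choice c)" for y
  proof (cases y)
    case (Copy v a d i)
    then show ?thesis using that c surviving_copy[OF U(1), of v a d i]
      agrees_contradicts[OF c(2), of v a]
      by (auto simp: neighbours_G)
  qed (use that c in \<open>auto simp: neighbours_G\<close>)
  obtain w where w: "w \<in> ?N (Choice c)" by (rule degree_outside_posE[OF max(2)])
  then obtain d where d: "w = Choice d" "d \<in> choices" "fst d = fst c" "d \<noteq> c"
    using choices_only by blast
  then obtain v where v: "v \<in> vars" "contradicts d v (\<sigma> v)"
    using agrees_unique[OF c(2) _ c(1), of d] not_agrees_contradicts[of \<sigma> d] by metis
  let ?z = "Copy v (\<sigma> v) d 0"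
  have "?z \<notin> U" using subsetD[OF U(2), of ?z] by auto
  then have z: "?z \<in> ?N w" using v d val n_ge_2 by (simp add: neighbours_G valid_def)
  have "?N (Choice c) - {w} \<subseteq> ?N w"
  proof
    fix y assume y: "y \<in> ?N (Choice c) - {w}"
    then obtain e where e: "y = Choice e" "e \<in> choices" "fst e = fst c" using choices_only by blast
    then have "e \<noteq> d" using y d(1) by simp
    with y d e show "y \<in> ?N w" by (simp add: neighbours_G not_sym[of e d])
  qed
  moreover have "Choice c \<notin> U" using max(1) by (simp add: max_degree_outside_def)
  then have "Choice c \<in> ?N w" using c d by (simp add: neighbours_G)
  ultimately have larger: "insert ?z (insert (Choice c) (?N (Choice c) - {w})) \<subseteq> ?N w" using z by blast
  have fin: "finite (?N x)" for x using finite_neighbours[OF simple_G] by simp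
  have "card (insert ?z (insert (Choice c) (?N (Choice c) - {w}))) = card (?N (Choice c)) + 1"
  proof -
    have "?z \<notin> ?N (Choice c)" "Choice c \<notin> ?N (Choice c)" using choices_only by blast+
    then show ?thesis using fin w card_Suc_Diff1[OF fin w] by simp
  qed
  then have "degree_outside G U (Choice c) < degree_outside G U w"
    using card_mono[OF fin larger] unfolding degree_outside_def by linarith
  then show False using max_degree_outsideD[OF max(1), of w] w d by simp
qed

lemma surviving_copy_neighbour:
  assumes U: "rejected \<sigma> \<subseteq> U" and u: "Copy v a c i \<in> vertices - U"
    and y: "y \<in> neighbours G (Copy v a c i) - U"
  shows "y = Choice c" "c \<in> choices" "\<not> agrees \<sigma> c"
proof -
  have a: "a = \<sigma> v" by (rule surviving_copy[OF U u])
  have adj: "y \<in> vertices - U" "csp_adj (Copy v a c i) y"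
    using y u neighbours_G[of "Copy v a c i"] by blast+
  have "y = Choice c \<and> contradicts c v a"
  proof (cases y)
    case (Copy w b d j)
    then have "b = \<sigma> w" using surviving_copy[OF U, of w b d j] adj(1) by blast
    then show ?thesis using adj(2) a Copy by (cases "v = w") simp_all
  qed (use adj(2) in simp)
  then show "y = Choice c" "c \<in> choices" "\<not> agrees \<sigma> c"
    using adj(1) a agrees_contradicts[of \<sigma> c v a] by auto
qed

lemma removing_choices_step:
  assumes val: "valid \<sigma>" and U: "rejected \<sigma> \<subseteq> U" "U \<subseteq> assignment_cover \<sigma>"
    and edge: "x \<in> vertices - U" "0 < degree_outside G U x"
  shows "\<exists>y\<in>assignment_cover \<sigma> - U. max_degree_outside G U y"
proof -
  obtain u where u: "max_degree_outside G U u"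
    using max_degree_outside_exists[OF simple_G, of x U] edge by auto
  have u_vert: "u \<in> vertices - U" using u by (simp add: max_degree_outside_def)
  have pos: "0 < degree_outside G U u" using max_degree_outsideD[OF u, of x] edge by auto
  show ?thesis
  proof (cases u)
    case (Choice c)
    then have "u \<in> assignment_cover \<sigma> - U"
      using agreeing_choice_not_max[OF val U, of c] u pos u_vert by auto
    then show ?thesis using u by blast
  next
    case (Copy v a c i)
    note only = surviving_copy_neighbour[OF U(1) u_vert[unfolded Copy], folded Copy]
    obtain w where w: "w \<in> neighbours G u - U" by (rule degree_outside_posE[OF pos])
    then have w_cover: "w \<in> assignment_cover \<sigma> - U" "w \<in> vertices - U" using only[OF w] by simp_all
    have "neighbours G u - U \<subseteq> {w}" using only(1) w by blast
    then have "degree_outside G U u \<le> card {w}" unfolding degree_outside_def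
      by (intro card_mono) simp_all
    also have "\<dots> \<le> degree_outside G U w"
      using degree_outside_pos[OF simple_G, of u w U] w u_vert neighbours_sym[of w G u] by simp
    finally show ?thesis using max_degree_outside_trans[OF u] w_cover by auto
  qed
qed

lemma min_mdg_le_assignment:
  assumes val: "valid \<sigma>" shows "min_mdg G + card (agreeing \<sigma>) \<le> rejected_size + card choices"
proof -
  let ?C = "assignment_cover \<sigma>" and ?inv = "\<lambda>U. removing_blocks \<sigma> U \<or> rejected \<sigma> \<subseteq> U"
  have "\<exists>vs. greedy_run G {} vs \<and> set vs \<subseteq> ?C - {}"
  proof (rule greedy_run_within_cover[OF simple_G vertex_cover_assignment_cover, where I = ?inv])
    show "?inv {}" by (simp add: removing_blocks_def started_def)
    fix U assume U: "?inv U" "U \<subseteq> ?C" and edge: "\<exists>u\<in>verts G - U. 0 < degree_outside G U u"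
    show "\<exists>v\<in>?C - U. max_degree_outside G U v \<and> ?inv (insert v U)"
    proof (cases "rejected \<sigma> \<subseteq> U")
      case True
      then obtain v where "v \<in> ?C - U" "max_degree_outside G U v"
        using removing_choices_step[OF val True U(2)] edge by auto
      then show ?thesis using True by blast
    next
      case False
      then show ?thesis using removing_blocks_step[OF val _ False] U(1)
        by (auto simp: assignment_cover_def)
    qed
  qed simp
  then obtain vs where vs: "greedy_run G {} vs" "set vs \<subseteq> ?C" by auto
  have "min_mdg G \<le> card (set vs)"
    using min_mdg_le[OF simple_G vs(1)] greedy_run_distinct[OF vs(1)] by (simp add: distinct_card)
  also have "\<dots> \<le> card ?C"
    using finite_vertex_cover[OF simple_G vertex_cover_assignment_cover] vs(2) by (rule card_mono)
  finally show ?thesis using card_assignment_cover[OF val] by simp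
qed

subsection \<open>Optimal assignments\<close>

definition optimal :: "('v \<Rightarrow> 'a) \<Rightarrow> bool" where
  "optimal \<sigma> \<longleftrightarrow> valid \<sigma> \<and> (\<forall>\<tau>. valid \<tau> \<longrightarrow> card (agreeing \<tau>) \<le> card (agreeing \<sigma>))"

lemma card_choices_le:
  assumes "agreeing \<tau> - C \<subseteq> D" "finite D"
  shows "card choices \<le> card {c \<in> choices. \<not> agrees \<tau> c \<or> c \<in> C} + card D"
proof -
  have "choices \<subseteq> {c \<in> choices. \<not> agrees \<tau> c \<or> c \<in> C} \<union> D" using assms(1)
    unfolding agreeing_def by blast
  then have "card choices \<le> card ({c \<in> choices. \<not> agrees \<tau> c \<or> c \<in> C} \<union> D)"
    using finite_choices assms(2) by (intro card_mono) simp_all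
  also have "\<dots> \<le> card {c \<in> choices. \<not> agrees \<tau> c \<or> c \<in> C} + card D" by (rule card_Un_le)
  finally show ?thesis .
qed

lemma mvc_optimal:
  assumes "optimal \<sigma>" shows "mvc G + card (agreeing \<sigma>) = rejected_size + card choices"
    "min_mdg G = mvc G"
proof -
  obtain X where X: "vertex_cover G X" "card X = mvc G" by (rule mvc_obtain[OF simple_G])
  obtain \<tau> where \<tau>: "valid \<tau>" "rejected_size + card {c \<in> choices. \<not> agrees \<tau> c \<or> Choice c \<in> X} \<le> card X"
    by (rule vertex_cover_card_ge[OF X(1)])
  have "card {c \<in> choices. \<not> agrees \<tau> c \<or> c \<in> {}} \<le> card {c \<in> choices. \<not> agrees \<tau> c \<or> Choice c \<in> X}"
    using finite_choices by (intro card_mono) auto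
  then have "rejected_size + card choices \<le> mvc G + card (agreeing \<tau>)"
    using card_choices_le[of \<tau> "{}" "agreeing \<tau>"] finite_agreeing \<tau>(2) X(2) by simp
  also have "\<dots> \<le> mvc G + card (agreeing \<sigma>)" using assms \<tau>(1) by (simp add: optimal_def)
  finally have "rejected_size + card choices \<le> mvc G + card (agreeing \<sigma>)" .
  moreover have "min_mdg G + card (agreeing \<sigma>) \<le> rejected_size + card choices"
    using assms min_mdg_le_assignment by (simp add: optimal_def)
  ultimately show "mvc G + card (agreeing \<sigma>) = rejected_size + card choices" "min_mdg G = mvc G"
    using mvc_le_min_mdg[OF simple_G] by linarith+
qed

definition dispensable :: "('i, 'v, 'a) choice \<Rightarrow> bool" where
  "dispensable \<beta> \<longleftrightarrow> (\<exists>\<sigma> \<tau>. optimal \<sigma> \<and> valid \<tau> \<and> card (agreeing \<sigma>) \<le> card (agreeing \<tau> - {\<beta>}))"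

lemma minimum_cover_through_choice:
  assumes opt: "optimal \<sigma>" and \<beta>: "\<beta> \<in> choices" and \<tau>: "valid \<tau>"
    "card (agreeing \<sigma>) \<le> card (agreeing \<tau> - {\<beta>})"
  shows "\<exists>C. vertex_cover G C \<and> Choice \<beta> \<in> C \<and> card C \<le> mvc G"
proof (intro exI[of _ "insert (Choice \<beta>) (assignment_cover \<tau>)"] conjI)
  let ?C = "insert (Choice \<beta>) (assignment_cover \<tau>)"
  show "vertex_cover G ?C"
    using vertex_cover_assignment_cover[of \<tau>] \<beta> by (auto simp: vertex_cover_def)
  note sizes = card_assignment_cover[OF \<tau>(1)] mvc_optimal(1)[OF opt]
  show "card ?C \<le> mvc G"
  proof (cases "\<beta> \<in> agreeing \<tau>")
    case True
    have "card ?C \<le> card (assignment_cover \<tau>) + 1" by (simp add: card_insert_le_m1)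
    moreover have "card (agreeing \<tau> - {\<beta>}) + 1 = card (agreeing \<tau>)"
      using card_Suc_Diff1[OF finite_agreeing True] by simp
    ultimately show ?thesis using \<tau>(2) sizes by linarith
  next
    case False
    then have "Choice \<beta> \<in> assignment_cover \<tau>" using \<beta> by (simp add: agreeing_def)
    then have "card ?C = card (assignment_cover \<tau>)" by (simp add: insert_absorb)
    then show ?thesis using False \<tau>(2) sizes by simp
  qed
qed simp

lemma cover_through_choice_card_ge:
  assumes opt: "optimal \<sigma>" and C: "vertex_cover G C" "Choice \<beta> \<in> C" and \<beta>: "\<not> dispensable \<beta>"
  shows "mvc G < card C"
proof -
  obtain \<tau> where \<tau>: "valid \<tau>" "rejected_size + card {c \<in> choices. \<not> agrees \<tau> c \<or> Choice c \<in> C} \<le> card C"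
    by (rule vertex_cover_card_ge[OF C(1)])
  have "card {c \<in> choices. \<not> agrees \<tau> c \<or> c \<in> {\<beta>}} \<le> card {c \<in> choices. \<not> agrees \<tau> c \<or> Choice c \<in> C}"
    using finite_choices C(2) by (intro card_mono) auto
  then have "rejected_size + card choices \<le> card C + card (agreeing \<tau> - {\<beta>})"
    using card_choices_le[of \<tau> "{\<beta>}" "agreeing \<tau> - {\<beta>}"] finite_agreeing \<tau>(2) by simp
  moreover have "card (agreeing \<tau> - {\<beta>}) < card (agreeing \<sigma>)"
    using opt \<beta> \<tau>(1) unfolding dispensable_def by (metis not_less)
  ultimately show ?thesis using mvc_optimal(1)[OF opt] by linarith
qed

lemma mvc_hub_choice:
  assumes opt: "optimal \<sigma>" and \<beta>: "\<beta> \<in> choices"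
  shows "mvc (hub_graph vertices csp_adj {Choice \<beta>} D) = D + mvc G + (if dispensable \<beta> then 0 else 1)"
proof (rule antisym)
  interpret hub: hub_gadget vertices "{Choice \<beta>}" csp_adj D
    by unfold_locales (use finite_vertices symp_csp_adj \<beta> in auto)
  have indep: "card (agreeing \<sigma>') = card (agreeing \<sigma>)" if "optimal \<sigma>'" for \<sigma>'
    using that opt by (auto simp: optimal_def intro: antisym)
  show "mvc (hub_graph vertices csp_adj {Choice \<beta>} D) \<le> D + mvc G + (if dispensable \<beta> then 0 else 1)"
  proof (cases "dispensable \<beta>")
    case True
    then obtain C where "vertex_cover G C" "Choice \<beta> \<in> C" "card C \<le> mvc G"
      using minimum_cover_through_choice[OF opt \<beta>] indep unfolding dispensable_def by metis
    then show ?thesis using hub.mvc_hub_graph_le[of C] True by simp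
  next
    case False
    obtain C where C: "vertex_cover G C" "card C = mvc G" by (rule mvc_obtain[OF simple_G])
    have "card ({Choice \<beta>} - C) \<le> 1" using card_mono[of "{Choice \<beta>}" "{Choice \<beta>} - C"] by auto
    then show ?thesis using hub.mvc_hub_graph_le[OF C(1)] C(2) False by simp
  qed
  obtain X where X: "vertex_cover (hub_graph vertices csp_adj {Choice \<beta>} D) X"
    "card X = mvc (hub_graph vertices csp_adj {Choice \<beta>} D)"
    by (rule mvc_obtain[OF hub.simple_hub_graph])
  note base = hub.hub_cover_base[OF X(1)] and size = hub.hub_cover_card[OF X(1)]
  show "D + mvc G + (if dispensable \<beta> then 0 else 1) \<le> mvc (hub_graph vertices csp_adj {Choice \<beta>} D)"
  proof (cases "Base (Choice \<beta>) \<in> X")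
    case True
    then show ?thesis using cover_through_choice_card_ge[OF opt base, of \<beta>] mvc_le[OF base] size X(2)
      by auto
  next
    case False
    then have "{v \<in> {Choice \<beta>}. Hub v \<in> X} = {Choice \<beta>}" using hub.hub_cover_hub[OF X(1)] by auto
    then show ?thesis using size mvc_le[OF base] X(2) by simp
  qed
qed

end

section \<open>Hard constraints and claims\<close>

text \<open>Every hard constraint is present in \<open>Suc N\<close> copies, which outweigh all \<open>N\<close> claims. A dummy choice
  is contradicted by every value of its variable, which keeps the degrees of the copies for this
  variable high enough for the greedy heuristic.\<close>

datatype ('h, 'v) constraint_id = Hard 'h nat | Claim nat | Dummy 'v

primrec assignments :: "('v \<Rightarrow> 'a list) \<Rightarrow> 'v list \<Rightarrow> ('v \<times> 'a) list list" where
  "assignments domain [] = [[]]"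
| "assignments domain (v # vs) =
    concat (map (\<lambda>a. map (\<lambda>l. (v, a) # l) (assignments domain vs)) (domain v))"

lemma set_assignments:
  "l \<in> set (assignments domain vs) \<longleftrightarrow> map fst l = vs \<and> (\<forall>(v, a)\<in>set l. a \<in> set (domain v))"
proof (induction vs arbitrary: l)
  case (Cons v vs)
  show ?case by (cases l) (auto simp: Cons.IH image_iff)
qed auto

definition hard_choices ::
  "('v \<Rightarrow> 'a list) \<Rightarrow> ('h \<Rightarrow> 'v list) \<Rightarrow> ('h \<Rightarrow> 'a list \<Rightarrow> bool) \<Rightarrow> nat \<Rightarrow> 'h \<Rightarrow>
      (('h, 'v) constraint_id, 'v, 'a) choice list" where
  "hard_choices domain scope holds N h = concat (map (\<lambda>i. map (\<lambda>l. (Hard h i, l))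
     (filter (\<lambda>l. holds h (map snd l)) (assignments domain (scope h)))) [0..<Suc N])"

definition claim_choice :: "(nat \<Rightarrow> 'v) \<Rightarrow> 'a \<Rightarrow> nat \<Rightarrow> (('h, 'v) constraint_id, 'v, 'a) choice" where
  "claim_choice claim_var yes j = (Claim j, [(claim_var j, yes)])"

definition dummy_choice :: "'a \<Rightarrow> 'a \<Rightarrow> 'v \<Rightarrow> (('h, 'v) constraint_id, 'v, 'a) choice" where
  "dummy_choice yes no v = (Dummy v, [(v, yes), (v, no)])"

definition weighted_choices ::
  "'v list \<Rightarrow> ('v \<Rightarrow> 'a list) \<Rightarrow> 'h list \<Rightarrow> ('h \<Rightarrow> 'v list) \<Rightarrow> ('h \<Rightarrow> 'a list \<Rightarrow> bool) \<Rightarrow> (nat \<Rightarrow> 'v) \<Rightarrow>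
    'a \<Rightarrow> 'a \<Rightarrow> nat \<Rightarrow> (('h, 'v) constraint_id, 'v, 'a) choice list" where
  "weighted_choices vars domain hards scope holds claim_var yes no N =
     concat (map (hard_choices domain scope holds N) hards) @ map (claim_choice claim_var yes) [0..<N] @
     map (dummy_choice yes no) vars"

definition copy_number :: "'v list \<Rightarrow> ('v \<Rightarrow> 'a list) \<Rightarrow> nat" where
  "copy_number vars domain = Suc (sum_list (map (\<lambda>v. length (domain v)) vars))"

locale weighted_csp =
  fixes vars :: "'v list" and domain :: "'v \<Rightarrow> 'a list" and hards :: "'h list"
    and scope :: "'h \<Rightarrow> 'v list" and holds :: "'h \<Rightarrow> 'a list \<Rightarrow> bool"
    and claim_var :: "nat \<Rightarrow> 'v" and yes no :: 'a and N :: nat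
  assumes vars_nonempty: "vars \<noteq> []" and domain_nonempty: "v \<in> set vars \<Longrightarrow> domain v \<noteq> []"
    and scope_subset_vars: "h \<in> set hards \<Longrightarrow> set (scope h) \<subseteq> set vars"
    and claim_var_in_vars: "j < N \<Longrightarrow> claim_var j \<in> set vars"
    and yes_neq_no: "yes \<noteq> no" and N_pos: "0 < N"
begin

abbreviation claim :: "nat \<Rightarrow> (('h, 'v) constraint_id, 'v, 'a) choice" where
  "claim \<equiv> claim_choice claim_var yes"

abbreviation dummy :: "'v \<Rightarrow> (('h, 'v) constraint_id, 'v, 'a) choice" where
  "dummy \<equiv> dummy_choice yes no"

abbreviation "choices \<equiv> weighted_choices vars domain hards scope holds claim_var yes no N"
abbreviation "copies \<equiv> copy_number vars domain"

lemma choices_cases: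
  assumes "c \<in> set choices"
  obtains (Hard) h i l where "c = (Hard h i, l)" "h \<in> set hards" "i \<le> N" "map fst l = scope h"
      "\<forall>(v, a)\<in>set l. a \<in> set (domain v)" "holds h (map snd l)"
    | (Claim) j where "c = claim j" "j < N"
    | (Dummy) v where "c = dummy v" "v \<in> set vars"
  using assms unfolding weighted_choices_def hard_choices_def
  by (auto simp: set_assignments less_Suc_eq_le simp del: upt_Suc)

lemma hard_mem_choices:
  "h \<in> set hards \<Longrightarrow> i \<le> N \<Longrightarrow> map fst l = scope h \<Longrightarrow> \<forall>(v, a)\<in>set l. a \<in> set (domain v) \<Longrightarrow>
   holds h (map snd l) \<Longrightarrow> (Hard h i, l) \<in> set choices"
  unfolding weighted_choices_def hard_choices_def
  by (auto simp: set_assignments image_iff simp del: upt_Suc)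

lemma claim_mem_choices: "j < N \<Longrightarrow> claim j \<in> set choices"
  by (simp add: weighted_choices_def)

lemma dummy_mem_choices: "v \<in> set vars \<Longrightarrow> dummy v \<in> set choices"
  by (simp add: weighted_choices_def)

lemma scope_of_choice:
  assumes "c \<in> set choices"
  shows "map fst (snd c) = (case fst c of Hard h i \<Rightarrow> scope h |
      Claim j \<Rightarrow> [claim_var j] | Dummy v \<Rightarrow> [v, v])"
    and "fst ` set (snd c) \<subseteq> set vars"
proof -
  show scope: "map fst (snd c) =
      (case fst c of Hard h i \<Rightarrow> scope h | Claim j \<Rightarrow> [claim_var j] | Dummy v \<Rightarrow> [v, v])"
    using assms by (cases rule: choices_cases) (auto simp: claim_choice_def dummy_choice_def)
  have "set (map fst (snd c)) \<subseteq> set vars" unfolding scope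
    using assms by (cases rule: choices_cases)
      (use scope_subset_vars claim_var_in_vars in \<open>auto simp: claim_choice_def dummy_choice_def\<close>)
  then show "fst ` set (snd c) \<subseteq> set vars" by simp
qed

lemma sum_card_domain_le:
  "(\<Sum>v\<in>set vs. card (set (domain v))) \<le> sum_list (map (\<lambda>v. length (domain v)) vs)"
proof (induction vs)
  case (Cons v vs)
  then show ?case using card_length[of "domain v"] by (cases "v \<in> set vs") (auto simp: insert_absorb)
qed simp

sublocale csp "set vars" "\<lambda>v. set (domain v)" "set choices" copies
proof
  show "set vars \<noteq> {}" using vars_nonempty by simp
  show "set choices \<noteq> {}" using claim_mem_choices[OF N_pos] by auto
  fix v assume v: "v \<in> set vars"
  then show "set (domain v) \<noteq> {}" using domain_nonempty by simp
  have "contradicts (dummy v) v a" for a using yes_neq_no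
    by (auto simp: contradicts_def dummy_choice_def)
  then show "\<exists>c\<in>set choices. \<forall>a. contradicts c v a" using dummy_mem_choices[OF v] by blast
next
  fix c d assume "c \<in> set choices" "d \<in> set choices" "fst c = fst d"
  then show "map fst (snd c) = map fst (snd d)"
    using scope_of_choice(1)[of c] scope_of_choice(1)[of d] by simp
next
  fix c assume "c \<in> set choices"
  then show "fst ` set (snd c) \<subseteq> set vars" by (rule scope_of_choice(2))
next
  show "(\<Sum>v\<in>set vars. card (set (domain v))) < copies"
    unfolding copy_number_def by (rule le_imp_less_Suc[OF sum_card_domain_le])
qed auto

definition satisfied :: "('v \<Rightarrow> 'a) \<Rightarrow> 'h set" where
  "satisfied \<sigma> = {h \<in> set hards. holds h (map \<sigma> (scope h))}"

definition feasible :: "('v \<Rightarrow> 'a) \<Rightarrow> bool" where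
  "feasible \<sigma> \<longleftrightarrow> valid \<sigma> \<and> satisfied \<sigma> = set hards"

definition claimed :: "('v \<Rightarrow> 'a) \<Rightarrow> nat set" where
  "claimed \<sigma> = {j. j < N \<and> \<sigma> (claim_var j) = yes}"

definition hard_choice :: "('v \<Rightarrow> 'a) \<Rightarrow> 'h \<Rightarrow> nat \<Rightarrow> (('h, 'v) constraint_id, 'v, 'a) choice" where
  "hard_choice \<sigma> h i = (Hard h i, map (\<lambda>v. (v, \<sigma> v)) (scope h))"

lemma finite_satisfied: "finite (satisfied \<sigma>)"
  by (simp add: satisfied_def)

lemma finite_claimed: "finite (claimed \<sigma>)"
  by (simp add: claimed_def)

lemma agreeing_eq:
  assumes "valid \<sigma>"
  shows "agreeing \<sigma> = case_prod (hard_choice \<sigma>) ` (satisfied \<sigma> \<times> {..N}) \<union> claim ` claimed \<sigma>"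
proof (intro equalityI subsetI)
  fix c assume "c \<in> agreeing \<sigma>"
  then have c: "c \<in> set choices" "agrees \<sigma> c" by (simp_all add: agreeing_def)
  from c(1) show "c \<in> case_prod (hard_choice \<sigma>) ` (satisfied \<sigma> \<times> {..N}) \<union> claim ` claimed \<sigma>"
  proof (cases rule: choices_cases)
    case (Hard h i l)
    have l: "l = map (\<lambda>v. (v, \<sigma> v)) (map fst l)"
      unfolding map_map by (rule map_idI[symmetric]) (use c(2) Hard(1) in \<open>auto simp: agrees_def\<close>)
    then have "c = hard_choice \<sigma> h i" using Hard(1,4) by (simp add: hard_choice_def)
    moreover have "map snd l = map \<sigma> (scope h)" using arg_cong[OF l, of "map snd"] Hard(4)
      by (simp add: comp_def)
    then have "h \<in> satisfied \<sigma>" using Hard by (simp add: satisfied_def)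
    ultimately show ?thesis using Hard(3) by blast
  next
    case (Claim j)
    then have "j \<in> claimed \<sigma>" using c(2) by (simp add: claimed_def agrees_def claim_choice_def)
    then show ?thesis using Claim(1) by blast
  next
    case (Dummy v)
    then show ?thesis using c(2) yes_neq_no by (auto simp: agrees_def dummy_choice_def)
  qed
next
  fix c assume "c \<in> case_prod (hard_choice \<sigma>) ` (satisfied \<sigma> \<times> {..N}) \<union> claim ` claimed \<sigma>"
  then consider h i where "c = hard_choice \<sigma> h i" "h \<in> satisfied \<sigma>" "i \<le> N"
    | j where "c = claim j" "j \<in> claimed \<sigma>"
    by auto
  then show "c \<in> agreeing \<sigma>"
  proof cases
    case (1 h i)
    then have h: "h \<in> set hards" "holds h (map \<sigma> (scope h))" by (simp_all add: satisfied_def)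
    then have "\<forall>v\<in>set (scope h). \<sigma> v \<in> set (domain v)"
      using scope_subset_vars[OF h(1)] assms by (auto simp: valid_def)
    then have "c \<in> set choices"
      unfolding 1(1) hard_choice_def using h 1(3) by (intro hard_mem_choices) (auto simp: comp_def)
    then show ?thesis by (auto simp: agreeing_def agrees_def 1(1) hard_choice_def)
  next
    case (2 j)
    then show ?thesis by (auto simp: agreeing_def agrees_def claim_choice_def claimed_def
        claim_mem_choices[unfolded claim_choice_def])
  qed
qed

lemma card_agreeing_Diff:
  assumes "valid \<sigma>"
  shows "card (agreeing \<sigma> - claim ` J) = card (satisfied \<sigma>) * Suc N + card (claimed \<sigma> - J)"
proof -
  let ?hard = "case_prod (hard_choice \<sigma>) ` (satisfied \<sigma> \<times> {..N})"
  have inj: "inj claim" by (auto simp: inj_def claim_choice_def)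
  have "agreeing \<sigma> - claim ` J = ?hard \<union> claim ` (claimed \<sigma> - J)"
    unfolding agreeing_eq[OF assms] image_set_diff[OF inj]
    by (auto simp: hard_choice_def claim_choice_def)
  also have "card \<dots> = card ?hard + card (claim ` (claimed \<sigma> - J))"
    using finite_satisfied finite_claimed
    by (intro card_Un_disjoint) (auto simp: hard_choice_def claim_choice_def)
  also have "card (claim ` (claimed \<sigma> - J)) = card (claimed \<sigma> - J)"
    by (rule card_image[OF inj_on_subset[OF inj subset_UNIV]])
  also have "card ?hard = card (satisfied \<sigma> \<times> {..N})"
    by (rule card_image) (auto simp: inj_on_def hard_choice_def)
  finally show ?thesis by (simp add: card_cartesian_product)
qed

lemma card_agreeing: "valid \<sigma> \<Longrightarrow> card (agreeing \<sigma>) = card (satisfied \<sigma>) * Suc N + card (claimed \<sigma>)"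
  using card_agreeing_Diff[of \<sigma> "{}"] by simp

lemma infeasible_card_less:
  assumes "\<not> feasible \<sigma>" "valid \<sigma>" shows "card (agreeing \<sigma>) < card (set hards) * Suc N"
proof -
  have "satisfied \<sigma> \<subset> set hards" using assms by (auto simp: feasible_def satisfied_def)
  then have "Suc (card (satisfied \<sigma>)) \<le> card (set hards)" by (simp add: Suc_leI psubset_card_mono)
  then have "Suc (card (satisfied \<sigma>)) * Suc N \<le> card (set hards) * Suc N" by (rule mult_le_mono1)
  moreover have "card (claimed \<sigma>) \<le> card {..<N}" by (rule card_mono) (auto simp: claimed_def)
  ultimately show ?thesis using card_agreeing[OF assms(2)] by simp
qed

lemma feasible_card_agreeing_Diff:
  "feasible \<sigma> \<Longrightarrow> card (agreeing \<sigma> - claim ` J) = card (set hards) * Suc N + card (claimed \<sigma> - J)"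
  using card_agreeing_Diff by (simp add: feasible_def)

lemma optimal_exists:
  assumes "feasible \<rho>" obtains \<sigma> where "feasible \<sigma>" "optimal \<sigma>"
proof -
  have "card (claimed \<sigma>) \<le> N" for \<sigma> using card_mono[of "{..<N}" "claimed \<sigma>"] by (auto simp: claimed_def)
  then have "\<forall>\<sigma>. feasible \<sigma> \<longrightarrow> card (claimed \<sigma>) < Suc N" by (simp add: le_imp_less_Suc)
  from ex_has_greatest_nat[OF assms this] obtain \<sigma> where
    \<sigma>: "feasible \<sigma>" "\<And>\<tau>. feasible \<tau> \<Longrightarrow> card (claimed \<tau>) \<le> card (claimed \<sigma>)" by blast
  have size: "card (agreeing \<tau>) = card (set hards) * Suc N + card (claimed \<tau>)" if "feasible \<tau>" for \<tau>
    using feasible_card_agreeing_Diff[OF that, of "{}"] by simp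
  have "card (agreeing \<tau>) \<le> card (agreeing \<sigma>)" if "valid \<tau>" for \<tau>
    using size[OF \<sigma>(1)] size[of \<tau>] \<sigma>(2)[of \<tau>] infeasible_card_less[OF _ that]
    by (cases "feasible \<tau>") simp_all
  then show thesis using that[OF \<sigma>(1)] \<sigma>(1) by (simp add: optimal_def feasible_def)
qed

lemma optimal_imp_feasible:
  assumes "feasible \<rho>" "optimal \<sigma>" shows "feasible \<sigma>"
proof (rule ccontr)
  assume "\<not> feasible \<sigma>"
  then have "card (agreeing \<sigma>) < card (set hards) * Suc N"
    using infeasible_card_less assms(2) by (simp add: optimal_def)
  also have "\<dots> \<le> card (agreeing \<rho>)" using feasible_card_agreeing_Diff[OF assms(1), of "{}"] by simp
  finally show False using assms by (simp add: optimal_def feasible_def not_less[symmetric])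
qed

lemma dispensable_claim_iff:
  assumes "feasible \<rho>"
  shows "dispensable (claim 0) \<longleftrightarrow>
      \<not> (\<exists>\<sigma>. feasible \<sigma> \<and> (\<forall>\<tau>. feasible \<tau> \<longrightarrow> card (claimed \<tau> - {0}) < card (claimed \<sigma>)))"
    (is "_ \<longleftrightarrow> \<not> ?indispensable")
proof
  assume "dispensable (claim 0)"
  then obtain \<sigma> \<tau> where \<sigma>: "optimal \<sigma>" and \<tau>: "valid \<tau>"
    "card (agreeing \<sigma>) \<le> card (agreeing \<tau> - {claim 0})"
    by (auto simp: dispensable_def)
  have feas: "feasible \<sigma>" by (rule optimal_imp_feasible[OF assms \<sigma>])
  note size = feasible_card_agreeing_Diff[of _ "{}", simplified]
    feasible_card_agreeing_Diff[of _ "{0}", simplified]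
  have "card (agreeing \<tau> - {claim 0}) \<le> card (agreeing \<tau>)" by (intro card_mono finite_agreeing) auto
  then have "feasible \<tau>" using infeasible_card_less[OF _ \<tau>(1)] \<tau>(2) size(1)[OF feas]
    by (cases "feasible \<tau>") simp_all
  then have "card (claimed \<sigma>) \<le> card (claimed \<tau> - {0})"
    using \<tau>(2) size(1)[OF feas] size(2)[of \<tau>] by simp
  moreover have "card (claimed \<sigma>') \<le> card (claimed \<sigma>)" if "feasible \<sigma>'" for \<sigma>'
    using \<sigma> size(1)[OF feas] size(1)[OF that] that by (auto simp: optimal_def feasible_def)
  ultimately show "\<not> ?indispensable" using \<open>feasible \<tau>\<close> by (meson le_less_trans less_le_not_le)
next
  assume no: "\<not> ?indispensable"
  obtain \<sigma> where \<sigma>: "feasible \<sigma>" "optimal \<sigma>" by (rule optimal_exists[OF assms])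
  then obtain \<tau> where \<tau>: "feasible \<tau>" "card (claimed \<sigma>) \<le> card (claimed \<tau> - {0})"
    using no by (auto simp: not_less)
  then have "card (agreeing \<sigma>) \<le> card (agreeing \<tau> - {claim 0})"
    using feasible_card_agreeing_Diff[OF \<sigma>(1), of "{}"] feasible_card_agreeing_Diff[OF \<tau>(1), of "{0}"]
    by simp
  then show "dispensable (claim 0)" using \<sigma>(2) \<tau>(1) unfolding dispensable_def
    by (auto simp: feasible_def)
qed

end

section \<open>Computations as constraint satisfaction problems\<close>

text \<open>\<open>Control t\<close> holds the state, the scanned symbols and the head positions at time \<open>t\<close>, and
  \<open>Cell t pos\<close> the symbols of all tapes in cell \<open>pos - T\<close> at time \<open>t\<close>. \<open>Output j\<close> claims that the
  \<open>j\<close>-th output bit is 1.\<close>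

datatype tableau_var = Control nat | Cell nat nat | Output nat

datatype tableau_law = Transition nat nat | Readout nat

text \<open>A value consists of a state or bit, a list of symbols and a list of head positions, which are
  shifted by \<open>T\<close>.\<close>

type_synonym tableau_value = "nat \<times> nat list \<times> nat list"

abbreviation state :: "tableau_value \<Rightarrow> nat" where "state d \<equiv> fst d"
abbreviation symbols :: "tableau_value \<Rightarrow> nat list" where "symbols d \<equiv> fst (snd d)"
abbreviation heads :: "tableau_value \<Rightarrow> nat list" where "heads d \<equiv> snd (snd d)"
abbreviation entry :: "nat list \<Rightarrow> nat \<Rightarrow> nat" where "entry \<equiv> nth_default 0"

definition Bit :: "bool \<Rightarrow> tableau_value" where "Bit b = (of_bool b, [], [])"

lemma Bit_inject [simp]: "Bit a = Bit b \<longleftrightarrow> a = b"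
  by (simp add: Bit_def)

definition tableau_vars :: "nat \<Rightarrow> tableau_var list" where
  "tableau_vars T = map Control [0..<Suc T] @
      concat (map (\<lambda>t. map (Cell t) [0..<2 * T + 1]) [0..<Suc T]) @
     map Output [0..<Suc T]"

definition tableau_laws :: "nat \<Rightarrow> tableau_law list" where
  "tableau_laws T = concat (map (\<lambda>t. map (Transition t) [0..<2 * T + 1]) [0..<T]) @
      map Readout [0..<Suc T]"

fun tableau_scope :: "nat \<Rightarrow> tableau_law \<Rightarrow> tableau_var list" where
  "tableau_scope T (Transition t pos) = [Control t, Control (Suc t), Cell t pos, Cell (Suc t) pos]"
| "tableau_scope T (Readout j) = [Cell T (T + j), Output j]"

definition transition_ok ::
  "tm \<Rightarrow> nat \<Rightarrow> tableau_value \<Rightarrow> tableau_value \<Rightarrow> tableau_value \<Rightarrow> tableau_value \<Rightarrow> bool" where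
  "transition_ok M pos d d' c c' \<longleftrightarrow> state d' = fst (shifted_trans M (state d, symbols d)) \<and>
     (\<forall>i<tm_tapes M.
        entry (heads d') i + 1 =
          entry (heads d) i + snd (nth_default (0, 0) (snd (shifted_trans M (state d, symbols d))) i) \<and>
        (if entry (heads d) i = pos
         then entry (symbols c) i = entry (symbols d) i \<and>
           entry (symbols c') i = fst (nth_default (0, 0)
               (snd (shifted_trans M (state d, symbols d))) i)
         else entry (symbols c') i = entry (symbols c) i))"

definition readout_ok :: "tm \<Rightarrow> tableau_value \<Rightarrow> tableau_value \<Rightarrow> bool" where
  "readout_ok M c b \<longleftrightarrow> b = Bit False \<or> entry (symbols c) (tm_tapes M - 1) = 2"

abbreviation value_at :: "tableau_value list \<Rightarrow> nat \<Rightarrow> tableau_value" where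
  "value_at \<equiv> nth_default (0, [], [])"

fun tableau_holds :: "tm \<Rightarrow> tableau_law \<Rightarrow> tableau_value list \<Rightarrow> bool" where
  "tableau_holds M (Transition t pos) vs \<longleftrightarrow>
     transition_ok M pos (value_at vs 0) (value_at vs 1) (value_at vs 2) (value_at vs 3)"
| "tableau_holds M (Readout j) vs \<longleftrightarrow> readout_ok M (value_at vs 0) (value_at vs 1)"

definition control_values :: "tm \<Rightarrow> nat \<Rightarrow> nat \<Rightarrow> tableau_value list" where
  "control_values M T t =
     (if t = 0 then map (\<lambda>ss. (0, ss, replicate (tm_tapes M) T))
         (List.n_lists (tm_tapes M) [0..<tm_symbols M])
      else concat (map (\<lambda>q. concat
          (map (\<lambda>ss. map (\<lambda>hs. (q, ss, hs)) (List.n_lists (tm_tapes M) [0..<2 * T + 1]))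
        (List.n_lists (tm_tapes M) [0..<tm_symbols M]))) [0..<Suc (tm_states M)]))"

text \<open>The tape holds \<open>x\<close> followed by \<open>m\<close> unknown bits.\<close>

definition initial_symbols :: "word \<Rightarrow> nat \<Rightarrow> nat \<Rightarrow> nat \<Rightarrow> nat list" where
  "initial_symbols x m T pos =
     (if pos < T \<or> T + length x + m \<le> pos then [0]
      else if pos < T + length x then [if nth_default False x (pos - T) then 2 else 1] else [1, 2])"

definition cell_values :: "tm \<Rightarrow> word \<Rightarrow> nat \<Rightarrow> nat \<Rightarrow> nat \<Rightarrow> nat \<Rightarrow> tableau_value list" where
  "cell_values M x m T t pos =
     (if t = 0 then map (\<lambda>s. (0, s # replicate (tm_tapes M - 1) 0, [])) (initial_symbols x m T pos)
      else map (\<lambda>cs. (0, cs, [])) (List.n_lists (tm_tapes M) [0..<tm_symbols M]))"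

fun tableau_domain :: "tm \<Rightarrow> word \<Rightarrow> nat \<Rightarrow> nat \<Rightarrow> tableau_var \<Rightarrow> tableau_value list" where
  "tableau_domain M x m T (Control t) = control_values M T t"
| "tableau_domain M x m T (Cell t pos) = cell_values M x m T t pos"
| "tableau_domain M x m T (Output j) = [Bit False, Bit True]"

lemma mem_tableau_vars [simp]:
  "Control t \<in> set (tableau_vars T) \<longleftrightarrow> t \<le> T"
  "Cell t pos \<in> set (tableau_vars T) \<longleftrightarrow> t \<le> T \<and> pos \<le> 2 * T"
  "Output j \<in> set (tableau_vars T) \<longleftrightarrow> j \<le> T"
  by (auto simp: tableau_vars_def less_Suc_eq_le image_iff simp del: upt_Suc)

lemma mem_tableau_laws [simp]:
  "Transition t pos \<in> set (tableau_laws T) \<longleftrightarrow> t < T \<and> pos \<le> 2 * T"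
  "Readout j \<in> set (tableau_laws T) \<longleftrightarrow> j \<le> T"
  by (auto simp: tableau_laws_def less_Suc_eq_le image_iff simp del: upt_Suc)

lemma mem_control_values:
  "(q, ss, hs) \<in> set (control_values M T t) \<longleftrightarrow> length ss = tm_tapes M \<and> set ss \<subseteq> {..<tm_symbols M} \<and>
     (if t = 0 then q = 0 \<and> hs = replicate (tm_tapes M) T
      else q \<le> tm_states M \<and> length hs = tm_tapes M \<and> set hs \<subseteq> {..2 * T})"
  unfolding control_values_def
  by (auto simp: set_n_lists image_iff less_Suc_eq_le atLeast0LessThan lessThan_Suc_atMost
      simp del: upt_Suc)

lemma mem_cell_values:
  "c \<in> set (cell_values M x m T t pos) \<longleftrightarrow> state c = 0 \<and> heads c = [] \<and>
     (if t = 0 then \<exists>s\<in>set (initial_symbols x m T pos). symbols c = s # replicate (tm_tapes M - 1) 0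
      else length (symbols c) = tm_tapes M \<and> set (symbols c) \<subseteq> {..<tm_symbols M})"
  by (cases c) (auto simp: cell_values_def set_n_lists image_iff atLeast0LessThan)

lemma initial_symbols_word_tape:
  assumes "length w = m"
  shows "word_tape (x @ w) (int pos - int T) \<in> set (initial_symbols x m T pos)"
    and "s \<in> set (initial_symbols x m T pos) \<Longrightarrow>
      (\<And>j. j < m \<Longrightarrow> pos = T + length x + j \<Longrightarrow> s = 2 \<longleftrightarrow> w ! j) \<Longrightarrow> s = word_tape (x @ w) (int pos - int T)"
proof -
  consider (blank) "pos < T \<or> T + length x + m \<le> pos" | (input) j where "pos = T + j" "j < length x"
    | (guess) j where "pos = T + length x + j" "j < m"
    by (metis add.assoc add_less_cancel_left le_Suc_ex not_less)
  note position = this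
  show "word_tape (x @ w) (int pos - int T) \<in> set (initial_symbols x m T pos)"
    by (cases rule: position)
      (use assms in \<open>auto simp: initial_symbols_def word_tape_def nth_append nth_default_nth\<close>)
  assume s: "s \<in> set (initial_symbols x m T pos)" and w: "\<And>j. j < m \<Longrightarrow> pos = T + length x + j \<Longrightarrow>
      s = 2 \<longleftrightarrow> w ! j"
  show "s = word_tape (x @ w) (int pos - int T)"
  proof (cases rule: position)
    case (guess j)
    have index: "nat (int (length x) + int j) = length x + j" by linarith
    show ?thesis using s w[OF guess(2,1)] guess assms
      by (auto simp: initial_symbols_def word_tape_def nth_append index)
  qed (use s assms in \<open>auto simp: initial_symbols_def word_tape_def nth_append nth_default_nth
      split: if_splits\<close>)
qed

locale tableau =
  fixes M :: tm and x :: word and m T :: nat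
  assumes valid_M: "valid_tm M" and long_enough: "length x + m \<le> T"
begin

abbreviation "k \<equiv> tm_tapes M"

lemma k_pos: "0 < k" and symbols_ge_3: "3 \<le> tm_symbols M"
  using valid_M by (auto simp: valid_tm_def)

definition config_at :: "word \<Rightarrow> nat \<Rightarrow> config" where
  "config_at w t = (tm_step M ^^ t) (tm_init M (x @ w))"

lemma config_at_bounded: "length w = m \<Longrightarrow> t \<le> T \<Longrightarrow> config_bounded M T t (config_at w t)"
  unfolding config_at_def using long_enough by (intro config_bounded_funpow[OF valid_M]) auto

definition control_encodes :: "tableau_value \<Rightarrow> config \<Rightarrow> bool" where
  "control_encodes d c \<longleftrightarrow> state d = fst c \<and> (\<forall>i<k. int (entry (heads d) i) = snd (snd c ! i) + int T)"

definition cell_encodes :: "tableau_value \<Rightarrow> nat \<Rightarrow> config \<Rightarrow> bool" where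
  "cell_encodes v pos c \<longleftrightarrow> (\<forall>i<k. entry (symbols v) i = fst (snd c ! i) (int pos - int T))"

lemma transition_ok_iff_encodes:
  assumes c: "config_bounded M N n (q, ts)" and step: "tm_step M (q, ts) = (q', ts')"
    and d: "control_encodes d (q, ts)" "symbols d = scanned ts" and v: "cell_encodes v pos (q, ts)"
  shows "transition_ok M pos d d' v v' \<longleftrightarrow> control_encodes d' (q', ts') \<and> cell_encodes v' pos (q', ts')"
proof -
  from shifted_trans_step[OF valid_M c step] obtain as where
    as: "shifted_trans M (q, scanned ts) = (q', as)" "length as = k"
    "\<And>i. i < k \<Longrightarrow> ts' ! i = act_tape (fst (as ! i), int (snd (as ! i)) - 1) (ts ! i)" by metis
  have "entry (heads d') i + 1 = entry (heads d) i + snd (as ! i) \<and>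
        (if entry (heads d) i = pos then entry (symbols v) i = entry (scanned ts) i \<and>
            entry (symbols v') i = fst (as ! i)
         else entry (symbols v') i = entry (symbols v) i) \<longleftrightarrow>
      int (entry (heads d') i) = snd (ts' ! i) + int T \<and> entry (symbols v') i = fst (ts' ! i)
        (int pos - int T)"
    if i: "i < k" for i
  proof -
    have tape: "snd (ts' ! i) = snd (ts ! i) + int (snd (as ! i)) - 1"
      "fst (ts' ! i) = (fst (ts ! i))(snd (ts ! i) := fst (as ! i))"
      using as(3)[OF i] by (simp_all add: act_tape_def case_prod_unfold)
    have head: "int (entry (heads d) i) = snd (ts ! i) + int T" using d(1) i
      by (simp add: control_encodes_def)
    then have "entry (heads d) i = pos \<longleftrightarrow> int pos - int T = snd (ts ! i)" by linarith
    moreover have "entry (symbols v) i = fst (ts ! i) (int pos - int T)" using v i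
      by (simp add: cell_encodes_def)
    moreover have "entry (scanned ts) i = fst (ts ! i) (snd (ts ! i))"
      using i config_boundedD(2)[OF c] by (simp add: nth_default_nth nth_scanned)
    moreover have "entry (heads d') i + 1 = entry (heads d) i + snd (as ! i) \<longleftrightarrow>
        int (entry (heads d') i) = snd (ts' ! i) + int T"
      using head tape(1) by linarith
    ultimately show ?thesis by (simp add: tape(2))
  qed
  note pointwise = this
  have "state d = q" using d(1) by (simp add: control_encodes_def)
  then have "transition_ok M pos d d' v v' \<longleftrightarrow> state d' = q' \<and>
      (\<forall>i<k. entry (heads d') i + 1 = entry (heads d) i + snd (as ! i) \<and>
        (if entry (heads d) i = pos then entry (symbols v) i = entry (scanned ts) i \<and>
            entry (symbols v') i = fst (as ! i)
         else entry (symbols v') i = entry (symbols v) i))"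
    using as(1,2) d(2) by (simp add: transition_ok_def nth_default_nth cong: imp_cong)
  also have "\<dots> \<longleftrightarrow> state d' = q' \<and>
      (\<forall>i<k. int (entry (heads d') i) = snd (ts' ! i) + int T \<and>
          entry (symbols v') i = fst (ts' ! i) (int pos - int T))"
    by (rule arg_cong2[of _ _ _ _ "(\<and>)", OF refl all_cong]) (rule pointwise)
  finally show ?thesis by (auto simp: control_encodes_def cell_encodes_def)
qed

definition proper :: "(tableau_var \<Rightarrow> tableau_value) \<Rightarrow> bool" where
  "proper \<sigma> \<longleftrightarrow> (\<forall>v\<in>set (tableau_vars T). \<sigma> v \<in> set (tableau_domain M x m T v))"

definition lawful :: "(tableau_var \<Rightarrow> tableau_value) \<Rightarrow> bool" where
  "lawful \<sigma> \<longleftrightarrow> (\<forall>h\<in>set (tableau_laws T). tableau_holds M h (map \<sigma> (tableau_scope T h)))"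

lemma properD:
  assumes "proper \<sigma>"
  shows "t \<le> T \<Longrightarrow> \<sigma> (Control t) \<in> set (control_values M T t)"
    "t \<le> T \<Longrightarrow> pos \<le> 2 * T \<Longrightarrow> \<sigma> (Cell t pos) \<in> set (cell_values M x m T t pos)"
  using bspec[OF assms[unfolded proper_def], of "Control t"]
    bspec[OF assms[unfolded proper_def], of "Cell t pos"]
  by simp_all

lemma lawfulD:
  assumes "lawful \<sigma>"
  shows "t < T \<Longrightarrow> pos \<le> 2 * T \<Longrightarrow>
      transition_ok M pos (\<sigma> (Control t)) (\<sigma> (Control (Suc t))) (\<sigma> (Cell t pos)) (\<sigma> (Cell (Suc t) pos))"
    "j \<le> T \<Longrightarrow> readout_ok M (\<sigma> (Cell T (T + j))) (\<sigma> (Output j))"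
  using bspec[OF assms[unfolded lawful_def], of "Transition t pos"]
    bspec[OF assms[unfolded lawful_def], of "Readout j"]
  by (simp_all add: nth_default_nth)

definition encodes :: "(tableau_var \<Rightarrow> tableau_value) \<Rightarrow> nat \<Rightarrow> config \<Rightarrow> bool" where
  "encodes \<sigma> t c \<longleftrightarrow> control_encodes (\<sigma> (Control t)) c \<and>
      (\<forall>pos\<le>2 * T. cell_encodes (\<sigma> (Cell t pos)) pos c)"

definition output_bit :: "word \<Rightarrow> nat \<Rightarrow> bool" where
  "output_bit w j \<longleftrightarrow> fst (last (snd (config_at w T))) (int j) = 2"

lemma output_bit_nth:
  assumes "length w = m" shows "output_bit w j \<longleftrightarrow> fst (snd (config_at w T) ! (k - 1)) (int j) = 2"
proof -
  have "length (snd (config_at w T)) = k" using config_at_bounded[OF assms, of T]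
    by (simp add: config_bounded_def)
  moreover from this have "snd (config_at w T) \<noteq> []" using k_pos
    by (cases "snd (config_at w T)") simp_all
  ultimately show ?thesis by (simp add: output_bit_def last_conv_nth)
qed

subsection \<open>Lawful assignments describe computations\<close>

definition guessed_word :: "(tableau_var \<Rightarrow> tableau_value) \<Rightarrow> word" where
  "guessed_word \<sigma> = map (\<lambda>j. entry (symbols (\<sigma> (Cell 0 (T + length x + j)))) 0 = 2) [0..<m]"

lemma encodes_initial:
  assumes "proper \<sigma>" shows "encodes \<sigma> 0 (config_at (guessed_word \<sigma>) 0)"
proof -
  let ?w = "guessed_word \<sigma>"
  have len: "length ?w = m" by (simp add: guessed_word_def)
  have tape: "snd (config_at ?w 0) ! i = (word_tape (if i = 0 then x @ ?w else []), 0)" if "i < k" for i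
    using that by (simp add: config_at_def tm_init_nth)
  obtain q ss hs where "\<sigma> (Control 0) = (q, ss, hs)" by (rule prod_cases3)
  then have "control_encodes (\<sigma> (Control 0)) (config_at ?w 0)"
    using properD(1)[OF assms, of 0] tape
    by (auto simp: control_encodes_def mem_control_values nth_default_def)
      (simp add: config_at_def tm_init_def)
  moreover have "cell_encodes (\<sigma> (Cell 0 pos)) pos (config_at ?w 0)" if pos: "pos \<le> 2 * T" for pos
  proof -
    obtain s where s: "s \<in> set (initial_symbols x m T pos)"
      "symbols (\<sigma> (Cell 0 pos)) = s # replicate (k - 1) 0"
      using properD(2)[OF assms _ pos, of 0] by (auto simp: mem_cell_values)
    have "s = word_tape (x @ ?w) (int pos - int T)"
      by (rule initial_symbols_word_tape(2)[OF len s(1)]) (use s(2) in \<open>auto simp: guessed_word_def\<close>)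
    then show ?thesis using s(2) tape
      by (auto simp: cell_encodes_def nth_default_def nth_Cons' word_tape_def)
  qed
  ultimately show ?thesis by (simp add: encodes_def)
qed

lemma symbols_control_scanned:
  assumes "proper \<sigma>" "lawful \<sigma>" "t < T" and c: "config_bounded M T t (q, ts)"
    and enc: "encodes \<sigma> t (q, ts)"
  shows "symbols (\<sigma> (Control t)) = scanned ts"
proof (rule nth_equalityI)
  obtain q' ss hs where d: "\<sigma> (Control t) = (q', ss, hs)" by (rule prod_cases3)
  then have len: "length ss = k" using properD(1)[OF assms(1), of t] assms(3)
    by (simp add: mem_control_values)
  then show "length (symbols (\<sigma> (Control t))) = length (scanned ts)"
    using d config_boundedD(2)[OF c] by simp
  fix i assume "i < length (symbols (\<sigma> (Control t)))"
  then have i: "i < k" using d len by simp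
  define pos where "pos = entry hs i"
  have head: "int pos = snd (ts ! i) + int T" using enc i d
    by (simp add: encodes_def control_encodes_def pos_def)
  moreover have "\<bar>snd (ts ! i)\<bar> \<le> int t" by (rule config_boundedD(3)[OF c i])
  ultimately have pos: "pos \<le> 2 * T" using assms(3) by linarith
  have "entry (symbols (\<sigma> (Cell t pos))) i = entry ss i"
    using lawfulD(1)[OF assms(2,3) pos] i d by (simp add: transition_ok_def pos_def)
  moreover have "entry (symbols (\<sigma> (Cell t pos))) i = fst (ts ! i) (snd (ts ! i))"
    using enc pos i head by (simp add: encodes_def cell_encodes_def)
  ultimately show "symbols (\<sigma> (Control t)) ! i = scanned ts ! i"
    using d i len config_boundedD(2)[OF c] by (simp add: nth_scanned nth_default_nth)
qed

lemma encodes_config: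
  assumes "proper \<sigma>" "lawful \<sigma>" shows "t \<le> T \<Longrightarrow> encodes \<sigma> t (config_at (guessed_word \<sigma>) t)"
proof (induction t)
  case 0
  then show ?case using encodes_initial[OF assms(1)] by simp
next
  case (Suc t)
  let ?w = "guessed_word \<sigma>"
  obtain q ts where c: "config_at ?w t = (q, ts)" by fastforce
  obtain q' ts' where c': "config_at ?w (Suc t) = (q', ts')" by fastforce
  have step: "tm_step M (q, ts) = (q', ts')" using c c' by (simp add: config_at_def)
  have bounded: "config_bounded M T t (q, ts)"
    using config_at_bounded[of ?w t] c Suc.prems by (simp add: guessed_word_def)
  have enc: "encodes \<sigma> t (q, ts)" using Suc c by simp
  have "symbols (\<sigma> (Control t)) = scanned ts"
    by (rule symbols_control_scanned[OF assms _ bounded enc]) (use Suc.prems in simp)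
  then have next_step: "control_encodes (\<sigma> (Control (Suc t))) (q', ts') \<and>
      cell_encodes (\<sigma> (Cell (Suc t) pos)) pos (q', ts')"
    if "pos \<le> 2 * T" for pos
    using transition_ok_iff_encodes[OF bounded step] lawfulD(1)[OF assms(2), of t pos]
      Suc.prems that enc
    unfolding encodes_def by simp
  then show ?case using next_step[of 0] unfolding c' encodes_def by simp
qed

lemma lawful_claims:
  assumes "proper \<sigma>" "lawful \<sigma>"
  shows "\<exists>w. length w = m \<and> (\<forall>j\<le>T. \<sigma> (Output j) = Bit True \<longrightarrow> output_bit w j)"
proof (intro exI[of _ "guessed_word \<sigma>"] conjI allI impI)
  show len: "length (guessed_word \<sigma>) = m" by (simp add: guessed_word_def)
  fix j assume j: "j \<le> T" "\<sigma> (Output j) = Bit True"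
  have "encodes \<sigma> T (config_at (guessed_word \<sigma>) T)" by (rule encodes_config[OF assms order_refl])
  then have "entry (symbols (\<sigma> (Cell T (T + j)))) (k - 1) =
      fst (snd (config_at (guessed_word \<sigma>) T) ! (k - 1)) (int j)"
    using j(1) k_pos by (simp add: encodes_def cell_encodes_def)
  then show "output_bit (guessed_word \<sigma>) j"
    using lawfulD(2)[OF assms(2) j(1)] j(2) by (simp add: readout_ok_def output_bit_nth[OF len])
qed

subsection \<open>Computations give lawful assignments\<close>

fun computation :: "word \<Rightarrow> tableau_var \<Rightarrow> tableau_value" where
  "computation w (Control t) = (fst (config_at w t), scanned (snd (config_at w t)),
     map (\<lambda>tape. nat (snd tape + int T)) (snd (config_at w t)))"
| "computation w (Cell t pos) = (0, map (\<lambda>tape. fst tape (int pos - int T)) (snd (config_at w t)), [])"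
| "computation w (Output j) = Bit (output_bit w j)"

context
  fixes w :: word assumes length_w: "length w = m"
begin

lemma computation_bounds:
  assumes "t \<le> T"
  shows "fst (config_at w t) \<le> tm_states M" "length (snd (config_at w t)) = k"
    "i < k \<Longrightarrow> \<bar>snd (snd (config_at w t) ! i)\<bar> \<le> int t"
    "i < k \<Longrightarrow> fst (snd (config_at w t) ! i) p < tm_symbols M"
    "set (scanned (snd (config_at w t))) \<subseteq> {..<tm_symbols M}"
  using config_at_bounded[OF length_w assms]
    config_boundedD[of M T t "fst (config_at w t)" "snd (config_at w t)"]
    set_scanned_config_bounded[of M T t "fst (config_at w t)" "snd (config_at w t)"] by simp_all

lemma computation_encodes:
  assumes "t \<le> T" shows "encodes (computation w) t (config_at w t)"
proof -
  have "0 \<le> snd (snd (config_at w t) ! i) + int T" if "i < k" for i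
    using computation_bounds(3)[OF assms that] assms by linarith
  then show ?thesis using computation_bounds(2)[OF assms]
    by (simp add: encodes_def control_encodes_def cell_encodes_def nth_default_nth)
qed

lemma initial_config_at:
  "snd (config_at w 0) = (word_tape (x @ w), 0) # replicate (k - 1) (word_tape [], 0)"
    "fst (config_at w 0) = 0"
  by (simp_all add: config_at_def tm_init_def)

lemma computation_Control_proper:
  assumes "t \<le> T" shows "computation w (Control t) \<in> set (control_values M T t)"
proof -
  have "length (scanned (snd (config_at w t))) = k" using computation_bounds(2)[OF assms] by simp
  moreover have "map (\<lambda>tape. nat (snd tape + int T)) (snd (config_at w 0)) = replicate k T"
    using k_pos by (cases k) (simp_all add: initial_config_at)
  moreover have "set (map (\<lambda>tape. nat (snd tape + int T)) (snd (config_at w t))) \<subseteq> {..2 * T}"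
  proof
    fix y assume "y \<in> set (map (\<lambda>tape. nat (snd tape + int T)) (snd (config_at w t)))"
    then obtain i where "i < k" "y = nat (snd (snd (config_at w t) ! i) + int T)"
      using computation_bounds(2)[OF assms] by (auto simp: in_set_conv_nth)
    then show "y \<in> {..2 * T}" using computation_bounds(3)[OF assms, of i] assms by auto
  qed
  ultimately show ?thesis
    using computation_bounds(1,2,5)[OF assms] by (auto simp: mem_control_values initial_config_at(2))
qed

lemma computation_Cell_proper:
  assumes "t \<le> T" shows "computation w (Cell t pos) \<in> set (cell_values M x m T t pos)"
proof (cases "t = 0")
  case True
  have "word_tape [] p = 0" for p by (simp add: word_tape_def)
  then show ?thesis using True initial_symbols_word_tape(1)[OF length_w, of x pos T]
    by (simp add: mem_cell_values initial_config_at)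
next
  case False
  have "set (map (\<lambda>tape. fst tape (int pos - int T)) (snd (config_at w t))) \<subseteq> {..<tm_symbols M}"
    using computation_bounds(2,4)[OF assms] by (auto simp: set_conv_nth)
  then show ?thesis using False computation_bounds(2)[OF assms] by (simp add: mem_cell_values)
qed

lemma computation_proper: "proper (computation w)"
  unfolding proper_def
proof
  fix v assume v: "v \<in> set (tableau_vars T)"
  show "computation w v \<in> set (tableau_domain M x m T v)"
  proof (cases v)
    case (Control t)
    then show ?thesis using computation_Control_proper[of t] v by (simp del: computation.simps)
  next
    case (Cell t pos)
    then show ?thesis using computation_Cell_proper[of t pos] v by (simp del: computation.simps)
  qed simp
qed

lemma computation_lawful: "lawful (computation w)"
  unfolding lawful_def
proof
  fix h assume h: "h \<in> set (tableau_laws T)"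
  show "tableau_holds M h (map (computation w) (tableau_scope T h))"
  proof (cases h)
    case (Transition t pos)
    then have t: "t < T" "pos \<le> 2 * T" using h by simp_all
    obtain q ts where c: "config_at w t = (q, ts)" by fastforce
    obtain q' ts' where c': "config_at w (Suc t) = (q', ts')" by fastforce
    have step: "tm_step M (q, ts) = (q', ts')" using c c' by (simp add: config_at_def)
    have bounded: "config_bounded M T t (q, ts)"
      using config_at_bounded[OF length_w, of t] c t(1) by simp
    have "symbols (computation w (Control t)) = scanned ts" using c by simp
    moreover have "encodes (computation w) t (q, ts)" "encodes (computation w) (Suc t) (q', ts')"
      using computation_encodes[of t] computation_encodes[of "Suc t"] c c' t by simp_all
    ultimately have "transition_ok M pos (computation w (Control t)) (computation w (Control (Suc t)))
        (computation w (Cell t pos)) (computation w (Cell (Suc t) pos))"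
      using transition_ok_iff_encodes[OF bounded step] t(2) unfolding encodes_def by blast
    then show ?thesis using Transition by (simp add: nth_default_nth del: computation.simps)
  next
    case (Readout j)
    then show ?thesis using computation_bounds(2)[of T] k_pos output_bit_nth[OF length_w, of j]
      by (simp add: readout_ok_def nth_default_nth)
  qed
qed

end

subsection \<open>The optimum of the constraint satisfaction problem\<close>

sublocale wcsp: weighted_csp "tableau_vars T" "tableau_domain M x m T" "tableau_laws T"
  "tableau_scope T"
  "tableau_holds M" Output "Bit True" "Bit False" "Suc T"
proof
  have "Output 0 \<in> set (tableau_vars T)" by simp
  then show "tableau_vars T \<noteq> []" by force
  show "tableau_domain M x m T v \<noteq> []" if "v \<in> set (tableau_vars T)" for v
    using bspec[OF computation_proper[of "replicate m False", unfolded proper_def] that] by auto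
  fix h assume h: "h \<in> set (tableau_laws T)"
  show "set (tableau_scope T h) \<subseteq> set (tableau_vars T)"
  proof (cases h)
    case (Transition t pos)
    then show ?thesis using h by simp
  next
    case (Readout j)
    then show ?thesis using h by simp
  qed
qed simp_all

lemma feasible_iff: "wcsp.feasible \<sigma> \<longleftrightarrow> proper \<sigma> \<and> lawful \<sigma>"
  by (auto simp: wcsp.feasible_def wcsp.valid_def wcsp.satisfied_def proper_def lawful_def)

definition outputs :: "word \<Rightarrow> nat set" where
  "outputs w = {j. j < Suc T \<and> output_bit w j}"

lemma finite_outputs: "finite (outputs w)"
  by (simp add: outputs_def)

lemma computation_feasible: "length w = m \<Longrightarrow> wcsp.feasible (computation w)"
  by (simp add: feasible_iff computation_proper computation_lawful)

lemma computation_claimed: "wcsp.claimed (computation w) = outputs w"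
  by (auto simp: wcsp.claimed_def outputs_def)

lemma feasible_claimed_subset:
  assumes "wcsp.feasible \<sigma>" obtains w where "length w = m" "wcsp.claimed \<sigma> \<subseteq> outputs w"
proof -
  obtain w where "length w = m" "\<forall>j\<le>T. \<sigma> (Output j) = Bit True \<longrightarrow> output_bit w j"
    using lawful_claims assms by (auto simp: feasible_iff)
  moreover from this have "wcsp.claimed \<sigma> \<subseteq> outputs w" by (auto simp: wcsp.claimed_def outputs_def)
  ultimately show thesis by (intro that)
qed

lemma min_mdg_eq_mvc: "min_mdg wcsp.G = mvc wcsp.G"
  using wcsp.optimal_exists[OF computation_feasible[of "replicate m False"]] wcsp.mvc_optimal(2) by auto

lemma dispensable_claim_iff_outputs:
  "wcsp.dispensable (wcsp.claim 0) \<longleftrightarrow>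
    \<not> (\<exists>w. length w = m \<and> (\<forall>w'. length w' = m \<longrightarrow> card (outputs w' - {0}) < card (outputs w)))"
proof -
  have le: "card (A - J) \<le> card (outputs w - J)" if "A \<subseteq> outputs w" for A J :: "nat set" and w
    using that finite_outputs[of w] by (intro card_mono) auto
  have "(\<exists>\<sigma>. wcsp.feasible \<sigma> \<and>
      (\<forall>\<tau>. wcsp.feasible \<tau> \<longrightarrow> card (wcsp.claimed \<tau> - {0}) < card (wcsp.claimed \<sigma>))) \<longleftrightarrow>
      (\<exists>w. length w = m \<and> (\<forall>w'. length w' = m \<longrightarrow> card (outputs w' - {0}) < card (outputs w)))"
  proof
    assume "\<exists>\<sigma>. wcsp.feasible \<sigma> \<and>
        (\<forall>\<tau>. wcsp.feasible \<tau> \<longrightarrow> card (wcsp.claimed \<tau> - {0}) < card (wcsp.claimed \<sigma>))"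
    then obtain \<sigma> where \<sigma>: "wcsp.feasible \<sigma>"
      "\<And>\<tau>. wcsp.feasible \<tau> \<Longrightarrow> card (wcsp.claimed \<tau> - {0}) < card (wcsp.claimed \<sigma>)" by blast
    obtain w where w: "length w = m" "wcsp.claimed \<sigma> \<subseteq> outputs w"
      by (rule feasible_claimed_subset[OF \<sigma>(1)])
    have "card (outputs w' - {0}) < card (outputs w)" if "length w' = m" for w'
      using \<sigma>(2)[OF computation_feasible[OF that]] le[OF w(2), of "{}"]
      by (simp add: computation_claimed)
    then show "\<exists>w. length w = m \<and> (\<forall>w'. length w' = m \<longrightarrow> card (outputs w' - {0}) < card (outputs w))"
      using w(1) by blast
  next
    assume "\<exists>w. length w = m \<and> (\<forall>w'. length w' = m \<longrightarrow> card (outputs w' - {0}) < card (outputs w))"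
    then obtain w where w: "length w = m"
      "\<And>w'. length w' = m \<Longrightarrow> card (outputs w' - {0}) < card (outputs w)" by blast
    have "card (wcsp.claimed \<tau> - {0}) < card (wcsp.claimed (computation w))"
      if feasible: "wcsp.feasible \<tau>" for \<tau>
    proof -
      obtain w' where w': "length w' = m" "wcsp.claimed \<tau> \<subseteq> outputs w'"
        by (rule feasible_claimed_subset[OF feasible])
      show ?thesis using le[OF w'(2), of "{0}"] w(2)[OF w'(1)] by (simp add: computation_claimed)
    qed
    then show "\<exists>\<sigma>. wcsp.feasible \<sigma> \<and>
        (\<forall>\<tau>. wcsp.feasible \<tau> \<longrightarrow> card (wcsp.claimed \<tau> - {0}) < card (wcsp.claimed \<sigma>))"
      using computation_feasible[OF w(1)] by blast
  qed
  then show ?thesis using wcsp.dispensable_claim_iff[OF computation_feasible[of "replicate m False"]]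
    by simp
qed

lemma mvc_hub_claim:
  "mvc (hub_graph wcsp.vertices csp_adj {Choice (wcsp.claim 0)} D) = D + mvc wcsp.G +
    (if \<exists>w. length w = m \<and> (\<forall>w'. length w' = m \<longrightarrow> card (outputs w' - {0}) < card (outputs w))
        then 1 else 0)"
proof -
  obtain \<sigma> where "wcsp.optimal \<sigma>"
    using wcsp.optimal_exists[OF computation_feasible[of "replicate m False"]] by auto
  from wcsp.mvc_hub_choice[OF this wcsp.claim_mem_choices] show ?thesis
    by (simp add: dispensable_claim_iff_outputs)
qed

lemma outputs_halting:
  assumes "tm_halts_with M (x @ w) t y" "t \<le> T" "length w = m"
  shows "outputs w = {j. j < length y \<and> y ! j}"
proof -
  have "tm_halts_with M (x @ w) T y" by (rule tm_halts_with_mono[OF assms(1,2)])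
  then have tape: "fst (last (snd (config_at w T))) = word_tape y"
    by (simp add: tm_halts_with_def config_at_def case_prod_unfold)
  have "fst (snd (config_at w T) ! (k - 1)) (int T + 1) = 0"
    using config_at_bounded[OF assms(3), of T] k_pos by (simp add: config_bounded_def)
  moreover have "length (snd (config_at w T)) = k" using computation_bounds(2)[OF assms(3)] by simp
  moreover from this have "snd (config_at w T) \<noteq> []" using k_pos
    by (cases "snd (config_at w T)") simp_all
  ultimately have "word_tape y (int T + 1) = 0" using tape by (simp add: last_conv_nth)
  then have "length y \<le> Suc T" by (auto simp: word_tape_def split: if_splits)
  then show ?thesis unfolding outputs_def output_bit_def tape
    by (auto simp: word_tape_def split: if_splits)
qed

end

section \<open>The graph of the reduction\<close>

text \<open>Three kinds of pieces are combined: \<open>a\<close> copies of the graph with a hub at \<open>\<beta>\<close>, whose minimum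
  vertex cover depends on the answer, \<open>b\<close> copies of the graph with hubs everywhere, for which the ratio
  is smaller than \<open>(q + d) / q\<close>, and \<open>j\<close> copies of a graph for which it is larger.\<close>

fun piece_adj :: "('a \<Rightarrow> 'a \<Rightarrow> bool) \<Rightarrow> (nat \<times> nat) list \<Rightarrow> 'a hub_vertex + nat \<Rightarrow>
    'a hub_vertex + nat \<Rightarrow> bool" where
  "piece_adj E bad_edges (Inl u) (Inl v) \<longleftrightarrow> hub_adj E u v"
| "piece_adj E bad_edges (Inr i) (Inr j) \<longleftrightarrow> (i, j) \<in> set bad_edges"
| "piece_adj E bad_edges _ _ \<longleftrightarrow> False"

definition pieces_adj ::
  "('a \<Rightarrow> 'a \<Rightarrow> bool) \<Rightarrow> (nat \<times> nat) list \<Rightarrow> nat \<times> ('a hub_vertex + nat) \<Rightarrow>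
      nat \<times> ('a hub_vertex + nat) \<Rightarrow> bool" where
  "pieces_adj E bad_edges x y \<longleftrightarrow> fst x = fst y \<and> piece_adj E bad_edges (snd x) (snd y)"

definition piece :: "'a set \<Rightarrow> 'a \<Rightarrow> nat \<Rightarrow> nat \<Rightarrow> nat \<Rightarrow> nat \<Rightarrow> nat \<Rightarrow> ('a hub_vertex + nat) set" where
  "piece V \<beta> D nB a b i = (if i < a then Inl ` hub_verts V {\<beta>} D
     else if i < a + b then Inl ` hub_verts V V D else Inr ` {..<nB})"

definition padding :: "nat \<Rightarrow> nat \<Rightarrow> nat \<Rightarrow> nat \<Rightarrow> nat" where
  "padding q d n D = q * d * D + d * d * (n * (D + 1)) + q * d"

lemma ratio_balance:
  fixes q d c D N C e mB vB :: nat
  assumes B: "q * mB = (q + d) * vB + c" and c: "0 < c" and q: "0 < q" and e: "e \<le> 1"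
    and j: "j = q * d * D + d * d * N + q * d"
  shows "q * (q * c * (D + 1 + C) + d * c * (N + C) + j * mB) \<le>
    (q + d) * (q * c * (D + C + e) + d * c * N + j * vB) \<longleftrightarrow> e = 1"
proof -
  let ?base = "(q + d) * (q * c * (D + C) + d * c * N + j * vB)"
  have "q * (j * mB) = j * ((q + d) * vB + c)" using B by (metis mult.left_commute)
  then have "q * (q * c * (D + 1 + C) + d * c * (N + C) + j * mB) =
      q * (q * c * (D + 1 + C) + d * c * (N + C)) + j * c + (q + d) * (j * vB)"
    by (simp add: algebra_simps)
  also have "q * (q * c * (D + 1 + C) + d * c * (N + C)) + j * c =
      (q + d) * (q * c * (D + C) + d * c * N) + c * q * (q + d)"
    unfolding j by (simp add: algebra_simps)
  finally have "q * (q * c * (D + 1 + C) + d * c * (N + C) + j * mB) = ?base + c * q * (q + d)"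
    by (simp add: algebra_simps)
  moreover have "(q + d) * (q * c * (D + C + e) + d * c * N + j * vB) = ?base + c * q * (q + d) * e"
    by (simp add: algebra_simps)
  moreover have "0 < c * q * (q + d)" using c q by simp
  ultimately show ?thesis using e by (cases e) auto
qed

lemma sum_three_blocks:
  fixes a b j x y z :: nat
  shows "(\<Sum>i<a + b + j. if i < a then x else if i < a + b then y else z) = a * x + b * y + j * z"
    (is "sum ?f _ = _")
proof -
  have "sum ?f {0..<a} + sum ?f {a..<a + b} = sum ?f {0..<a + b}"
    "sum ?f {0..<a + b} + sum ?f {a + b..<a + b + j} = sum ?f {0..<a + b + j}"
    by (rule sum.atLeastLessThan_concat; simp)+
  then have "sum ?f {..<a + b + j} = sum ?f {0..<a} + sum ?f {a..<a + b} + sum ?f {a + b..<a + b + j}"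
    unfolding lessThan_atLeast0 by linarith
  also have "\<dots> = a * x + b * y + j * z" by simp
  finally show ?thesis .
qed

locale ratio_reduction =
  fixes V :: "'a set" and E :: "'a \<Rightarrow> 'a \<Rightarrow> bool" and \<beta> :: 'a and B :: "nat graph"
    and bad_edges :: "(nat \<times> nat) list"
    and nB D :: nat
  assumes finite_V: "finite V" and symp_E: "symp E" and \<beta>: "\<beta> \<in> V" and D: "D = card V + 2"
    and opt: "min_mdg (graph_of V E) = mvc (graph_of V E)"
    and B: "simple_graph B" "verts B = {..<nB}" "set bad_edges = {(u, v). {u, v} \<in> edges B}"
begin

lemma symp_piece_adj: "symp (piece_adj E bad_edges)"
proof (rule sympI)
  fix x y assume "piece_adj E bad_edges x y"
  then show "piece_adj E bad_edges y x"
    using sympD[OF symp_hub_adj[OF symp_E]] B(3) by (cases x; cases y) (auto simp: insert_commute)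
qed

lemma symp_pieces_adj: "symp (pieces_adj E bad_edges)"
  using sympD[OF symp_piece_adj] by (auto simp: symp_def pieces_adj_def)

lemma hub_gadget_subset: "S \<subseteq> V \<Longrightarrow> hub_gadget V S E"
  using finite_V symp_E by unfold_locales

lemma hub_piece:
  assumes "S \<subseteq> V"
  shows "min_mdg (graph_of (Inl ` hub_verts V S D) (piece_adj E bad_edges)) =
      min_mdg (hub_graph V E S D)"
    "mvc (graph_of (Inl ` hub_verts V S D) (piece_adj E bad_edges)) = mvc (hub_graph V E S D)"
proof -
  interpret hub_gadget V S E D by (rule hub_gadget_subset[OF assms])
  have "bij_betw Inl (hub_verts V S D) (Inl ` hub_verts V S D)" by (simp add: bij_betw_def)
  from mdg_mvc_graph_of_bij[OF this finite_hub_verts symp_hub_adj[OF symp_E] symp_piece_adj]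
  show "min_mdg (graph_of (Inl ` hub_verts V S D) (piece_adj E bad_edges)) =
      min_mdg (hub_graph V E S D)"
    "mvc (graph_of (Inl ` hub_verts V S D) (piece_adj E bad_edges)) = mvc (hub_graph V E S D)"
    by (simp_all add: hub_graph_def)
qed

lemma bad_piece:
  "min_mdg (graph_of (Inr ` {..<nB}) (piece_adj E bad_edges)) = min_mdg B"
  "mvc (graph_of (Inr ` {..<nB}) (piece_adj E bad_edges)) = mvc B"
proof -
  have symp: "symp (\<lambda>u v. {u, v} \<in> edges B)" by (simp add: symp_def insert_commute)
  have "bij_betw Inr {..<nB} (Inr ` {..<nB})" by (simp add: bij_betw_def)
  from mdg_mvc_graph_of_bij[OF this _ symp symp_piece_adj]
  show "min_mdg (graph_of (Inr ` {..<nB}) (piece_adj E bad_edges)) = min_mdg B"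
    "mvc (graph_of (Inr ` {..<nB}) (piece_adj E bad_edges)) = mvc B"
    using graph_of_edges[OF B(1)] B(2,3) by simp_all
qed

lemma min_mdg_hub:
  assumes "S \<subseteq> V" "S \<noteq> {}" shows "min_mdg (hub_graph V E S D) = card S * (D + 1) + mvc (graph_of V E)"
proof -
  interpret hub_gadget V S E D by (rule hub_gadget_subset[OF assms(1)])
  have "card (neighbours G v) < D" if "v \<in> V" for v
  proof -
    have "card (neighbours G v) \<le> card V"
      by (rule card_mono[OF finite_V]) (use neighbours_subset[OF simple_graph_of[OF finite_V]] in auto)
    then show ?thesis using D by simp
  qed
  then show ?thesis using min_mdg_hub_graph[OF _ _ assms(2) opt] D by simp
qed

definition assembled :: "nat \<Rightarrow> nat \<Rightarrow> nat \<Rightarrow> (nat \<times> ('a hub_vertex + nat)) graph" where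
  "assembled a b j = graph_of (Sigma {..<a + b + j} (piece V \<beta> D nB a b)) (pieces_adj E bad_edges)"

lemma assembled_sums:
  "min_mdg (assembled a b j) =
      (\<Sum>i<a + b + j. min_mdg (graph_of (piece V \<beta> D nB a b i) (piece_adj E bad_edges)))"
  "mvc (assembled a b j) =
      (\<Sum>i<a + b + j. mvc (graph_of (piece V \<beta> D nB a b i) (piece_adj E bad_edges)))"
proof -
  have "finite (hub_verts V S D)" if "S \<subseteq> V" for S
    using hub_gadget.finite_hub_verts[OF hub_gadget_subset[OF that]] .
  then have "finite (piece V \<beta> D nB a b i)" for i using \<beta> by (simp add: piece_def)
  from mdg_mvc_disjoint_sum[of "a + b + j", OF this symp_piece_adj]
  show "min_mdg (assembled a b j) =
      (\<Sum>i<a + b + j. min_mdg (graph_of (piece V \<beta> D nB a b i) (piece_adj E bad_edges)))"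
    "mvc (assembled a b j) =
      (\<Sum>i<a + b + j. mvc (graph_of (piece V \<beta> D nB a b i) (piece_adj E bad_edges)))"
    by (simp_all add: assembled_def pieces_adj_def[abs_def])
qed

lemma min_mdg_assembled:
  "min_mdg (assembled a b j) =
    a * (D + 1 + mvc (graph_of V E)) + b * (card V * (D + 1) + mvc (graph_of V E)) + j * min_mdg B"
proof -
  have "min_mdg (graph_of (piece V \<beta> D nB a b i) (piece_adj E bad_edges)) =
      (if i < a then D + 1 + mvc (graph_of V E)
       else if i < a + b then card V * (D + 1) + mvc (graph_of V E) else min_mdg B)" for i
    using min_mdg_hub[of "{\<beta>}"] min_mdg_hub[of V] \<beta> by (auto simp: piece_def hub_piece bad_piece)
  then show ?thesis by (simp only: assembled_sums sum_three_blocks)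
qed

lemma mvc_assembled:
  "mvc (assembled a b j) = a * mvc (hub_graph V E {\<beta>} D) + b * (card V * (D + 1)) + j * mvc B"
proof -
  have "mvc (hub_graph V E V D) = card V * (D + 1)"
    using hub_gadget.mvc_hub_graph_all[OF hub_gadget_subset] by blast
  then have "mvc (graph_of (piece V \<beta> D nB a b i) (piece_adj E bad_edges)) =
      (if i < a then mvc (hub_graph V E {\<beta>} D) else if i < a + b then card V * (D + 1)
          else mvc B)" for i
    using \<beta> by (auto simp: piece_def hub_piece bad_piece)
  then show ?thesis by (simp only: assembled_sums sum_three_blocks)
qed

lemma assembled_ratio_iff:
  assumes hub: "mvc (hub_graph V E {\<beta>} D) = D + mvc (graph_of V E) + (if A then 1 else 0)"
    and c: "q * min_mdg B = (q + d) * mvc B + c" "0 < c"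
    and q: "0 < q" and j: "j = padding q d (card V) D"
  shows "q * min_mdg (assembled (q * c) (d * c) j) \<le> (q + d) * mvc (assembled (q * c) (d * c) j) \<longleftrightarrow> A"
proof -
  have "j = q * d * D + d * d * (card V * (D + 1)) + q * d" using j by (simp only: padding_def)
  from ratio_balance[OF c q _ this, of "if A then 1 else 0" "mvc (graph_of V E)"]
  show ?thesis unfolding min_mdg_assembled mvc_assembled hub by auto
qed

end

subsection \<open>Lists of vertices\<close>

definition hub_list :: "'a list \<Rightarrow> 'a list \<Rightarrow> nat \<Rightarrow> 'a hub_vertex list" where
  "hub_list vs S D = map Base vs @ map Hub S @ concat (map (\<lambda>v. map (Near v) [0..<D]) S) @
     concat (map (\<lambda>v. map (Far v) [0..<D]) S)"

lemma set_hub_list: "set (hub_list vs S D) = hub_verts (set vs) (set S) D"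
  by (auto simp: hub_list_def hub_verts_def pendants_def)

definition pieces_list :: "'a list \<Rightarrow> 'a \<Rightarrow> nat \<Rightarrow> nat \<Rightarrow> nat \<Rightarrow> nat \<Rightarrow> nat \<Rightarrow>
    (nat \<times> ('a hub_vertex + nat)) list" where
  "pieces_list vs \<beta> D nB a b j = concat (map (\<lambda>i. map (Pair i)
     (if i < a then map Inl (hub_list vs [\<beta>] D) else if i < a + b then map Inl (hub_list vs vs D)
         else map Inr [0..<nB]))
     [0..<a + b + j])"

lemma set_pieces_list: "set (pieces_list vs \<beta> D nB a b j) =
    Sigma {..<a + b + j} (piece (set vs) \<beta> D nB a b)"
proof -
  have "set (if i < a then map Inl (hub_list vs [\<beta>] D) else if i < a + b then map Inl (hub_list vs vs D)
      else map Inr [0..<nB]) = piece (set vs) \<beta> D nB a b i" for i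
    by (simp add: piece_def set_hub_list atLeast0LessThan)
  then have "set (pieces_list vs \<beta> D nB a b j) =
      (\<Union>i\<in>{..<a + b + j}. Pair i ` piece (set vs) \<beta> D nB a b i)"
    unfolding pieces_list_def by (simp only: set_concat set_map image_image set_upt atLeast0LessThan)
  then show ?thesis by auto
qed

definition csp_vertex_list ::
  "'v list \<Rightarrow> ('v \<Rightarrow> 'a list) \<Rightarrow> ('i, 'v, 'a) choice list \<Rightarrow> nat \<Rightarrow> ('i, 'v, 'a) csp_vertex list" where
  "csp_vertex_list vars domain choices n = concat (map (\<lambda>v. concat (map (\<lambda>a. concat (map (\<lambda>c.
     map (Copy v a c) [0..<n]) choices)) (domain v))) vars) @ map Choice choices"

lemma set_csp_vertex_list:
  fixes domain :: "'v \<Rightarrow> 'a list" and choices :: "('i, 'v, 'a) choice list"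
  shows "set (csp_vertex_list vars domain choices n) = csp_verts (set vars) (\<lambda>v. set (domain v))
      (set choices) n"
proof -
  have "(\<Union>c\<in>set choices. Copy v a c ` {0..<n}) = case_prod (Copy v a) ` (set choices \<times> {..<n})"
    for v :: 'v and a :: 'a
    by auto
  then show ?thesis by (simp add: csp_vertex_list_def csp_verts_def)
qed

section \<open>The reduction is computable in polynomial time\<close>

subsection \<open>Encodings of the datatypes\<close>

fun tableau_var_code :: "tableau_var \<Rightarrow> nat + nat \<times> nat + nat" where
  "tableau_var_code (Control t) = Inl t"
| "tableau_var_code (Cell t pos) = Inr (Inl (t, pos))"
| "tableau_var_code (Output j) = Inr (Inr j)"

fun tableau_law_code :: "tableau_law \<Rightarrow> nat \<times> nat + nat" where
  "tableau_law_code (Transition t pos) = Inl (t, pos)"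
| "tableau_law_code (Readout j) = Inr j"

fun constraint_id_code :: "('h, 'v) constraint_id \<Rightarrow> 'h \<times> nat + nat + 'v" where
  "constraint_id_code (Hard h i) = Inl (h, i)"
| "constraint_id_code (Claim j) = Inr (Inl j)"
| "constraint_id_code (Dummy v) = Inr (Inr v)"

fun csp_vertex_code :: "('i, 'v, 'a) csp_vertex \<Rightarrow>
    'v \<times> 'a \<times> ('i, 'v, 'a) choice \<times> nat + ('i, 'v, 'a) choice" where
  "csp_vertex_code (Copy v a c i) = Inl (v, a, c, i)"
| "csp_vertex_code (Choice c) = Inr c"

fun hub_vertex_code :: "'a hub_vertex \<Rightarrow> 'a + 'a + 'a \<times> nat + 'a \<times> nat" where
  "hub_vertex_code (Base v) = Inl v"
| "hub_vertex_code (Hub v) = Inr (Inl v)"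
| "hub_vertex_code (Near v i) = Inr (Inr (Inl (v, i)))"
| "hub_vertex_code (Far v i) = Inr (Inr (Inr (v, i)))"

instantiation tableau_var :: enc
begin
definition enc_tableau_var :: "tableau_var \<Rightarrow> word" where "enc_tableau_var v = enc (tableau_var_code v)"
instance
proof
  fix x y :: tableau_var assume "enc x = enc y"
  then have "tableau_var_code x = tableau_var_code y" unfolding enc_tableau_var_def by (rule enc_inject)
  then show "x = y" by (cases x; cases y) simp_all
qed
end

instantiation tableau_law :: enc
begin
definition enc_tableau_law :: "tableau_law \<Rightarrow> word" where "enc_tableau_law h = enc (tableau_law_code h)"
instance
proof
  fix x y :: tableau_law assume "enc x = enc y"
  then have "tableau_law_code x = tableau_law_code y" unfolding enc_tableau_law_def by (rule enc_inject)
  then show "x = y" by (cases x; cases y) simp_all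
qed
end

instantiation constraint_id :: (enc, enc) enc
begin
definition enc_constraint_id :: "('a, 'b) constraint_id \<Rightarrow> word" where
  "enc_constraint_id c = enc (constraint_id_code c)"
instance
proof
  fix x y :: "('a, 'b) constraint_id" assume "enc x = enc y"
  then have "constraint_id_code x = constraint_id_code y" unfolding enc_constraint_id_def
    by (rule enc_inject)
  then show "x = y" by (cases x; cases y) simp_all
qed
end

instantiation csp_vertex :: (enc, enc, enc) enc
begin
definition enc_csp_vertex :: "('a, 'b, 'c) csp_vertex \<Rightarrow> word" where
  "enc_csp_vertex v = enc (csp_vertex_code v)"
instance
proof
  fix x y :: "('a, 'b, 'c) csp_vertex" assume "enc x = enc y"
  then have "csp_vertex_code x = csp_vertex_code y" unfolding enc_csp_vertex_def by (rule enc_inject)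
  then show "x = y" by (cases x; cases y) simp_all
qed
end

instantiation hub_vertex :: (enc) enc
begin
definition enc_hub_vertex :: "'a hub_vertex \<Rightarrow> word" where
  "enc_hub_vertex v = enc (hub_vertex_code v)"
instance
proof
  fix x y :: "'a hub_vertex" assume "enc x = enc y"
  then have "hub_vertex_code x = hub_vertex_code y" unfolding enc_hub_vertex_def by (rule enc_inject)
  then show "x = y" by (cases x; cases y) simp_all
qed
end

lemma ptime_of_code:
  "ptime (\<lambda>x. tableau_var_code (v x)) \<Longrightarrow> ptime v"
  "ptime (\<lambda>x. tableau_law_code (h x)) \<Longrightarrow> ptime h"
  "ptime (\<lambda>x. constraint_id_code (c x)) \<Longrightarrow> ptime c"
  "ptime (\<lambda>x. csp_vertex_code (u x)) \<Longrightarrow> ptime u"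
  "ptime (\<lambda>x. hub_vertex_code (w x)) \<Longrightarrow> ptime w"
  by (erule ptime_on_enc_cong,
      simp add: enc_tableau_var_def enc_tableau_law_def enc_constraint_id_def enc_csp_vertex_def
        enc_hub_vertex_def)+

lemma ptime_code [ptime_intros]:
  "ptime v \<Longrightarrow> ptime (\<lambda>x. tableau_var_code (v x))"
  "ptime u \<Longrightarrow> ptime (\<lambda>x. csp_vertex_code (u x))"
  "ptime w \<Longrightarrow> ptime (\<lambda>x. hub_vertex_code (w x))"
  by (erule ptime_on_enc_cong, simp add: enc_tableau_var_def enc_csp_vertex_def enc_hub_vertex_def)+

lemma ptime_constructors [ptime_intros]:
  "ptime t \<Longrightarrow> ptime (\<lambda>x. Control (t x))"
  "ptime t \<Longrightarrow> ptime p \<Longrightarrow> ptime (\<lambda>x. Cell (t x) (p x))"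
  "ptime j \<Longrightarrow> ptime (\<lambda>x. Output (j x))"
  "ptime t \<Longrightarrow> ptime p \<Longrightarrow> ptime (\<lambda>x. Transition (t x) (p x))"
  "ptime j \<Longrightarrow> ptime (\<lambda>x. Readout (j x))"
  "ptime h \<Longrightarrow> ptime i \<Longrightarrow> ptime (\<lambda>x. Hard (h x) (i x) :: ('h::enc, 'v::enc) constraint_id)"
  "ptime j \<Longrightarrow> ptime (\<lambda>x. Claim (j x) :: ('h, 'v) constraint_id)"
  "ptime v \<Longrightarrow> ptime (\<lambda>x. Dummy (v x) :: ('h, 'v) constraint_id)"
  "ptime v \<Longrightarrow> ptime a \<Longrightarrow> ptime c \<Longrightarrow> ptime i \<Longrightarrow>
      ptime (\<lambda>x. Copy (v x) (a x) (c x) (i x) :: ('h, 'v, 'a::enc) csp_vertex)"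
  "ptime c \<Longrightarrow> ptime (\<lambda>x. Choice (c x) :: ('h, 'v, 'a) csp_vertex)"
  "ptime v \<Longrightarrow> ptime (\<lambda>x. Base (v x))"
  "ptime v \<Longrightarrow> ptime (\<lambda>x. Hub (v x))"
  "ptime v \<Longrightarrow> ptime i \<Longrightarrow> ptime (\<lambda>x. Near (v x) (i x))"
  "ptime v \<Longrightarrow> ptime i \<Longrightarrow> ptime (\<lambda>x. Far (v x) (i x))"
  by (rule ptime_of_code; simp; intro ptime_intros; assumption)+

subsection \<open>Adjacency\<close>

lemma ptime_contradicts [ptime_intros]:
  assumes "ptime c" "ptime v" "ptime a" shows "ptime (\<lambda>x. contradicts (c x) (v x) (a x))"
  unfolding contradicts_def by (intro ptime_intros assms assms[THEN ptime_comp])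

lemma csp_adj_code:
  "csp_adj x y \<longleftrightarrow> (case csp_vertex_code x of
     Inl p \<Rightarrow> (case csp_vertex_code y of
         Inl r \<Rightarrow> fst p = fst r \<and> fst (snd p) \<noteq> fst (snd r)
       | Inr d \<Rightarrow> snd (snd (snd p)) = 0 \<and> fst (snd (snd p)) = d \<and> contradicts d (fst p) (fst (snd p)))
   | Inr c \<Rightarrow> (case csp_vertex_code y of
         Inl r \<Rightarrow> snd (snd (snd r)) = 0 \<and> fst (snd (snd r)) = c \<and> contradicts c (fst r) (fst (snd r))
       | Inr d \<Rightarrow> fst c = fst d \<and> c \<noteq> d))"
  by (cases x; cases y) auto

lemma ptime_csp_adj [ptime_intros]:
  assumes "ptime f" "ptime g" shows "ptime (\<lambda>x. csp_adj (f x) (g x))"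
  unfolding csp_adj_code by (intro ptime_intros assms assms[THEN ptime_comp])

lemma hub_adj_code:
  "hub_adj E x y \<longleftrightarrow> (case hub_vertex_code x of
     Inl u \<Rightarrow> (case hub_vertex_code y of Inl v \<Rightarrow> E u v | Inr _ \<Rightarrow> y = Hub u)
   | Inr r \<Rightarrow> (case r of
       Inl u \<Rightarrow> y = Base u \<or> (case hub_vertex_code y of Inl _ \<Rightarrow> False | Inr s \<Rightarrow>
         (case s of Inl _ \<Rightarrow> False | Inr t \<Rightarrow> (case t of Inl p \<Rightarrow> fst p = u | Inr _ \<Rightarrow> False)))
     | Inr s \<Rightarrow> (case s of
         Inl p \<Rightarrow> y = Hub (fst p) \<or> y = Far (fst p) (snd p)
       | Inr p \<Rightarrow> y = Near (fst p) (snd p))))"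
  by (cases x; cases y) auto

lemma ptime_hub_adj [ptime_intros]:
  assumes "ptime (\<lambda>z. E (fst z) (snd z))" "ptime f" "ptime g" shows "ptime (\<lambda>x. hub_adj E (f x) (g x))"
proof -
  have "ptime (\<lambda>x. E (u x) (v x))" if "ptime u" "ptime v" for u v :: "'x::enc \<Rightarrow> _"
    using ptime_comp[OF assms(1) ptime_Pair[OF that]] by simp
  note E = this
  show ?thesis unfolding hub_adj_code by (intro ptime_intros E assms assms(2,3)[THEN ptime_comp])
qed

lemma piece_adj_code:
  "piece_adj E bad_edges x y \<longleftrightarrow> (case x of
     Inl u \<Rightarrow> (case y of Inl v \<Rightarrow> hub_adj E u v | Inr _ \<Rightarrow> False)
   | Inr i \<Rightarrow> (case y of Inl _ \<Rightarrow> False | Inr j \<Rightarrow> (i, j) \<in> set bad_edges))"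
  by (cases x; cases y) auto

lemma ptime_pieces_adj [ptime_intros]:
  assumes "ptime (\<lambda>z. E (fst z) (snd z))" "ptime f" "ptime g"
  shows "ptime (\<lambda>x. pieces_adj E bad_edges (f x) (g x))"
  unfolding pieces_adj_def piece_adj_code
  by (intro ptime_intros assms assms(2,3)[THEN ptime_comp])

subsection \<open>Lists of choices and the reduction\<close>

lemma ptime_all_less [ptime_intros]:
  fixes n :: "'x::enc \<Rightarrow> nat"
  assumes "ptime n" "ptime (\<lambda>z. P (fst z) (snd z))" shows "ptime (\<lambda>x. \<forall>i<n x. P x i)"
proof -
  have "ptime (\<lambda>x. \<forall>i\<in>set [0..<n x]. P x i)" by (intro ptime_intros assms)
  then show ?thesis by (rule ptime_on_cong) auto
qed

lemma ptime_transition_ok [ptime_intros]: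
  assumes "ptime pos" "ptime d" "ptime d'" "ptime c" "ptime c'"
  shows "ptime (\<lambda>x. transition_ok M (pos x) (d x) (d' x) (c x) (c' x))"
  unfolding transition_ok_def by (intro ptime_intros assms assms[THEN ptime_comp])

lemma ptime_readout_ok [ptime_intros]:
  assumes "ptime c" "ptime b" shows "ptime (\<lambda>x. readout_ok M (c x) (b x))"
  unfolding readout_ok_def by (intro ptime_intros assms)

lemma ptime_tableau_vars [ptime_intros]:
  assumes "ptime T" shows "ptime (\<lambda>x. tableau_vars (T x))"
  unfolding tableau_vars_def by (intro ptime_intros assms assms[THEN ptime_comp])

lemma ptime_control_values [ptime_intros]:
  assumes "ptime T" "ptime t" shows "ptime (\<lambda>x. control_values M (T x) (t x))"
  unfolding control_values_def by (intro ptime_intros assms assms[THEN ptime_comp])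

lemma ptime_cell_values [ptime_intros]:
  assumes "ptime w" "ptime m" "ptime T" "ptime t" "ptime pos"
  shows "ptime (\<lambda>x. cell_values M (w x) (m x) (T x) (t x) (pos x))"
  unfolding cell_values_def initial_symbols_def by (intro ptime_intros assms assms[THEN ptime_comp])

lemma tableau_domain_code:
  "tableau_domain M w m T v = (case tableau_var_code v of
     Inl t \<Rightarrow> control_values M T t
   | Inr r \<Rightarrow> (case r of Inl p \<Rightarrow> cell_values M w m T (fst p) (snd p) | Inr _ \<Rightarrow> [Bit False, Bit True]))"
  by (cases v) simp_all

lemma ptime_tableau_domain [ptime_intros]:
  assumes "ptime w" "ptime m" "ptime T" "ptime v"
  shows "ptime (\<lambda>x. tableau_domain M (w x) (m x) (T x) (v x))"
  unfolding tableau_domain_code by (intro ptime_intros assms assms[THEN ptime_comp])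

lemma ptime_copy_number [ptime_intros]:
  assumes "ptime vars" "ptime (\<lambda>z. domain (fst z) (snd z))"
  shows "ptime (\<lambda>x. copy_number (vars x) (domain x))"
  unfolding copy_number_def by (intro ptime_intros assms)

lemma ptime_assignments_Nil [ptime_intros]: "ptime (\<lambda>x. assignments (domain x) [])"
  unfolding assignments.simps by (rule ptime_const)

lemma ptime_assignments_Cons [ptime_intros]:
  assumes "ptime (\<lambda>x. domain x (v x))" "ptime v" "ptime (\<lambda>x. assignments (domain x) (vs x))"
  shows "ptime (\<lambda>x. assignments (domain x) (v x # vs x))"
  unfolding assignments.simps by (intro ptime_intros assms assms[THEN ptime_comp])

lemma ptime_hard_choices:
  assumes "ptime h" "ptime N" "ptime (\<lambda>x. assignments (domain x) (scope x (h x)))"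
    and "ptime (\<lambda>z. holds (h (fst z)) (snd z))"
  shows "ptime (\<lambda>x. hard_choices (domain x) (scope x) holds (N x) (h x))"
proof -
  have "ptime (\<lambda>x. holds (h (f x)) (map snd (l x)))" if "ptime f" "ptime l"
    for f and l :: "_ \<Rightarrow> (_ \<times> _) list"
    using ptime_comp[OF assms(4), of "\<lambda>x. (f x, map snd (l x))"] that by (simp add: ptime_intros)
  note holds = this
  show ?thesis unfolding hard_choices_def by (intro ptime_intros holds assms assms[THEN ptime_comp])
qed

abbreviation tableau_choices ::
  "tm \<Rightarrow> word \<Rightarrow> nat \<Rightarrow> nat \<Rightarrow> ((tableau_law, tableau_var) constraint_id, tableau_var,
      tableau_value) choice list" where
  "tableau_choices M w m T \<equiv> weighted_choices (tableau_vars T) (tableau_domain M w m T) (tableau_laws T)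
     (tableau_scope T) (tableau_holds M) Output (Bit True) (Bit False) (Suc T)"

lemma ptime_tableau_hard_choices [ptime_intros]:
  assumes "ptime w" "ptime m" "ptime T" "ptime N"
  shows "ptime t \<Longrightarrow> ptime p \<Longrightarrow>
      ptime (\<lambda>x. hard_choices (tableau_domain M (w x) (m x) (T x)) (tableau_scope (T x))
      (tableau_holds M) (N x) (Transition (t x) (p x)))"
    and "ptime j \<Longrightarrow> ptime (\<lambda>x. hard_choices (tableau_domain M (w x) (m x) (T x)) (tableau_scope (T x))
      (tableau_holds M) (N x) (Readout (j x)))"
proof -
  show "ptime (\<lambda>x. hard_choices (tableau_domain M (w x) (m x) (T x)) (tableau_scope (T x))
      (tableau_holds M) (N x) (Transition (t x) (p x)))" if "ptime t" "ptime p"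
    by (rule ptime_hard_choices, unfold tableau_scope.simps tableau_holds.simps)
      (intro ptime_intros assms that assms[THEN ptime_comp] that[THEN ptime_comp])+
  show "ptime (\<lambda>x. hard_choices (tableau_domain M (w x) (m x) (T x)) (tableau_scope (T x))
      (tableau_holds M) (N x) (Readout (j x)))" if "ptime j"
    by (rule ptime_hard_choices, unfold tableau_scope.simps tableau_holds.simps)
      (intro ptime_intros assms that assms[THEN ptime_comp] that[THEN ptime_comp])+
qed

lemma concat_map_tableau_laws:
  "concat (map f (tableau_laws T)) =
     concat (concat (map (\<lambda>t. map (\<lambda>pos. f (Transition t pos)) [0..<2 * T + 1]) [0..<T])) @
     concat (map (\<lambda>j. f (Readout j)) [0..<Suc T])"
  by (simp add: tableau_laws_def map_concat comp_def del: upt_Suc)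

lemma ptime_tableau_choices [ptime_intros]:
  assumes "ptime w" "ptime m" "ptime T" shows "ptime (\<lambda>x. tableau_choices M (w x) (m x) (T x))"
  unfolding weighted_choices_def concat_map_tableau_laws claim_choice_def dummy_choice_def
  by (intro ptime_intros assms assms[THEN ptime_comp])

definition tableau_vertices ::
  "tm \<Rightarrow> word \<Rightarrow> nat \<Rightarrow> nat \<Rightarrow> ((tableau_law, tableau_var) constraint_id, tableau_var,
      tableau_value) csp_vertex list" where
  "tableau_vertices M w m T = remdups (csp_vertex_list (tableau_vars T) (tableau_domain M w m T)
     (tableau_choices M w m T) (copy_number (tableau_vars T) (tableau_domain M w m T)))"

lemma ptime_csp_vertex_list [ptime_intros]:
  assumes "ptime vars" "ptime (\<lambda>z. domain (fst z) (snd z))" "ptime choices" "ptime n"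
  shows "ptime (\<lambda>x. csp_vertex_list (vars x) (domain x) (choices x) (n x))"
  unfolding csp_vertex_list_def by (intro ptime_intros assms assms[THEN ptime_comp])

lemma ptime_tableau_vertices [ptime_intros]:
  assumes "ptime w" "ptime m" "ptime T" shows "ptime (\<lambda>x. tableau_vertices M (w x) (m x) (T x))"
  unfolding tableau_vertices_def by (intro ptime_intros assms assms[THEN ptime_comp])

definition reduction_vertices where
  "reduction_vertices M q d c nB w m T = (let vs = tableau_vertices M w m T; D = length vs + 2 in
     remdups (pieces_list vs (Choice (claim_choice Output (Bit True) 0)) D nB (q * c) (d * c)
         (padding q d (length vs) D)))"

lemma ptime_hub_list [ptime_intros]:
  assumes "ptime vs" "ptime S" "ptime D" shows "ptime (\<lambda>x. hub_list (vs x) (S x) (D x))"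
  unfolding hub_list_def by (intro ptime_intros assms assms[THEN ptime_comp])

lemma ptime_pieces_list [ptime_intros]:
  assumes "ptime vs" "ptime \<beta>" "ptime D" "ptime a" "ptime b" "ptime j"
  shows "ptime (\<lambda>x. pieces_list (vs x) (\<beta> x) (D x) nB (a x) (b x) (j x))"
  unfolding pieces_list_def by (intro ptime_intros assms assms[THEN ptime_comp])

lemma ptime_reduction_vertices [ptime_intros]:
  assumes "ptime w" "ptime m" "ptime T"
  shows "ptime (\<lambda>x. reduction_vertices M q d c nB (w x) (m x) (T x))"
  unfolding reduction_vertices_def Let_def padding_def by (intro ptime_intros assms)

definition reduction :: "tm \<Rightarrow> nat \<Rightarrow> nat \<Rightarrow> nat \<Rightarrow> nat \<Rightarrow> (nat \<times> nat) list \<Rightarrow> word \<Rightarrow> nat \<Rightarrow> nat \<Rightarrow> word" where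
  "reduction M q d c nB bad_edges w m T = (let us = reduction_vertices M q d c nB w m T in
     concat (map (\<lambda>u. map (\<lambda>v. u \<noteq> v \<and> pieces_adj csp_adj bad_edges u v) us) us))"

lemma ptime_reduction [ptime_intros]:
  assumes "ptime w" "ptime m" "ptime T"
  shows "ptime (\<lambda>x. reduction M q d c nB bad_edges (w x) (m x) (T x))"
  unfolding reduction_def Let_def by (intro ptime_intros assms assms[THEN ptime_comp])

context tableau
begin

lemma set_tableau_vertices: "set (tableau_vertices M x m T) = wcsp.vertices"
  by (simp add: tableau_vertices_def set_csp_vertex_list)

lemma reduction_in_S_MDG_iff:
  assumes B: "is_graph B" "verts B = {..<nB}" "set bad_edges = {(u, v). {u, v} \<in> edges B}"
    and c: "q * min_mdg B = (q + d) * mvc B + c" "0 < c" and q: "0 < q"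
  shows "reduction M q d c nB bad_edges x m T \<in> S_MDG (of_nat (q + d) / of_nat q) \<longleftrightarrow>
    (\<exists>w. length w = m \<and> (\<forall>w'. length w' = m \<longrightarrow> card (outputs w' - {0}) < card (outputs w)))"
        (is "_ \<longleftrightarrow> ?A")
proof -
  let ?vs = "tableau_vertices M x m T" and ?us = "reduction_vertices M q d c nB x m T"
    and ?\<beta> = "Choice (wcsp.claim 0)"
  let ?D = "length ?vs + 2" and ?j = "padding q d (length ?vs) (length ?vs + 2)"
  have card: "card wcsp.vertices = length ?vs"
    unfolding set_tableau_vertices[symmetric] by (rule distinct_card) (simp add: tableau_vertices_def)
  interpret ratio_reduction wcsp.vertices csp_adj ?\<beta> B bad_edges nB ?D
  proof
    show "?\<beta> \<in> wcsp.vertices" by (simp add: wcsp.claim_mem_choices)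
    show "simple_graph B" using B(1) by (simp add: is_graph_iff)
  qed (rule wcsp.finite_vertices symp_csp_adj min_mdg_eq_mvc B(2,3) | simp only: card)+
  have set_us: "graph_of (set ?us) (pieces_adj csp_adj bad_edges) = assembled (q * c) (d * c) ?j"
    unfolding assembled_def reduction_vertices_def Let_def set_remdups set_pieces_list
      set_tableau_vertices ..
  have "(0, Inl (Base ?\<beta>)) \<in> set ?us"
    using c(2) q \<beta> by (simp add: reduction_vertices_def Let_def set_pieces_list
        set_tableau_vertices piece_def)
  then have nonempty: "?us \<noteq> []" by (metis empty_iff list.set(1))
  have distinct: "distinct ?us" by (simp add: reduction_vertices_def Let_def)
  obtain G where G: "is_graph G" "verts G = {..<length ?us}"
    "enc_graph G = concat (map (\<lambda>u. map (\<lambda>v. u \<noteq> v \<and> pieces_adj csp_adj bad_edges u v) ?us) ?us)"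
    "min_mdg G = min_mdg (graph_of (set ?us) (pieces_adj csp_adj bad_edges))"
    "mvc G = mvc (graph_of (set ?us) (pieces_adj csp_adj bad_edges))"
    by (rule enumerated_graph[OF distinct nonempty symp_pieces_adj])
  have "reduction M q d c nB bad_edges x m T = enc_graph G" by (simp add: reduction_def Let_def G(3))
  then have "reduction M q d c nB bad_edges x m T \<in> S_MDG (of_nat (q + d) / of_nat q) \<longleftrightarrow>
      q * min_mdg G \<le> (q + d) * mvc G"
    by (simp only: enc_graph_in_S_MDG_iff[OF G(1,2)] of_nat_le_ratio_mult_iff[OF q])
  also have "\<dots> \<longleftrightarrow> ?A"
    unfolding G(4,5) set_us by (rule assembled_ratio_iff[OF mvc_hub_claim c q]) (simp add: card)
  finally show ?thesis .
qed

end

section \<open>Hardness\<close>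

subsection \<open>Guessing answers and witnesses\<close>

definition true_positions :: "bool list \<Rightarrow> nat set" where
  "true_positions bs = {i. i < length bs \<and> bs ! i}"

definition count_true :: "bool list \<Rightarrow> nat" where
  "count_true bs = length (filter id bs)"

lemma card_true_positions: "card (true_positions bs) = count_true bs"
  by (simp add: true_positions_def count_true_def length_filter_conv_card)

lemma card_true_positions_tail: "card (true_positions (b # bs) - {0}) = count_true bs"
proof -
  have "true_positions (b # bs) - {0} = Suc ` true_positions bs"
  proof (rule set_eqI)
    fix i
    show "i \<in> true_positions (b # bs) - {0} \<longleftrightarrow> i \<in> Suc ` true_positions bs"
      by (cases i) (auto simp: true_positions_def)
  qed
  then show ?thesis by (simp add: card_image card_true_positions)
qed

lemma count_true_less:
  assumes "length as = length bs" "\<And>i. i < length as \<Longrightarrow> as ! i \<Longrightarrow> bs ! i" "as \<noteq> bs"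
  shows "count_true as < count_true bs"
proof -
  obtain i where "i < length as" "as ! i \<noteq> bs ! i" using assms(1,3) nth_equalityI by blast
  then have "true_positions as \<subset> true_positions bs" using assms(1,2) by (auto simp: true_positions_def)
  then show ?thesis unfolding card_true_positions[symmetric]
    by (intro psubset_card_mono) (simp_all add: true_positions_def)
qed

locale parallel_NP_machine =
  fixes A V R :: lang and g :: "word \<Rightarrow> word list" and p :: "nat poly"
  assumes polytime_g: "polytime (\<lambda>x. enc_words (g x))" and V: "V \<in> class_P" and R: "R \<in> class_P"
    and A_iff: "y \<in> A \<longleftrightarrow> (\<exists>w. length w \<le> poly p (length y) \<and> enc_pair y w \<in> R)"
begin

definition is_witness :: "word \<Rightarrow> word \<Rightarrow> bool" where
  "is_witness y w \<longleftrightarrow> length w \<le> poly p (length y) \<and> enc_pair y w \<in> R"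

text \<open>A guessed word \<open>w\<close> contains one candidate for a witness per query.\<close>

definition guessed_answers :: "word \<Rightarrow> word \<Rightarrow> bool list" where
  "guessed_answers x w = map (\<lambda>z. is_witness (fst z) (nth_default [] (split_words w) (snd z)))
     (zip (g x) [0..<length (g x)])"

definition true_answers :: "word \<Rightarrow> bool list" where
  "true_answers x = map (\<lambda>y. y \<in> A) (g x)"

text \<open>Every answer is repeated, so that one more positive answer outweighs the verdict.\<close>

definition verdict :: "word \<Rightarrow> word \<Rightarrow> bool list" where
  "verdict x w = (enc_pair x (guessed_answers x w) \<in> V) # guessed_answers x w @ guessed_answers x w"

lemma ptime_g [ptime_intros]: "ptime f \<Longrightarrow> ptime (\<lambda>x. g (f x))"
  using ptime_split_words[OF polytime_imp_ptime[OF polytime_g]] by simp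

lemma ptime_is_witness [ptime_intros]: "ptime f \<Longrightarrow> ptime h \<Longrightarrow> ptime (\<lambda>x. is_witness (f x) (h x))"
  unfolding is_witness_def by (intro ptime_intros ptime_class_P[OF R])

lemma ptime_verdict [ptime_intros]:
  assumes "ptime f" "ptime h" shows "ptime (\<lambda>x. verdict (f x) (h x))"
  unfolding verdict_def guessed_answers_def
  by (intro ptime_intros ptime_class_P[OF V] assms assms[THEN ptime_comp])

lemma length_guessed_answers [simp]: "length (guessed_answers x w) = length (g x)"
  by (simp add: guessed_answers_def)

lemma guessed_answers_sound: "i < length (g x) \<Longrightarrow> guessed_answers x w ! i \<Longrightarrow> true_answers x ! i"
  using A_iff by (auto simp: guessed_answers_def true_answers_def is_witness_def)

definition query_bound :: "nat poly" where
  "query_bound = (SOME r. \<forall>x. length (enc_words (g x)) \<le> poly r (len x))"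

lemma length_queries_le: "length (enc_words (g x)) \<le> poly query_bound (4 * length x)"
proof -
  have "poly_bounded (\<lambda>x. length (enc_words (g x)))" by (intro poly_bounded_length ptime_intros)
  then obtain r where "length (enc_words (g x)) \<le> poly r (len x)" for x by (rule poly_boundedE) blast
  then have "\<exists>r. \<forall>x. length (enc_words (g x)) \<le> poly r (len x)" by blast
  from someI_ex[OF this] show ?thesis unfolding query_bound_def[symmetric] by (simp add: len_word)
qed

definition guess_length :: "word \<Rightarrow> nat" where
  "guess_length x = (let n = poly query_bound (4 * length x) in n * (2 * poly p n + 2))"

lemma ptime_guess_length [ptime_intros]: "ptime f \<Longrightarrow> ptime (\<lambda>x. guess_length (f x))"
  unfolding guess_length_def Let_def by (intro ptime_intros)

lemma guessed_answers_complete: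
  obtains w where "length w = guess_length x" "guessed_answers x w = true_answers x"
proof -
  let ?n = "poly query_bound (4 * length x)"
  have "\<exists>w. length w \<le> poly p (length y) \<and> (is_witness y w \<longleftrightarrow> y \<in> A)" for y
    using A_iff[of y] unfolding is_witness_def by (cases "y \<in> A") (auto intro: exI[of _ "[]"])
  then obtain witness where witness: "length (witness y) \<le> poly p (length y)"
    "is_witness y (witness y) \<longleftrightarrow> y \<in> A" for y
    by metis
  let ?code = "enc_words (map witness (g x))"
  have "length (witness y) \<le> poly p ?n" if "y \<in> set (g x)" for y
    using witness(1) poly_nat_mono le_trans length_le_length_enc_words(2)[OF that] length_queries_le
    by meson
  then have "length ?code \<le> ?n * (2 * poly p ?n + 2)"
    using le_trans[OF length_le_length_enc_words(1) length_queries_le]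
    by (intro length_enc_words_le) auto
  then have "length (?code @ replicate (guess_length x - length ?code) False) = guess_length x"
    by (simp add: guess_length_def Let_def)
  moreover obtain more where "split_words (?code @ replicate (guess_length x - length ?code) False) =
      map witness (g x) @ more"
    using split_words_append by blast
  then have "guessed_answers x (?code @ replicate (guess_length x - length ?code) False) =
      true_answers x"
    by (auto intro!: nth_equalityI
        simp: guessed_answers_def true_answers_def witness(2) nth_default_append nth_default_nth)
  ultimately show thesis by (rule that)
qed

lemma best_guess_iff:
  "(\<exists>w. length w = guess_length x \<and> (\<forall>w'. length w' = guess_length x \<longrightarrow>
      card (true_positions (verdict x w') - {0}) < card (true_positions (verdict x w)))) \<longleftrightarrow>
    enc_pair x (true_answers x) \<in> V" (is "?best \<longleftrightarrow> _")
proof -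
  let ?count = "\<lambda>w. count_true (guessed_answers x w)"
  have tail: "card (true_positions (verdict x w) - {0}) = 2 * ?count w" for w
    unfolding verdict_def card_true_positions_tail by (simp add: count_true_def)
  have all: "card (true_positions (verdict x w)) = of_bool (enc_pair x (guessed_answers x w) \<in> V) +
      2 * ?count w" for w
    unfolding verdict_def card_true_positions by (simp add: count_true_def)
  have less: "?count w < count_true (true_answers x)" if "guessed_answers x w \<noteq> true_answers x" for w
    by (rule count_true_less[OF _ _ that])
      (simp_all add: true_answers_def[THEN arg_cong, of length] guessed_answers_sound)
  obtain w\<^sub>0 where w\<^sub>0: "length w\<^sub>0 = guess_length x" "guessed_answers x w\<^sub>0 = true_answers x"
    by (rule guessed_answers_complete)
  show ?thesis
  proof
    assume ?best
    then obtain w where "card (true_positions (verdict x w\<^sub>0) - {0}) <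
        card (true_positions (verdict x w))"
      using w\<^sub>0(1) by blast
    then have gain: "2 * count_true (true_answers x) < of_bool (enc_pair x (guessed_answers x w) \<in> V)
        + 2 * ?count w"
      unfolding tail all w\<^sub>0(2) .
    then have "guessed_answers x w = true_answers x" using less[of w]
      by (auto simp: of_bool_def split: if_splits)
    then show "enc_pair x (true_answers x) \<in> V" using gain by (auto simp: of_bool_def split: if_splits)
  next
    assume accept: "enc_pair x (true_answers x) \<in> V"
    have "?count w' \<le> ?count w\<^sub>0" for w' using less[of w'] w\<^sub>0(2)
      by (cases "guessed_answers x w' = true_answers x") auto
    then have "card (true_positions (verdict x w') - {0}) < card (true_positions (verdict x w\<^sub>0))"
      for w'
      unfolding tail all using accept w\<^sub>0(2) by (simp add: less_Suc_eq_le)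
    then show ?best using w\<^sub>0(1) by blast
  qed
qed

lemma verdict_machine:
  obtains M r where "valid_tm M"
    "\<And>x w. \<exists>t\<le>poly r (2 * length x + 2 + length w). tm_halts_with M (enc_word x @ w) t (verdict x w)"
proof -
  have "polytime (\<lambda>z. verdict (pair_fst z) (pair_snd z))"
    by (intro ptime_word_imp_polytime ptime_intros)
  then obtain M r where M: "valid_tm M"
    "\<And>z. \<exists>t\<le>poly r (length z). tm_halts_with M z t (verdict (pair_fst z) (pair_snd z))"
    unfolding polytime_def by blast
  have "\<exists>t\<le>poly r (2 * length x + 2 + length w). tm_halts_with M (enc_word x @ w) t (verdict x w)"
    for x w
    using M(2)[of "enc_pair x w"]
    by (simp add: enc_pair_def[symmetric] pair_fst_enc_pair) (simp add: enc_pair_def)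
  then show thesis by (rule that[OF M(1)])
qed

theorem many_one_reducible_S_MDG:
  assumes q: "0 < q" and L: "\<And>x. x \<in> L \<longleftrightarrow> enc_pair x (true_answers x) \<in> V"
  shows "L \<le>\<^sub>m\<^sup>p S_MDG (of_nat (q + d) / of_nat q)"
proof -
  obtain B :: "nat graph" and nB where B: "is_graph B" "verts B = {..<nB}"
    "(q + d) * mvc B < q * min_mdg B"
    by (rule bad_graph_exists[OF q, of "q + d"])
  then obtain c where c: "q * min_mdg B = (q + d) * mvc B + c" "0 < c"
    using less_imp_add_positive by metis
  have "{(u, v). {u, v} \<in> edges B} \<subseteq> verts B \<times> verts B"
    using simple_graph_edge_subset B(1) by (fastforce simp: is_graph_iff)
  then have "finite {(u, v). {u, v} \<in> edges B}" by (rule finite_subset) (simp add: B(2))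
  then obtain bad_edges where bad_edges: "set bad_edges = {(u, v). {u, v} \<in> edges B}"
    using finite_list by blast
  obtain M r where M: "valid_tm M"
    "\<And>x w. \<exists>t\<le>poly r (2 * length x + 2 + length w). tm_halts_with M (enc_word x @ w) t (verdict x w)"
    by (rule verdict_machine) blast
  define T where "T x = poly r (2 * length x + 2 + guess_length x) +
      (2 * length x + 2 + guess_length x)" for x :: word
  define f where "f x = reduction M q d c nB bad_edges (enc_word x) (guess_length x) (T x)" for x
  have "polytime f" unfolding f_def T_def by (intro ptime_word_imp_polytime ptime_intros)
  moreover have "x \<in> L \<longleftrightarrow> f x \<in> S_MDG (of_nat (q + d) / of_nat q)" for x
  proof -
    interpret tableau M "enc_word x" "guess_length x" "T x" by unfold_locales (simp_all add: M(1) T_def)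
    have "outputs w = true_positions (verdict x w)" if "length w = guess_length x" for w
    proof -
      obtain t where "t \<le> poly r (2 * length x + 2 + length w)"
        "tm_halts_with M (enc_word x @ w) t (verdict x w)"
        using M(2) by blast
      then show ?thesis using outputs_halting[of w t] that by (simp add: T_def true_positions_def)
    qed
    then have "f x \<in> S_MDG (of_nat (q + d) / of_nat q) \<longleftrightarrow> (\<exists>w. length w = guess_length x \<and>
        (\<forall>w'. length w' = guess_length x \<longrightarrow>
          card (true_positions (verdict x w') - {0}) < card (true_positions (verdict x w))))"
      unfolding f_def reduction_in_S_MDG_iff[OF B(1,2) bad_edges c q] by auto
    then show ?thesis unfolding best_guess_iff L by simp
  qed
  ultimately show ?thesis unfolding many_one_reducible_def by blast
qed

end

theorem S_MDG_hard:
  assumes "L \<in> class_P_NP_par" "0 < q" shows "L \<le>\<^sub>m\<^sup>p S_MDG (of_nat (q + d) / of_nat q)"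
proof -
  obtain A g V where L: "A \<in> class_NP" "V \<in> class_P" "polytime (\<lambda>x. enc_words (g x))"
    "\<And>x. x \<in> L \<longleftrightarrow> enc_pair x (map (\<lambda>y. y \<in> A) (g x)) \<in> V"
    using assms(1) unfolding class_P_NP_par_def by blast
  obtain R p where R: "R \<in> class_P" "\<And>y. y \<in> A \<longleftrightarrow> (\<exists>w. length w \<le> poly p (length y) \<and> enc_pair y w \<in> R)"
    using L(1) unfolding class_NP_def by blast
  interpret parallel_NP_machine A V R g p by unfold_locales (use L R in blast)+
  show ?thesis using L(4) by (intro many_one_reducible_S_MDG assms(2)) (simp add: true_answers_def)
qed

section \<open>Membership\<close>

subsection \<open>Decoding graphs\<close>

text \<open>Every word is read as a graph, by taking the symmetric and irreflexive closure of the matrix.\<close>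

definition graph_size :: "word \<Rightarrow> nat" where
  "graph_size x = nth_default 0 (filter (\<lambda>n. n * n = length x) [0..<Suc (length x)]) 0"

definition matrix_entry :: "word \<Rightarrow> nat \<Rightarrow> nat \<Rightarrow> bool" where
  "matrix_entry x i j \<longleftrightarrow> nth_default False x (i * graph_size x + j)"

definition joined :: "word \<Rightarrow> nat \<Rightarrow> nat \<Rightarrow> bool" where
  "joined x i j \<longleftrightarrow> i < graph_size x \<and> j < graph_size x \<and> i \<noteq> j \<and>
      (matrix_entry x i j \<or> matrix_entry x j i)"

definition decoded_graph :: "word \<Rightarrow> nat graph" where
  "decoded_graph x = graph_of {..<graph_size x} (joined x)"

definition encodes_graph :: "word \<Rightarrow> bool" where
  "encodes_graph x \<longleftrightarrow> 0 < graph_size x \<and> enc_graph (decoded_graph x) = x"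

lemma square_eq_iff: "m * m = n * n \<longleftrightarrow> m = (n :: nat)"
  by (metis mult_strict_mono' nat_neq_iff zero_le)

lemma graph_size_eq:
  assumes "length x = n * n" shows "graph_size x = n"
proof -
  have "filter (\<lambda>i. i = n) [0..<m] = (if n < m then [n] else [])" for m by (induction m) auto
  moreover have "n \<le> length x" using assms by (cases n) auto
  ultimately have "filter (\<lambda>i. i * i = length x) [0..<Suc (length x)] = [n]"
    unfolding assms square_eq_iff by (simp add: less_Suc_eq_le del: upt_Suc)
  then show ?thesis by (simp add: graph_size_def)
qed

lemma graph_size_square_le: "graph_size x * graph_size x \<le> length x"
proof (cases "\<exists>n. length x = n * n")
  case True
  then show ?thesis using graph_size_eq by auto
next
  case False
  then have "filter (\<lambda>n. n * n = length x) [0..<Suc (length x)] = []"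
    unfolding filter_empty_conv by (metis (mono_tags))
  then show ?thesis by (simp add: graph_size_def)
qed

lemma graph_size_le: "graph_size x \<le> length x"
  using graph_size_square_le[of x] by (cases "graph_size x") auto

lemma symp_joined: "symp (joined x)"
  by (auto simp: symp_def joined_def)

lemma simple_decoded_graph: "simple_graph (decoded_graph x)"
  by (simp add: decoded_graph_def simple_graph_of)

lemma verts_decoded_graph [simp]: "verts (decoded_graph x) = {..<graph_size x}"
  by (simp add: decoded_graph_def)

lemma neighbours_decoded_graph: "neighbours (decoded_graph x) v = {u. joined x v u}"
  by (auto simp: neighbours_def decoded_graph_def edge_graph_of_iff[OF symp_joined] joined_def)

lemma decoded_graph_enc_graph:
  assumes "simple_graph G" "verts G = {..<n}" shows "decoded_graph (enc_graph G) = G"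
proof -
  have size: "graph_size (enc_graph G) = n" by (rule graph_size_eq[OF length_enc_graph[OF assms(2)]])
  have entry: "matrix_entry (enc_graph G) i j \<longleftrightarrow> {i, j} \<in> edges G" if "i < n" "j < n" for i j
  proof -
    have "i * n + j < Suc i * n" using that(2) by simp
    also have "\<dots> \<le> n * n" using that(1) by (intro mult_le_mono1) simp
    finally show ?thesis
      using enc_graph_nth[OF assms(2) that] length_enc_graph[OF assms(2)]
      by (simp add: matrix_entry_def size nth_default_nth)
  qed
  have "decoded_graph (enc_graph G) = graph_of (verts G) (\<lambda>i j. {i, j} \<in> edges G)"
    unfolding decoded_graph_def size assms(2)
    by (rule graph_of_cong) (auto simp: joined_def size entry insert_commute)
  then show ?thesis using graph_of_edges[OF assms(1)] by simp
qed

lemma S_MDG_iff: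
  assumes "0 < q"
  shows "x \<in> S_MDG (of_nat p / of_nat q) \<longleftrightarrow>
    encodes_graph x \<and> q * min_mdg (decoded_graph x) \<le> p * mvc (decoded_graph x)"
proof
  assume "x \<in> S_MDG (of_nat p / of_nat q)"
  then obtain G n where G: "x = enc_graph G" "is_graph G" "verts G = {..<n}"
    "of_nat (min_mdg G) \<le> of_nat p / of_nat q * (of_nat (mvc G) :: rat)" unfolding S_MDG_def by blast
  then have "decoded_graph x = G" using decoded_graph_enc_graph by (simp add: is_graph_iff)
  moreover from this have "0 < graph_size x"
    using G(2) verts_decoded_graph[of x] by (auto simp: is_graph_iff lessThan_empty_iff)
  ultimately show "encodes_graph x \<and> q * min_mdg (decoded_graph x) \<le> p * mvc (decoded_graph x)"
    using G(1) G(4)[unfolded of_nat_le_ratio_mult_iff[OF assms]] by (simp add: encodes_graph_def)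
next
  assume x: "encodes_graph x \<and> q * min_mdg (decoded_graph x) \<le> p * mvc (decoded_graph x)"
  then have "is_graph (decoded_graph x)"
    by (auto simp: encodes_graph_def is_graph_iff simple_decoded_graph lessThan_empty_iff)
  then have "enc_graph (decoded_graph x) \<in> S_MDG (of_nat p / of_nat q)"
    using x enc_graph_in_S_MDG_iff[OF _ verts_decoded_graph, of x] of_nat_le_ratio_mult_iff[OF assms]
    by blast
  then show "x \<in> S_MDG (of_nat p / of_nat q)" using x by (simp add: encodes_graph_def)
qed

subsection \<open>Checking greedy runs and vertex covers\<close>

lemma ptime_graph_size [ptime_intros]: "ptime f \<Longrightarrow> ptime (\<lambda>z. graph_size (f z))"
proof -
  assume f: "ptime f"
  show ?thesis unfolding graph_size_def by (intro ptime_intros f f[THEN ptime_comp])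
qed

lemma ptime_joined [ptime_intros]:
  assumes "ptime f" "ptime i" "ptime j" shows "ptime (\<lambda>z. joined (f z) (i z) (j z))"
  unfolding joined_def matrix_entry_def by (intro ptime_intros assms)

lemma ptime_encodes_graph [ptime_intros]:
  assumes "ptime f" shows "ptime (\<lambda>z. encodes_graph (f z))"
proof -
  have "enc_graph (decoded_graph x) =
      concat (map (\<lambda>i. map (\<lambda>j. joined x i j) [0..<graph_size x]) [0..<graph_size x])" for x
  proof -
    have "{i, j} \<in> edges (decoded_graph x) \<longleftrightarrow> joined x i j" for i j
      by (auto simp: decoded_graph_def edge_graph_of_iff[OF symp_joined] joined_def)
    then show ?thesis by (simp add: enc_graph_def Let_def)
  qed
  then show ?thesis
    unfolding encodes_graph_def by (simp only:) (intro ptime_intros assms assms[THEN ptime_comp])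
qed

lemma degree_outside_decoded_graph:
  "degree_outside (decoded_graph x) (set us) v =
      length (filter (\<lambda>u. u \<notin> set us \<and> joined x v u) [0..<graph_size x])"
proof -
  have "neighbours (decoded_graph x) v - set us =
      set (filter (\<lambda>u. u \<notin> set us \<and> joined x v u) [0..<graph_size x])"
    by (auto simp: neighbours_decoded_graph joined_def)
  then show ?thesis unfolding degree_outside_def
    by (simp only: distinct_card[OF distinct_filter[OF distinct_upt]])
qed

lemma ptime_degree_outside [ptime_intros]:
  assumes "ptime f" "ptime us" "ptime v"
  shows "ptime (\<lambda>z. degree_outside (decoded_graph (f z)) (set (us z)) (v z))"
  unfolding degree_outside_decoded_graph by (intro ptime_intros assms assms[THEN ptime_comp])

lemma greedy_run_iff_nth:
  "greedy_run G (set us) vs \<longleftrightarrow>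
    (\<forall>i<length vs. max_degree_outside G (set (us @ take i vs)) (nth_default v\<^sub>0 vs i) \<and>
      0 < degree_outside G (set (us @ take i vs)) (nth_default v\<^sub>0 vs i)) \<and>
    (\<forall>v\<in>verts G - set (us @ vs). degree_outside G (set (us @ vs)) v = 0)"
proof (induction vs arbitrary: us)
  case (Cons v vs)
  have "greedy_run G (insert v (set us)) vs \<longleftrightarrow>
    (\<forall>i<length vs. max_degree_outside G (insert v (set us) \<union> set (take i vs)) (nth_default v\<^sub>0 vs i) \<and>
      0 < degree_outside G (insert v (set us) \<union> set (take i vs)) (nth_default v\<^sub>0 vs i)) \<and>
    (\<forall>u\<in>verts G - (insert v (set us) \<union> set vs). degree_outside G (insert v (set us) \<union> set vs) u = 0)"
    using Cons.IH[of "v # us"] by simp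
  then show ?case by (simp add: All_less_Suc2)
qed simp

lemma max_degree_outside_decoded_graph:
  "max_degree_outside (decoded_graph x) (set us) v \<longleftrightarrow> v < graph_size x \<and> v \<notin> set us \<and>
    (\<forall>u<graph_size x. u \<notin> set us \<longrightarrow>
      degree_outside (decoded_graph x) (set us) u \<le> degree_outside (decoded_graph x) (set us) v)"
  by (auto simp: max_degree_outside_def)

lemma ptime_greedy_run [ptime_intros]:
  assumes "ptime f" "ptime vs" shows "ptime (\<lambda>z. greedy_run (decoded_graph (f z)) {} (vs z))"
proof -
  have "greedy_run (decoded_graph x) {} vs \<longleftrightarrow>
    (\<forall>i<length vs. max_degree_outside (decoded_graph x) (set (take i vs)) (nth_default 0 vs i) \<and>
      0 < degree_outside (decoded_graph x) (set (take i vs)) (nth_default 0 vs i)) \<and>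
    (\<forall>v<graph_size x. v \<notin> set vs \<longrightarrow> degree_outside (decoded_graph x) (set vs) v = 0)" for x vs
    using greedy_run_iff_nth[of "decoded_graph x" "[]" vs 0] by (auto simp: Ball_def)
  then show ?thesis
    unfolding max_degree_outside_decoded_graph
    by (simp only:) (intro ptime_intros assms assms[THEN ptime_comp])
qed

lemma ptime_vertex_cover [ptime_intros]:
  assumes "ptime f" "ptime vs" shows "ptime (\<lambda>z. vertex_cover (decoded_graph (f z)) (set (vs z)))"
proof -
  have "vertex_cover (decoded_graph x) (set vs) \<longleftrightarrow> (\<forall>v\<in>set vs. v < graph_size x) \<and>
      (\<forall>i<graph_size x. \<forall>j<graph_size x. joined x i j \<longrightarrow> i \<in> set vs \<or> j \<in> set vs)" for x vs
    by (auto simp: vertex_cover_iff_neighbours[OF simple_decoded_graph]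
        neighbours_decoded_graph joined_def)
  then show ?thesis by (simp only:) (intro ptime_intros assms assms[THEN ptime_comp])
qed

subsection \<open>Queries\<close>

definition query :: "word \<Rightarrow> nat \<Rightarrow> bool \<Rightarrow> word" where
  "query x k b = enc_words [x, replicate k True, [b]]"

definition query_accepts :: "nat \<Rightarrow> nat \<Rightarrow> word \<Rightarrow> nat \<Rightarrow> bool \<Rightarrow> nat list \<Rightarrow> bool" where
  "query_accepts p q x k b vs \<longleftrightarrow>
     (if b then greedy_run (decoded_graph x) {} vs \<and> length vs \<le> k
      else vertex_cover (decoded_graph x) (set vs) \<and> p * length vs < q * k)"

definition query_check :: "nat \<Rightarrow> nat \<Rightarrow> word \<Rightarrow> word \<Rightarrow> bool" where
  "query_check p q y w \<longleftrightarrow> query_accepts p q (nth_default [] (split_words y) 0)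
     (length (nth_default [] (split_words y) 1))
     (nth_default [] (split_words y) 2 = [True]) (map length (split_words w))"

definition query_lang :: "nat \<Rightarrow> nat \<Rightarrow> lang" where
  "query_lang p q = {y. \<exists>w. length w \<le> poly [:0, 4:] (length y) \<and> query_check p q y w}"

lemma query_lang_NP: "query_lang p q \<in> class_NP"
  unfolding query_lang_def
  by (rule class_NP_ptime) (unfold query_check_def query_accepts_def, intro ptime_intros)

lemma query_check_query: "query_check p q (query x k b) w \<longleftrightarrow>
    query_accepts p q x k b (map length (split_words w))"
  by (simp add: query_check_def query_def eval_nat_numeral)

lemma query_accepts_distinct:
  assumes "query_accepts p q x k b vs"
  obtains us where "distinct us" "set us \<subseteq> {..<graph_size x}" "query_accepts p q x k b us"
proof (cases b)
  case True
  then have "distinct vs \<and> set vs \<subseteq> verts (decoded_graph x) - {}"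
    using assms greedy_run_distinct unfolding query_accepts_def by metis
  then show ?thesis using that[of vs] assms by simp
next
  case False
  have "p * length (remdups vs) \<le> p * length vs" by (rule mult_le_mono2[OF length_remdups_leq])
  also have "\<dots> < q * k" using assms False by (simp add: query_accepts_def)
  finally have "query_accepts p q x k b (remdups vs)" using assms False by (simp add: query_accepts_def)
  moreover have "set (remdups vs) \<subseteq> {..<graph_size x}"
    using assms False by (simp add: query_accepts_def vertex_cover_def)
  ultimately show ?thesis using that[of "remdups vs"] by simp
qed

lemma query_in_query_lang_iff: "query x k b \<in> query_lang p q \<longleftrightarrow> (\<exists>vs. query_accepts p q x k b vs)"
proof
  assume "query x k b \<in> query_lang p q"
  then show "\<exists>vs. query_accepts p q x k b vs" by (auto simp: query_lang_def query_check_query)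
next
  assume "\<exists>vs. query_accepts p q x k b vs"
  then obtain us where us: "distinct us" "set us \<subseteq> {..<graph_size x}" "query_accepts p q x k b us"
    using query_accepts_distinct by blast
  let ?n = "graph_size x" and ?w = "enc_words (map (\<lambda>v. replicate v True) us)"
  have "length us \<le> ?n" using card_mono[OF _ us(2)] distinct_card[OF us(1)] by simp
  then have "length ?w \<le> ?n * (2 * ?n + 2)" using us(2) by (intro length_enc_words_le) auto
  also have "\<dots> \<le> 4 * (?n * ?n)" by (cases ?n) auto
  also have "\<dots> \<le> 4 * length (query x k b)"
    using graph_size_square_le[of x] by (simp add: query_def enc_words_def)
  finally have "length ?w \<le> poly [:0, 4:] (length (query x k b))" by (simp add: mult.commute)
  moreover have "query_check p q (query x k b) ?w" using us(3) by (simp add: query_check_query comp_def)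
  ultimately show "query x k b \<in> query_lang p q" unfolding query_lang_def by blast
qed

lemma greedy_query_iff: "query x k True \<in> query_lang p q \<longleftrightarrow> min_mdg (decoded_graph x) \<le> k"
proof -
  obtain vs where "greedy_run (decoded_graph x) {} vs" "length vs = min_mdg (decoded_graph x)"
    by (rule min_mdg_obtain[OF simple_decoded_graph])
  then show ?thesis
    using min_mdg_le[OF simple_decoded_graph] le_trans
    unfolding query_in_query_lang_iff query_accepts_def by fastforce
qed

lemma cover_query_iff: "query x k False \<in> query_lang p q \<longleftrightarrow> p * mvc (decoded_graph x) < q * k"
proof
  assume "query x k False \<in> query_lang p q"
  then obtain vs where vs: "vertex_cover (decoded_graph x) (set vs)" "p * length vs < q * k"
    by (auto simp: query_in_query_lang_iff query_accepts_def)
  have "mvc (decoded_graph x) \<le> length vs" using mvc_le[OF vs(1)] card_length le_trans by blast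
  then show "p * mvc (decoded_graph x) < q * k" using vs(2) by (meson le_less_trans mult_le_mono2)
next
  assume less: "p * mvc (decoded_graph x) < q * k"
  obtain C where C: "vertex_cover (decoded_graph x) C" "card C = mvc (decoded_graph x)"
    by (rule mvc_obtain[OF simple_decoded_graph])
  obtain vs where "set vs = C" "distinct vs"
    using finite_distinct_list[OF finite_vertex_cover[OF simple_decoded_graph C(1)]] by blast
  then have "query_accepts p q x k False vs" using C less distinct_card
    by (fastforce simp: query_accepts_def)
  then show "query x k False \<in> query_lang p q" unfolding query_in_query_lang_iff by blast
qed

lemma min_mdg_le_card_verts:
  assumes "simple_graph G" shows "min_mdg G \<le> card (verts G)"
proof -
  obtain vs where vs: "greedy_run G {} vs" "length vs = min_mdg G" by (rule min_mdg_obtain[OF assms])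
  then have "distinct vs" "set vs \<subseteq> verts G" using greedy_run_distinct by blast+
  then show ?thesis using card_mono[OF simple_graph_finite[OF assms]] distinct_card vs(2) by metis
qed

theorem S_MDG_in_class_P_NP_par:
  assumes "0 < q" shows "S_MDG (of_nat p / of_nat q) \<in> class_P_NP_par"
proof (rule class_P_NP_par_ptime[OF query_lang_NP[of p q]])
  let ?queries = "\<lambda>x b. map (\<lambda>k. query x k b) [0..<Suc (length x)]"
  let ?verdict = "\<lambda>x as. encodes_graph x \<and> (\<exists>k\<in>set [0..<Suc (length x)].
    nth_default False as k \<and> \<not> nth_default False as (Suc (length x) + k))"
  show "ptime (\<lambda>x. ?queries x True @ ?queries x False)" unfolding query_def by (intro ptime_intros)
  show "ptime (\<lambda>z. ?verdict (fst z) (snd z))" by (intro ptime_intros)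
  fix x
  let ?G = "decoded_graph x"
    and ?answers = "map (\<lambda>y. y \<in> query_lang p q) (?queries x True @ ?queries x False)"
  have answers: "nth_default False ?answers k \<longleftrightarrow> min_mdg ?G \<le> k"
    "nth_default False ?answers (Suc (length x) + k) \<longleftrightarrow> p * mvc ?G < q * k" if "k < Suc (length x)" for k
    using that by (simp_all add: nth_default_nth nth_append greedy_query_iff cover_query_iff
        del: upt_Suc)
  have "q * min_mdg ?G \<le> p * mvc ?G \<longleftrightarrow> (\<exists>k<Suc (length x). min_mdg ?G \<le> k \<and> \<not> p * mvc ?G < q * k)"
  proof
    assume "q * min_mdg ?G \<le> p * mvc ?G"
    moreover have "min_mdg ?G < Suc (length x)"
      using min_mdg_le_card_verts[OF simple_decoded_graph[of x]] graph_size_le[of x] by simp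
    ultimately show "\<exists>k<Suc (length x). min_mdg ?G \<le> k \<and> \<not> p * mvc ?G < q * k"
      by (intro exI[of _ "min_mdg ?G"]) (simp add: not_less)
  next
    assume "\<exists>k<Suc (length x). min_mdg ?G \<le> k \<and> \<not> p * mvc ?G < q * k"
    then show "q * min_mdg ?G \<le> p * mvc ?G" by (meson le_trans mult_le_mono2 not_less)
  qed
  then show "x \<in> S_MDG (of_nat p / of_nat q) \<longleftrightarrow> ?verdict x ?answers"
    unfolding S_MDG_iff[OF assms] using answers by (auto simp del: upt_Suc)
qed

theorem theorem4p3:
  fixes r :: rat
  assumes "r \<ge> 1"
  shows "many_one_complete class_P_NP_par (S_MDG r)"
proof -
  obtain a b where ab: "quotient_of r = (a, b)" by fastforce
  define q d where "q = nat b" and "d = nat (a - b)"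
  have b: "0 < b" by (rule quotient_of_denom_pos[OF ab])
  have r: "r = of_int a / of_int b" by (rule quotient_of_div[OF ab])
  then have "of_int b \<le> (of_int a :: rat)" using assms b by (simp add: pos_le_divide_eq)
  then have "b \<le> a" by (simp only: of_int_le_iff)
  then have r': "r = of_nat (q + d) / of_nat q" using b by (simp add: r q_def d_def)
  have q: "0 < q" using b by (simp add: q_def)
  show ?thesis
    unfolding many_one_complete_def r' using S_MDG_in_class_P_NP_par[OF q] S_MDG_hard[OF _ q] by blast
qed

end
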